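(* For billiard tables $\mathcal{D}=\mathbb{R}^2\setminus(\mathcal{O}_1\cup\mathcal{O}_2\cup\mathcal{O}_3)$ as in the context, the Marked Lyapunov Spectrum is entirely determined by the Marked Length Spectrum. That is, if two such tables $\mathcal{D},\widetilde{\mathcal{D}}$ satisfy $\mathcal{L}_{\mathcal{D}}(\sigma)=\mathcal{L}_{\widetilde{\mathcal{D}}}(\sigma)$ for every finite admissible word $\sigma$, then $\mathrm{LE}_{\mathcal{D}}(\sigma)=\mathrm{LE}_{\widetilde{\mathcal{D}}}(\sigma)$ for every finite admissible word $\sigma$.
   Context: Billiard table: $\mathcal{O}_1,\mathcal{O}_2,\mathcal{O}_3\subset\mathbb{R}^2$ are bounded strictly convex domains (obstacles) whose boundaries $\Gamma_i=\partial\mathcal{O}_i$ are of class at least $C^3$ with positive curvature, satisfying the non-eclipse condition: the convex hull of any two obstacles is disjoint from the third one. $\mathcal{D}=\mathbb{R}^2\setminus\bigcup_i\mathcal{O}_i$. Billiard map: the collision space $\mathcal{M}$ is the set of pairs $(q,v)$ with $q\in\bigcup_i\Gamma_i$ and $v$ a unit vector with $\langle v,n\rangle\ge 0$, where $n$ is the unit normal at $q$ pointing inside $\mathcal{D}$. Coordinates on $\mathcal{M}$ are $(s,\varphi)$, with $s$ the arc-length parameter of $q$ and $\varphi\in[-\frac{\pi}{2},\frac{\pi}{2}]$ the oriented angle between $n$ and $v$. $\mathcal{F}$ is the billiard map, sending a collision to the next one (straight flight in $\mathcal{D}$, then elastic reflection), defined where a next collision exists. Coding: a bi-infinite word $(\rho_j)_{j\in\mathbb{Z}}\in\{1,2,3\}^{\mathbb{Z}}$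 is admissible if $\rho_{j+1}\neq\rho_j$ for all $j$; each admissible word is realized by exactly one orbit $(x_j)_{j\in\mathbb{Z}}$ of $\mathcal{F}$ with $x_j$ based on $\Gamma_{\rho_j}$. A finite word $\sigma=(\sigma_1\dots\sigma_p)\in\{1,2,3\}^p$, $p\ge2$, is admissible if its periodic repetition is; it labels a periodic orbit of period $p$. Marked Length Spectrum: the function $\sigma\mapsto\mathcal{L}(\sigma)$ on finite admissible words, where $\mathcal{L}(\sigma)$ is the length (sum of the lengths of the $p$ segments) of the periodic orbit labelled by $\sigma$. Marked Lyapunov Spectrum: the function $\sigma\mapsto\mathrm{LE}(\sigma)=\frac1p\log\mu(\sigma)$ on finite admissible words, where $p$ is the length of $\sigma$ and $\mu(\sigma)>1$ is the largest eigenvalue of $D\mathcal{F}^p$ at the points of the orbit labelled by $\sigma$ (this matrix has determinant $1$ and is hyperbolic). *)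

theory Defs
  imports "HOL-Analysis.Analysis"
begin

text \<open>
  The Euclidean plane is the type \<open>complex\<close>: \<open>inner\<close> is the dot product and multiplication by
  \<open>\<i>\<close> is the rotation by \<open>\<pi>/2\<close>. The three labels 1, 2, 3 are the elements of the numeral
  type \<open>3\<close> (where \<open>3 = 0\<close>).
\<close>

section \<open>Billiard tables\<close>

definition strictly_convex :: "'a::real_normed_vector set \<Rightarrow> bool" where
  "strictly_convex S \<longleftrightarrow>
    (\<forall>x\<in>closure S. \<forall>y\<in>closure S. x \<noteq> y \<longrightarrow> open_segment x y \<subseteq> interior S)"

definition C_class :: "nat \<Rightarrow> (real \<Rightarrow> 'a::real_normed_vector) \<Rightarrow> bool" where
  "C_class k f \<longleftrightarrow> (\<exists>D. D 0 = f \<and>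
     (\<forall>m<k. \<forall>t. (D m has_vector_derivative D (Suc m) t) (at t)) \<and> continuous_on UNIV (D k))"

definition velocity :: "(real \<Rightarrow> complex) \<Rightarrow> real \<Rightarrow> complex" where
  "velocity g s = vector_derivative g (at s)"

text \<open>
  Signed curvature of a unit-speed curve, i.e. \<open>det (g', g'')\<close>. It is positive on the boundary of
  a convex domain exactly when the boundary is traversed counterclockwise.
\<close>

definition curvature :: "(real \<Rightarrow> complex) \<Rightarrow> real \<Rightarrow> real" where
  "curvature g s = Im (cnj (velocity g s) * velocity (velocity g) s)"

text \<open>
  The obstacles are open sets. \<open>bdry T i\<close> is an arc-length parametrization of the boundary of
  obstacle \<open>i\<close>, defined on the whole line and periodic with period \<open>perim T i\<close>.
\<close>

record billiard =
  obst :: "3 \<Rightarrow> complex set"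
  bdry :: "3 \<Rightarrow> real \<Rightarrow> complex"
  perim :: "3 \<Rightarrow> real"

definition arclength_boundary :: "complex set \<Rightarrow> (real \<Rightarrow> complex) \<Rightarrow> real \<Rightarrow> bool" where
  "arclength_boundary S g l \<longleftrightarrow>
     0 < l \<and> (\<forall>s. g (s + l) = g s) \<and> inj_on g {0..<l} \<and> range g = frontier S \<and>
     (\<forall>s. norm (velocity g s) = 1)"

text \<open>
  The non-eclipse condition concerns the obstacles together with their boundaries: in particular
  the closures of distinct obstacles are disjoint.
\<close>

definition non_eclipse :: "(3 \<Rightarrow> complex set) \<Rightarrow> bool" where
  "non_eclipse Ob \<longleftrightarrow> (\<forall>i j k. i \<noteq> j \<and> i \<noteq> k \<and> j \<noteq> k \<longrightarrow>
     convex hull (closure (Ob i) \<union> closure (Ob j)) \<inter> closure (Ob k) = {})"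

definition billiard_table :: "billiard \<Rightarrow> bool" where
  "billiard_table T \<longleftrightarrow>
     (\<forall>i. obst T i \<noteq> {} \<and> open (obst T i) \<and> connected (obst T i) \<and>
          bounded (obst T i) \<and> strictly_convex (obst T i) \<and>
          arclength_boundary (obst T i) (bdry T i) (perim T i) \<and>
          C_class 3 (bdry T i) \<and> (\<forall>s. curvature (bdry T i) s > 0)) \<and>
     non_eclipse (obst T)"

section \<open>The billiard map\<close>

definition boundary :: "billiard \<Rightarrow> complex set" where
  "boundary T = (\<Union>i. frontier (obst T i))"

text \<open>
  By the counterclockwise orientation, this is the unit normal pointing out of the obstacle, that
  is, into the table.
\<close>

definition normal :: "billiard \<Rightarrow> 3 \<Rightarrow> real \<Rightarrow> complex" where
  "normal T i s = - \<i> * velocity (bdry T i) s"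

definition normal_at :: "billiard \<Rightarrow> complex \<Rightarrow> complex" where
  "normal_at T q = (THE n. \<exists>i s. q = bdry T i s \<and> n = normal T i s)"

definition collision_space :: "billiard \<Rightarrow> (complex \<times> complex) set" where
  "collision_space T = {(q, v). q \<in> boundary T \<and> norm v = 1 \<and> v \<bullet> normal_at T q \<ge> 0}"

definition hit_times :: "billiard \<Rightarrow> complex \<times> complex \<Rightarrow> real set" where
  "hit_times T = (\<lambda>(q, v). {t. 0 < t \<and> q + t *\<^sub>R v \<in> boundary T})"

definition map_domain :: "billiard \<Rightarrow> (complex \<times> complex) set" where
  "map_domain T = {x \<in> collision_space T. hit_times T x \<noteq> {}}"

text \<open>Only meaningful on \<^term>\<open>map_domain T\<close>.\<close>

definition billiard_map :: "billiard \<Rightarrow> complex \<times> complex \<Rightarrow> complex \<times> complex" where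
  "billiard_map T = (\<lambda>(q, v).
     let t = (LEAST t. t \<in> hit_times T (q, v));
         q' = q + t *\<^sub>R v;
         n = normal_at T q'
     in (q', v - (2 * (v \<bullet> n)) *\<^sub>R n))"

section \<open>Coordinates and differential\<close>

definition chart :: "billiard \<Rightarrow> 3 \<Rightarrow> real \<times> real \<Rightarrow> complex \<times> complex" where
  "chart T i = (\<lambda>(s, \<phi>). (bdry T i s, normal T i s * cis \<phi>))"

text \<open>
  The coordinates of a collision on obstacle \<open>i\<close>. The arc length is defined modulo the perimeter;
  the representative is taken in the period centred at \<open>c\<close>, so that the coordinates are continuous
  near \<open>s = c\<close>.
\<close>

definition coords :: "billiard \<Rightarrow> 3 \<Rightarrow> real \<Rightarrow> complex \<times> complex \<Rightarrow> real \<times> real" where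
  "coords T i c x =
     (THE z. fst z \<in> {c - perim T i / 2 ..< c + perim T i / 2} \<and>
             snd z \<in> {- (pi / 2) .. pi / 2} \<and> chart T i z = x)"

text \<open>
  Differential, in the coordinates \<open>(s, \<phi>)\<close>, of the \<open>p\<close>-th iterate of the billiard map at a
  point \<open>x\<close> on obstacle \<open>i\<close> that is fixed by this iterate.
\<close>

definition return_differential ::
  "billiard \<Rightarrow> 3 \<Rightarrow> nat \<Rightarrow> complex \<times> complex \<Rightarrow> real \<times> real \<Rightarrow> real \<times> real" where
  "return_differential T i p x =
     (let z0 = coords T i 0 x
      in frechet_derivative
           (\<lambda>z. coords T i (fst z0) ((billiard_map T ^^ p) (chart T i z))) (at z0))"

definition eigenvalues :: "('a::real_vector \<Rightarrow> 'a) \<Rightarrow> real set" where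
  "eigenvalues A = {c. \<exists>v. v \<noteq> 0 \<and> A v = c *\<^sub>R v}"

section \<open>Coding and marked spectra\<close>

definition admissible :: "3 list \<Rightarrow> bool" where
  "admissible \<sigma> \<longleftrightarrow> 2 \<le> length \<sigma> \<and>
     (\<forall>j<length \<sigma>. \<sigma> ! (Suc j mod length \<sigma>) \<noteq> \<sigma> ! j)"

definition periodic_repetition :: "3 list \<Rightarrow> int \<Rightarrow> 3" where
  "periodic_repetition \<sigma> j = \<sigma> ! nat (j mod int (length \<sigma>))"

definition realizes :: "billiard \<Rightarrow> (int \<Rightarrow> 3) \<Rightarrow> (int \<Rightarrow> complex \<times> complex) \<Rightarrow> bool" where
  "realizes T \<rho> x \<longleftrightarrow> (\<forall>j. x j \<in> map_domain T \<and> x (j + 1) = billiard_map T (x j) \<and>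
     fst (x j) \<in> frontier (obst T (\<rho> j)))"

definition labelled_orbit :: "billiard \<Rightarrow> 3 list \<Rightarrow> int \<Rightarrow> complex \<times> complex" where
  "labelled_orbit T \<sigma> = (THE x. realizes T (periodic_repetition \<sigma>) x)"

definition marked_length :: "billiard \<Rightarrow> 3 list \<Rightarrow> real" where
  "marked_length T \<sigma> = (let x = labelled_orbit T \<sigma>
     in \<Sum>j<length \<sigma>. dist (fst (x (int j))) (fst (x (int j + 1))))"

text \<open>
  The largest eigenvalue is the one of largest modulus, and \<open>\<mu>\<close> is its modulus: in these
  coordinates the differential of each single reflection has negative entries, so for words of
  odd length both eigenvalues of the return differential are negative. The eigenvalues are real
  (the return differential is hyperbolic) and are the same at all points of the orbit; the point
  with index 0 is used.
\<close>

definition marked_multiplier :: "billiard \<Rightarrow> 3 list \<Rightarrow> real" where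
  "marked_multiplier T \<sigma> =
     Max (abs ` eigenvalues
       (return_differential T (\<sigma> ! 0) (length \<sigma>) (labelled_orbit T \<sigma> 0)))"

definition marked_lyapunov :: "billiard \<Rightarrow> 3 list \<Rightarrow> real" where
  "marked_lyapunov T \<sigma> = ln (marked_multiplier T \<sigma>) / real (length \<sigma>)"

end

theory Submission
  imports Defs
begin

text \<open>
  The periodic orbit with a given label minimises length among closed polygons with vertices on the
  prescribed obstacles, because length is convex and the reflection law is its first order condition.

  Fix a word \<open>\<sigma>\<close> of length \<open>p\<close> and a letter \<open>t\<close> different from its first and last letters, and compare
  \<open>\<sigma>^(2M) t\<close> with \<open>\<sigma>^(2(M + n)) t\<close>. The excess \<open>E = L(\<sigma>^(2M) t) + 2n L(\<sigma>) - L(\<sigma>^(2(M + n)) t)\<close> is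
  bounded from below by splicing \<open>2n\<close> turns of the orbit of \<open>\<sigma>\<close> into the orbit of \<open>\<sigma>^(2M) t\<close>, and from
  above by cutting \<open>2n\<close> periods out of the orbit of \<open>\<sigma>^(2(M + n)) t\<close>. Each operation reconnects two
  nearby orbits \<open>x\<close>, \<open>x'\<close> between the indices \<open>k\<close> and \<open>k + 1\<close>, at a cost of
  \<open>- h \<xi>\<^sub>k \<xi>\<^sub>k\<^sub>+\<^sub>1\<close> with \<open>h > 0\<close> and \<open>\<xi> = x' - x\<close> in arc length.

  In the coordinates (arc length, sine of the angle), \<open>\<xi>\<close> evolves by minus a positive matrix close to
  the derivative of the billiard map along the orbit of \<open>\<sigma>\<close>. Hence in the middle of the block
  \<open>\<sigma>^(2M)\<close> it has size \<open>\<nu>^(-Mp)\<close> up to subexponential factors, where \<open>ln \<nu>\<close> is the Lyapunov exponent,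
  and \<open>\<bar>E\<bar>\<close> is at most \<open>\<nu>^(-2Mp)\<close> up to such factors. For the converse bound, if
  \<open>\<xi>\<^sub>k \<xi>\<^sub>k\<^sub>+\<^sub>1 \<ge> 0\<close> for some \<open>k\<close>, then moving the two vertices next to the cut gains
  a further multiple of \<open>\<xi>\<^sub>k\<^sup>2 + \<xi>\<^sub>k\<^sub>+\<^sub>1\<^sup>2\<close>. Such a \<open>k\<close> exists either for the difference between the
  excursion orbit and the orbit of \<open>\<sigma>\<close>, or, if the former alternates in sign throughout, for the
  difference between the excursion orbit and its own shift. So \<open>E\<close> determines \<open>\<nu>\<close>.
\<close>

text \<open>The obstacle is the sign of \<open>\<xi>\<^sub>k \<xi>\<^sub>k\<^sub>+\<^sub>1\<close>.
  The linearised motion is minus a positive matrix, so differences tend to alternate in sign, and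
  then reconnecting gives only bounds that do not exclude a vanishing excess. The way out is a
  parity count. If \<open>\<xi>\<close> alternates along the whole block, let \<open>\<eta>\<close>
  be the difference between the excursion orbit and its own shift by whole turns. At the left end of
  the block \<open>\<eta>\<close> has the sign of \<open>- \<xi>\<close>, at the right end that of
  the unshifted end value of \<open>\<xi>\<close>, because the other term is already small there.
  For a shift by an even number of bounces this contradicts an alternating \<open>\<eta>\<close>.
  Hence the even powers of \<open>\<sigma>\<close>, and hence a lower bound that concerns either
  \<open>M\<close> or \<open>M - n\<close>. No expansion of the lengths is made. All comparisons
  hold up to factors \<open>g ^ k\<close> with arbitrary \<open>g > 1\<close>, for which continuity
  of the second derivatives of the chord length suffices; an exponential rate does not notice such
  factors.\<close>

locale table =
  fixes T :: billiard
  assumes table: "billiard_table T"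
begin

abbreviation bd where "bd \<equiv> bdry T"
abbreviation vel where "vel i \<equiv> velocity (bdry T i)"
abbreviation acc where "acc i \<equiv> velocity (velocity (bdry T i))"
abbreviation nml where "nml \<equiv> normal T"
abbreviation ob where "ob \<equiv> obst T"
abbreviation cl where "cl i \<equiv> closure (obst T i)"
abbreviation curv where "curv i \<equiv> curvature (bdry T i)"

section \<open>Boundary curves: moving frame and supporting lines\<close>

lemma obstD:
  shows ob_ne: "ob i \<noteq> {}" and ob_open: "open (ob i)" and ob_bounded: "bounded (ob i)"
    and ob_strict: "strictly_convex (ob i)" and perim_pos: "0 < perim T i"
    and bd_period: "bd i (s + perim T i) = bd i s" and bd_inj: "inj_on (bd i) {0..<perim T i}"
    and bd_range: "range (bd i) = frontier (ob i)" and norm_vel: "norm (vel i s) = 1"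
    and bd_C: "C_class 3 (bd i)" and curv_pos: "curv i s > 0"
  using table unfolding billiard_table_def arclength_boundary_def by blast+

text \<open>\<open>velocity\<close> is a choice operator; the derivatives supplied by
  \<open>C_class\<close> identify it and its iterate with genuine derivatives.\<close>

lemma bd_C2:
  shows bd_deriv: "(bd i has_vector_derivative vel i s) (at s)"
    and vel_deriv: "(vel i has_vector_derivative acc i s) (at s)"
    and acc_cont: "continuous_on UNIV (acc i)"
proof -
  obtain D where D0: "D 0 = bd i"
    and D: "\<And>m t. m < 3 \<Longrightarrow> (D m has_vector_derivative D (Suc m) t) (at t)"
    using bd_C[of i] unfolding C_class_def by blast
  have 1: "vel i = D 1"
    using D[of 0] D0 by (auto simp: velocity_def vector_derivative_at fun_eq_iff)
  have 2: "acc i = D 2"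
    using D[of 1] unfolding 1 by (auto simp: velocity_def vector_derivative_at fun_eq_iff numeral_2_eq_2)
  show "(bd i has_vector_derivative vel i s) (at s)" using D[of 0 s] D0 1 by simp
  show "(vel i has_vector_derivative acc i s) (at s)"
    using D[of 1 s] 1 2 by (simp add: numeral_2_eq_2)
  show "continuous_on UNIV (acc i)"
    unfolding 2 using D[of 2] by (auto intro!: continuous_at_imp_continuous_on has_vector_derivative_continuous)
qed

lemma bd_cont: "continuous_on S (bd i)" and vel_cont: "continuous_on S (vel i)"
  using bd_deriv vel_deriv
  by (auto intro!: continuous_at_imp_continuous_on has_vector_derivative_continuous)

lemma nml_eq: "nml i s = - \<i> * vel i s" by (simp add: normal_def)

lemma norm_nml: "norm (nml i s) = 1" by (simp add: nml_eq norm_mult norm_vel)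

lemma nml_cont: "continuous_on S (nml i)"
proof -
  have "continuous_on S (\<lambda>s. - \<i> * vel i s)" by (intro continuous_intros vel_cont)
  then show ?thesis by (simp add: nml_eq[abs_def] fun_eq_iff cong: continuous_on_cong)
qed

lemma vel_eq: "vel i s = \<i> * nml i s" by (simp add: nml_eq)

lemma inner_vel_vel: "vel i s \<bullet> vel i s = 1" and inner_nml_nml: "nml i s \<bullet> nml i s = 1"
  by (simp_all add: dot_square_norm norm_vel norm_nml)

lemma inner_vel_nml: "vel i s \<bullet> nml i s = 0" and inner_nml_vel: "nml i s \<bullet> vel i s = 0"
  by (simp_all add: nml_eq inner_complex_def)

lemma frame_expand: "z = (z \<bullet> nml i s) *\<^sub>R nml i s + (z \<bullet> vel i s) *\<^sub>R vel i s"
proof -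
  have a: "Re (vel i s) * Re (vel i s) + Im (vel i s) * Im (vel i s) = 1"
    using inner_vel_vel[of i s] by (simp add: inner_complex_def)
  have *: "x = (x * b - y * a) * b + (x * a + y * b) * a" "y = - (x * b - y * a) * a + (x * a + y * b) * b"
    if "a * a + b * b = 1" for x y a b :: real
  proof -
    have "(x * b - y * a) * b + (x * a + y * b) * a = x * (a * a + b * b)"
      "- (x * b - y * a) * a + (x * a + y * b) * b = y * (a * a + b * b)"
      by (simp_all add: algebra_simps)
    then show "x = (x * b - y * a) * b + (x * a + y * b) * a" "y = - (x * b - y * a) * a + (x * a + y * b) * b"
      using that by simp_all
  qed
  show ?thesis
    using *(1)[OF a, of "Re z" "Im z"] *(2)[OF a, of "Im z" "Re z"]
    by (auto simp: complex_eq_iff nml_eq inner_complex_def algebra_simps)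
qed

lemma norm_frame: "(z \<bullet> nml i s)\<^sup>2 + (z \<bullet> vel i s)\<^sup>2 = (norm z)\<^sup>2"
proof -
  have "(norm z)\<^sup>2 = z \<bullet> ((z \<bullet> nml i s) *\<^sub>R nml i s + (z \<bullet> vel i s) *\<^sub>R vel i s)"
    using frame_expand[of z i s] by (metis dot_square_norm)
  then show ?thesis by (simp add: inner_add_right power2_eq_square)
qed

text \<open>Frenet equation. Differentiating the constant \<open>vel i s \<bullet> vel i s\<close>
  kills the tangential part; the minus sign appears because \<open>nml\<close> points out of the
  obstacle while the curve bends inwards.\<close>

lemma acc_eq: "acc i s = - curv i s *\<^sub>R nml i s"
proof -
  have "((\<lambda>s. vel i s \<bullet> vel i s) has_real_derivative (vel i s \<bullet> acc i s + acc i s \<bullet> vel i s)) (at s)"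
    using has_derivative_inner[OF vel_deriv[of i s, unfolded has_vector_derivative_def]
        vel_deriv[of i s, unfolded has_vector_derivative_def]]
    unfolding has_field_derivative_def
    by (rule has_derivative_eq_rhs) (auto simp: fun_eq_iff algebra_simps)
  moreover have "((\<lambda>s. vel i s \<bullet> vel i s) has_real_derivative 0) (at s)"
    by (simp add: inner_vel_vel)
  ultimately have "vel i s \<bullet> acc i s + acc i s \<bullet> vel i s = 0" by (rule DERIV_unique)
  then have 0: "acc i s \<bullet> vel i s = 0" by (simp add: inner_commute)
  have "acc i s \<bullet> nml i s = - curv i s"
    by (simp add: nml_eq inner_complex_def curvature_def)
  then show ?thesis using frame_expand[of "acc i s" i s] 0 by simp
qed

lemma acc_inner_nml: "acc i s \<bullet> nml i s = - curv i s"
  by (simp add: acc_eq inner_nml_nml)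

lemma curv_cont: "continuous_on S (curv i)"
proof -
  have "continuous_on S (\<lambda>s. Im (cnj (vel i s) * acc i s))"
    by (intro continuous_intros vel_cont continuous_on_subset[OF acc_cont]) auto
  then show ?thesis by (simp add: curvature_def[abs_def] cong: continuous_on_cong)
qed

lemma bd_frontier: "bd i s \<in> frontier (ob i)" and bd_cl: "bd i s \<in> cl i"
  using bd_range[of i] by (auto simp: frontier_def)

lemma frontier_bdE:
  assumes "q \<in> frontier (ob i)" obtains s where "q = bd i s"
  using assms bd_range[of i] by blast

lemma frontier_cl: "q \<in> frontier (ob i) \<Longrightarrow> q \<in> cl i" by (simp add: frontier_def)

lemma ob_segment: "x \<in> cl i \<Longrightarrow> y \<in> cl i \<Longrightarrow> x \<noteq> y \<Longrightarrow> open_segment x y \<subseteq> ob i"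
  using ob_strict[of i] ob_open[of i] unfolding strictly_convex_def by (simp add: interior_open)

lemma ob_convex: "convex (ob i)"
  unfolding convex_contains_open_segment
  using ob_segment closure_subset by fastforce

lemma cl_convex: "convex (cl i)" by (simp add: convex_closure ob_convex)

lemma cl_compact: "compact (cl i)" by (simp add: ob_bounded compact_closure)

lemma frontier_compact: "compact (frontier (ob i))"
  by (simp add: ob_bounded compact_frontier_bounded)

lemma frontier_notin: "q \<in> frontier (ob i) \<Longrightarrow> q \<notin> ob i"
  using ob_open[of i] by (simp add: frontier_def interior_open)

text \<open>At a maximum of the height \<open>a \<bullet> bd i t\<close> the first derivative
  vanishes. A negative normal component would, by positive curvature, make the second derivative
  positive, and the height would still increase to the right of \<open>s\<close>.\<close>

lemma critical_max_inner:
  assumes "\<And>t. a \<bullet> bd i t \<le> a \<bullet> bd i s"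
  shows "a \<bullet> vel i s = 0" and "0 \<le> a \<bullet> nml i s"
proof -
  have d: "((\<lambda>t. a \<bullet> bd i t) has_real_derivative a \<bullet> vel i t) (at t)" for t
    using has_derivative_inner_right[OF bd_deriv[of i t, unfolded has_vector_derivative_def], of a]
    unfolding has_field_derivative_def by (rule has_derivative_eq_rhs) (auto simp: fun_eq_iff)
  have d2: "((\<lambda>t. a \<bullet> vel i t) has_real_derivative a \<bullet> acc i t) (at t)" for t
    using has_derivative_inner_right[OF vel_deriv[of i t, unfolded has_vector_derivative_def], of a]
    unfolding has_field_derivative_def by (rule has_derivative_eq_rhs) (auto simp: fun_eq_iff)
  show 0: "a \<bullet> vel i s = 0"
    using DERIV_local_max[OF d[of s], of 1] assms by auto
  show "0 \<le> a \<bullet> nml i s"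
  proof (rule ccontr)
    assume "\<not> 0 \<le> a \<bullet> nml i s"
    then have "a \<bullet> acc i s > 0" using curv_pos[of i s] by (simp add: acc_eq mult_pos_neg)
    from DERIV_pos_inc_right[OF d2 this] obtain e where e: "e > 0"
      and inc: "\<And>h. 0 < h \<Longrightarrow> h < e \<Longrightarrow> a \<bullet> vel i s < a \<bullet> vel i (s + h)" by blast
    have "a \<bullet> bd i s < a \<bullet> bd i (s + e / 2)"
    proof (rule DERIV_pos_imp_increasing_open[where f="\<lambda>t. a \<bullet> bd i t"])
      show "s < s + e / 2" using e by simp
      show "\<exists>y. ((\<lambda>t. a \<bullet> bd i t) has_real_derivative y) (at x) \<and> 0 < y"
        if "s < x" "x < s + e / 2" for x
        using inc[of "x - s"] that e 0 d[of x] by auto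
      show "continuous_on {s..s + e / 2} (\<lambda>t. a \<bullet> bd i t)"
        by (intro continuous_intros bd_cont)
    qed
    then show False using assms[of "s + e / 2"] by simp
  qed
qed

text \<open>\<open>normal\<close> is defined through the orientation of the curve only. Convexity
  supplies some supporting line at the boundary point, and the criterion for maxima of the height
  shows that its outer normal is a positive multiple of \<open>nml\<close>.\<close>

lemma supporting_normal: "y \<in> cl i \<Longrightarrow> nml i s \<bullet> (y - bd i s) \<le> 0"
proof -
  assume y: "y \<in> cl i"
  have ri: "rel_interior (cl i) = ob i"
    by (simp add: convex_rel_interior_closure ob_convex ob_open rel_interior_open)
  obtain a where a: "a \<noteq> 0" "\<And>y. y \<in> cl i \<Longrightarrow> a \<bullet> bd i s \<le> a \<bullet> y"
    using supporting_hyperplane_rel_boundary[OF cl_convex[of i] bd_cl[of i s]]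
      frontier_notin[OF bd_frontier[of i s]] ri by metis
  define b where "b = - a"
  have max: "b \<bullet> y \<le> b \<bullet> bd i s" if "y \<in> cl i" for y
    using a(2)[OF that] by (simp add: b_def)
  note crit = critical_max_inner[of b i s, OF max[OF bd_cl]]
  have b: "b = (b \<bullet> nml i s) *\<^sub>R nml i s"
    using frame_expand[of b i s] crit(1) by simp
  then have pos: "b \<bullet> nml i s > 0" using crit(2) a(1) b_def
    by (metis less_eq_real_def neg_equal_0_iff_equal scaleR_zero_left)
  have "(b \<bullet> nml i s) * (nml i s \<bullet> (y - bd i s)) = b \<bullet> (y - bd i s)"
    using b by (metis inner_scaleR_left)
  also have "\<dots> \<le> 0" using max[OF y] by (simp add: inner_diff_right)
  finally show ?thesis using pos by (simp add: mult_le_0_iff)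
qed

text \<open>By strict convexity the midpoint of a second contact point and \<open>bd i s\<close>
  would be interior; pushing it slightly along the normal stays inside and violates the support
  inequality.\<close>

lemma supporting_normal_strict:
  assumes y: "y \<in> cl i" "y \<noteq> bd i s" shows "nml i s \<bullet> (y - bd i s) < 0"
proof (rule ccontr)
  assume "\<not> ?thesis"
  then have 0: "nml i s \<bullet> (y - bd i s) = 0" using supporting_normal[OF y(1), of s] by simp
  define m where "m = midpoint y (bd i s)"
  have "m \<in> ob i"
    using ob_segment[OF y(1) bd_cl y(2)] y(2) by (auto simp: m_def)
  then obtain e where e: "e > 0" "ball m e \<subseteq> ob i" using ob_open open_contains_ball by blast
  define z where "z = m + (e / 2) *\<^sub>R nml i s"
  have "z \<in> ob i" using e by (auto simp: z_def dist_norm norm_nml intro!: subsetD[OF e(2)])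
  then have "z \<in> cl i" using closure_subset by blast
  from supporting_normal[OF this, of s] have "nml i s \<bullet> (z - bd i s) \<le> 0" .
  moreover have "z - bd i s = (1/2) *\<^sub>R (y - bd i s) + (e / 2) *\<^sub>R nml i s"
    by (simp add: z_def m_def midpoint_def complex_eq_iff field_simps)
  ultimately show False using 0 e(1) by (simp add: inner_add_right inner_nml_nml)
qed

text \<open>The height in direction \<open>nml i s\<close> is maximal at both parameters, so
  tangency at \<open>s'\<close> and unit length leave only the same vector. This makes
  \<open>normal_at\<close> well defined.\<close>

lemma nml_unique:
  assumes "bd i s = bd i s'" shows "nml i s = nml i s'"
proof -
  have "nml i s \<bullet> bd i t \<le> nml i s \<bullet> bd i s'" for t
    using supporting_normal[OF bd_cl[of i t], of s] assms by (simp add: inner_diff_right)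
  note crit = critical_max_inner[of "nml i s" i s', OF this]
  have e: "nml i s = (nml i s \<bullet> nml i s') *\<^sub>R nml i s'"
    using frame_expand[of "nml i s" i s'] crit(1) by simp
  then have "norm (nml i s) = \<bar>nml i s \<bullet> nml i s'\<bar> * norm (nml i s')" by (metis norm_scaleR)
  then have "nml i s \<bullet> nml i s' = 1" using crit(2) by (simp add: norm_nml)
  then show ?thesis using e by simp
qed

end

section \<open>Unit directions as gradients of the norm\<close>

lemma sgn_dist: "norm x *\<^sub>R sgn x = (x :: 'a :: real_normed_vector)"
  by (cases "x = 0") (simp_all add: sgn_div_norm)

lemma inner_sgn_self: "x \<bullet> sgn x = norm x" for x :: "'a :: real_inner"
  by (cases "x = 0") (simp_all add: sgn_div_norm dot_square_norm power2_eq_square)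

lemma inner_sgn_le: "x \<bullet> sgn y \<le> norm x" for x y :: "'a :: real_inner"
  using norm_cauchy_schwarz[of x "sgn y"] by (cases "y = 0") (auto simp: norm_sgn)

text \<open>\<open>sgn\<close> is the gradient of the norm, and the gradient of a convex function is
  monotone.\<close>

lemma sgn_monotone: "0 \<le> (sgn x - sgn y) \<bullet> (x - y)" for x y :: "'a :: real_inner"
proof -
  have "x \<bullet> sgn y \<le> norm x" "y \<bullet> sgn x \<le> norm y" by (rule inner_sgn_le)+
  then show ?thesis
    by (simp add: inner_diff_left inner_diff_right inner_sgn_self inner_commute[of "sgn _"])
qed

lemma norm_diff_scaleR:
  "(norm (d - c *\<^sub>R n))\<^sup>2 = (norm d)\<^sup>2 - 2 * c * (d \<bullet> n) + c\<^sup>2 * (norm n)\<^sup>2" for d n :: "'a :: real_inner"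
proof -
  have "(d - c *\<^sub>R n) \<bullet> (d - c *\<^sub>R n) = d \<bullet> d - 2 * c * (d \<bullet> n) + c * c * (n \<bullet> n)"
    by (simp add: inner_diff_left inner_diff_right inner_commute[of n d] algebra_simps)
  then show ?thesis by (simp add: dot_square_norm power2_eq_square)
qed

lemma ex_third: "\<exists>k::3. k \<noteq> i \<and> k \<noteq> j"
proof -
  have "card {i, j} < CARD(3)" using card_insert_le_m1[of 2 "{j}" i] by simp
  then have "{i, j} \<noteq> UNIV" by (metis less_irrefl)
  then show ?thesis by blast
qed

context table
begin

section \<open>Consequences of the non-eclipse condition\<close>

lemma hull_disjoint:
  "i \<noteq> j \<Longrightarrow> i \<noteq> k \<Longrightarrow> j \<noteq> k \<Longrightarrow> convex hull (cl i \<union> cl j) \<inter> cl k = {}"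
  using table unfolding billiard_table_def non_eclipse_def by blast

text \<open>Non-eclipse speaks of three distinct labels; the hull of one obstacle with the third
  contains the first and misses the second.\<close>

lemma cl_disjoint: assumes "i \<noteq> j" shows "cl i \<inter> cl j = {}"
proof -
  obtain k where k: "k \<noteq> i" "k \<noteq> j" using ex_third by blast
  have "cl i \<subseteq> convex hull (cl i \<union> cl k)" by (meson Un_upper1 hull_subset order_trans)
  then show ?thesis using hull_disjoint[of i k j] k assms by blast
qed

lemma cl_label_unique: "x \<in> cl i \<Longrightarrow> x \<in> cl j \<Longrightarrow> i = j"
  using cl_disjoint by blast

text \<open>The form in which non-eclipse enters the dynamics: for \<open>a = c\<close> it is
  convexity together with disjointness, otherwise it is the hull condition.\<close>

lemma not_between:
  assumes "a \<noteq> b" "b \<noteq> c" "x \<in> cl a" "y \<in> cl b" "z \<in> cl c"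
  shows "y \<notin> closed_segment x z"
proof
  assume y: "y \<in> closed_segment x z"
  show False
  proof (cases "a = c")
    case True
    then have "closed_segment x z \<subseteq> cl a"
      using assms cl_convex by (simp add: convex_contains_segment)
    then show False using y assms cl_label_unique by blast
  next
    case False
    have "closed_segment x z \<subseteq> convex hull (cl a \<union> cl c)"
      by (meson Un_iff assms(3,5) convex_contains_segment convex_convex_hull hull_inc)
    then show False using y assms hull_disjoint[of a c b] False by blast
  qed
qed

text \<open>A path that continues undeflected at \<open>y\<close> would put \<open>y\<close> on the
  segment from \<open>x\<close> to \<open>z\<close>. This is what excludes grazing bounces.\<close>

lemma directions_distinct:
  assumes "a \<noteq> b" "b \<noteq> c" "x \<in> cl a" "y \<in> cl b" "z \<in> cl c"
  shows "sgn (y - x) \<noteq> sgn (z - y)"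
proof
  assume e: "sgn (y - x) = sgn (z - y)"
  define u where "u = sgn (z - y)"
  have 1: "y - x = norm (y - x) *\<^sub>R u" using e u_def sgn_dist by metis
  have 2: "z - y = norm (z - y) *\<^sub>R u" using u_def sgn_dist by metis
  have "between (x, z) y"
    unfolding between
  proof -
    have "z - x = (norm (y - x) + norm (z - y)) *\<^sub>R u"
      using 1 2 by (simp add: scaleR_add_left flip: 1 2)
    moreover have "norm u = 1"
      using assms cl_label_unique unfolding u_def by (auto simp: norm_sgn)
    ultimately have "norm (z - x) = norm (y - x) + norm (z - y)" by simp
    then show "dist x z = dist x y + dist y z" by (simp add: dist_norm norm_minus_commute)
  qed
  then show False using not_between[OF assms] by (simp add: between_mem_segment)
qed

lemma cl_ne: "cl i \<noteq> {}" using ob_ne by simp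

text \<open>Compactness over the finitely many label triples turns the inequality of directions into
  a uniform gap, which later keeps all collisions away from grazing.\<close>

lemma directions_gap:
  obtains c where "0 < c"
    "\<And>a b d x y z. a \<noteq> b \<Longrightarrow> b \<noteq> d \<Longrightarrow> x \<in> cl a \<Longrightarrow> y \<in> cl b \<Longrightarrow> z \<in> cl d \<Longrightarrow>
      c \<le> norm (sgn (z - y) - sgn (y - x))"
proof -
  define f where "f = (\<lambda>(x::complex, y, z). norm (sgn (z - y) - sgn (y - x)))"
  define K where "K = (\<Union>(a,b,d) \<in> {(a, b, d). a \<noteq> b \<and> b \<noteq> d}. cl a \<times> cl b \<times> cl d)"
  have "compact K" unfolding K_def
    by (intro compact_UN) (auto intro!: compact_Times cl_compact)
  moreover have "continuous_on K f"
    unfolding f_def split_def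
  proof (intro continuous_intros ballI)
    fix k assume "k \<in> K"
    then obtain a b d where "a \<noteq> b" "b \<noteq> d" "k \<in> cl a \<times> cl b \<times> cl d" unfolding K_def by auto
    then show "snd (snd k) - fst (snd k) \<noteq> 0" "fst (snd k) - fst k \<noteq> 0"
      using cl_label_unique[of "fst (snd k)"] by (auto simp: mem_Times_iff)
  qed
  moreover have "K \<noteq> {}"
  proof -
    obtain x y where "x \<in> cl 1" "y \<in> cl 2" using cl_ne[of 1] cl_ne[of 2] by (metis all_not_in_conv)
    then have "(x, y, x) \<in> K"
      unfolding K_def by (intro UN_I[of "(1, 2, 1)"]) auto
    then show ?thesis by blast
  qed
  ultimately obtain k where k: "k \<in> K" "\<And>k'. k' \<in> K \<Longrightarrow> f k \<le> f k'"
    using continuous_attains_inf[of K f] by blast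
  have "0 < f k"
  proof -
    obtain a b d x y z where "a \<noteq> b" "b \<noteq> d" "x \<in> cl a" "y \<in> cl b" "z \<in> cl d" "k = (x, y, z)"
      using k(1) unfolding K_def by auto
    with directions_distinct[of a b d x y z] show ?thesis by (simp add: f_def)
  qed
  moreover have "f k \<le> norm (sgn (z - y) - sgn (y - x))"
    if "a \<noteq> b" "b \<noteq> d" "x \<in> cl a" "y \<in> cl b" "z \<in> cl d" for a b d x y z
  proof -
    have "(x, y, z) \<in> K" unfolding K_def using that by (intro UN_I[of "(a, b, d)"]) auto
    from k(2)[OF this] show ?thesis by (simp add: f_def)
  qed
  ultimately show ?thesis using that by blast
qed

section \<open>Normals, hitting times and the first collision\<close>

abbreviation nu where "nu \<equiv> normal_at T"

text \<open>\<open>THE\<close> is unambiguous: a point determines its obstacle by disjointness, and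
  its normal by \<open>nml_unique\<close>.\<close>

lemma normal_at_bd: "nu (bd i s) = nml i s"
  unfolding normal_at_def
proof (rule the_equality)
  fix n assume "\<exists>j t. bd i s = bd j t \<and> n = nml j t"
  then obtain j t where jt: "bd i s = bd j t" "n = nml j t" by blast
  then have "j = i" using cl_label_unique[of "bd j t"] bd_cl[of j t] bd_cl[of i s] by simp
  then show "n = nml i s" using jt nml_unique[of i s t] by simp
qed blast

lemma norm_nu: "q \<in> frontier (ob i) \<Longrightarrow> norm (nu q) = 1"
  using normal_at_bd norm_nml by (metis frontier_bdE)

lemma inner_nu_nu: "q \<in> frontier (ob i) \<Longrightarrow> nu q \<bullet> nu q = 1"
  by (simp add: dot_square_norm norm_nu)

lemma nu_support: "q \<in> frontier (ob i) \<Longrightarrow> y \<in> cl i \<Longrightarrow> nu q \<bullet> (y - q) \<le> 0"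
  using normal_at_bd supporting_normal by (metis frontier_bdE)

lemma nu_support_strict: "q \<in> frontier (ob i) \<Longrightarrow> y \<in> cl i \<Longrightarrow> y \<noteq> q \<Longrightarrow> nu q \<bullet> (y - q) < 0"
  using normal_at_bd supporting_normal_strict by (metis frontier_bdE)

lemma boundary_iff: "q \<in> boundary T \<longleftrightarrow> (\<exists>i. q \<in> frontier (ob i))"
  by (simp add: boundary_def)

lemma boundary_compact: "compact (boundary T)"
  unfolding boundary_def by (intro compact_UN) (auto simp: frontier_compact)

lemma ray_leaves:
  assumes q: "q \<in> frontier (ob i)" and v: "0 \<le> v \<bullet> nu q" "v \<noteq> 0" and t: "0 < t"
  shows "q + t *\<^sub>R v \<notin> cl i"
proof
  assume "q + t *\<^sub>R v \<in> cl i"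
  from nu_support_strict[OF q this] v t show False
    by (auto simp: inner_commute mult_less_0_iff)
qed

text \<open>\<open>billiard_map\<close> takes \<open>LEAST\<close> over the reals, which needs an
  attained minimum. The ray never meets its own obstacle again, so the hits lie on the other,
  disjoint boundaries and cannot accumulate at time 0.\<close>

lemma hit_least:
  assumes q: "q \<in> boundary T" and v: "norm v = 1" "0 \<le> v \<bullet> nu q" and ne: "hit_times T (q, v) \<noteq> {}"
  obtains t where "t \<in> hit_times T (q, v)" "(LEAST t. t \<in> hit_times T (q, v)) = t"
proof -
  obtain i where i: "q \<in> frontier (ob i)" using q boundary_iff by blast
  have v0: "v \<noteq> 0" using v(1) by auto
  have out: "\<And>t. 0 < t \<Longrightarrow> q + t *\<^sub>R v \<notin> cl i" using ray_leaves[OF i v(2) v0] .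
  define C where "C = (\<Union>j\<in>-{i}. frontier (ob j))"
  have C: "compact C" unfolding C_def by (intro compact_UN) (auto simp: frontier_compact)
  define H where "H = {t \<in> {0..}. q + t *\<^sub>R v \<in> C}"
  have H: "H = hit_times T (q, v)"
  proof -
    have "q \<notin> C" using i frontier_cl cl_label_unique unfolding C_def by blast
    then show ?thesis using out frontier_cl
      unfolding H_def hit_times_def boundary_def C_def
      by (auto simp: less_le) blast+
  qed
  have "closed H" unfolding H_def
  proof -
    have "closed ({0..} \<inter> (\<lambda>t. q + t *\<^sub>R v) -` C)"
      by (intro continuous_closed_preimage continuous_intros compact_imp_closed[OF C])
    then show "closed {t \<in> {0..}. q + t *\<^sub>R v \<in> C}" by (simp add: vimage_def Int_def)
  qed
  moreover have bdd: "bdd_below H" by (auto simp: H_def bdd_below_def)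
  ultimately have in_H: "Inf H \<in> H" using ne H closed_contains_Inf[of H] by simp
  have "(LEAST t. t \<in> H) = Inf H"
    using in_H bdd by (intro Least_equality) (auto intro: cInf_lower)
  then show ?thesis using that in_H H by blast
qed

text \<open>An earlier hit would lie between \<open>x\<close> and \<open>z\<close>. It is not on
  obstacle \<open>a\<close> because the ray has left it, not on \<open>b\<close> because the flight
  reaches \<open>z\<close> from the outer side of the tangent there, and not on the third by
  non-eclipse.\<close>

lemma hit_chord:
  assumes x: "x \<in> frontier (ob a)" and z: "z \<in> frontier (ob b)" and ab: "a \<noteq> b"
    and out: "0 \<le> sgn (z - x) \<bullet> nu x" and inc: "sgn (z - x) \<bullet> nu z < 0"
  shows "norm (z - x) \<in> hit_times T (x, sgn (z - x))"
    and "(LEAST t. t \<in> hit_times T (x, sgn (z - x))) = norm (z - x)"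
proof -
  have ne: "z \<noteq> x" using x z ab frontier_cl cl_label_unique by blast
  show mem: "norm (z - x) \<in> hit_times T (x, sgn (z - x))"
    using ne z by (auto simp: hit_times_def sgn_dist boundary_iff)
  have "t \<notin> hit_times T (x, sgn (z - x))" if t: "t < norm (z - x)" for t
  proof
    assume "t \<in> hit_times T (x, sgn (z - x))"
    then obtain c where t0: "0 < t" and c: "x + t *\<^sub>R sgn (z - x) \<in> frontier (ob c)"
      by (auto simp: hit_times_def boundary_iff)
    define y where "y = x + t *\<^sub>R sgn (z - x)"
    have zy: "y - z = - ((norm (z - x) - t) *\<^sub>R sgn (z - x))"
      by (simp add: y_def scaleR_diff_left sgn_dist)
    have ycl: "y \<in> cl c" using c frontier_cl y_def by simp
    have "c \<noteq> a"
      using ray_leaves[OF x out _ t0] ne ycl y_def by (auto simp: sgn_zero_iff)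
    moreover have "c \<noteq> b"
    proof
      assume "c = b"
      then have "nu z \<bullet> (y - z) \<le> 0" using nu_support[OF z] ycl by simp
      moreover have "nu z \<bullet> (y - z) = - ((norm (z - x) - t) * (sgn (z - x) \<bullet> nu z))"
        by (simp add: zy inner_commute)
      ultimately show False using inc t by (simp add: mult_le_0_iff zero_le_mult_iff not_le)
    qed
    moreover have "y \<in> closed_segment x z"
    proof -
      have "y = (1 - t / norm (z - x)) *\<^sub>R x + (t / norm (z - x)) *\<^sub>R z"
        using ne by (simp add: y_def sgn_div_norm algebra_simps divide_inverse)
      then show ?thesis unfolding closed_segment_def using t t0 ne by fastforce
    qed
    ultimately show False
      using not_between[of a c b x y z] x z ycl frontier_cl by blast
  qed
  then show "(LEAST t. t \<in> hit_times T (x, sgn (z - x))) = norm (z - x)"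
    using mem by (intro Least_equality) (auto simp: not_less[symmetric])
qed

lemma billiard_map_chord:
  assumes x: "x \<in> frontier (ob a)" and z: "z \<in> frontier (ob b)" and ab: "a \<noteq> b"
    and out: "0 \<le> sgn (z - x) \<bullet> nu x" and inc: "sgn (z - x) \<bullet> nu z < 0"
  shows "billiard_map T (x, sgn (z - x)) =
    (z, sgn (z - x) - (2 * (sgn (z - x) \<bullet> nu z)) *\<^sub>R nu z)"
    and "(x, sgn (z - x)) \<in> map_domain T"
proof -
  have ne: "z \<noteq> x" using x z ab frontier_cl cl_label_unique by blast
  show "billiard_map T (x, sgn (z - x)) =
    (z, sgn (z - x) - (2 * (sgn (z - x) \<bullet> nu z)) *\<^sub>R nu z)"
    unfolding billiard_map_def using hit_chord(2)[OF assms] by (simp add: Let_def sgn_dist)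
  show "(x, sgn (z - x)) \<in> map_domain T"
    using hit_chord(1)[OF assms] x out ne
    by (auto simp: map_domain_def collision_space_def boundary_iff norm_sgn)
qed

end

section \<open>Reflecting sequences\<close>

text \<open>Orbits are encoded by their collision points alone. Both directions are unit vectors, so
  a jump along the normal is exactly specular reflection, and \<open>c > 0\<close> says that the
  bounce happens on the outer side.\<close>

definition refl_seq :: "billiard \<Rightarrow> (int \<Rightarrow> 3) \<Rightarrow> (int \<Rightarrow> complex) \<Rightarrow> bool" where
  "refl_seq T \<rho> q \<longleftrightarrow> (\<forall>j. \<rho> (j + 1) \<noteq> \<rho> j \<and> q j \<in> frontier (obst T (\<rho> j)) \<and>
     (\<exists>c>0. sgn (q (j + 1) - q j) - sgn (q j - q (j - 1)) = c *\<^sub>R normal_at T (q j)))"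

definition dir :: "(int \<Rightarrow> complex) \<Rightarrow> int \<Rightarrow> complex" where
  "dir q j = sgn (q (j + 1) - q j)"

lemma refl_seq_shift: "refl_seq T \<rho> q \<Longrightarrow> refl_seq T (\<lambda>j. \<rho> (j + m)) (\<lambda>j. q (j + m))"
  unfolding refl_seq_def
proof (intro allI)
  fix j
  assume "\<forall>j. \<rho> (j + 1) \<noteq> \<rho> j \<and> q j \<in> frontier (obst T (\<rho> j)) \<and>
     (\<exists>c>0. sgn (q (j + 1) - q j) - sgn (q j - q (j - 1)) = c *\<^sub>R normal_at T (q j))"
  note A = spec[OF this, of "j + m"]
  have "j + m + 1 = j + 1 + m" "j + m - 1 = j - 1 + m" by simp_all
  with A show "\<rho> (j + 1 + m) \<noteq> \<rho> (j + m) \<and> q (j + m) \<in> frontier (obst T (\<rho> (j + m))) \<and>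
     (\<exists>c>0. sgn (q (j + 1 + m) - q (j + m)) - sgn (q (j + m) - q (j - 1 + m)) = c *\<^sub>R normal_at T (q (j + m)))"
    by simp
qed

text \<open>Time reversal: reading the points backwards negates and swaps the two unit directions,
  which leaves their difference unchanged. It turns statements about pasts into statements about
  futures.\<close>

lemma refl_seq_reverse: "refl_seq T \<rho> q \<Longrightarrow> refl_seq T (\<lambda>j. \<rho> (- j)) (\<lambda>j. q (- j))"
  unfolding refl_seq_def
proof (intro allI conjI)
  fix j
  assume A: "\<forall>j. \<rho> (j + 1) \<noteq> \<rho> j \<and> q j \<in> frontier (obst T (\<rho> j)) \<and>
     (\<exists>c>0. sgn (q (j + 1) - q j) - sgn (q j - q (j - 1)) = c *\<^sub>R normal_at T (q j))"
  show "\<rho> (- (j + 1)) \<noteq> \<rho> (- j)"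
    using A[rule_format, of "- j - 1"] by auto
  show "q (- j) \<in> frontier (obst T (\<rho> (- j)))" using A by blast
  obtain c where "c > 0" "sgn (q (- j + 1) - q (- j)) - sgn (q (- j) - q (- j - 1)) = c *\<^sub>R normal_at T (q (- j))"
    using A by blast
  moreover have "sgn (q (- j + 1) - q (- j)) - sgn (q (- j) - q (- j - 1)) =
    sgn (q (- (j + 1)) - q (- j)) - sgn (q (- j) - q (- (j - 1)))"
  proof -
    have "- (j + 1) = - j - 1" "- (j - 1) = - j + 1" by simp_all
    then show ?thesis
      using sgn_minus[of "q (- j + 1) - q (- j)"] sgn_minus[of "q (- j) - q (- j - 1)"]
      by (simp only: minus_diff_eq) simp
  qed
  ultimately show "\<exists>c>0. sgn (q (- (j + 1)) - q (- j)) - sgn (q (- j) - q (- (j - 1))) = c *\<^sub>R normal_at T (q (- j))"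
    by metis
qed

context table
begin

lemma refl_seqD:
  assumes "refl_seq T \<rho> q"
  shows refl_label: "\<rho> (j + 1) \<noteq> \<rho> j" and refl_label': "\<rho> j \<noteq> \<rho> (j - 1)"
    and refl_frontier: "q j \<in> frontier (ob (\<rho> j))" and refl_cl: "q j \<in> cl (\<rho> j)"
    and refl_norm_dir: "norm (dir q j) = 1"
    and refl_law: "\<exists>c>0. dir q j - dir q (j - 1) = c *\<^sub>R nu (q j)"
proof -
  show 1: "\<rho> (j + 1) \<noteq> \<rho> j" "\<rho> j \<noteq> \<rho> (j - 1)" 
    using assms unfolding refl_seq_def by (metis, metis diff_add_cancel)
  show 2: "q j \<in> frontier (ob (\<rho> j))" for j using assms unfolding refl_seq_def by metis
  show "q j \<in> cl (\<rho> j)" using 2 frontier_cl by blast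
  have "q (j + 1) \<noteq> q j" using 1 2 frontier_cl cl_label_unique by metis
  then show "norm (dir q j) = 1" by (simp add: dir_def norm_sgn)
  show "\<exists>c>0. dir q j - dir q (j - 1) = c *\<^sub>R nu (q j)"
    using assms unfolding refl_seq_def dir_def by simp
qed

text \<open>Two unit vectors that differ by a multiple \<open>c\<close> of the unit normal have
  opposite normal components: expanding the norm gives
  \<open>c = 2 * (dir q j \<bullet> nu (q j))\<close>.\<close>

lemma refl_reflect:
  assumes r: "refl_seq T \<rho> q"
  shows refl_out: "0 < dir q j \<bullet> nu (q j)" and refl_in: "dir q (j - 1) \<bullet> nu (q j) = - (dir q j \<bullet> nu (q j))"
    and refl_jump: "dir q j - dir q (j - 1) = (2 * (dir q j \<bullet> nu (q j))) *\<^sub>R nu (q j)"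
proof -
  obtain c where c: "c > 0" "dir q j - dir q (j - 1) = c *\<^sub>R nu (q j)" using refl_law[OF r] by blast
  have n: "nu (q j) \<bullet> nu (q j) = 1" using inner_nu_nu refl_frontier[OF r] by blast
  have "dir q (j - 1) = dir q j - c *\<^sub>R nu (q j)" using c(2) by (simp add: algebra_simps)
  then have "(norm (dir q (j - 1)))\<^sup>2 = (norm (dir q j))\<^sup>2 - 2 * c * (dir q j \<bullet> nu (q j)) + c * c"
    using norm_nu[OF refl_frontier[OF r, of j]] by (simp only: norm_diff_scaleR \<open>dir q (j - 1) = dir q j - c *\<^sub>R nu (q j)\<close>) (simp add: power2_eq_square)
  then have "c * (c - 2 * (dir q j \<bullet> nu (q j))) = 0"
    using refl_norm_dir[OF r] by (simp add: right_diff_distrib)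
  then have c2: "c = 2 * (dir q j \<bullet> nu (q j))" using c(1) by simp
  show "0 < dir q j \<bullet> nu (q j)" using c(1) c2 by simp
  show "dir q j - dir q (j - 1) = (2 * (dir q j \<bullet> nu (q j))) *\<^sub>R nu (q j)" using c(2) c2 by simp
  then have "(dir q j - dir q (j - 1)) \<bullet> nu (q j) = 2 * (dir q j \<bullet> nu (q j))" by (simp add: n)
  then show "dir q (j - 1) \<bullet> nu (q j) = - (dir q j \<bullet> nu (q j))" by (simp add: inner_diff_left)
qed

text \<open>The deflection at a bounce has length twice the cosine of the angle with the normal, so
  \<open>directions_gap\<close> bounds that cosine below for all orbits at once.\<close>

lemma refl_out_lower:
  obtains c where "0 < c" "\<And>\<rho> q j. refl_seq T \<rho> q \<Longrightarrow> c \<le> dir q j \<bullet> nu (q j)"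
proof -
  obtain c where c: "0 < c"
    "\<And>a b d x y z. a \<noteq> b \<Longrightarrow> b \<noteq> d \<Longrightarrow> x \<in> cl a \<Longrightarrow> y \<in> cl b \<Longrightarrow> z \<in> cl d \<Longrightarrow>
      c \<le> norm (sgn (z - y) - sgn (y - x))" using directions_gap by blast
  have "c / 2 \<le> dir q j \<bullet> nu (q j)" if r: "refl_seq T \<rho> q" for \<rho> q j
  proof -
    have "c \<le> norm (dir q j - dir q (j - 1))"
      using c(2)[of "\<rho> (j - 1)" "\<rho> j" "\<rho> (j + 1)" "q (j - 1)" "q j" "q (j + 1)"]
        refl_label[OF r] refl_label'[OF r] refl_cl[OF r] by (metis diff_add_cancel dir_def)
    also have "\<dots> = 2 * (dir q j \<bullet> nu (q j))"
      using refl_out[OF r, of j] norm_nu[OF refl_frontier[OF r]] by (simp add: refl_jump[OF r])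
    finally show ?thesis by simp
  qed
  then show ?thesis using that[of "c / 2"] c(1) by simp
qed

text \<open>\<open>collision_space\<close> admits tangential velocities. The point is that the jump
  is strictly positive, which holds because consecutive directions differ.\<close>

lemma realizes_imp_refl:
  assumes R: "realizes T \<rho> x" and lab: "\<And>j. \<rho> (j + 1) \<noteq> \<rho> j"
  shows "refl_seq T \<rho> (\<lambda>j. fst (x j))" and "x j = (fst (x j), dir (\<lambda>j. fst (x j)) j)"
proof -
  define q where "q = (\<lambda>j. fst (x j))"
  define v where "v = (\<lambda>j. snd (x j))"
  have xj: "x j = (q j, v j)" for j by (simp add: q_def v_def)
  have fr: "q j \<in> frontier (ob (\<rho> j))" for j using R by (simp add: realizes_def q_def)
  have dom: "(q j, v j) \<in> map_domain T" for j using R xj by (metis realizes_def)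
  have coll: "norm (v j) = 1" "0 \<le> v j \<bullet> nu (q j)" "q j \<in> boundary T" for j
    using dom[of j] by (auto simp: map_domain_def collision_space_def)
  have step: "v j = dir q j \<and> v (j + 1) = v j - (2 * (v j \<bullet> nu (q (j + 1)))) *\<^sub>R nu (q (j + 1))" for j
  proof -
    have "hit_times T (q j, v j) \<noteq> {}" using dom[of j] by (simp add: map_domain_def)
    from hit_least[OF coll(3,1,2) this] obtain t where
      t: "t \<in> hit_times T (q j, v j)" "(LEAST t. t \<in> hit_times T (q j, v j)) = t" by blast
    have "x (j + 1) = billiard_map T (q j, v j)" using R xj by (metis realizes_def)
    then have "(q (j + 1), v (j + 1)) = (q j + t *\<^sub>R v j, v j - (2 * (v j \<bullet> nu (q j + t *\<^sub>R v j))) *\<^sub>R nu (q j + t *\<^sub>R v j))"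
      using t(2) xj[of "j + 1"] by (simp add: billiard_map_def Let_def)
    moreover have "0 < t" using t(1) by (simp add: hit_times_def)
    ultimately show ?thesis using coll(1)[of j] by (auto simp: dir_def sgn_scaleR sgn_div_norm)
  qed
  show "x j = (fst (x j), dir (\<lambda>j. fst (x j)) j)"
    using xj step by (simp add: q_def)
  show "refl_seq T \<rho> (\<lambda>j. fst (x j))"
    unfolding refl_seq_def q_def[symmetric, unfolded fun_eq_iff, rule_format]
  proof (intro allI conjI)
    fix j
    show "\<rho> (j + 1) \<noteq> \<rho> j" by (rule lab)
    show "q j \<in> frontier (ob (\<rho> j))" by (rule fr)
    have e: "dir q j - dir q (j - 1) = (- 2 * (dir q (j - 1) \<bullet> nu (q j))) *\<^sub>R nu (q j)"
      using step[of "j - 1"] step[of j] by simp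
    have n: "nu (q j) \<bullet> nu (q j) = 1" using fr inner_nu_nu by blast
    have "dir q j \<bullet> nu (q j) = - (dir q (j - 1) \<bullet> nu (q j))"
      using arg_cong[OF e, of "\<lambda>z. z \<bullet> nu (q j)"] n by (simp add: inner_diff_left)
    then have "0 \<le> - 2 * (dir q (j - 1) \<bullet> nu (q j))" using coll(2)[of j] step[of j] by simp
    moreover have "dir q j \<noteq> dir q (j - 1)"
      using directions_distinct[of "\<rho> (j - 1)" "\<rho> j" "\<rho> (j + 1)" "q (j - 1)" "q j" "q (j + 1)"]
        lab[of j] lab[of "j - 1"] fr frontier_cl by (auto simp: dir_def)
    ultimately have "0 < - 2 * (dir q (j - 1) \<bullet> nu (q j))" using e by (auto simp: less_le)
    then show "\<exists>c>0. sgn (q (j + 1) - q j) - sgn (q j - q (j - 1)) = c *\<^sub>R nu (q j)"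
      using e by (intro exI[of _ "- 2 * (dir q (j - 1) \<bullet> nu (q j))"]) (simp add: dir_def)
  qed
qed

text \<open>Each chord between consecutive points is the first collision, by
  \<open>billiard_map_chord\<close>. Existence and uniqueness in \<open>labelled_orbit\<close> can
  therefore be settled for point sequences.\<close>

lemma refl_imp_realizes:
  assumes r: "refl_seq T \<rho> q"
  shows "realizes T \<rho> (\<lambda>j. (q j, dir q j))"
  unfolding realizes_def
proof (intro allI)
  fix j
  have c: "0 \<le> sgn (q (j + 1) - q j) \<bullet> nu (q j)"
    using refl_out[OF r, of j] by (simp add: dir_def)
  have i: "sgn (q (j + 1) - q j) \<bullet> nu (q (j + 1)) < 0"
    using refl_out[OF r, of "j + 1"] refl_in[OF r, of "j + 1"] by (simp add: dir_def)
  have m: "billiard_map T (q j, dir q j) = (q (j + 1), dir q j - (2 * (dir q j \<bullet> nu (q (j + 1)))) *\<^sub>R nu (q (j + 1)))"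
    "(q j, dir q j) \<in> map_domain T"
    using billiard_map_chord[OF refl_frontier[OF r] refl_frontier[OF r] refl_label[OF r, symmetric] c i]
    unfolding dir_def by auto
  have "dir q (j + 1) - dir q j = (2 * (dir q (j + 1) \<bullet> nu (q (j + 1)))) *\<^sub>R nu (q (j + 1))"
    using refl_jump[OF r, of "j + 1"] by simp
  moreover have "dir q j \<bullet> nu (q (j + 1)) = - (dir q (j + 1) \<bullet> nu (q (j + 1)))"
    using refl_in[OF r, of "j + 1"] by simp
  ultimately have "dir q (j + 1) = dir q j - (2 * (dir q j \<bullet> nu (q (j + 1)))) *\<^sub>R nu (q (j + 1))"
    by (simp add: algebra_simps)
  then show "(q j, dir q j) \<in> map_domain T \<and> (q (j + 1), dir q (j + 1)) = billiard_map T (q j, dir q j) \<and>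
         fst (q j, dir q j) \<in> frontier (ob (\<rho> j))"
    using m refl_frontier[OF r] by simp
qed

end

lemma finite_uniform_pos:
  fixes P :: "'a \<Rightarrow> real \<Rightarrow> bool"
  assumes "finite A" "\<And>i. i \<in> A \<Longrightarrow> \<exists>d>0. P i d"
    and mono: "\<And>i d d'. P i d \<Longrightarrow> 0 < d' \<Longrightarrow> d' \<le> d \<Longrightarrow> P i d'"
  shows "\<exists>d>0. \<forall>i\<in>A. P i d"
  using assms(1,2)
proof (induction A rule: finite_induct)
  case empty
  show ?case by (intro exI[of _ 1]) simp
next
  case (insert a A)
  obtain d where d: "d > 0" "\<forall>i\<in>A. P i d" using insert by blast
  obtain d' where d': "d' > 0" "P a d'" using insert by blast
  show ?case
    using d d' mono by (intro exI[of _ "min d d'"]) (auto intro: mono)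
qed

context table
begin

section \<open>Uniform estimates over one period of the boundary\<close>

lemma bd_period_int: "bd i (s + of_int k * perim T i) = bd i s"
proof -
  have nat: "bd i (s + of_nat n * perim T i) = bd i s" for s n
  proof (induction n)
    case (Suc n)
    have "bd i (s + of_nat (Suc n) * perim T i) = bd i ((s + of_nat n * perim T i) + perim T i)"
      by (simp add: algebra_simps)
    then show ?case using Suc bd_period by simp
  qed simp
  show ?thesis
  proof (cases k)
    case (nonneg n)
    then show ?thesis using nat by simp
  next
    case (neg n)
    have "bd i (s + of_int k * perim T i) = bd i (s + of_int k * perim T i + of_nat (Suc n) * perim T i)"
      by (rule nat[symmetric])
    also have "s + of_int k * perim T i + of_nat (Suc n) * perim T i = s"
    proof -
      have "real_of_int k = - real (Suc n)" using neg by simp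
      then show ?thesis by (simp only: mult_minus_left)
    qed
    finally show ?thesis .
  qed
qed

lemma bd_window:
  obtains s' k where "s' \<in> {c..<c + perim T i}" "bd i s' = bd i s" "s' = s + of_int k * perim T i"
proof -
  define l where "l = perim T i"
  have l: "0 < l" using perim_pos by (simp add: l_def)
  define k where "k = \<lfloor>(s - c) / l\<rfloor>"
  define s' where "s' = s + of_int (- k) * l"
  have "of_int k \<le> (s - c) / l" "(s - c) / l < of_int k + 1" unfolding k_def by linarith+
  then have "of_int k * l \<le> s - c" "s - c < (of_int k + 1) * l"
    using l by (simp_all add: pos_le_divide_eq pos_divide_less_eq)
  then have "s' \<in> {c..<c + l}" by (simp add: s'_def algebra_simps)
  moreover have "bd i s' = bd i s" using bd_period_int[of i s "- k"] by (simp add: s'_def l_def)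
  ultimately show ?thesis using that[of s' "- k"] by (simp add: l_def s'_def)
qed

lemma frontier_window:
  assumes "q \<in> frontier (ob i)" obtains s where "s \<in> {c..<c + perim T i}" "q = bd i s"
  using assms by (metis frontier_bdE bd_window)

text \<open>Strictness of the support inequality, made uniform by compactness of the pairs of
  parameters in one period.\<close>

lemma support_gap:
  assumes \<delta>: "0 < \<delta>"
  shows "\<exists>\<tau>>0. \<forall>i q y. q \<in> frontier (ob i) \<longrightarrow> y \<in> frontier (ob i) \<longrightarrow> \<delta> \<le> norm (y - q) \<longrightarrow> nu q \<bullet> (y - q) \<le> - \<tau>"
proof -
  have "\<exists>\<tau>>0. \<forall>i\<in>UNIV. \<forall>q\<in>frontier (ob i). \<forall>y\<in>frontier (ob i). \<delta> \<le> norm (y - q) \<longrightarrow> nu q \<bullet> (y - q) \<le> - \<tau>"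
  proof (rule finite_uniform_pos)
    fix i :: 3
    define I where "I = {0..perim T i}"
    define K where "K = {z \<in> I \<times> I. \<delta> \<le> norm (bd i (snd z) - bd i (fst z))}"
    define f where "f = (\<lambda>z. nml i (fst z) \<bullet> (bd i (snd z) - bd i (fst z)))"
    have I: "compact (I \<times> I)" by (simp add: I_def compact_Times)
    have comp: "continuous_on S (\<lambda>z. bd i (snd z))" "continuous_on S (\<lambda>z. bd i (fst z))"
      "continuous_on S (\<lambda>z. nml i (fst z))" for S :: "(real \<times> real) set"
      by (auto intro!: continuous_on_compose2[OF bd_cont[of UNIV]] continuous_on_compose2[OF nml_cont[of UNIV]] continuous_intros)
    have "compact ((I \<times> I) \<inter> (\<lambda>z. norm (bd i (snd z) - bd i (fst z))) -` {\<delta>..})"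
      by (rule compact_Int_closed[OF I]) (intro closed_vimage continuous_on_norm continuous_on_diff comp closed_atLeast)
    then have K: "compact K" by (simp add: K_def vimage_def Int_def)
    have f: "continuous_on K f" unfolding f_def by (intro continuous_intros comp)
    have fneg: "f z < 0" if "z \<in> K" for z
      using that \<delta> supporting_normal_strict[OF bd_cl, of i "snd z" "fst z"]
      by (cases "bd i (snd z) = bd i (fst z)") (auto simp: K_def f_def)
    obtain \<tau> where \<tau>: "\<tau> > 0" "\<And>z. z \<in> K \<Longrightarrow> f z \<le> - \<tau>"
    proof (cases "K = {}")
      case True
      then show ?thesis using that[of 1] by simp
    next
      case False
      then obtain z0 where "z0 \<in> K" "\<And>z. z \<in> K \<Longrightarrow> f z \<le> f z0"
        using continuous_attains_sup[OF K _ f] by blast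
      then show ?thesis using that[of "- f z0"] fneg by simp
    qed
    show "\<exists>\<tau>>0. \<forall>q\<in>frontier (ob i). \<forall>y\<in>frontier (ob i). \<delta> \<le> norm (y - q) \<longrightarrow> nu q \<bullet> (y - q) \<le> - \<tau>"
    proof (intro exI[of _ \<tau>] conjI ballI impI)
      fix q y assume q: "q \<in> frontier (ob i)" and y: "y \<in> frontier (ob i)" and d: "\<delta> \<le> norm (y - q)"
      obtain s where s: "s \<in> {0..<0 + perim T i}" "q = bd i s" using frontier_window[OF q] .
      obtain t where t: "t \<in> {0..<0 + perim T i}" "y = bd i t" using frontier_window[OF y] .
      have "(s, t) \<in> K" using s t d by (simp add: K_def I_def)
      from \<tau>(2)[OF this] show "nu q \<bullet> (y - q) \<le> - \<tau>" using s t by (simp add: f_def normal_at_bd)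
    qed (rule \<tau>(1))
  qed (simp, meson neg_le_iff_le order_trans)
  then show ?thesis by blast
qed

section \<open>Orbits with equal labels are close\<close>

text \<open>Difference of directions paired with the difference of positions at the end of the
  flight. By \<open>cross_step\<close> and \<open>gain_nonneg\<close> it is a monotone quantity for
  two orbits with equal labels.\<close>

definition cross :: "(int \<Rightarrow> complex) \<Rightarrow> (int \<Rightarrow> complex) \<Rightarrow> int \<Rightarrow> real" where
  "cross q q' j = (dir q' j - dir q j) \<bullet> (q' (j + 1) - q (j + 1))"

text \<open>Contribution of bounce \<open>j\<close> to \<open>cross\<close>: the two normal jumps
  paired with the displacement. For equal labels both terms are nonnegative by the support
  inequality, and they detect how far apart the points are.\<close>

definition gain :: "(int \<Rightarrow> complex) \<Rightarrow> (int \<Rightarrow> complex) \<Rightarrow> int \<Rightarrow> real" where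
  "gain q q' j = - 2 * (dir q j \<bullet> nu (q j)) * (nu (q j) \<bullet> (q' j - q j)) -
     2 * (dir q' j \<bullet> nu (q' j)) * (nu (q' j) \<bullet> (q j - q' j))"

text \<open>The flight can only increase \<open>cross\<close> because \<open>sgn\<close> is
  monotone; the bounce adds exactly \<open>gain\<close> by the reflection law.\<close>

lemma cross_step:
  assumes r: "refl_seq T \<rho> q" and r': "refl_seq T \<rho>' q'"
  shows "cross q q' (j - 1) + gain q q' j \<le> cross q q' j"
proof -
  have m: "0 \<le> (dir q' j - dir q j) \<bullet> ((q' (j + 1) - q' j) - (q (j + 1) - q j))"
    unfolding dir_def by (rule sgn_monotone)
  have "dir q' j - dir q j = (dir q' (j - 1) - dir q (j - 1)) +
      ((2 * (dir q' j \<bullet> nu (q' j))) *\<^sub>R nu (q' j) - (2 * (dir q j \<bullet> nu (q j))) *\<^sub>R nu (q j))"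
    using refl_jump[OF r, of j] refl_jump[OF r', of j] by (simp add: algebra_simps)
  then have "(dir q' j - dir q j) \<bullet> (q' j - q j) = (dir q' (j - 1) - dir q (j - 1)) \<bullet> (q' j - q j) +
      ((2 * (dir q' j \<bullet> nu (q' j))) *\<^sub>R nu (q' j) - (2 * (dir q j \<bullet> nu (q j))) *\<^sub>R nu (q j)) \<bullet> (q' j - q j)"
    by (metis inner_add_left)
  also have "\<dots> = cross q q' (j - 1) + gain q q' j"
    by (simp add: cross_def gain_def inner_diff_left inner_diff_right algebra_simps)
  finally show ?thesis using m by (simp add: cross_def inner_diff_right algebra_simps)
qed

lemma gain_lower:
  assumes \<delta>: "0 < \<delta>"
  shows "\<exists>\<tau>>0. \<forall>\<rho> q \<rho>' q' j. refl_seq T \<rho> q \<longrightarrow> refl_seq T \<rho>' q' \<longrightarrow> \<rho> j = \<rho>' j \<longrightarrow>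
    \<delta> \<le> norm (q' j - q j) \<longrightarrow> \<tau> \<le> gain q q' j"
proof -
  obtain \<tau> where \<tau>: "\<tau> > 0" "\<And>i q y. q \<in> frontier (ob i) \<Longrightarrow> y \<in> frontier (ob i) \<Longrightarrow> \<delta> \<le> norm (y - q) \<Longrightarrow> nu q \<bullet> (y - q) \<le> - \<tau>"
    using support_gap[OF \<delta>] by blast
  obtain c where c: "0 < c" "\<And>\<rho> q j. refl_seq T \<rho> q \<Longrightarrow> c \<le> dir q j \<bullet> nu (q j)"
    using refl_out_lower by blast
  have "c * \<tau> \<le> gain q q' j"
    if r: "refl_seq T \<rho> q" and r': "refl_seq T \<rho>' q'" and l: "\<rho> j = \<rho>' j" and d: "\<delta> \<le> norm (q' j - q j)"
    for \<rho> q \<rho>' q' j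
  proof -
    have "\<tau> \<le> - (nu (q j) \<bullet> (q' j - q j))"
      using \<tau>(2)[OF refl_frontier[OF r] _ d] refl_frontier[OF r', of j] l by force
    then have "c * \<tau> \<le> (dir q j \<bullet> nu (q j)) * - (nu (q j) \<bullet> (q' j - q j))"
      using c \<tau>(1) r by (intro mult_mono) (auto intro: order_trans[OF less_imp_le])
    moreover have "0 \<le> (dir q' j \<bullet> nu (q' j)) * - (nu (q' j) \<bullet> (q j - q' j))"
      using refl_out[OF r', of j] nu_support[OF refl_frontier[OF r', of j], of "q j"] refl_cl[OF r, of j] l
      by (intro mult_nonneg_nonneg) auto
    moreover have "0 < c * \<tau>" using c(1) \<tau>(1) by simp
    ultimately show ?thesis unfolding gain_def by (simp add: algebra_simps)
  qed
  then show ?thesis using c(1) \<tau>(1) by (intro exI[of _ "c * \<tau>"]) auto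
qed

lemma gain_nonneg:
  assumes r: "refl_seq T \<rho> q" and r': "refl_seq T \<rho>' q'" and l: "\<rho> j = \<rho>' j"
  shows "0 \<le> gain q q' j"
proof (cases "q' j = q j")
  case True
  then show ?thesis by (simp add: gain_def)
next
  case False
  then obtain \<tau> where "0 < \<tau>" "\<tau> \<le> gain q q' j"
    using gain_lower[of "norm (q' j - q j)"] r r' l by auto
  then show ?thesis by simp
qed

lemma cross_mono:
  assumes r: "refl_seq T \<rho> q" and r': "refl_seq T \<rho>' q'"
    and l: "\<And>j. m < j \<Longrightarrow> j \<le> m + int n \<Longrightarrow> c \<le> gain q q' j"
  shows "cross q q' m + real n * c \<le> cross q q' (m + int n)"
  using l
proof (induction n)
  case (Suc n)
  then have "cross q q' m + real n * c \<le> cross q q' (m + int n)" by simp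
  moreover have "c \<le> gain q q' (m + int (Suc n))" using Suc.prems by simp
  moreover have "m + int (Suc n) - 1 = m + int n" by simp
  ultimately show ?case using cross_step[OF r r', of "m + int (Suc n)"] by (simp add: algebra_simps)
qed simp

lemma cross_bound:
  assumes r: "refl_seq T \<rho> q" and r': "refl_seq T \<rho>' q'"
  shows "\<bar>cross q q' j\<bar> \<le> 2 * norm (q' (j + 1) - q (j + 1))"
proof -
  have "\<bar>cross q q' j\<bar> \<le> norm (dir q' j - dir q j) * norm (q' (j + 1) - q (j + 1))"
    unfolding cross_def by (rule Cauchy_Schwarz_ineq2)
  also have "\<dots> \<le> 2 * norm (q' (j + 1) - q (j + 1))"
    using norm_triangle_ineq4[of "dir q' j" "dir q j"] refl_norm_dir[OF r] refl_norm_dir[OF r']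
    by (intro mult_right_mono) auto
  finally show ?thesis .
qed

lemma boundary_diam:
  obtains D where "0 < D" "\<And>\<rho> q \<rho>' q' i j. refl_seq T \<rho> q \<Longrightarrow> refl_seq T \<rho>' q' \<Longrightarrow> norm (q' i - q j) \<le> D"
proof -
  obtain B where B: "\<And>x. x \<in> boundary T \<Longrightarrow> norm x \<le> B"
    using boundary_compact compact_imp_bounded bounded_iff by metis
  have "norm (q' i - q j) \<le> 2 * \<bar>B\<bar> + 1" if "refl_seq T \<rho> q" "refl_seq T \<rho>' q'" for \<rho> q \<rho>' q' i j
  proof -
    have "norm (q' i) \<le> B" "norm (q j) \<le> B"
      using B that refl_frontier boundary_iff by blast+
    then show ?thesis using norm_triangle_ineq4[of "q' i" "q j"] by linarith
  qed
  then show ?thesis using that[of "2 * \<bar>B\<bar> + 1"] by auto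
qed

text \<open>\<open>cross\<close> is bounded and nondecreasing where labels agree, so a fixed gain
  cannot recur too often: within \<open>K\<close> bounces on each side of \<open>a\<close> there is
  an index where the orbits are \<open>\<epsilon>\<close>-close. Near it \<open>cross\<close> is
  tiny, which leaves no room for the gain that a distance \<open>\<delta>\<close> at
  \<open>a\<close> would cause.\<close>

theorem label_closeness:
  assumes \<delta>: "0 < \<delta>"
  shows "\<exists>K::nat. \<forall>\<rho> q \<rho>' q' a. refl_seq T \<rho> q \<longrightarrow> refl_seq T \<rho>' q' \<longrightarrow>
    (\<forall>j. \<bar>j - a\<bar> \<le> int K \<longrightarrow> \<rho> j = \<rho>' j) \<longrightarrow> norm (q' a - q a) < \<delta>"
proof -
  obtain D where D: "0 < D" "\<And>\<rho> q \<rho>' q' i j. refl_seq T \<rho> q \<Longrightarrow> refl_seq T \<rho>' q' \<Longrightarrow> norm (q' i - q j) \<le> D"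
    using boundary_diam by blast
  obtain \<tau> where \<tau>: "\<tau> > 0" "\<And>\<rho> q \<rho>' q' j. refl_seq T \<rho> q \<Longrightarrow> refl_seq T \<rho>' q' \<Longrightarrow> \<rho> j = \<rho>' j \<Longrightarrow>
    \<delta> \<le> norm (q' j - q j) \<Longrightarrow> \<tau> \<le> gain q q' j" using gain_lower[OF \<delta>] by metis
  \<comment> \<open>At the two close indices \<open>cross\<close> has size at most
    \<open>2 * \<epsilon>\<close>, so its increase in between is at most
    \<open>4 * \<epsilon> = \<tau> / 2\<close>.\<close>
  define \<epsilon> where "\<epsilon> = \<tau> / 8"
  have \<epsilon>: "\<epsilon> > 0" using \<tau>(1) by (simp add: \<epsilon>_def)
  obtain \<tau>' where \<tau>': "\<tau>' > 0" "\<And>\<rho> q \<rho>' q' j. refl_seq T \<rho> q \<Longrightarrow> refl_seq T \<rho>' q' \<Longrightarrow> \<rho> j = \<rho>' j \<Longrightarrow>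
    \<epsilon> \<le> norm (q' j - q j) \<Longrightarrow> \<tau>' \<le> gain q q' j" using gain_lower[OF \<epsilon>] by metis
  \<comment> \<open>\<open>cross\<close> varies by at most \<open>4 * D\<close> overall, hence
    \<open>K\<close> gains of size \<open>\<tau>'\<close> are impossible.\<close>
  obtain K :: nat where K: "4 * D < real K * \<tau>'" using reals_Archimedean3[OF \<tau>'(1)] by blast
  have "norm (q' a - q a) < \<delta>"
    if r: "refl_seq T \<rho> q" and r': "refl_seq T \<rho>' q'" and l: "\<And>j. \<bar>j - a\<bar> \<le> int K \<Longrightarrow> \<rho> j = \<rho>' j"
    for \<rho> q \<rho>' q' a
  proof (rule ccontr)
    assume "\<not> norm (q' a - q a) < \<delta>"
    then have g: "\<tau> \<le> gain q q' a" using \<tau>(2)[OF r r'] l by simp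
    have small: "\<exists>j. m < j \<and> j \<le> m + int K \<and> norm (q' j - q j) < \<epsilon>"
      if "\<And>j. m < j \<Longrightarrow> j \<le> m + int K \<Longrightarrow> \<rho> j = \<rho>' j" for m
    proof (rule ccontr)
      assume "\<not> ?thesis"
      then have "\<tau>' \<le> gain q q' j" if "m < j" "j \<le> m + int K" for j
        using \<tau>'(2)[OF r r'] \<open>\<And>j. m < j \<Longrightarrow> j \<le> m + int K \<Longrightarrow> \<rho> j = \<rho>' j\<close> that by (metis not_less)
      from cross_mono[OF r r' this]
      have "cross q q' m + real K * \<tau>' \<le> cross q q' (m + int K)" by simp
      moreover have "\<bar>cross q q' m\<bar> \<le> 2 * D" "\<bar>cross q q' (m + int K)\<bar> \<le> 2 * D"
        using cross_bound[OF r r', of m] cross_bound[OF r r', of "m + int K"] D(2)[OF r r', of "m + 1" "m + 1"]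
          D(2)[OF r r', of "m + int K + 1" "m + int K + 1"] by auto
      ultimately show False using K by linarith
    qed
    obtain j0 where j0: "a - int K - 1 < j0" "j0 \<le> a - 1" "norm (q' j0 - q j0) < \<epsilon>"
      using small[of "a - int K - 1"] l by force
    obtain j1 where j1: "a < j1" "j1 \<le> a + int K" "norm (q' j1 - q j1) < \<epsilon>"
      using small[of a] l by force
    have mono: "cross q q' m \<le> cross q q' n" if "m \<le> n" "\<And>j. m < j \<Longrightarrow> j \<le> n \<Longrightarrow> \<rho> j = \<rho>' j" for m n
      using cross_mono[OF r r', of m "nat (n - m)" 0] that gain_nonneg[OF r r'] by auto
    \<comment> \<open>The index is \<open>j0 - 1\<close> because \<open>cross\<close> at an index
      involves the positions one step later.\<close>
    have "cross q q' (j0 - 1) \<le> cross q q' (a - 1)" by (rule mono) (use j0 l in auto)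
    moreover have "cross q q' a \<le> cross q q' (j1 - 1)" by (rule mono) (use j1 l in auto)
    moreover have "cross q q' (a - 1) + gain q q' a \<le> cross q q' a" by (rule cross_step[OF r r'])
    moreover have "\<bar>cross q q' (j0 - 1)\<bar> \<le> 2 * \<epsilon>" "\<bar>cross q q' (j1 - 1)\<bar> \<le> 2 * \<epsilon>"
      using cross_bound[OF r r', of "j0 - 1"] cross_bound[OF r r', of "j1 - 1"] j0(3) j1(3) by auto
    ultimately show False using g \<tau>(1) unfolding \<epsilon>_def by linarith
  qed
  then show ?thesis by blast
qed

text \<open>With all labels equal every window condition holds, so the distance at an index would be
  smaller than itself. This is uniqueness in the coding.\<close>

corollary refl_seq_unique:
  assumes r: "refl_seq T \<rho> q" and r': "refl_seq T \<rho> q'"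
  shows "q = q'"
proof (rule ext, rule ccontr)
  fix j assume "q j \<noteq> q' j"
  then have "0 < norm (q' j - q j)" by simp
  from label_closeness[OF this] r r' have "norm (q' j - q j) < norm (q' j - q j)" by blast
  then show False by simp
qed

section \<open>Orbits minimise length\<close>

text \<open>A calibration argument: each side of the competitor is at least its projection on the
  direction of the corresponding side of the orbit. Summation by parts leaves vertex terms, whose
  sign is right by the reflection law and the support inequality.\<close>

lemma orbit_minimal:
  assumes r: "refl_seq T \<rho> q" and per: "\<And>j. q (j + int N) = q j"
    and Q: "\<And>i. i < N \<Longrightarrow> Q i \<in> cl (\<rho> (a + int i))" and closed: "Q N = Q 0"
  shows "(\<Sum>i<N. norm (q (a + int i + 1) - q (a + int i))) \<le> (\<Sum>i<N. norm (Q (Suc i) - Q i))"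
proof -
  \<comment> \<open>The induction runs over open polygons; the two boundary terms cancel at
    \<open>n = N\<close> by periodicity of \<open>q\<close> and closedness of
    \<open>Q\<close>.\<close>
  have "(\<Sum>i<n. norm (q (a + int i + 1) - q (a + int i))) + dir q (a + int n - 1) \<bullet> (Q n - q (a + int n))
      - dir q (a - 1) \<bullet> (Q 0 - q a) \<le> (\<Sum>i<n. norm (Q (Suc i) - Q i))" if "n \<le> N" for n
    using that
  proof (induction n)
    case (Suc n)
    define b where "b = a + int n"
    have b1: "a + int (Suc n) = b + 1" by (simp add: b_def)
    have IH: "(\<Sum>i<n. norm (q (a + int i + 1) - q (a + int i))) + dir q (b - 1) \<bullet> (Q n - q b)
      - dir q (a - 1) \<bullet> (Q 0 - q a) \<le> (\<Sum>i<n. norm (Q (Suc i) - Q i))"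
      using Suc b_def by simp
    have "dir q b \<bullet> (Q n - q b) - dir q (b - 1) \<bullet> (Q n - q b) = 2 * (dir q b \<bullet> nu (q b)) * (nu (q b) \<bullet> (Q n - q b))"
      by (simp flip: inner_diff_left add: refl_jump[OF r])
    also have "\<dots> \<le> 0"
      using refl_out[OF r, of b] nu_support[OF refl_frontier[OF r, of b]] Q[of n] Suc.prems
      by (simp add: b_def mult_le_0_iff)
    finally have 1: "dir q b \<bullet> (Q n - q b) \<le> dir q (b - 1) \<bullet> (Q n - q b)" by simp
    have 2: "(Q (Suc n) - Q n) \<bullet> dir q b \<le> norm (Q (Suc n) - Q n)"
      unfolding dir_def by (rule inner_sgn_le)
    have 3: "norm (q (b + 1) - q b) = (q (b + 1) - q b) \<bullet> dir q b"
      unfolding dir_def by (simp add: inner_sgn_self)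
    have "(\<Sum>i<Suc n. norm (q (a + int i + 1) - q (a + int i))) =
      (\<Sum>i<n. norm (q (a + int i + 1) - q (a + int i))) + norm (q (b + 1) - q b)"
      by (simp add: b_def)
    then show ?case unfolding b1 using IH 1 2 3
      by (simp add: inner_diff_left inner_diff_right inner_commute algebra_simps)
  qed simp
  from this[of N] have "(\<Sum>i<N. norm (q (a + int i + 1) - q (a + int i))) + dir q (a + int N - 1) \<bullet> (Q N - q (a + int N))
      - dir q (a - 1) \<bullet> (Q 0 - q a) \<le> (\<Sum>i<N. norm (Q (Suc i) - Q i))" by simp
  moreover have "dir q (a + int N - 1) = dir q (a - 1)"
    using per[of a] per[of "a - 1"] by (simp add: dir_def algebra_simps)
  ultimately show ?thesis using per[of a] closed by simp
qed

end

section \<open>Existence of periodic orbits\<close>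

context table
begin

text \<open>First order condition for a vertex that minimises its two adjacent sides over a convex
  set. The gradient does not vanish because the two directions differ; hence the vertex is on the
  boundary and the gradient is an inward normal.\<close>

lemma vertex_reflects:
  assumes lab: "a \<noteq> b" "b \<noteq> d" and x: "x \<in> cl a" and y: "y \<in> cl b" and z: "z \<in> cl d"
    and min: "\<And>y'. y' \<in> cl b \<Longrightarrow> norm (y - x) + norm (z - y) \<le> norm (y' - x) + norm (z - y')"
  shows "y \<in> frontier (ob b) \<and> (\<exists>c>0. sgn (z - y) - sgn (y - x) = c *\<^sub>R nu y)"
proof -
  \<comment> \<open>The gradient at \<open>y\<close> of the length of the two sides.\<close>
  define w where "w = sgn (y - x) - sgn (z - y)"
  have w0: "w \<noteq> 0" using directions_distinct[OF lab x y z] by (simp add: w_def)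
  have ne: "y - x \<noteq> 0" "z - y \<noteq> 0" using lab x y z cl_label_unique by auto
  have w: "0 \<le> w \<bullet> (y' - y)" if y': "y' \<in> cl b" for y'
  proof (rule ccontr)
    define h where "h = y' - y"
    assume "\<not> 0 \<le> w \<bullet> (y' - y)"
    then have neg: "w \<bullet> h < 0" by (simp add: h_def)
    define f where "f t = norm (y + t *\<^sub>R h - x) + norm (z - (y + t *\<^sub>R h))" for t
    have d1: "((\<lambda>t. norm (y + t *\<^sub>R h - x)) has_derivative (\<lambda>t. sgn (y - x) \<bullet> (t *\<^sub>R h))) (at 0)"
      by (rule has_derivative_compose[of "\<lambda>t. y + t *\<^sub>R h - x" "\<lambda>t. t *\<^sub>R h" 0 UNIV norm "\<lambda>h. sgn (y - x) \<bullet> h"])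
        (use ne has_derivative_norm[of "y - x"] in \<open>auto intro!: derivative_eq_intros simp: inner_commute\<close>)
    have d2: "((\<lambda>t. norm (z - (y + t *\<^sub>R h))) has_derivative (\<lambda>t. sgn (z - y) \<bullet> (- (t *\<^sub>R h)))) (at 0)"
      by (rule has_derivative_compose[of "\<lambda>t. z - (y + t *\<^sub>R h)" "\<lambda>t. - (t *\<^sub>R h)" 0 UNIV norm "\<lambda>h. sgn (z - y) \<bullet> h"])
        (use ne has_derivative_norm[of "z - y"] in \<open>auto intro!: derivative_eq_intros simp: inner_commute\<close>)
    have "(f has_real_derivative w \<bullet> h) (at 0)"
      unfolding f_def[abs_def] has_field_derivative_def
      using has_derivative_add[OF d1 d2]
      by (rule has_derivative_eq_rhs) (auto simp: w_def fun_eq_iff inner_diff_left inner_commute[of h] algebra_simps)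
    from DERIV_neg_dec_right[OF this neg] obtain e where e: "e > 0"
      "\<And>t. 0 < t \<Longrightarrow> t < e \<Longrightarrow> f (0 + t) < f 0" by blast
    define t where "t = min (e / 2) 1"
    have t: "0 < t" "t < e" "t \<le> 1" using e(1) by (auto simp: t_def)
    have "y + t *\<^sub>R h = (1 - t) *\<^sub>R y + t *\<^sub>R y'" by (simp add: h_def algebra_simps)
    also have "\<dots> \<in> cl b" using t y y' cl_convex by (intro convexD) auto
    finally have "f 0 \<le> f t" using min by (simp add: f_def)
    then show False using e(2)[of t] t by simp
  qed
  have fr: "y \<in> frontier (ob b)"
  proof (rule ccontr)
    assume "y \<notin> frontier (ob b)"
    then have "y \<in> ob b" using y ob_open by (auto simp: frontier_def interior_open)
    then obtain e where e: "e > 0" "ball y e \<subseteq> ob b" using ob_open open_contains_ball by blast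
    \<comment> \<open>From an interior point a short step against the gradient stays in the obstacle
      and contradicts the variational inequality.\<close>
    define y' where "y' = y - (e / 2) *\<^sub>R sgn w"
    have "y' \<in> ball y e" using e(1) w0 by (simp add: y'_def dist_norm norm_sgn)
    then have "y' \<in> cl b" using e(2) closure_subset by blast
    from w[OF this] have "0 \<le> w \<bullet> (- (e / 2) *\<^sub>R sgn w)" by (simp add: y'_def)
    then show False using w0 e(1) by (simp add: inner_sgn_self mult_le_0_iff)
  qed
  then obtain s where s: "y = bd b s" by (rule frontier_bdE)
  have "- w \<bullet> bd b t \<le> - w \<bullet> bd b s" for t
    using w[OF bd_cl[of b t]] s by (simp add: inner_diff_right)
  note crit = critical_max_inner[of "- w" b s, OF this]
  define c where "c = - w \<bullet> nml b s"
  have "- w = c *\<^sub>R nml b s + 0 *\<^sub>R vel b s"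
    using frame_expand[of "- w" b s] unfolding crit(1) c_def .
  then have "- w = c *\<^sub>R nml b s" by simp
  moreover have "0 < c"
  proof -
    have "c \<noteq> 0" using \<open>- w = c *\<^sub>R nml b s\<close> w0 by auto
    then show ?thesis using crit(2) by (simp add: c_def)
  qed
  moreover have "sgn (z - y) - sgn (y - x) = - w" by (simp add: w_def)
  ultimately show ?thesis using fr s normal_at_bd by metis
qed

lemma periodic_repetition_nat:
  "i < length \<sigma> \<Longrightarrow> periodic_repetition \<sigma> (int i) = \<sigma> ! i"
  by (simp add: periodic_repetition_def)

lemma periodic_repetition_period: "periodic_repetition \<sigma> (j + int (length \<sigma>)) = periodic_repetition \<sigma> j"
  by (simp add: periodic_repetition_def)

lemma admissible_step:
  assumes adm: "admissible \<sigma>" shows "periodic_repetition \<sigma> (j + 1) \<noteq> periodic_repetition \<sigma> j"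
proof -
  define N where "N = int (length \<sigma>)"
  have N: "2 \<le> N" using adm by (simp add: admissible_def N_def)
  define i where "i = nat (j mod N)"
  have i: "i < length \<sigma>" "int i = j mod N" 
  proof -
    have "0 \<le> j mod N" "j mod N < N" using N by simp_all
    then show "i < length \<sigma>" "int i = j mod N"
      by (simp_all add: i_def nat_less_iff flip: N_def)
  qed
  have "(j + 1) mod N = int (Suc i mod length \<sigma>)"
    using i(2) by (simp add: of_nat_mod mod_add_right_eq add.commute[of j] flip: N_def)
  then have "nat ((j + 1) mod N) = Suc i mod length \<sigma>" by simp
  then show ?thesis
    using adm i(1) unfolding admissible_def periodic_repetition_def N_def[symmetric] i_def[symmetric] by simp
qed

text \<open>The orbit comes from minimising the perimeter over the product of the closed obstacles;
  minimality is then exploited one vertex at a time.\<close>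

lemma periodic_orbit_exists:
  assumes adm: "admissible \<sigma>"
  shows "\<exists>q. refl_seq T (periodic_repetition \<sigma>) q"
proof -
  define N where "N = length \<sigma>"
  have N: "2 \<le> N" using adm by (simp add: admissible_def N_def)
  \<comment> \<open>Coordinates from \<open>N\<close> on are pinned to 0, so that the product over
    all natural numbers is compact.\<close>
  define S where "S i = (if i < N then cl (\<sigma> ! i) else {0})" for i
  define K where "K = PiE UNIV S"
  define f where "f Q = (\<Sum>k<N. norm (Q (Suc k mod N) - Q k))" for Q :: "nat \<Rightarrow> complex"
  have "compactin (product_topology (\<lambda>i. euclidean) UNIV) (PiE UNIV S)"
    unfolding compactin_PiE by (auto simp: S_def ob_bounded)
  then have "compact K" by (simp add: K_def euclidean_product_topology)
  moreover have "K \<noteq> {}" using cl_ne by (auto simp: K_def PiE_eq_empty_iff S_def)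
  moreover have "continuous_on K f"
    unfolding f_def by (intro continuous_intros continuous_on_subset[OF continuous_on_product_coordinates]) auto
  ultimately obtain Q where Q: "Q \<in> K" "\<And>Q'. Q' \<in> K \<Longrightarrow> f Q \<le> f Q'"
    using continuous_attains_inf[of K f] by blast
  have Qcl: "Q i \<in> cl (\<sigma> ! i)" if "i < N" for i
    using PiE_mem[OF Q(1)[unfolded K_def], of i] that by (simp add: S_def)
  have vertex: "Q i \<in> frontier (ob (\<sigma> ! i)) \<and> (\<exists>c>0. sgn (Q (Suc i mod N) - Q i) - sgn (Q i - Q ip) = c *\<^sub>R nu (Q i))"
    if i: "i < N" and ip: "ip < N" "Suc ip mod N = i" for i ip
  proof (rule vertex_reflects)
    have "\<sigma> ! (Suc ip mod N) \<noteq> \<sigma> ! ip" using adm ip(1) by (simp add: admissible_def N_def)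
    then show "\<sigma> ! ip \<noteq> \<sigma> ! i" using ip by simp
    have "\<sigma> ! (Suc i mod N) \<noteq> \<sigma> ! i" using adm i by (simp add: admissible_def N_def)
    then show "\<sigma> ! i \<noteq> \<sigma> ! (Suc i mod N)" by simp
    show "Q ip \<in> cl (\<sigma> ! ip)" "Q i \<in> cl (\<sigma> ! i)" using Qcl i ip by auto
    show "Q (Suc i mod N) \<in> cl (\<sigma> ! (Suc i mod N))" using Qcl N by simp
    have sn: "Suc k mod N = (if Suc k = N then 0 else Suc k)" if "k < N" for k using that by auto
    have ne: "ip \<noteq> i" "Suc i mod N \<noteq> i" using ip i N sn by (auto split: if_splits)
    fix y' assume y': "y' \<in> cl (\<sigma> ! i)"
    define Q' where "Q' = Q(i := y')"
    have "Q' k \<in> S k" for k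
      using PiE_mem[OF Q(1)[unfolded K_def], of k] y' i by (auto simp: Q'_def S_def)
    then have "Q' \<in> K" by (auto simp: K_def)
    from Q(2)[OF this] have le: "f Q \<le> f Q'" .
    \<comment> \<open>Moving vertex \<open>i\<close> alone affects only the two sides that meet
      there.\<close>
    have split: "f P = norm (P (Suc i mod N) - P i) + norm (P i - P ip) +
       (\<Sum>k\<in>{..<N} - {i} - {ip}. norm (P (Suc k mod N) - P k))" for P
      unfolding f_def using i ip ne
      by (subst sum.remove[of _ i], simp, simp, subst sum.remove[of _ ip]) auto
    have same: "(\<Sum>k\<in>{..<N} - {i} - {ip}. norm (Q' (Suc k mod N) - Q' k)) =
      (\<Sum>k\<in>{..<N} - {i} - {ip}. norm (Q (Suc k mod N) - Q k))"
    proof (rule sum.cong[OF refl])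
      fix k assume k: "k \<in> {..<N} - {i} - {ip}"
      then have "Suc k mod N \<noteq> i" using ip sn[of k] sn[of ip] by (auto split: if_splits)
      then show "norm (Q' (Suc k mod N) - Q' k) = norm (Q (Suc k mod N) - Q k)"
        using k by (simp add: Q'_def)
    qed
    show "norm (Q i - Q ip) + norm (Q (Suc i mod N) - Q i) \<le> norm (y' - Q ip) + norm (Q (Suc i mod N) - y')"
      using le unfolding split[of Q] split[of Q'] same using ne by (simp add: Q'_def)
  qed
  define q where "q j = Q (nat (j mod int N))" for j
  have "refl_seq T (periodic_repetition \<sigma>) q"
    unfolding refl_seq_def
  proof (intro allI conjI)
    fix j
    show "periodic_repetition \<sigma> (j + 1) \<noteq> periodic_repetition \<sigma> j" by (rule admissible_step[OF adm])
    have nx: "nat ((k + 1) mod int N) = Suc (nat (k mod int N)) mod N" for k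
    proof -
      have "(k + 1) mod int N = int (Suc (nat (k mod int N)) mod N)"
        using N by (simp add: of_nat_mod mod_add_right_eq add.commute[of k])
      then show ?thesis by simp
    qed
    have lt: "nat (k mod int N) < N" for k using N by (simp add: nat_less_iff)
    have v: "Q (nat (j mod int N)) \<in> frontier (ob (\<sigma> ! nat (j mod int N))) \<and>
        (\<exists>c>0. sgn (Q (Suc (nat (j mod int N)) mod N) - Q (nat (j mod int N))) -
          sgn (Q (nat (j mod int N)) - Q (nat ((j - 1) mod int N))) = c *\<^sub>R nu (Q (nat (j mod int N))))"
      by (rule vertex[OF lt lt]) (use nx[of "j - 1"] in simp)
    then show "q j \<in> frontier (ob (periodic_repetition \<sigma> j))"
      by (simp add: q_def periodic_repetition_def N_def)
    show "\<exists>c>0. sgn (q (j + 1) - q j) - sgn (q j - q (j - 1)) = c *\<^sub>R nu (q j)"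
      using v by (simp add: q_def nx)
  qed
  then show ?thesis by blast
qed

definition orb :: "3 list \<Rightarrow> int \<Rightarrow> complex" where
  "orb \<sigma> j = fst (labelled_orbit T \<sigma> j)"

lemma labelled_orbit_eq:
  assumes adm: "admissible \<sigma>" and r: "refl_seq T (periodic_repetition \<sigma>) q"
  shows "labelled_orbit T \<sigma> = (\<lambda>j. (q j, dir q j))"
  unfolding labelled_orbit_def
proof (rule the_equality)
  show "realizes T (periodic_repetition \<sigma>) (\<lambda>j. (q j, dir q j))" by (rule refl_imp_realizes[OF r])
  fix x assume x: "realizes T (periodic_repetition \<sigma>) x"
  note R = realizes_imp_refl[OF x admissible_step[OF adm]]
  have "(\<lambda>j. fst (x j)) = q" using refl_seq_unique[OF R(1) r] .
  then show "x = (\<lambda>j. (q j, dir q j))" using R(2) by (metis (no_types, lifting) ext)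
qed

lemma orb_refl: "admissible \<sigma> \<Longrightarrow> refl_seq T (periodic_repetition \<sigma>) (orb \<sigma>)"
proof -
  assume adm: "admissible \<sigma>"
  then obtain q where q: "refl_seq T (periodic_repetition \<sigma>) q" using periodic_orbit_exists by blast
  then have "orb \<sigma> = q" using labelled_orbit_eq[OF adm q] by (simp add: orb_def fun_eq_iff)
  then show ?thesis using q by simp
qed

lemma labelled_orbit_orb: "admissible \<sigma> \<Longrightarrow> labelled_orbit T \<sigma> j = (orb \<sigma> j, dir (orb \<sigma>) j)"
  using labelled_orbit_eq[OF _ orb_refl] by simp

text \<open>The orbit shifted by one period has the same labels, so uniqueness identifies the
  two.\<close>

lemma orb_period:
  assumes "admissible \<sigma>" shows "orb \<sigma> (j + int (length \<sigma>)) = orb \<sigma> j"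
proof -
  have "refl_seq T (periodic_repetition \<sigma>) (\<lambda>j. orb \<sigma> (j + int (length \<sigma>)))"
    using refl_seq_shift[OF orb_refl[OF assms], of "int (length \<sigma>)"] by (simp add: periodic_repetition_period)
  from refl_seq_unique[OF this orb_refl[OF assms]] show ?thesis by metis
qed

lemma marked_length_eq:
  assumes "admissible \<sigma>"
  shows "marked_length T \<sigma> = (\<Sum>j<length \<sigma>. norm (orb \<sigma> (int j + 1) - orb \<sigma> (int j)))"
  unfolding marked_length_def orb_def by (simp add: Let_def dist_norm norm_minus_commute)

end

section \<open>Second order calculus of the chord length\<close>

lemma has_derivative_sgn:
  fixes x :: "'a :: real_inner"
  assumes "x \<noteq> 0"
  shows "(sgn has_derivative (\<lambda>h. (h - (h \<bullet> sgn x) *\<^sub>R sgn x) /\<^sub>R norm x)) (at x)"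
proof -
  have n: "(norm has_derivative (\<lambda>h. h \<bullet> sgn x)) (at x)"
    using has_derivative_norm[OF assms] by (simp add: inner_commute)
  have "((\<lambda>x. inverse (norm x)) has_derivative (\<lambda>h. - (inverse (norm x) * (h \<bullet> sgn x) * inverse (norm x)))) (at x)"
    by (rule Deriv.has_derivative_inverse[OF _ n]) (use assms in simp)
  from has_derivative_scaleR[OF this has_derivative_ident]
  have "((\<lambda>x. inverse (norm x) *\<^sub>R x) has_derivative
      (\<lambda>h. inverse (norm x) *\<^sub>R h + (- (inverse (norm x) * (h \<bullet> sgn x) * inverse (norm x))) *\<^sub>R x)) (at x)" .
  moreover have "inverse (norm x) *\<^sub>R h + (- (inverse (norm x) * (h \<bullet> sgn x) * inverse (norm x))) *\<^sub>R x =
      (h - (h \<bullet> sgn x) *\<^sub>R sgn x) /\<^sub>R norm x" for h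
    by (simp add: sgn_div_norm scaleR_diff_right)
  ultimately show ?thesis by (simp add: sgn_div_norm[abs_def])
qed

text \<open>In the plane the projection orthogonal to the unit vector \<open>e\<close> is the rank
  one projection onto \<open>\<i> * e\<close>.\<close>

lemma inner_perp:
  fixes u v e :: complex
  assumes "norm e = 1"
  shows "u \<bullet> v - (u \<bullet> e) * (v \<bullet> e) = (u \<bullet> (\<i> * e)) * (v \<bullet> (\<i> * e))"
proof -
  have "(Re e)\<^sup>2 + (Im e)\<^sup>2 = 1" using assms by (metis cmod_power2 one_power2)
  then have "u \<bullet> v = (u \<bullet> v) * ((Re e)\<^sup>2 + (Im e)\<^sup>2)" by simp
  then show ?thesis by (simp add: inner_complex_def power2_eq_square algebra_simps)
qed

lemma segment_mvt:
  fixes f :: "real \<times> real \<Rightarrow> real"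
  assumes d: "\<And>z. (f has_derivative (\<lambda>h. A z * fst h + B z * snd h)) (at z)"
  obtains \<theta> where "\<theta> \<in> closed_segment z z'"
    "f z' - f z = A \<theta> * (fst z' - fst z) + B \<theta> * (snd z' - snd z)"
proof -
  define p where "p t = z + t *\<^sub>R (z' - z)" for t :: real
  have p: "(p has_derivative (\<lambda>t. t *\<^sub>R (z' - z))) (at t)" for t
    unfolding p_def[abs_def] by (auto intro!: derivative_eq_intros)
  have "((\<lambda>t. f (p t)) has_real_derivative A (p t) * (fst z' - fst z) + B (p t) * (snd z' - snd z)) (at t)" for t
    unfolding has_field_derivative_def
    using has_derivative_compose[OF p d]
    by (rule has_derivative_eq_rhs) (auto simp: fun_eq_iff algebra_simps)
  from MVT2[of 0 1 "\<lambda>t. f (p t)", OF _ this] obtain t where t: "0 < t" "t < 1"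
    "f (p 1) - f (p 0) = A (p t) * (fst z' - fst z) + B (p t) * (snd z' - snd z)" by auto
  have "p t = (1 - t) *\<^sub>R z + t *\<^sub>R z'" by (simp add: p_def algebra_simps)
  then have "p t \<in> closed_segment z z'" unfolding closed_segment_def using t by fastforce
  then show ?thesis using that t(3) by (simp add: p_def)
qed

text \<open>Boxes instead of discs: they are convex, and each arc-length parameter is bounded
  separately.\<close>

definition box_at :: "real \<Rightarrow> real \<times> real \<Rightarrow> (real \<times> real) set" where
  "box_at \<delta> z = {fst z - \<delta><..<fst z + \<delta>} \<times> {snd z - \<delta><..<snd z + \<delta>}"

lemma mem_box_at: "w \<in> box_at \<delta> z \<longleftrightarrow> \<bar>fst w - fst z\<bar> < \<delta> \<and> \<bar>snd w - snd z\<bar> < \<delta>"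
  by (cases w) (auto simp: box_at_def abs_less_iff)

lemma box_at_segment: "z \<in> box_at \<delta> w \<Longrightarrow> z' \<in> box_at \<delta> w \<Longrightarrow> closed_segment z z' \<subseteq> box_at \<delta> w"
  unfolding box_at_def by (intro closed_segment_subset convex_Times) auto

text \<open>Pairs of points are controlled simultaneously because the mean value theorem yields a
  different intermediate point for each function.\<close>

lemma eventually_box_at:
  assumes "eventually P (nhds (z, z))"
  shows "\<exists>\<delta>>0. \<forall>\<theta>\<in>box_at \<delta> z. \<forall>\<theta>'\<in>box_at \<delta> z. P (\<theta>, \<theta>')"
proof -
  obtain d where d: "d > 0" "\<And>w. dist w (z, z) < d \<Longrightarrow> P w"
    using assms unfolding eventually_nhds_metric by blast
  have "P (\<theta>, \<theta>')" if "\<theta> \<in> box_at (d / 4) z" "\<theta>' \<in> box_at (d / 4) z" for \<theta> \<theta>'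
  proof (rule d(2))
    have *: "dist w z < d / 2" if "w \<in> box_at (d / 4) z" for w
    proof -
      have "dist w z \<le> \<bar>fst w - fst z\<bar> + \<bar>snd w - snd z\<bar>"
        using norm_Pair_le[of "fst w - fst z" "snd w - snd z"]
        by (metis dist_norm fst_diff prod.collapse real_norm_def snd_diff)
      then show ?thesis using that by (auto simp: mem_box_at)
    qed
    have "dist (\<theta>, \<theta>') (z, z) \<le> dist \<theta> z + dist \<theta>' z"
      using norm_Pair_le[of "\<theta> - z" "\<theta>' - z"] by (simp add: dist_norm)
    then show "dist (\<theta>, \<theta>') (z, z) < d" using *[OF that(1)] *[OF that(2)] by linarith
  qed
  then show ?thesis using d(1) by (intro exI[of _ "d / 4"]) auto
qed

text \<open>Closeness by a factor rather than by a difference: in a product of \<open>n\<close>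
  positive matrices such errors combine to at most \<open>g ^ n\<close>.\<close>

definition near :: "real \<Rightarrow> real \<Rightarrow> real \<Rightarrow> bool" where
  "near g x y \<longleftrightarrow> y / g \<le> x \<and> x \<le> g * y"

lemma eventually_near:
  fixes F :: "'a :: t2_space \<Rightarrow> real"
  assumes F: "isCont F w" "0 < F w" and g: "1 < g"
  shows "eventually (\<lambda>x. near g (F x) (F w)) (nhds w)"
proof -
  have t: "(F \<longlongrightarrow> F w) (nhds w)" using F(1) by (simp add: isCont_def tendsto_at_iff_tendsto_nhds)
  have 1: "eventually (\<lambda>x. F w / g < F x) (nhds w)"
    by (rule order_tendstoD[OF t]) (use F g in \<open>simp add: divide_less_eq\<close>)
  have 2: "eventually (\<lambda>x. F x < g * F w) (nhds w)"
    by (rule order_tendstoD[OF t]) (use F g in simp)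
  show ?thesis using 1 2 by eventually_elim (simp add: near_def)
qed

context table
begin

definition disp :: "3 \<Rightarrow> 3 \<Rightarrow> real \<times> real \<Rightarrow> complex" where
  "disp i j z = bd j (snd z) - bd i (fst z)"

definition chord :: "3 \<Rightarrow> 3 \<Rightarrow> real \<times> real \<Rightarrow> real" where
  "chord i j z = norm (disp i j z)"

text \<open>\<open>- sin1\<close> and \<open>sin2\<close> are the partial derivatives of the chord
  length, which is the generating function of the billiard map.\<close>

definition sin1 :: "3 \<Rightarrow> 3 \<Rightarrow> real \<times> real \<Rightarrow> real" where
  "sin1 i j z = sgn (disp i j z) \<bullet> vel i (fst z)"

definition sin2 :: "3 \<Rightarrow> 3 \<Rightarrow> real \<times> real \<Rightarrow> real" where
  "sin2 i j z = sgn (disp i j z) \<bullet> vel j (snd z)"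

definition cos1 :: "3 \<Rightarrow> 3 \<Rightarrow> real \<times> real \<Rightarrow> real" where
  "cos1 i j z = sgn (disp i j z) \<bullet> nml i (fst z)"

text \<open>The sign makes this positive for a flight that arrives from outside, where the direction
  points against the outer normal.\<close>

definition cos2 :: "3 \<Rightarrow> 3 \<Rightarrow> real \<times> real \<Rightarrow> real" where
  "cos2 i j z = - (sgn (disp i j z) \<bullet> nml j (snd z))"

text \<open>\<open>H11\<close>, \<open>H12\<close> and \<open>H22\<close> are the second partial
  derivatives of \<open>chord\<close>. The curvature terms come from the bending of the boundaries,
  the quotients by \<open>chord\<close> from the turning of the chord.\<close>

definition H11 :: "3 \<Rightarrow> 3 \<Rightarrow> real \<times> real \<Rightarrow> real" where
  "H11 i j z = curv i (fst z) * cos1 i j z + cos1 i j z * cos1 i j z / chord i j z"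

definition H12 :: "3 \<Rightarrow> 3 \<Rightarrow> real \<times> real \<Rightarrow> real" where
  "H12 i j z = cos1 i j z * cos2 i j z / chord i j z"

definition H22 :: "3 \<Rightarrow> 3 \<Rightarrow> real \<times> real \<Rightarrow> real" where
  "H22 i j z = curv j (snd z) * cos2 i j z + cos2 i j z * cos2 i j z / chord i j z"

lemma disp_nz: "i \<noteq> j \<Longrightarrow> disp i j z \<noteq> 0"
  using cl_label_unique[OF bd_cl[of i "fst z"], of j] bd_cl[of j "snd z"] by (auto simp: disp_def)

lemma chord_pos: "i \<noteq> j \<Longrightarrow> 0 < chord i j z" by (simp add: chord_def disp_nz)

lemma norm_edge_dir: "i \<noteq> j \<Longrightarrow> norm (sgn (disp i j z)) = 1" by (simp add: disp_nz norm_sgn)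

lemma has_derivative_bd_fst:
  "((\<lambda>z. bd i (fst z)) has_derivative (\<lambda>h. fst h *\<^sub>R vel i (fst z))) (at z)"
  "((\<lambda>z. vel i (fst z)) has_derivative (\<lambda>h. fst h *\<^sub>R acc i (fst z))) (at z)"
  "((\<lambda>z. bd i (snd z)) has_derivative (\<lambda>h. snd h *\<^sub>R vel i (snd z))) (at z)"
  "((\<lambda>z. vel i (snd z)) has_derivative (\<lambda>h. snd h *\<^sub>R acc i (snd z))) (at z)"
  for z :: "real \<times> real"
  using has_derivative_compose[OF has_derivative_fst[OF has_derivative_ident] bd_deriv[of i "fst z", unfolded has_vector_derivative_def]]
    has_derivative_compose[OF has_derivative_fst[OF has_derivative_ident] vel_deriv[of i "fst z", unfolded has_vector_derivative_def]]
    has_derivative_compose[OF has_derivative_snd[OF has_derivative_ident] bd_deriv[of i "snd z", unfolded has_vector_derivative_def]]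
    has_derivative_compose[OF has_derivative_snd[OF has_derivative_ident] vel_deriv[of i "snd z", unfolded has_vector_derivative_def]]
  by simp_all

lemma has_derivative_disp:
  "(disp i j has_derivative (\<lambda>h. snd h *\<^sub>R vel j (snd z) - fst h *\<^sub>R vel i (fst z))) (at z)"
  unfolding disp_def[abs_def] by (intro has_derivative_diff has_derivative_bd_fst)

lemma has_derivative_chord:
  assumes "i \<noteq> j"
  shows "(chord i j has_derivative (\<lambda>h. - sin1 i j z * fst h + sin2 i j z * snd h)) (at z)"
  unfolding chord_def[abs_def]
  using has_derivative_compose[OF has_derivative_disp has_derivative_norm[OF disp_nz[OF assms]], of z]
  by (rule has_derivative_eq_rhs)
    (auto simp: fun_eq_iff sin1_def sin2_def inner_diff_left inner_diff_right inner_commute)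

lemma inner_perp_nml: "vel i s \<bullet> (\<i> * e) = nml i s \<bullet> e"
  by (simp add: nml_eq inner_complex_def)

lemma has_derivative_dir:
  assumes "i \<noteq> j"
  shows "((\<lambda>z. sgn (disp i j z)) has_derivative
     (\<lambda>h. (snd h *\<^sub>R vel j (snd z) - fst h *\<^sub>R vel i (fst z) -
        ((snd h *\<^sub>R vel j (snd z) - fst h *\<^sub>R vel i (fst z)) \<bullet> sgn (disp i j z)) *\<^sub>R sgn (disp i j z)) /\<^sub>R chord i j z)) (at z)"
  unfolding chord_def
  using has_derivative_compose[OF has_derivative_disp has_derivative_sgn[OF disp_nz[OF assms]], of z] .

text \<open>Moving the endpoints turns the chord only through their displacements orthogonal to it,
  which are the arc-length steps times the cosines.\<close>

lemma perp_component:
  assumes "i \<noteq> j"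
  shows "(snd h *\<^sub>R vel j (snd z) - fst h *\<^sub>R vel i (fst z) -
        ((snd h *\<^sub>R vel j (snd z) - fst h *\<^sub>R vel i (fst z)) \<bullet> sgn (disp i j z)) *\<^sub>R sgn (disp i j z)) \<bullet> v =
    - (fst h * cos1 i j z + snd h * cos2 i j z) * (v \<bullet> (\<i> * sgn (disp i j z)))"
proof -
  define u where "u = snd h *\<^sub>R vel j (snd z) - fst h *\<^sub>R vel i (fst z)"
  define e where "e = sgn (disp i j z)"
  have "(u - (u \<bullet> e) *\<^sub>R e) \<bullet> v = (u \<bullet> (\<i> * e)) * (v \<bullet> (\<i> * e))"
    using inner_perp[of e u v] norm_edge_dir[OF assms, of z] by (simp add: e_def inner_diff_left inner_commute[of v])
  moreover have "u \<bullet> (\<i> * e) = - (fst h * cos1 i j z + snd h * cos2 i j z)"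
    by (simp add: u_def inner_diff_left inner_perp_nml cos1_def cos2_def e_def inner_commute[of "nml _ _"])
  ultimately show ?thesis by (simp add: u_def e_def)
qed

lemma has_derivative_sin1:
  assumes "i \<noteq> j"
  shows "(sin1 i j has_derivative (\<lambda>h. - H11 i j z * fst h + - H12 i j z * snd h)) (at z)"
  unfolding sin1_def[abs_def]
  using has_derivative_inner[OF has_derivative_dir[OF assms] has_derivative_bd_fst(2)]
proof (rule has_derivative_eq_rhs)
  show "(\<lambda>h. sgn (disp i j z) \<bullet> fst h *\<^sub>R acc i (fst z) +
          ((snd h *\<^sub>R vel j (snd z) - fst h *\<^sub>R vel i (fst z) -
           ((snd h *\<^sub>R vel j (snd z) - fst h *\<^sub>R vel i (fst z)) \<bullet> sgn (disp i j z)) *\<^sub>R sgn (disp i j z)) /\<^sub>R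
          chord i j z) \<bullet> vel i (fst z)) = (\<lambda>h. - H11 i j z * fst h + - H12 i j z * snd h)"
    unfolding inner_scaleR_left perp_component[OF assms] inner_perp_nml acc_eq
    using chord_pos[OF assms, of z]
    by (simp add: fun_eq_iff H11_def H12_def cos1_def[symmetric] inner_commute[of "nml _ _"] field_simps)
qed

lemma has_derivative_sin2:
  assumes "i \<noteq> j"
  shows "(sin2 i j has_derivative (\<lambda>h. H12 i j z * fst h + H22 i j z * snd h)) (at z)"
  unfolding sin2_def[abs_def]
  using has_derivative_inner[OF has_derivative_dir[OF assms] has_derivative_bd_fst(4)]
proof (rule has_derivative_eq_rhs)
  have e: "sgn (disp i j z) \<bullet> nml j (snd z) = - cos2 i j z" by (simp add: cos2_def)
  show "(\<lambda>h. sgn (disp i j z) \<bullet> snd h *\<^sub>R acc j (snd z) +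
          ((snd h *\<^sub>R vel j (snd z) - fst h *\<^sub>R vel i (fst z) -
           ((snd h *\<^sub>R vel j (snd z) - fst h *\<^sub>R vel i (fst z)) \<bullet> sgn (disp i j z)) *\<^sub>R sgn (disp i j z)) /\<^sub>R
          chord i j z) \<bullet> vel j (snd z)) = (\<lambda>h. H12 i j z * fst h + H22 i j z * snd h)"
    unfolding inner_scaleR_left perp_component[OF assms] inner_perp_nml acc_eq
    using chord_pos[OF assms, of z]
    by (simp add: fun_eq_iff H12_def H22_def e inner_commute[of "nml _ _"] field_simps)
qed

lemma cont_chord_data:
  assumes "i \<noteq> j"
  shows "continuous_on S (H11 i j)" "continuous_on S (H12 i j)" "continuous_on S (H22 i j)"
    and "continuous_on S (cos1 i j)" "continuous_on S (cos2 i j)"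
proof -
  have d: "continuous_on S (disp i j)"
    unfolding disp_def[abs_def]
    by (intro continuous_intros continuous_on_compose2[OF bd_cont[of UNIV]]) auto
  have c: "continuous_on S (chord i j)" unfolding chord_def[abs_def] by (intro continuous_intros d)
  have s: "continuous_on S (\<lambda>z. sgn (disp i j z))"
    by (intro continuous_intros d) (simp add: disp_nz[OF assms])
  show c1: "continuous_on S (cos1 i j)" and c2: "continuous_on S (cos2 i j)"
    unfolding cos1_def[abs_def] cos2_def[abs_def]
    by (intro continuous_intros s continuous_on_compose2[OF nml_cont[of UNIV]]; simp)+
  show "continuous_on S (H11 i j)" "continuous_on S (H12 i j)" "continuous_on S (H22 i j)"
    unfolding H11_def[abs_def] H12_def[abs_def] H22_def[abs_def]
    using chord_pos[OF assms]
    by (intro continuous_intros c c1 c2 continuous_on_compose2[OF curv_cont[of UNIV]]; simp add: less_imp_neq[symmetric])+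
qed

text \<open>An open condition under which the chord is a genuine flight with transversal ends;
  non-eclipse keeps the third obstacle out of the way.\<close>

definition visible :: "3 \<Rightarrow> 3 \<Rightarrow> real \<times> real \<Rightarrow> bool" where
  "visible i j z \<longleftrightarrow> i \<noteq> j \<and> 0 < cos1 i j z \<and> 0 < cos2 i j z"

text \<open>Minus the matrix with rows \<open>(mA, mB)\<close> and \<open>(mC, mD)\<close> is the
  derivative of the billiard map in arc length and sine of the angle. It solves
  \<open>dy = - (H11 dx + H12 dx')\<close>, \<open>dy' = H12 dx + H22 dx'\<close> for
  \<open>dx'\<close> and \<open>dy'\<close>.\<close>

definition mA :: "3 \<Rightarrow> 3 \<Rightarrow> real \<times> real \<Rightarrow> real" where "mA i j z = H11 i j z / H12 i j z"
definition mB :: "3 \<Rightarrow> 3 \<Rightarrow> real \<times> real \<Rightarrow> real" where "mB i j z = 1 / H12 i j z"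
definition mC :: "3 \<Rightarrow> 3 \<Rightarrow> real \<times> real \<Rightarrow> real" where
  "mC i j z = (H11 i j z * H22 i j z - H12 i j z * H12 i j z) / H12 i j z"
definition mD :: "3 \<Rightarrow> 3 \<Rightarrow> real \<times> real \<Rightarrow> real" where "mD i j z = H22 i j z / H12 i j z"

text \<open>The curvature-free part of the Hessian has rank one, which is the identity
  \<open>xy\<close>; positive curvature makes the whole positive definite. Symmetry of the mixed
  derivative gives determinant 1.\<close>

lemma visible_pos:
  assumes "visible i j z"
  shows H12_pos: "0 < H12 i j z" and H11_pos: "0 < H11 i j z" and H22_pos: "0 < H22 i j z"
    and hess_pos: "0 < H11 i j z * H22 i j z - H12 i j z * H12 i j z"
    and m_pos: "0 < mA i j z" "0 < mB i j z" "0 < mC i j z" "0 < mD i j z"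
    and m_det: "mA i j z * mD i j z - mB i j z * mC i j z = 1"
proof -
  have ij: "i \<noteq> j" and c: "0 < cos1 i j z" "0 < cos2 i j z" using assms by (auto simp: visible_def)
  note l = chord_pos[OF ij, of z]
  note k = curv_pos[of i "fst z"] curv_pos[of j "snd z"]
  show 12: "0 < H12 i j z" using c l by (simp add: H12_def)
  show 11: "0 < H11 i j z" and 22: "0 < H22 i j z"
    unfolding H11_def H22_def using c l k by (auto intro!: add_pos_pos)
  define x where "x = cos1 i j z * cos1 i j z / chord i j z"
  define y where "y = cos2 i j z * cos2 i j z / chord i j z"
  have xy: "H12 i j z * H12 i j z = x * y" by (simp add: H12_def x_def y_def field_simps)
  have "H11 i j z * H22 i j z - x * y = curv i (fst z) * cos1 i j z * H22 i j z + x * (curv j (snd z) * cos2 i j z)"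
    by (simp add: H11_def H22_def x_def[symmetric] y_def[symmetric] algebra_simps)
  also have "\<dots> > 0" using 22 c l k by (auto intro!: add_pos_pos mult_pos_pos simp: x_def)
  finally show h: "0 < H11 i j z * H22 i j z - H12 i j z * H12 i j z" by (simp add: xy)
  show "0 < mA i j z" "0 < mB i j z" "0 < mC i j z" "0 < mD i j z"
    using 11 12 22 h by (simp_all add: mA_def mB_def mC_def mD_def)
  show "mA i j z * mD i j z - mB i j z * mC i j z = 1"
    using 12 by (simp add: mA_def mB_def mC_def mD_def field_simps)
qed

lemma local_bounds:
  assumes v: "visible i j z"
  shows "\<exists>\<delta>>0. \<forall>\<theta>\<in>box_at \<delta> z. near 2 (H11 i j \<theta>) (H11 i j z) \<and> near 2 (H12 i j \<theta>) (H12 i j z) \<and>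
    near 2 (H22 i j \<theta>) (H22 i j z)"
proof -
  have ij: "i \<noteq> j" using v by (simp add: visible_def)
  have c: "isCont (\<lambda>w. F (fst w)) w" if "continuous_on UNIV F" for F :: "real \<times> real \<Rightarrow> real" and w :: "(real \<times> real) \<times> (real \<times> real)"
    using that by (auto intro!: continuous_on_interior[of UNIV] continuous_on_compose2[OF that] continuous_intros)
  note cc = cont_chord_data[OF ij, of UNIV]
  have "eventually (\<lambda>w. near 2 (H11 i j (fst w)) (H11 i j z) \<and> near 2 (H12 i j (fst w)) (H12 i j z) \<and>
    near 2 (H22 i j (fst w)) (H22 i j z)) (nhds (z, z))"
    using eventually_near[OF c[OF cc(1)], of "(z, z)" 2] eventually_near[OF c[OF cc(2)], of "(z, z)" 2]
      eventually_near[OF c[OF cc(3)], of "(z, z)" 2] visible_pos[OF v]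
    by (intro eventually_conj) auto
  from eventually_box_at[OF this] show ?thesis by auto
qed

text \<open>Finite differences instead of derivatives: the exact difference of two flights is minus
  a matrix with entries within a factor \<open>g\<close> of those at \<open>z0\<close>. Solved
  backwards, with the sine difference negated, the matrix is again positive, which later gives an
  invariant cone for backward time.\<close>

lemma local_step:
  assumes v: "visible i j z0" and g: "1 < g"
  shows "\<exists>\<delta>>0. \<forall>z\<in>box_at \<delta> z0. \<forall>z'\<in>box_at \<delta> z0. 
    (\<exists>A B C D. near g A (mA i j z0) \<and> near g B (mB i j z0) \<and> near g C (mC i j z0) \<and> near g D (mD i j z0) \<and>
      snd z' - snd z = - (A * (fst z' - fst z) + B * (sin1 i j z' - sin1 i j z)) \<and>
      sin2 i j z' - sin2 i j z = - (C * (fst z' - fst z) + D * (sin1 i j z' - sin1 i j z))) \<and>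
    (\<exists>A B C D. near g A (mA i j z0) \<and> near g B (mB i j z0) \<and> near g C (mC i j z0) \<and> near g D (mD i j z0) \<and>
      fst z' - fst z = - (D * (snd z' - snd z) + B * - (sin2 i j z' - sin2 i j z)) \<and>
      - (sin1 i j z' - sin1 i j z) = - (C * (snd z' - snd z) + A * - (sin2 i j z' - sin2 i j z)))"
proof -
  have ij: "i \<noteq> j" using v by (simp add: visible_def)
  note cc = cont_chord_data[OF ij, of UNIV]
  \<comment> \<open>\<open>a\<close> and \<open>b\<close> sit at the intermediate point for
    \<open>sin1\<close>, \<open>b'\<close> and \<open>d\<close> at the one for \<open>sin2\<close>;
    this is why the mixed derivative occurs twice.\<close>
  define a where "a w = H11 i j (fst w)" for w :: "(real \<times> real) \<times> (real \<times> real)"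
  define b where "b w = H12 i j (fst w)" for w :: "(real \<times> real) \<times> (real \<times> real)"
  define b' where "b' w = H12 i j (snd w)" for w :: "(real \<times> real) \<times> (real \<times> real)"
  define d where "d w = H22 i j (snd w)" for w :: "(real \<times> real) \<times> (real \<times> real)"
  have cont: "isCont a w" "isCont b w" "isCont b' w" "isCont d w" for w
    unfolding a_def[abs_def] b_def[abs_def] b'_def[abs_def] d_def[abs_def]
    by (auto intro!: continuous_on_interior[of UNIV] continuous_on_compose2[OF cc(1)] continuous_on_compose2[OF cc(2)]
      continuous_on_compose2[OF cc(3)] continuous_intros)
  define w0 where "w0 = (z0, z0)"
  have w0: "a w0 = H11 i j z0" "b w0 = H12 i j z0" "b' w0 = H12 i j z0" "d w0 = H22 i j z0"
    by (simp_all add: w0_def a_def b_def b'_def d_def)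
  have nz: "b w0 \<noteq> 0" "b' w0 \<noteq> 0" using visible_pos(1)[OF v] w0 by auto
  have ev: "eventually (\<lambda>w. near g (F w) y) (nhds w0)" if "isCont F w0" "F w0 = y" "0 < y" for F y
    using eventually_near[OF that(1) _ g] that by simp
  have "eventually (\<lambda>w. (0 < b w \<and> 0 < b' w) \<and>
      (near g (a w / b w) (mA i j z0) \<and> near g (1 / b w) (mB i j z0) \<and>
       near g ((a w * d w - b w * b' w) / b w) (mC i j z0) \<and> near g (d w / b w) (mD i j z0)) \<and>
      (near g (a w / b' w) (mA i j z0) \<and> near g (1 / b' w) (mB i j z0) \<and>
       near g ((a w * d w - b w * b' w) / b' w) (mC i j z0) \<and> near g (d w / b' w) (mD i j z0))) (nhds w0)"
  proof (intro eventually_conj)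
    have "(b \<longlongrightarrow> b w0) (nhds w0)" "(b' \<longlongrightarrow> b' w0) (nhds w0)"
      using cont(2)[of w0] cont(3)[of w0] unfolding isCont_def tendsto_at_iff_tendsto_nhds .
    then show "eventually (\<lambda>w. 0 < b w) (nhds w0)" "eventually (\<lambda>w. 0 < b' w) (nhds w0)"
      using visible_pos(1)[OF v] w0 by (auto elim: order_tendstoD(1))
  qed (rule ev, (intro continuous_intros cont nz), (simp add: w0 mA_def mB_def mC_def mD_def), rule visible_pos[OF v])+
  from eventually_box_at[OF this[unfolded w0_def]] obtain \<delta> where \<delta>: "\<delta> > 0"
    and n: "\<And>\<theta> \<theta>'. \<theta> \<in> box_at \<delta> z0 \<Longrightarrow> \<theta>' \<in> box_at \<delta> z0 \<Longrightarrow> 0 < b (\<theta>, \<theta>') \<and> 0 < b' (\<theta>, \<theta>') \<and>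
      (near g (a (\<theta>, \<theta>') / b (\<theta>, \<theta>')) (mA i j z0) \<and> near g (1 / b (\<theta>, \<theta>')) (mB i j z0) \<and>
       near g ((a (\<theta>, \<theta>') * d (\<theta>, \<theta>') - b (\<theta>, \<theta>') * b' (\<theta>, \<theta>')) / b (\<theta>, \<theta>')) (mC i j z0) \<and> near g (d (\<theta>, \<theta>') / b (\<theta>, \<theta>')) (mD i j z0)) \<and>
      (near g (a (\<theta>, \<theta>') / b' (\<theta>, \<theta>')) (mA i j z0) \<and> near g (1 / b' (\<theta>, \<theta>')) (mB i j z0) \<and>
       near g ((a (\<theta>, \<theta>') * d (\<theta>, \<theta>') - b (\<theta>, \<theta>') * b' (\<theta>, \<theta>')) / b' (\<theta>, \<theta>')) (mC i j z0) \<and> near g (d (\<theta>, \<theta>') / b' (\<theta>, \<theta>')) (mD i j z0))"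
    by metis
  show ?thesis
  proof (rule exI[of _ \<delta>], intro conjI \<delta> ballI)
    fix z z' assume z: "z \<in> box_at \<delta> z0" and z': "z' \<in> box_at \<delta> z0"
    obtain \<theta> where \<theta>: "\<theta> \<in> closed_segment z z'"
      "sin1 i j z' - sin1 i j z = - H11 i j \<theta> * (fst z' - fst z) + - H12 i j \<theta> * (snd z' - snd z)"
      by (rule segment_mvt[OF has_derivative_sin1[OF ij]])
    obtain \<theta>' where \<theta>': "\<theta>' \<in> closed_segment z z'"
      "sin2 i j z' - sin2 i j z = H12 i j \<theta>' * (fst z' - fst z) + H22 i j \<theta>' * (snd z' - snd z)"
      by (rule segment_mvt[OF has_derivative_sin2[OF ij]])
    define x x' y y' where xy: "x = fst z' - fst z" "x' = snd z' - snd z" "y = sin1 i j z' - sin1 i j z" "y' = sin2 i j z' - sin2 i j z"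
    define p q r s where pq: "p = a (\<theta>, \<theta>')" "q = b (\<theta>, \<theta>')" "r = b' (\<theta>, \<theta>')" "s = d (\<theta>, \<theta>')"
    have y: "y = - p * x + - q * x'" "y' = r * x + s * x'"
      using \<theta>(2) \<theta>'(2) by (simp_all add: xy pq a_def b_def b'_def d_def)
    have box: "\<theta> \<in> box_at \<delta> z0" "\<theta>' \<in> box_at \<delta> z0" using box_at_segment[OF z z'] \<theta>(1) \<theta>'(1) by auto
    note nn = n[OF box, folded pq]
    have q: "q \<noteq> 0" "r \<noteq> 0" using nn by auto
    \<comment> \<open>Solving for the new position divides by the mixed derivative from
      \<open>sin1\<close>, solving for the old one by that from \<open>sin2\<close>.\<close>
    have e1: "x' = - (p / q * x + 1 / q * y)" "y' = - ((p * s - q * r) / q * x + s / q * y)"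
      using q unfolding y by (simp_all add: field_simps)
    have e2: "x = - (s / r * x' + 1 / r * - y')" "- y = - ((p * s - q * r) / r * x' + p / r * - y')"
      using q unfolding y by (simp_all add: field_simps)
    show "\<exists>A B C D. near g A (mA i j z0) \<and> near g B (mB i j z0) \<and> near g C (mC i j z0) \<and> near g D (mD i j z0) \<and>
      snd z' - snd z = - (A * (fst z' - fst z) + B * (sin1 i j z' - sin1 i j z)) \<and>
      sin2 i j z' - sin2 i j z = - (C * (fst z' - fst z) + D * (sin1 i j z' - sin1 i j z))"
      using nn e1 unfolding xy by blast
    show "\<exists>A B C D. near g A (mA i j z0) \<and> near g B (mB i j z0) \<and> near g C (mC i j z0) \<and> near g D (mD i j z0) \<and>
      fst z' - fst z = - (D * (snd z' - snd z) + B * - (sin2 i j z' - sin2 i j z)) \<and>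
      - (sin1 i j z' - sin1 i j z) = - (C * (snd z' - snd z) + A * - (sin2 i j z' - sin2 i j z))"
      using nn e2 unfolding xy by blast
  qed
qed

end

section \<open>The billiard map in coordinates\<close>

lemma isCont_nhds: "isCont f a \<Longrightarrow> (f \<longlongrightarrow> f a) (nhds a)"
  by (simp add: isCont_def tendsto_at_iff_tendsto_nhds)

context table
begin

lemma chart_dir:
  assumes v: "norm v = 1" "0 \<le> v \<bullet> nml i s"
  shows "nml i s * cis (arcsin (v \<bullet> vel i s)) = v"
proof -
  define y where "y = v \<bullet> vel i s"
  have *: "(v \<bullet> nml i s)\<^sup>2 + y\<^sup>2 = 1" using norm_frame[of v i s] v(1) by (simp add: y_def)
  have "0 \<le> (v \<bullet> nml i s)\<^sup>2" by simp
  then have "y\<^sup>2 \<le> 1" using * by linarith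
  then have "y\<^sup>2 \<le> 1\<^sup>2" by simp
  then have y: "- 1 \<le> y" "y \<le> 1" using abs_le_square_iff[of y 1] by (simp_all add: abs_le_iff)
  have "cos (arcsin y) = sqrt (1 - y\<^sup>2)" using y by (rule cos_arcsin)
  also have "\<dots> = v \<bullet> nml i s" using * v(2) by (intro real_sqrt_unique) auto
  finally have c: "cos (arcsin y) = v \<bullet> nml i s" .
  have "nml i s * cis (arcsin y) = cos (arcsin y) *\<^sub>R nml i s + sin (arcsin y) *\<^sub>R vel i s"
    by (simp add: complex_eq_iff nml_eq algebra_simps)
  also have "\<dots> = v" using frame_expand[of v i s] c y by (simp add: y_def)
  finally show ?thesis by (simp add: y_def)
qed

lemma sin_cos_chord:
  assumes "i \<noteq> j"
  shows "(cos1 i j z)\<^sup>2 + (sin1 i j z)\<^sup>2 = 1" "(cos2 i j z)\<^sup>2 + (sin2 i j z)\<^sup>2 = 1"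
  using norm_frame[of "sgn (disp i j z)" i "fst z"] norm_frame[of "sgn (disp i j z)" j "snd z"] norm_edge_dir[OF assms, of z]
  by (simp_all add: cos1_def sin1_def cos2_def sin2_def)

lemma visible_sin:
  assumes "visible i j z"
  shows "\<bar>sin1 i j z\<bar> < 1" "\<bar>sin2 i j z\<bar> < 1"
    and "sqrt (1 - (sin1 i j z)\<^sup>2) = cos1 i j z" "sqrt (1 - (sin2 i j z)\<^sup>2) = cos2 i j z"
proof -
  have ij: "i \<noteq> j" and c: "0 < cos1 i j z" "0 < cos2 i j z" using assms by (auto simp: visible_def)
  note s = sin_cos_chord[OF ij, of z]
  have "0 < (cos1 i j z)\<^sup>2" "0 < (cos2 i j z)\<^sup>2" using c by simp_all
  then have "(sin1 i j z)\<^sup>2 < 1" "(sin2 i j z)\<^sup>2 < 1" using s by linarith+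
  then show "\<bar>sin1 i j z\<bar> < 1" "\<bar>sin2 i j z\<bar> < 1" by (simp_all add: abs_square_less_1)
  show "sqrt (1 - (sin1 i j z)\<^sup>2) = cos1 i j z" "sqrt (1 - (sin2 i j z)\<^sup>2) = cos2 i j z"
    using s c by (auto intro!: real_sqrt_unique)
qed

text \<open>Ties the billiard map to the generating function: leaving with sine \<open>sin1\<close>
  aims along the chord, and reflection keeps the tangential part, so the outgoing sine is
  \<open>sin2\<close>.\<close>

lemma chart_map:
  assumes v: "visible i j z"
  shows "billiard_map T (chart T i (fst z, arcsin (sin1 i j z))) = chart T j (snd z, arcsin (sin2 i j z))"
proof -
  define e where "e = sgn (disp i j z)"
  have ij: "i \<noteq> j" and c: "0 < cos1 i j z" "0 < cos2 i j z" using v by (auto simp: visible_def)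
  have ne: "norm e = 1" using norm_edge_dir[OF ij] by (simp add: e_def)
  have 1: "nml i (fst z) * cis (arcsin (sin1 i j z)) = e"
    using chart_dir[OF ne, of i "fst z"] c by (simp add: e_def sin1_def cos1_def)
  define n where "n = nml j (snd z)"
  have nn: "n \<bullet> n = 1" by (simp add: n_def inner_nml_nml)
  define v' where "v' = e - (2 * (e \<bullet> n)) *\<^sub>R n"
  have "v' \<bullet> n = - (e \<bullet> n)" by (simp add: v'_def inner_diff_left nn)
  moreover have "- (e \<bullet> n) = cos2 i j z" by (simp add: cos2_def e_def n_def)
  ultimately have vn: "v' \<bullet> n = cos2 i j z" by simp
  have "(norm v')\<^sup>2 = 1" unfolding v'_def norm_diff_scaleR
    using ne nn by (simp add: norm_eq_sqrt_inner power2_eq_square)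
  then have nv: "norm v' = 1" by (simp add: power2_eq_1_iff) 
      (metis norm_ge_zero not_one_le_zero neg_0_le_iff_le le_minus_one_simps(3))
  have sv: "v' \<bullet> vel j (snd z) = sin2 i j z"
    by (simp add: v'_def inner_diff_left sin2_def e_def n_def inner_nml_vel)
  have 2: "nml j (snd z) * cis (arcsin (sin2 i j z)) = v'"
    using chart_dir[OF nv, of j "snd z"] vn c sv by (simp add: n_def)
  have "billiard_map T (bd i (fst z), sgn (bd j (snd z) - bd i (fst z))) = (bd j (snd z), v')"
    using billiard_map_chord(1)[OF bd_frontier bd_frontier ij, of "snd z" "fst z"] c
    by (simp add: normal_at_bd cos1_def cos2_def disp_def e_def v'_def n_def)
  then show ?thesis using 1 2 by (simp add: chart_def e_def disp_def)
qed

lemma visible_open: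
  assumes "visible i j z" shows "\<exists>\<delta>>0. \<forall>w\<in>box_at \<delta> z. visible i j w"
proof -
  have ij: "i \<noteq> j" and c: "0 < cos1 i j z" "0 < cos2 i j z" using assms by (auto simp: visible_def)
  have cc: "isCont (cos1 i j) z" "isCont (cos2 i j) z"
    using cont_chord_data(4,5)[OF ij, of UNIV] by (auto intro: continuous_on_interior)
  have "eventually (\<lambda>w. 0 < cos1 i j (fst w)) (nhds (z, z))" "eventually (\<lambda>w. 0 < cos2 i j (fst w)) (nhds (z, z))"
  proof -
    have "isCont (\<lambda>w. cos1 i j (fst w)) (z, z)" "isCont (\<lambda>w. cos2 i j (fst w)) (z, z)"
      using cc by (auto intro!: continuous_at_compose[of _ fst, unfolded o_def] continuous_intros)
    then have "((\<lambda>w. cos1 i j (fst w)) \<longlongrightarrow> cos1 i j z) (nhds (z, z))" "((\<lambda>w. cos2 i j (fst w)) \<longlongrightarrow> cos2 i j z) (nhds (z, z))"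
      using isCont_nhds[of "(z, z)" "\<lambda>w. cos1 i j (fst w)"] isCont_nhds[of "(z, z)" "\<lambda>w. cos2 i j (fst w)"] by simp_all
    then show "eventually (\<lambda>w. 0 < cos1 i j (fst w)) (nhds (z, z))" "eventually (\<lambda>w. 0 < cos2 i j (fst w)) (nhds (z, z))"
      using c by (auto elim: order_tendstoD(1))
  qed
  then have "eventually (\<lambda>w. 0 < cos1 i j (fst w) \<and> 0 < cos2 i j (fst w)) (nhds (z, z))"
    by (rule eventually_conj)
  from eventually_box_at[OF this] show ?thesis using ij by (auto simp: visible_def)
qed

lemma has_derivative_arcsin_chord:
  assumes v: "visible i j z"
  shows "((\<lambda>z. arcsin (sin1 i j z)) has_derivative (\<lambda>h. (- H11 i j z * fst h + - H12 i j z * snd h) / cos1 i j z)) (at z)"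
    and "((\<lambda>z. arcsin (sin2 i j z)) has_derivative (\<lambda>h. (H12 i j z * fst h + H22 i j z * snd h) / cos2 i j z)) (at z)"
proof -
  have ij: "i \<noteq> j" using v by (simp add: visible_def)
  have a: "(arcsin has_derivative (\<lambda>h. h / cos1 i j z)) (at (sin1 i j z))"
    "(arcsin has_derivative (\<lambda>h. h / cos2 i j z)) (at (sin2 i j z))"
    using DERIV_arcsin[of "sin1 i j z"] DERIV_arcsin[of "sin2 i j z"] visible_sin[OF v]
    by (auto simp: has_field_derivative_def abs_less_iff divide_inverse mult.commute[of "inverse _"] elim!: has_derivative_eq_rhs)
  show "((\<lambda>z. arcsin (sin1 i j z)) has_derivative (\<lambda>h. (- H11 i j z * fst h + - H12 i j z * snd h) / cos1 i j z)) (at z)"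
    using has_derivative_compose[OF has_derivative_sin1[OF ij] a(1)] .
  show "((\<lambda>z. arcsin (sin2 i j z)) has_derivative (\<lambda>h. (H12 i j z * fst h + H22 i j z * snd h) / cos2 i j z)) (at z)"
    using has_derivative_compose[OF has_derivative_sin2[OF ij] a(2)] .
qed

text \<open>In terms of chord endpoints the map is explicit, so it is written as \<open>G2\<close>
  after the inverse of \<open>G\<close>. The factors \<open>cos1\<close> and \<open>cos2\<close>
  convert between the angle and its sine.\<close>

lemma map_in_coords:
  assumes v: "visible i j z0"
  shows "\<exists>f. f (fst z0, arcsin (sin1 i j z0)) = (snd z0, arcsin (sin2 i j z0)) \<and>
    (f has_derivative (\<lambda>h. (- (mA i j z0 * fst h + mB i j z0 * (cos1 i j z0 * snd h)),
        - (mC i j z0 * fst h + mD i j z0 * (cos1 i j z0 * snd h)) / cos2 i j z0))) (at (fst z0, arcsin (sin1 i j z0))) \<and>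
    eventually (\<lambda>w. billiard_map T (chart T i w) = chart T j (f w)) (nhds (fst z0, arcsin (sin1 i j z0)))"
proof -
  have ij: "i \<noteq> j" using v by (simp add: visible_def)
  obtain \<delta> where \<delta>: "\<delta> > 0" "\<And>w. w \<in> box_at \<delta> z0 \<Longrightarrow> visible i j w" using visible_open[OF v] by blast
  define S where "S = box_at \<delta> z0"
  have S: "open S" "z0 \<in> S" using \<delta>(1) by (auto simp: S_def box_at_def mem_Times_iff intro!: open_Times)
  define G where "G = (\<lambda>z. (fst z, arcsin (sin1 i j z)))"
  define G2 where "G2 = (\<lambda>z. (snd z, arcsin (sin2 i j z)))"
  define g where "g = inv_into S G"
  have dG: "(G has_derivative (\<lambda>h. (fst h, (- H11 i j z * fst h + - H12 i j z * snd h) / cos1 i j z))) (at z)"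
    if "z \<in> S" for z
    unfolding G_def using \<delta>(2) that S_def
    by (intro has_derivative_Pair has_derivative_fst has_derivative_ident has_derivative_arcsin_chord) auto
  have contG: "continuous_on S G"
    by (auto intro!: continuous_at_imp_continuous_on has_derivative_continuous dG)
  have inj: "inj_on G S"
  proof (rule inj_onI)
    fix z z' assume z: "z \<in> S" "z' \<in> S" and eq: "G z = G z'"
    have "arcsin (sin1 i j z) = arcsin (sin1 i j z')" and f: "fst z = fst z'" using eq by (auto simp: G_def)
    moreover have "\<bar>sin1 i j z\<bar> \<le> 1" "\<bar>sin1 i j z'\<bar> \<le> 1"
      using visible_sin(1)[OF \<delta>(2), of z] visible_sin(1)[OF \<delta>(2), of z'] z by (simp_all add: S_def)
    ultimately have s: "sin1 i j z = sin1 i j z'" by (metis abs_le_iff minus_le_iff sin_arcsin)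
    \<comment> \<open>Twist condition: \<open>H12 > 0\<close> makes \<open>sin1\<close> strictly
      monotone in the far endpoint, so starting point and angle determine it.\<close>
    obtain \<theta> where \<theta>: "\<theta> \<in> closed_segment z z'"
      "sin1 i j z' - sin1 i j z = - H11 i j \<theta> * (fst z' - fst z) + - H12 i j \<theta> * (snd z' - snd z)"
      by (rule segment_mvt[OF has_derivative_sin1[OF ij]])
    have "\<theta> \<in> S" using box_at_segment[of z \<delta> z0 z'] z \<theta>(1) unfolding S_def by blast
    then have "H12 i j \<theta> > 0" using visible_pos(1) \<delta>(2) by (simp add: S_def)
    then have "snd z = snd z'" using \<theta>(2) s f by simp
    then show "z = z'" using f by (simp add: prod_eq_iff)
  qed
  have gG: "g (G z) = z" if "z \<in> S" for z using inj that by (simp add: g_def)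
  have H12: "H12 i j z0 > 0" and c1: "cos1 i j z0 > 0" using visible_pos(1)[OF v] v by (auto simp: visible_def)
  have dg: "(g has_derivative (\<lambda>h. (fst h, - (H11 i j z0 * fst h + cos1 i j z0 * snd h) / H12 i j z0))) (at (G z0))"
  proof (rule has_derivative_inverse_strong[OF S contG gG dG[OF S(2)]])
    show "(\<lambda>h. (fst h, (- H11 i j z0 * fst h + - H12 i j z0 * snd h) / cos1 i j z0)) \<circ>
        (\<lambda>h. (fst h, - (H11 i j z0 * fst h + cos1 i j z0 * snd h) / H12 i j z0)) = id"
      using H12 c1 by (auto simp: fun_eq_iff field_simps)
  qed
  have dG2: "(G2 has_derivative (\<lambda>h. (snd h, (H12 i j z0 * fst h + H22 i j z0 * snd h) / cos2 i j z0))) (at (g (G z0)))"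
    unfolding gG[OF S(2)] G2_def
    by (intro has_derivative_Pair has_derivative_snd has_derivative_ident has_derivative_arcsin_chord v)
  define f where "f = (\<lambda>w. G2 (g w))"
  have df: "(f has_derivative (\<lambda>h. (- (mA i j z0 * fst h + mB i j z0 * (cos1 i j z0 * snd h)),
        - (mC i j z0 * fst h + mD i j z0 * (cos1 i j z0 * snd h)) / cos2 i j z0))) (at (G z0))"
    unfolding f_def
    using has_derivative_compose[OF dg dG2]
  proof (rule has_derivative_eq_rhs)
    have E1: "H12 i j z0 * x + H22 i j z0 * - (mA i j z0 * x + mB i j z0 * y) = - (mC i j z0 * x + mD i j z0 * y)" for x y
      using H12 by (simp add: mA_def mB_def mC_def mD_def field_simps)
    have E2: "- (H11 i j z0 * x + y) / H12 i j z0 = - (mA i j z0 * x + mB i j z0 * y)" for x y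
      using H12 by (simp add: mA_def mB_def field_simps)
    show "(\<lambda>x. (snd (fst x, - (H11 i j z0 * fst x + cos1 i j z0 * snd x) / H12 i j z0),
           (H12 i j z0 * fst (fst x, - (H11 i j z0 * fst x + cos1 i j z0 * snd x) / H12 i j z0) +
            H22 i j z0 * snd (fst x, - (H11 i j z0 * fst x + cos1 i j z0 * snd x) / H12 i j z0)) / cos2 i j z0)) =
      (\<lambda>h. (- (mA i j z0 * fst h + mB i j z0 * (cos1 i j z0 * snd h)),
        - (mC i j z0 * fst h + mD i j z0 * (cos1 i j z0 * snd h)) / cos2 i j z0))"
      by (simp only: fst_conv snd_conv E2 E1)
  qed
  \<comment> \<open>Invariance of domain makes the image of the box a neighbourhood, so the formula
    holds at all nearby phase points.\<close>
  have op: "open (G ` S)" by (rule invariance_of_domain[OF contG S(1) inj])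
  have "eventually (\<lambda>w. w \<in> G ` S) (nhds (G z0))" by (rule eventually_nhds_in_open[OF op]) (use S(2) in blast)
  then have "eventually (\<lambda>w. billiard_map T (chart T i w) = chart T j (f w)) (nhds (G z0))"
  proof eventually_elim
    case (elim w)
    then obtain z where z: "z \<in> S" "w = G z" by blast
    have "billiard_map T (chart T i (G z)) = chart T j (G2 z)"
      unfolding G_def G2_def using chart_map \<delta>(2) z(1) by (simp add: S_def)
    then show ?case using z gG by (simp add: f_def)
  qed
  moreover have "f (G z0) = G2 z0" by (simp add: f_def gG[OF S(2)])
  ultimately show ?thesis using df unfolding G_def G2_def by (intro exI[of _ f]) simp
qed

lemma bd_inj_window:
  assumes s: "s \<in> {c..<c + perim T i}" "s' \<in> {c..<c + perim T i}" and eq: "bd i s = bd i s'"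
  shows "s = s'"
proof -
  obtain t k where t: "t \<in> {0..<0 + perim T i}" "bd i t = bd i s" "t = s + of_int k * perim T i" by (rule bd_window)
  obtain t' k' where t': "t' \<in> {0..<0 + perim T i}" "bd i t' = bd i s'" "t' = s' + of_int k' * perim T i" by (rule bd_window)
  have "t = t'" using bd_inj[of i] t(1,2) t'(1,2) eq by (auto simp: inj_on_def)
  then have d: "s - s' = of_int (k' - k) * perim T i" using t(3) t'(3) by (simp add: algebra_simps)
  have "\<bar>s - s'\<bar> < perim T i" using s by auto
  then have "\<bar>real_of_int (k' - k)\<bar> * perim T i < 1 * perim T i"
    using d perim_pos[of i] by (simp add: abs_mult)
  then have "\<bar>k' - k\<bar> < 1" using perim_pos[of i] by (simp only: mult_less_cancel_right) linarith
  then show ?thesis using d by simp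
qed

text \<open>\<open>THE\<close> is unique because the half-open window has the length of one period
  and sine is injective on the range of angles.\<close>

lemma coords_chart:
  assumes s: "s \<in> {c - perim T i / 2..<c + perim T i / 2}" and \<phi>: "\<phi> \<in> {- (pi / 2)..pi / 2}"
  shows "coords T i c (chart T i (s, \<phi>)) = (s, \<phi>)"
  unfolding coords_def
proof (rule the_equality)
  fix z assume z: "fst z \<in> {c - perim T i / 2..<c + perim T i / 2} \<and> snd z \<in> {- (pi / 2)..pi / 2} \<and> chart T i z = chart T i (s, \<phi>)"
  obtain s' \<phi>' where zz: "z = (s', \<phi>')" by (cases z)
  have "bd i s' = bd i s" using z zz by (simp add: chart_def)
  then have ss: "s' = s" using bd_inj_window[of s' "c - perim T i / 2" i s] z zz s by simp
  have "nml i s * cis \<phi>' = nml i s * cis \<phi>" using z zz ss by (simp add: chart_def)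
  then have "cis \<phi>' = cis \<phi>" using norm_nml[of i s] by auto
  then have "sin \<phi>' = sin \<phi>" by (metis cis.sel(2))
  then have "\<phi>' = \<phi>" using z zz \<phi> by (metis arcsin_sin atLeastAtMost_iff snd_conv)
  then show "z = (s, \<phi>)" using zz ss by simp
qed (use s \<phi> in auto)

end

section \<open>Products of positive matrices\<close>

text \<open>Products without the factor -1 of each bounce; that sign is carried separately.\<close>

primrec evo :: "(nat \<Rightarrow> real) \<Rightarrow> (nat \<Rightarrow> real) \<Rightarrow> (nat \<Rightarrow> real) \<Rightarrow> (nat \<Rightarrow> real) \<Rightarrow> nat \<Rightarrow> real \<times> real \<Rightarrow> real \<times> real" where
  "evo a b c d 0 v = v"
| "evo a b c d (Suc k) v = (a k * fst (evo a b c d k v) + b k * snd (evo a b c d k v),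
      c k * fst (evo a b c d k v) + d k * snd (evo a b c d k v))"

lemma evo_matrix:
  assumes pos: "\<And>k. 0 < a k" "\<And>k. 0 < b k" "\<And>k. 0 < c k" "\<And>k. 0 < d k"
    and det: "\<And>k. a k * d k - b k * c k = (1::real)"
  shows "\<exists>p q r s. 0 < p \<and> 0 \<le> q \<and> 0 \<le> r \<and> 0 < s \<and> (0 < n \<longrightarrow> 0 < q \<and> 0 < r) \<and> p * s - q * r = 1 \<and>
    (\<forall>v. evo a b c d n v = (p * fst v + q * snd v, r * fst v + s * snd v))"
proof (induction n)
  case 0
  show ?case by (intro exI[of _ 1] exI[of _ 0]) simp
next
  case (Suc n)
  then obtain p q r s where *: "0 < p" "0 \<le> q" "0 \<le> r" "0 < s" "p * s - q * r = 1"
    "\<And>v. evo a b c d n v = (p * fst v + q * snd v, r * fst v + s * snd v)" by blast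
  show ?case
  proof (rule exI[of _ "a n * p + b n * r"], rule exI[of _ "a n * q + b n * s"], rule exI[of _ "c n * p + d n * r"],
      rule exI[of _ "c n * q + d n * s"], intro conjI allI impI)
    show "0 < a n * p + b n * r" "0 < c n * p + d n * r"
      using * pos[of n] by (intro add_pos_nonneg; simp)+
    show "0 < c n * q + d n * s" "0 < a n * q + b n * s"
      using * pos[of n] by (intro add_nonneg_pos; simp)+
    then show "0 \<le> a n * q + b n * s" "0 \<le> c n * p + d n * r"
      using \<open>0 < c n * p + d n * r\<close> by simp_all
    have "(a n * p + b n * r) * (c n * q + d n * s) - (a n * q + b n * s) * (c n * p + d n * r) =
        (a n * d n - b n * c n) * (p * s - q * r)" by (simp add: algebra_simps)
    then show "(a n * p + b n * r) * (c n * q + d n * s) - (a n * q + b n * s) * (c n * p + d n * r) = 1"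
      using det *(5) by simp
    show "evo a b c d (Suc n) v = ((a n * p + b n * r) * fst v + (a n * q + b n * s) * snd v,
        (c n * p + d n * r) * fst v + (c n * q + d n * s) * snd v)" for v
      by (simp add: *(6) algebra_simps)
  qed
qed

lemma evo_scale: "evo a b c d n (e * x, e * y) = (e * fst (evo a b c d n (x, y)), e * snd (evo a b c d n (x, y)))"
  by (induction n) (auto simp: algebra_simps)

lemma evo_shift:
  assumes "\<And>k. a (k + N) = a k" "\<And>k. b (k + N) = b k" "\<And>k. c (k + N) = c k" "\<And>k. d (k + N) = d k"
  shows "evo a b c d (n + N) v = evo a b c d n (evo a b c d N v)"
  by (induction n) (auto simp: assms)

text \<open>For a root \<open>e\<close> of the characteristic polynomial \<open>(q, e - p)\<close>
  is an eigenvector. The bounds on \<open>p\<close> say that its entries have equal signs for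
  \<open>\<mu>\<close> and opposite signs for \<open>1 / \<mu>\<close>.\<close>

lemma posmat_spectrum:
  assumes pos: "0 < p" "0 < q" "0 < r" "0 < (s::real)" and det: "p * s - q * r = 1"
  obtains \<mu> where "1 < \<mu>" "p < \<mu>" "1 / \<mu> < p"
    "\<And>e. (\<exists>x y. (x \<noteq> 0 \<or> y \<noteq> 0) \<and> p * x + q * y = e * x \<and> r * x + s * y = e * y) \<longleftrightarrow> e = \<mu> \<or> e = 1 / \<mu>"
    "r * q + s * (\<mu> - p) = \<mu> * (\<mu> - p)" "r * q + s * (1 / \<mu> - p) = 1 / \<mu> * (1 / \<mu> - p)"
proof -
  define t where "t = p + s"
  have "t\<^sup>2 - 4 = (p - s)\<^sup>2 + 4 * (q * r)"
    using det by (simp add: t_def power2_eq_square algebra_simps)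
  moreover have qr: "0 < q * r" using pos by simp
  ultimately have t4: "0 < t\<^sup>2 - 4" using zero_le_power2[of "p - s"] by linarith
  define w where "w = sqrt (t\<^sup>2 - 4)"
  have w: "0 < w" "w\<^sup>2 = t\<^sup>2 - 4" using t4 by (simp_all add: w_def)
  have t0: "0 < t" using pos by (simp add: t_def)
  have t2: "2 < t"
  proof (rule power2_less_imp_less)
    show "2\<^sup>2 < t\<^sup>2" using t4 by simp
  qed (use t0 in simp)
  define \<mu> where "\<mu> = (t + w) / 2"
  have \<mu>1: "1 < \<mu>" using w t2 by (simp add: \<mu>_def)
  have "\<mu> * (t - \<mu>) = 1" using w(2) by (simp add: \<mu>_def power2_eq_square field_simps)
  then have inv: "1 / \<mu> = t - \<mu>" using \<mu>1 by (simp add: field_simps)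
  have quad: "(e - \<mu>) * (e - 1 / \<mu>) = e\<^sup>2 - t * e + 1" for e
    using \<open>\<mu> * (t - \<mu>) = 1\<close> unfolding inv by (simp add: power2_eq_square algebra_simps)
  have prod: "(\<mu> - p) * (\<mu> - s) = q * r"
    using \<open>\<mu> * (t - \<mu>) = 1\<close> det by (simp add: t_def algebra_simps)
  have sum: "(\<mu> - p) + (\<mu> - s) = w" by (simp add: \<mu>_def t_def)
  have gt: "p < \<mu>" "s < \<mu>"
  proof -
    have "0 < \<mu> - p \<and> 0 < \<mu> - s \<or> \<mu> - p < 0 \<and> \<mu> - s < 0"
      using prod qr by (metis zero_less_mult_iff)
    then show "p < \<mu>" "s < \<mu>" using sum w(1) by auto
  qed
  have root: "e = \<mu> \<or> e = 1 / \<mu> \<longleftrightarrow> e\<^sup>2 - t * e + 1 = 0" for e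
    unfolding quad[symmetric] by auto
  have second: "r * q + s * (e - p) = e * (e - p)" if "e\<^sup>2 - t * e + 1 = 0" for e
    using that det by (simp add: t_def power2_eq_square algebra_simps)
  have spec: "(\<exists>x y. (x \<noteq> 0 \<or> y \<noteq> 0) \<and> p * x + q * y = e * x \<and> r * x + s * y = e * y) \<longleftrightarrow> e = \<mu> \<or> e = 1 / \<mu>" for e
    unfolding root
  proof
    assume "e\<^sup>2 - t * e + 1 = 0"
    from second[OF this] show "\<exists>x y. (x \<noteq> 0 \<or> y \<noteq> 0) \<and> p * x + q * y = e * x \<and> r * x + s * y = e * y"
      using pos by (intro exI[of _ q] exI[of _ "e - p"]) (auto simp: algebra_simps)
  next
    assume "\<exists>x y. (x \<noteq> 0 \<or> y \<noteq> 0) \<and> p * x + q * y = e * x \<and> r * x + s * y = e * y"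
    then obtain x y where xy: "x \<noteq> 0 \<or> y \<noteq> 0" "q * y = (e - p) * x" "r * x = (e - s) * y"
      by (auto simp: algebra_simps)
    have "x \<noteq> 0" using xy pos by auto
    have "(e - s) * (e - p) * x = (e - s) * (q * y)" using xy(2) by simp
    also have "\<dots> = q * ((e - s) * y)" by simp
    also have "\<dots> = q * r * x" unfolding xy(3)[symmetric] by simp
    finally have "(e - s) * (e - p) = q * r" using \<open>x \<noteq> 0\<close> by simp
    then show "e\<^sup>2 - t * e + 1 = 0" using det by (simp add: t_def power2_eq_square algebra_simps)
  qed
  show ?thesis
  proof (rule that[OF \<mu>1 gt(1) _ spec])
    show "1 / \<mu> < p" using gt(2) by (simp add: inv t_def)
    show "r * q + s * (\<mu> - p) = \<mu> * (\<mu> - p)" "r * q + s * (1 / \<mu> - p) = 1 / \<mu> * (1 / \<mu> - p)"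
      using second root by blast+
  qed
qed

text \<open>Divided by \<open>\<nu> ^ k\<close> the sequence is periodic, so it has a positive
  minimum and a maximum.\<close>

lemma quasi_periodic_bounds:
  fixes f :: "nat \<Rightarrow> real"
  assumes N: "0 < N" and \<nu>: "0 < \<nu>" and f: "\<And>k. 0 < f k" "\<And>k. f (k + N) = \<nu> ^ N * f k"
  shows "\<exists>c1 c2. 0 < c1 \<and> 0 < c2 \<and> (\<forall>k. c1 * \<nu> ^ k \<le> f k \<and> f k \<le> c2 * \<nu> ^ k)"
proof -
  define h where "h k = f k / \<nu> ^ k" for k
  have h0: "0 < h k" for k using f(1) \<nu> by (simp add: h_def)
  have hN: "h (k + N) = h k" for k using f(2) \<nu> by (simp add: h_def power_add)
  have hmul: "h (k + n * N) = h k" for k n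
  proof (induction n)
    case (Suc n)
    then show ?case using hN[of "k + n * N"] by (simp add: algebra_simps)
  qed simp
  have hm: "h k = h (k mod N)" for k using hmul[of "k mod N" "k div N"] by simp
  define A where "A = h ` {..<N}"
  have A: "finite A" "A \<noteq> {}" using N by (auto simp: A_def)
  have mem: "h k \<in> A" for k unfolding A_def using hm[of k] N by (intro image_eqI[of _ _ "k mod N"]) auto
  have "0 < Min A" using A by (simp add: A_def h0)
  moreover have "Min A \<le> h k" "h k \<le> Max A" for k using mem A by auto
  moreover have "0 < Max A" using \<open>0 < Min A\<close> calculation(2,3)[of 0] by linarith
  ultimately show ?thesis using \<nu>
    by (intro exI[of _ "Min A"] exI[of _ "Max A"]) (auto simp: h_def pos_le_divide_eq pos_divide_le_eq)
qed

text \<open>Floquet theory for a periodic product of positive matrices. \<open>wx\<close>,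
  \<open>wy\<close> is the expanding solution; \<open>ux\<close>, \<open>uy\<close> is the
  contracting one with its second entry negated, so that it is positive and obeys a backward
  recursion with positive coefficients.\<close>

lemma floquet:
  assumes N: "0 < N"
    and pos: "\<And>k. 0 < a k" "\<And>k. 0 < b k" "\<And>k. 0 < c k" "\<And>k. 0 < d k"
    and det: "\<And>k. a k * d k - b k * c k = (1::real)"
    and per: "\<And>k. a (k + N) = a k" "\<And>k. b (k + N) = b k" "\<And>k. c (k + N) = c k" "\<And>k. d (k + N) = d k"
  obtains \<mu> \<nu> wx wy ux uy c1 c2 where "1 < \<mu>" "1 < \<nu>" "\<nu> ^ N = \<mu>"
    "\<And>e. (\<exists>v. v \<noteq> 0 \<and> evo a b c d N v = e *\<^sub>R v) \<longleftrightarrow> e = \<mu> \<or> e = 1 / \<mu>"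
    "\<And>k. wx (Suc k) = a k * wx k + b k * wy k" "\<And>k. wy (Suc k) = c k * wx k + d k * wy k"
    "\<And>k. ux k = d k * ux (Suc k) + b k * uy (Suc k)" "\<And>k. uy k = c k * ux (Suc k) + a k * uy (Suc k)"
    "0 < c1" "0 < c2"
    "\<And>k::nat. c1 * \<nu> ^ k \<le> wx k \<and> wx k \<le> c2 * \<nu> ^ k" "\<And>k::nat. c1 * \<nu> ^ k \<le> wy k \<and> wy k \<le> c2 * \<nu> ^ k"
    "\<And>k::nat. c1 * (1 / \<nu>) ^ k \<le> ux k \<and> ux k \<le> c2 * (1 / \<nu>) ^ k" "\<And>k::nat. c1 * (1 / \<nu>) ^ k \<le> uy k \<and> uy k \<le> c2 * (1 / \<nu>) ^ k"
proof -
  note E = evo_matrix[of a b c d, OF pos det]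
  obtain p q r s where M: "0 < p" "0 < q" "0 < r" "0 < s" "p * s - q * r = 1"
    "\<And>v. evo a b c d N v = (p * fst v + q * snd v, r * fst v + s * snd v)"
    using E[of N] N by blast
  obtain \<mu> where \<mu>: "1 < \<mu>" "p < \<mu>" "1 / \<mu> < p"
    "\<And>e. (\<exists>x y. (x \<noteq> 0 \<or> y \<noteq> 0) \<and> p * x + q * y = e * x \<and> r * x + s * y = e * y) \<longleftrightarrow> e = \<mu> \<or> e = 1 / \<mu>"
    "r * q + s * (\<mu> - p) = \<mu> * (\<mu> - p)" "r * q + s * (1 / \<mu> - p) = 1 / \<mu> * (1 / \<mu> - p)"
    using posmat_spectrum[OF M(1-5)] by blast
  define \<nu> where "\<nu> = root N \<mu>"
  have \<nu>: "1 < \<nu>" "\<nu> ^ N = \<mu>" using N \<mu>(1) by (simp_all add: \<nu>_def)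
  define W where "W k = evo a b c d k (q, \<mu> - p)" for k
  define U where "U k = evo a b c d k (q, 1 / \<mu> - p)" for k
  have quasi: "evo a b c d (k + N) (q, e - p) = (e * fst (evo a b c d k (q, e - p)), e * snd (evo a b c d k (q, e - p)))"
    if "r * q + s * (e - p) = e * (e - p)" for e k
  proof -
    have "evo a b c d N (q, e - p) = (e * q, e * (e - p))" using that by (simp add: M(6) algebra_simps)
    then show ?thesis using evo_shift[of a N b c d, OF per] evo_scale by simp
  qed
  note WN = quasi[OF \<mu>(5), folded W_def] and UN = quasi[OF \<mu>(6), folded U_def]
  have Wpos: "0 < fst (W k)" "0 < snd (W k)" for k
  proof -
    obtain p' q' r' s' where M': "0 < p'" "0 \<le> q'" "0 \<le> r'" "0 < s'"
      "\<And>v. evo a b c d k v = (p' * fst v + q' * snd v, r' * fst v + s' * snd v)" using E[of k] by blast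
    show "0 < fst (W k)" "0 < snd (W k)" using M' M(2) \<mu>(2) unfolding W_def M'(5)
      by (simp_all add: add_pos_nonneg add_nonneg_pos)
  qed
  \<comment> \<open>The inverse matrices, written out by means of determinant 1.\<close>
  have Uback: "fst (U k) = d k * fst (U (Suc k)) + b k * - snd (U (Suc k))"
    "- snd (U k) = c k * fst (U (Suc k)) + a k * - snd (U (Suc k))" for k
  proof -
    define x y where "x = fst (U k)" "y = snd (U k)"
    have S: "fst (U (Suc k)) = a k * x + b k * y" "snd (U (Suc k)) = c k * x + d k * y" by (simp_all add: U_def x_y_def)
    have "d k * (a k * x + b k * y) + b k * - (c k * x + d k * y) = (a k * d k - b k * c k) * x"
      "c k * (a k * x + b k * y) + a k * - (c k * x + d k * y) = - ((a k * d k - b k * c k) * y)"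
      by (simp_all add: algebra_simps)
    then show "fst (U k) = d k * fst (U (Suc k)) + b k * - snd (U (Suc k))"
      "- snd (U k) = c k * fst (U (Suc k)) + a k * - snd (U (Suc k))"
      unfolding S det by (simp_all add: x_y_def)
  qed
  have Umul: "0 < fst (U (n * N)) \<and> 0 < - snd (U (n * N))" for n
  proof (induction n)
    case 0
    show ?case using M(2) \<mu>(3) by (simp add: U_def)
  next
    case (Suc n)
    then show ?case using UN[of "n * N"] \<mu>(1) by (simp add: add.commute zero_less_divide_iff divide_less_0_iff)
  qed
  have Upos: "0 < fst (U k) \<and> 0 < - snd (U k)" for k
  proof -
    \<comment> \<open>Positivity is known at multiples of the period, where \<open>U\<close> is a
      positive multiple of the eigenvector, and descends to every earlier index through the backward
      recursion.\<close>
    have "k \<le> k * N" using N by simp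
    then show ?thesis
    proof (induction rule: inc_induct)
      case base
      show ?case by (rule Umul)
    next
      case (step n)
      then have "0 < d n * fst (U (Suc n)) + b n * - snd (U (Suc n))"
        "0 < c n * fst (U (Suc n)) + a n * - snd (U (Suc n))"
        using pos[of n] by (intro add_pos_pos mult_pos_pos; simp)+
      then show ?case unfolding Uback[of n] by simp
    qed
  qed
  have \<nu>0: "0 < \<nu>" "0 < 1 / \<nu>" "(1 / \<nu>) ^ N = 1 / \<mu>" using \<nu> by (simp_all add: power_one_over)
  obtain A1 A2 where A: "0 < A1" "0 < A2" "\<And>k. A1 * \<nu> ^ k \<le> fst (W k) \<and> fst (W k) \<le> A2 * \<nu> ^ k"
    using quasi_periodic_bounds[OF N \<nu>0(1), of "\<lambda>k. fst (W k)"] Wpos WN \<nu>(2) by auto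
  obtain B1 B2 where B: "0 < B1" "0 < B2" "\<And>k. B1 * \<nu> ^ k \<le> snd (W k) \<and> snd (W k) \<le> B2 * \<nu> ^ k"
    using quasi_periodic_bounds[OF N \<nu>0(1), of "\<lambda>k. snd (W k)"] Wpos WN \<nu>(2) by auto
  obtain C1 C2 where C: "0 < C1" "0 < C2" "\<And>k. C1 * (1 / \<nu>) ^ k \<le> fst (U k) \<and> fst (U k) \<le> C2 * (1 / \<nu>) ^ k"
    using quasi_periodic_bounds[OF N \<nu>0(2), of "\<lambda>k. fst (U k)"] Upos UN unfolding \<nu>0(3) by auto
  obtain D1 D2 where D: "0 < D1" "0 < D2" "\<And>k. D1 * (1 / \<nu>) ^ k \<le> - snd (U k) \<and> - snd (U k) \<le> D2 * (1 / \<nu>) ^ k"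
    using quasi_periodic_bounds[OF N \<nu>0(2), of "\<lambda>k. - snd (U k)"] Upos UN unfolding \<nu>0(3) by auto
  define c1 where "c1 = min (min A1 B1) (min C1 D1)"
  define c2 where "c2 = max (max A2 B2) (max C2 D2)"
  have c: "0 < c1" "0 < c2" "c1 \<le> A1" "c1 \<le> B1" "c1 \<le> C1" "c1 \<le> D1" "A2 \<le> c2" "B2 \<le> c2" "C2 \<le> c2" "D2 \<le> c2"
    using A B C D by (auto simp: c1_def c2_def)
  have weaken: "c1 * e ^ k \<le> x \<and> x \<le> c2 * e ^ k"
    if "0 < e" "c1 \<le> X1" "X2 \<le> c2" "X1 * e ^ k \<le> x \<and> x \<le> X2 * e ^ k" for e X1 X2 x :: real and k :: nat
  proof -
    have "c1 * e ^ k \<le> X1 * e ^ k" "X2 * e ^ k \<le> c2 * e ^ k" using that by (auto intro!: mult_right_mono)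
    then show ?thesis using that by linarith
  qed
  have spec: "(\<exists>v. v \<noteq> 0 \<and> evo a b c d N v = e *\<^sub>R v) \<longleftrightarrow> e = \<mu> \<or> e = 1 / \<mu>" for e
    unfolding \<mu>(4)[symmetric] M(6) by (auto simp: prod_eq_iff)
  show ?thesis
  proof (rule that[OF \<mu>(1) \<nu> spec _ _ _ _ c(1,2)])
    show "fst (W (Suc k)) = a k * fst (W k) + b k * snd (W k)" "snd (W (Suc k)) = c k * fst (W k) + d k * snd (W k)" for k
      by (simp_all add: W_def)
    show "fst (U k) = d k * fst (U (Suc k)) + b k * - snd (U (Suc k))"
      "- snd (U k) = c k * fst (U (Suc k)) + a k * - snd (U (Suc k))" for k by (rule Uback)+
    show "c1 * \<nu> ^ k \<le> fst (W k) \<and> fst (W k) \<le> c2 * \<nu> ^ k" "c1 * \<nu> ^ k \<le> snd (W k) \<and> snd (W k) \<le> c2 * \<nu> ^ k"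
      "c1 * (1 / \<nu>) ^ k \<le> fst (U k) \<and> fst (U k) \<le> c2 * (1 / \<nu>) ^ k"
      "c1 * (1 / \<nu>) ^ k \<le> - snd (U k) \<and> - snd (U k) \<le> c2 * (1 / \<nu>) ^ k" for k
      using weaken[OF \<nu>0(1) c(3,7) A(3)] weaken[OF \<nu>0(1) c(4,8) B(3)]
        weaken[OF \<nu>0(2) c(5,9) C(3)] weaken[OF \<nu>0(2) c(6,10) D(3)] by blast+
  qed
qed

text \<open>Comparison with a positive solution \<open>w\<close>: once a multiple of
  \<open>w\<close> dominates the absolute values at the start, positivity of the coefficients
  propagates this, with a loss of \<open>g\<close> per step. The scale \<open>e\<close> allows an
  arbitrary starting index.\<close>

lemma grow_upper:
  fixes x y :: "nat \<Rightarrow> real"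
  assumes step: "\<And>k. k < n \<Longrightarrow> \<bar>x (Suc k)\<bar> \<le> g * (a k * \<bar>x k\<bar> + b k * \<bar>y k\<bar>)"
      "\<And>k. k < n \<Longrightarrow> \<bar>y (Suc k)\<bar> \<le> g * (c k * \<bar>x k\<bar> + d k * \<bar>y k\<bar>)"
    and w: "\<And>k. k < n \<Longrightarrow> wx (Suc k) = a k * wx k + b k * wy k" "\<And>k. k < n \<Longrightarrow> wy (Suc k) = c k * wx k + d k * wy k"
    and pos: "\<And>k. k < n \<Longrightarrow> 0 \<le> a k \<and> 0 \<le> b k \<and> 0 \<le> c k \<and> 0 \<le> d k"
    and c: "0 < c1" "0 < e" "0 < g" "0 < \<nu>"
    and lo: "c1 * e \<le> wx 0" "c1 * e \<le> wy 0" and up: "wx n \<le> c2 * e * \<nu> ^ n" "wy n \<le> c2 * e * \<nu> ^ n"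
  shows "\<bar>x n\<bar> + \<bar>y n\<bar> \<le> 2 * (c2 / c1) * (g * \<nu>) ^ n * (\<bar>x 0\<bar> + \<bar>y 0\<bar>)"
proof -
  define R where "R = (\<bar>x 0\<bar> + \<bar>y 0\<bar>) / (c1 * e)"
  have R0: "0 \<le> R" using c by (simp add: R_def)
  have init: "\<bar>x 0\<bar> + \<bar>y 0\<bar> = R * (c1 * e)" using c by (simp add: R_def)
  have "\<bar>x k\<bar> \<le> R * g ^ k * wx k \<and> \<bar>y k\<bar> \<le> R * g ^ k * wy k" if "k \<le> n" for k
    using that
  proof (induction k)
    case 0
    have "R * (c1 * e) \<le> R * wx 0" "R * (c1 * e) \<le> R * wy 0" using lo R0 by (auto intro: mult_left_mono)
    then show ?case using init by auto
  next
    case (Suc k)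
    then have k: "k < n" and IH: "\<bar>x k\<bar> \<le> R * g ^ k * wx k" "\<bar>y k\<bar> \<le> R * g ^ k * wy k" by auto
    have *: "u * \<bar>x k\<bar> + v * \<bar>y k\<bar> \<le> R * g ^ k * (u * wx k + v * wy k)" if "0 \<le> u" "0 \<le> v" for u v
      using mult_left_mono[OF IH(1) that(1)] mult_left_mono[OF IH(2) that(2)] by (simp add: algebra_simps)
    have "\<bar>x (Suc k)\<bar> \<le> g * (R * g ^ k * (a k * wx k + b k * wy k))"
      using step(1)[OF k] *[of "a k" "b k"] pos[OF k] c(3) by (meson mult_left_mono less_imp_le order_trans)
    moreover have "\<bar>y (Suc k)\<bar> \<le> g * (R * g ^ k * (c k * wx k + d k * wy k))"
      using step(2)[OF k] *[of "c k" "d k"] pos[OF k] c(3) by (meson mult_left_mono less_imp_le order_trans)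
    ultimately show ?case by (simp add: w[OF k] algebra_simps)
  qed
  then have "\<bar>x n\<bar> \<le> R * g ^ n * wx n" "\<bar>y n\<bar> \<le> R * g ^ n * wy n" by auto
  moreover have "R * g ^ n * wx n \<le> R * g ^ n * (c2 * e * \<nu> ^ n)" "R * g ^ n * wy n \<le> R * g ^ n * (c2 * e * \<nu> ^ n)"
    using up R0 c(3) by (auto intro!: mult_left_mono)
  moreover have "R * g ^ n * (c2 * e * \<nu> ^ n) = c2 / c1 * (g * \<nu>) ^ n * (\<bar>x 0\<bar> + \<bar>y 0\<bar>)"
    unfolding init using c by (simp add: power_mult_distrib)
  ultimately show ?thesis by linarith
qed

text \<open>Inside the positive quadrant no cancellation occurs, so a vector grows at least like the
  positive solution, up to \<open>g\<close> per step.\<close>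

lemma grow_lower:
  fixes x y :: "nat \<Rightarrow> real"
  assumes step: "\<And>k. k < n \<Longrightarrow> 0 \<le> x k \<Longrightarrow> 0 \<le> y k \<Longrightarrow> (a k * x k + b k * y k) / g \<le> x (Suc k)"
      "\<And>k. k < n \<Longrightarrow> 0 \<le> x k \<Longrightarrow> 0 \<le> y k \<Longrightarrow> (c k * x k + d k * y k) / g \<le> y (Suc k)"
    and w: "\<And>k. k < n \<Longrightarrow> wx (Suc k) = a k * wx k + b k * wy k" "\<And>k. k < n \<Longrightarrow> wy (Suc k) = c k * wx k + d k * wy k"
    and pos: "\<And>k. k < n \<Longrightarrow> m \<le> a k \<and> m \<le> b k \<and> m \<le> c k \<and> m \<le> d k"
    and c: "0 < c1" "0 < c2" "0 < e" "1 \<le> g" "0 < \<nu>" "0 < m"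
    and bd: "\<And>k. k \<le> n \<Longrightarrow> c1 * e * \<nu> ^ k \<le> wx k \<and> wx k \<le> c2 * e * \<nu> ^ k"
      "\<And>k. k \<le> n \<Longrightarrow> c1 * e * \<nu> ^ k \<le> wy k \<and> wy k \<le> c2 * e * \<nu> ^ k"
    and init: "0 \<le> x 0" "0 \<le> y 0"
  shows "min 1 (m * c1 / (c2 * \<nu>)) * (\<nu> / g) ^ n * (x 0 + y 0) \<le> x n + y n"
proof (cases n)
  \<comment> \<open>This case is the reason for \<open>min 1\<close> in the constant.\<close>
  case 0
  have "min 1 (m * c1 / (c2 * \<nu>)) * (x 0 + y 0) \<le> 1 * (x 0 + y 0)"
    using init by (intro mult_right_mono) auto
  then show ?thesis using 0 by simp
next
  case (Suc n')
  define S where "S = x 0 + y 0"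
  \<comment> \<open>\<open>x 0\<close> or \<open>y 0\<close> may vanish, so the comparison with
    \<open>w\<close> starts after one step, when both entries are at least
    \<open>m * (x 0 + y 0) / g\<close>.\<close>
  define R where "R = m / g * S / (c2 * e * \<nu>)"
  have S0: "0 \<le> S" using init by (simp add: S_def)
  have R0: "0 \<le> R" using S0 c by (simp add: R_def)
  have wpos: "0 \<le> wx k" "0 \<le> wy k" if "k \<le> n" for k
  proof -
    have "0 \<le> c1 * e * \<nu> ^ k" using c by simp
    then show "0 \<le> wx k" "0 \<le> wy k" using bd[OF that] by linarith+
  qed
  have main: "R / g ^ k * wx (Suc k) \<le> x (Suc k) \<and> R / g ^ k * wy (Suc k) \<le> y (Suc k)" if "k \<le> n'" for k
    using that
  proof (induction k)
    case 0
    have n0: "0 < n" using Suc by simp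
    have low: "m * S / g \<le> (u * x 0 + v * y 0) / g" if "m \<le> u" "m \<le> v" for u v
    proof -
      have "m * x 0 \<le> u * x 0" "m * y 0 \<le> v * y 0" using that init by (auto intro: mult_right_mono)
      then show ?thesis using c(4) by (intro divide_right_mono) (auto simp: S_def distrib_left)
    qed
    have R: "R * (c2 * e * \<nu>) = m * S / g" using c by (simp add: R_def)
    have "R * wx 1 \<le> R * (c2 * e * \<nu>)" "R * wy 1 \<le> R * (c2 * e * \<nu>)"
      using bd(1)[of 1] bd(2)[of 1] Suc R0 by (auto intro!: mult_left_mono)
    moreover have "m * S / g \<le> x 1" "m * S / g \<le> y 1"
      using step[OF n0 init] low[of "a 0" "b 0"] low[of "c 0" "d 0"] pos[OF n0] by auto
    ultimately show ?case using R by simp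
  next
    case (Suc k)
    define k1 where "k1 = Suc k"
    have k1: "k1 < n" using Suc.prems \<open>n = Suc n'\<close> by (simp add: k1_def)
    have IH: "R / g ^ k * wx k1 \<le> x k1" "R / g ^ k * wy k1 \<le> y k1" using Suc by (auto simp: k1_def)
    have Rg: "0 \<le> R / g ^ k" using R0 c by simp
    have xy0: "0 \<le> x k1" "0 \<le> y k1"
      using IH mult_nonneg_nonneg[OF Rg wpos(1)[of k1]] mult_nonneg_nonneg[OF Rg wpos(2)[of k1]] k1 by auto
    have *: "R / g ^ k * (u * wx k1 + v * wy k1) / g \<le> (u * x k1 + v * y k1) / g" if "m \<le> u" "m \<le> v" for u v
    proof (rule divide_right_mono)
      have "0 \<le> u" "0 \<le> v" using that c by auto
      from mult_left_mono[OF IH(1) this(1)] mult_left_mono[OF IH(2) this(2)]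
      show "R / g ^ k * (u * wx k1 + v * wy k1) \<le> u * x k1 + v * y k1" by (simp add: algebra_simps)
    qed (use c in simp)
    have "R / g ^ Suc k * wx (Suc k1) = R / g ^ k * (a k1 * wx k1 + b k1 * wy k1) / g"
      "R / g ^ Suc k * wy (Suc k1) = R / g ^ k * (c k1 * wx k1 + d k1 * wy k1) / g"
      by (simp_all add: w[OF k1] field_simps)
    then show ?case using step[OF k1 xy0] *[of "a k1" "b k1"] *[of "c k1" "d k1"] pos[OF k1]
      unfolding k1_def[symmetric] by auto
  qed
  have "R / g ^ n' * (c1 * e * \<nu> ^ n) \<le> R / g ^ n' * wx n"
    using bd(1)[of n] R0 c by (intro mult_left_mono) auto
  also have "\<dots> \<le> x n" using main[of n'] Suc by simp
  finally have 1: "R / g ^ n' * (c1 * e * \<nu> ^ n) \<le> x n" .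
  have "0 \<le> R / g ^ n' * wy n" using R0 c wpos(2)[of n] by simp
  then have 2: "0 \<le> y n" using main[of n'] Suc by auto
  have "R / g ^ n' * (c1 * e * \<nu> ^ n) = m * c1 / (c2 * \<nu>) * (\<nu> / g) ^ n * S"
    using c Suc by (simp add: R_def power_divide field_simps)
  moreover have "min 1 (m * c1 / (c2 * \<nu>)) * ((\<nu> / g) ^ n * S) \<le> m * c1 / (c2 * \<nu>) * ((\<nu> / g) ^ n * S)"
    using S0 c by (intro mult_right_mono) auto
  ultimately show ?thesis using 1 2 by (simp add: S_def mult.assoc)
qed

section \<open>The return differential\<close>

context table
begin

lemma vel_preserved:
  assumes r: "refl_seq T \<rho> q" and s: "bd (\<rho> j) s = q j"
  shows "dir q (j - 1) \<bullet> vel (\<rho> j) s = dir q j \<bullet> vel (\<rho> j) s"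
proof -
  have "dir q (j - 1) = dir q j - (2 * (dir q j \<bullet> nu (q j))) *\<^sub>R nu (q j)"
    using refl_jump[OF r, of j] by (simp add: algebra_simps)
  moreover have "nu (q j) = nml (\<rho> j) s" using normal_at_bd[of "\<rho> j" s] s by simp
  ultimately show ?thesis by (simp add: inner_diff_left inner_nml_vel)
qed

text \<open>Dictionary between orbits and chords. Reflection keeps the sine, so the arrival sine of
  one flight is the departure sine of the next and one number per bounce suffices.\<close>

lemma chord_refl:
  assumes r: "refl_seq T \<rho> q" and s: "bd (\<rho> j) s = q j" and t: "bd (\<rho> (j + 1)) t = q (j + 1)"
  shows "visible (\<rho> j) (\<rho> (j + 1)) (s, t)"
    and "sgn (disp (\<rho> j) (\<rho> (j + 1)) (s, t)) = dir q j"
    and "chord (\<rho> j) (\<rho> (j + 1)) (s, t) = norm (q (j + 1) - q j)"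
    and "sin1 (\<rho> j) (\<rho> (j + 1)) (s, t) = dir q j \<bullet> vel (\<rho> j) s"
    and "sin2 (\<rho> j) (\<rho> (j + 1)) (s, t) = dir q (j + 1) \<bullet> vel (\<rho> (j + 1)) t"
    and "cos1 (\<rho> j) (\<rho> (j + 1)) (s, t) = dir q j \<bullet> nu (q j)"
    and "cos2 (\<rho> j) (\<rho> (j + 1)) (s, t) = dir q (j + 1) \<bullet> nu (q (j + 1))"
proof -
  have d: "disp (\<rho> j) (\<rho> (j + 1)) (s, t) = q (j + 1) - q j" using s t by (simp add: disp_def)
  then show d': "sgn (disp (\<rho> j) (\<rho> (j + 1)) (s, t)) = dir q j"
    and "chord (\<rho> j) (\<rho> (j + 1)) (s, t) = norm (q (j + 1) - q j)" by (simp_all add: dir_def chord_def)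
  have n: "nml (\<rho> j) s = nu (q j)" "nml (\<rho> (j + 1)) t = nu (q (j + 1))"
    using normal_at_bd[of "\<rho> j" s] normal_at_bd[of "\<rho> (j + 1)" t] s t by simp_all
  show c1: "cos1 (\<rho> j) (\<rho> (j + 1)) (s, t) = dir q j \<bullet> nu (q j)"
    by (simp add: cos1_def d' n)
  show c2: "cos2 (\<rho> j) (\<rho> (j + 1)) (s, t) = dir q (j + 1) \<bullet> nu (q (j + 1))"
    using refl_in[OF r, of "j + 1"] by (simp add: cos2_def d' n)
  show "sin1 (\<rho> j) (\<rho> (j + 1)) (s, t) = dir q j \<bullet> vel (\<rho> j) s"
    by (simp add: sin1_def d')
  show "sin2 (\<rho> j) (\<rho> (j + 1)) (s, t) = dir q (j + 1) \<bullet> vel (\<rho> (j + 1)) t"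
    using vel_preserved[OF r t] by (simp add: sin2_def d')
  show "visible (\<rho> j) (\<rho> (j + 1)) (s, t)"
    unfolding visible_def c1 c2 using refl_out[OF r] refl_label[OF r, of j] by auto
qed

text \<open>The chain rule along the orbit. Multiplying the angle by the cosine \<open>C 0\<close>
  passes to the sine, where the derivative is \<open>evo\<close> up to sign; dividing by
  \<open>C k\<close> passes back.\<close>

lemma iterate_coords:
  assumes r: "refl_seq T \<rho> q" and s: "\<And>j. bd (\<rho> j) (s j) = q j"
  defines "z \<equiv> \<lambda>k::nat. (s (int k), s (int k + 1))"
  defines "C \<equiv> \<lambda>k::nat. cos1 (\<rho> (int k)) (\<rho> (int k + 1)) (z k)"
  defines "st \<equiv> \<lambda>k::nat. (s (int k), arcsin (sin1 (\<rho> (int k)) (\<rho> (int k + 1)) (z k)))"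
  defines "E \<equiv> evo (\<lambda>k. mA (\<rho> (int k)) (\<rho> (int k + 1)) (z k)) (\<lambda>k. mB (\<rho> (int k)) (\<rho> (int k + 1)) (z k))
     (\<lambda>k. mC (\<rho> (int k)) (\<rho> (int k + 1)) (z k)) (\<lambda>k. mD (\<rho> (int k)) (\<rho> (int k + 1)) (z k))"
  shows "\<exists>f. f (st 0) = st k \<and>
    (f has_derivative (\<lambda>h. ((- 1) ^ k * fst (E k (fst h, C 0 * snd h)), (- 1) ^ k * snd (E k (fst h, C 0 * snd h)) / C k))) (at (st 0)) \<and>
    eventually (\<lambda>w. (billiard_map T ^^ k) (chart T (\<rho> 0) w) = chart T (\<rho> (int k)) (f w)) (nhds (st 0))"
proof (induction k)
  case 0
  have "0 < C 0" using chord_refl(6)[OF r s s, of 0] refl_out[OF r, of 0] by (simp add: C_def z_def)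
  moreover have "((\<lambda>w. w) has_derivative (\<lambda>h. (fst h, snd h))) (at (st 0))"
    by (auto intro!: derivative_eq_intros)
  ultimately show ?case by (intro exI[of _ "\<lambda>w. w"]) (simp add: E_def)
next
  case (Suc k)
  then obtain f where f: "f (st 0) = st k"
    "(f has_derivative (\<lambda>h. ((- 1) ^ k * fst (E k (fst h, C 0 * snd h)), (- 1) ^ k * snd (E k (fst h, C 0 * snd h)) / C k))) (at (st 0))"
    "eventually (\<lambda>w. (billiard_map T ^^ k) (chart T (\<rho> 0) w) = chart T (\<rho> (int k)) (f w)) (nhds (st 0))" by blast
  define i where "i = \<rho> (int k)"
  define j where "j = \<rho> (int k + 1)"
  have v: "visible i j (z k)" unfolding i_def j_def z_def by (rule chord_refl(1)[OF r s s])
  have ck: "C k = cos1 i j (z k)" by (simp add: C_def i_def j_def)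
  have Ck: "0 < C k" using v by (simp add: ck visible_def)
  have Sk: "int (Suc k) = int k + 1" "int (Suc k) + 1 = int k + 1 + 1" by simp_all
  have CSk: "C (Suc k) = cos2 i j (z k)"
    using chord_refl(7)[OF r s s, of "int k"] chord_refl(6)[OF r s s, of "int k + 1"]
    unfolding C_def z_def Sk i_def j_def by simp
  have st0: "(fst (z k), arcsin (sin1 i j (z k))) = st k" by (simp add: st_def z_def i_def j_def)
  have st1: "(snd (z k), arcsin (sin2 i j (z k))) = st (Suc k)"
    using chord_refl(5)[OF r s s, of "int k"] chord_refl(4)[OF r s s, of "int k + 1"]
    unfolding st_def z_def Sk i_def j_def by simp
  obtain \<phi> where \<phi>: "\<phi> (st k) = st (Suc k)"
    "(\<phi> has_derivative (\<lambda>h. (- (mA i j (z k) * fst h + mB i j (z k) * (C k * snd h)),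
        - (mC i j (z k) * fst h + mD i j (z k) * (C k * snd h)) / C (Suc k)))) (at (f (st 0)))"
    "eventually (\<lambda>w. billiard_map T (chart T i w) = chart T j (\<phi> w)) (nhds (f (st 0)))"
    using map_in_coords[OF v] unfolding st0 st1 ck[symmetric] CSk[symmetric] f(1) by blast
  have "filterlim f (nhds (f (st 0))) (nhds (st 0))"
    using isCont_nhds[OF has_derivative_continuous[OF f(2)]] .
  then have "eventually (\<lambda>w. billiard_map T (chart T i (f w)) = chart T j (\<phi> (f w))) (nhds (st 0))"
    by (rule eventually_compose_filterlim[OF \<phi>(3)])
  with f(3) have "eventually (\<lambda>w. (billiard_map T ^^ Suc k) (chart T (\<rho> 0) w) = chart T j (\<phi> (f w))) (nhds (st 0))"
    by eventually_elim (simp add: i_def)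
  moreover have "((\<lambda>w. \<phi> (f w)) has_derivative (\<lambda>h. ((- 1) ^ Suc k * fst (E (Suc k) (fst h, C 0 * snd h)),
      (- 1) ^ Suc k * snd (E (Suc k) (fst h, C 0 * snd h)) / C (Suc k)))) (at (st 0))"
    using has_derivative_compose[OF f(2) \<phi>(2)]
  proof (rule has_derivative_eq_rhs)
    have "C k * ((- 1) ^ k * y / C k) = (- 1) ^ k * y" for y using Ck by simp
    with Ck show "(\<lambda>x. (- (mA i j (z k) * fst ((- 1) ^ k * fst (E k (fst x, C 0 * snd x)), (- 1) ^ k * snd (E k (fst x, C 0 * snd x)) / C k) +
          mB i j (z k) * (C k * snd ((- 1) ^ k * fst (E k (fst x, C 0 * snd x)), (- 1) ^ k * snd (E k (fst x, C 0 * snd x)) / C k))),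
       - (mC i j (z k) * fst ((- 1) ^ k * fst (E k (fst x, C 0 * snd x)), (- 1) ^ k * snd (E k (fst x, C 0 * snd x)) / C k) +
          mD i j (z k) * (C k * snd ((- 1) ^ k * fst (E k (fst x, C 0 * snd x)), (- 1) ^ k * snd (E k (fst x, C 0 * snd x)) / C k))) / C (Suc k))) =
      (\<lambda>h. ((- 1) ^ Suc k * fst (E (Suc k) (fst h, C 0 * snd h)), (- 1) ^ Suc k * snd (E (Suc k) (fst h, C 0 * snd h)) / C (Suc k)))"
      by (simp add: fun_eq_iff E_def i_def j_def algebra_simps)
  qed
  ultimately show ?case using \<phi>(1) f(1) by (intro exI[of _ "\<lambda>w. \<phi> (f w)"]) (simp add: j_def add.commute)
qed

definition per where "per \<equiv> periodic_repetition"

text \<open>The window around 0 is the one used by \<open>coords T i 0\<close> in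
  \<open>return_differential\<close>. The choice depends only on label and point, so it is periodic
  along the orbit.\<close>

definition spar :: "3 list \<Rightarrow> int \<Rightarrow> real" where
  "spar \<sigma> j = (SOME s. s \<in> {0 - perim T (per \<sigma> j) / 2..<0 + perim T (per \<sigma> j) / 2} \<and> bd (per \<sigma> j) s = orb \<sigma> j)"

definition zpar :: "3 list \<Rightarrow> int \<Rightarrow> real \<times> real" where "zpar \<sigma> j = (spar \<sigma> j, spar \<sigma> (j + 1))"

lemma per_period: "per \<sigma> (j + int (length \<sigma>)) = per \<sigma> j"
  by (simp add: per_def periodic_repetition_period)

lemma spar:
  assumes "admissible \<sigma>"
  shows "spar \<sigma> j \<in> {0 - perim T (per \<sigma> j) / 2..<0 + perim T (per \<sigma> j) / 2}" and bd_spar: "bd (per \<sigma> j) (spar \<sigma> j) = orb \<sigma> j"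
proof -
  define l where "l = perim T (per \<sigma> j)"
  have "orb \<sigma> j \<in> frontier (ob (per \<sigma> j))"
    using refl_frontier[OF orb_refl[OF assms]] by (simp add: per_def)
  then obtain s where "s \<in> {0 - l / 2..<0 - l / 2 + l}" "orb \<sigma> j = bd (per \<sigma> j) s"
    unfolding l_def by (rule frontier_window)
  then have "\<exists>s. s \<in> {0 - l / 2..<0 + l / 2} \<and> bd (per \<sigma> j) s = orb \<sigma> j" by auto
  from someI_ex[OF this] show "spar \<sigma> j \<in> {0 - perim T (per \<sigma> j) / 2..<0 + perim T (per \<sigma> j) / 2}"
    "bd (per \<sigma> j) (spar \<sigma> j) = orb \<sigma> j" by (simp_all add: spar_def l_def)
qed

lemma spar_period: "admissible \<sigma> \<Longrightarrow> spar \<sigma> (j + int (length \<sigma>)) = spar \<sigma> j"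
  by (simp add: spar_def per_period orb_period)

lemma zpar_period: "admissible \<sigma> \<Longrightarrow> zpar \<sigma> (j + int (length \<sigma>)) = zpar \<sigma> j"
proof -
  assume a: "admissible \<sigma>"
  have *: "j + int (length \<sigma>) + 1 = j + 1 + int (length \<sigma>)" by simp
  show ?thesis by (simp only: zpar_def * spar_period[OF a])
qed

lemma zpar_visible: "admissible \<sigma> \<Longrightarrow> visible (per \<sigma> j) (per \<sigma> (j + 1)) (zpar \<sigma> j)"
  using chord_refl(1)[OF orb_refl, of \<sigma> j] bd_spar by (simp add: zpar_def per_def)

definition sA where "sA \<sigma> k = mA (per \<sigma> (int k)) (per \<sigma> (int k + 1)) (zpar \<sigma> (int k))" for k :: nat
definition sB where "sB \<sigma> k = mB (per \<sigma> (int k)) (per \<sigma> (int k + 1)) (zpar \<sigma> (int k))" for k :: nat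
definition sC where "sC \<sigma> k = mC (per \<sigma> (int k)) (per \<sigma> (int k + 1)) (zpar \<sigma> (int k))" for k :: nat
definition sD where "sD \<sigma> k = mD (per \<sigma> (int k)) (per \<sigma> (int k + 1)) (zpar \<sigma> (int k))" for k :: nat

lemma s_pos:
  assumes "admissible \<sigma>"
  shows "0 < sA \<sigma> k" "0 < sB \<sigma> k" "0 < sC \<sigma> k" "0 < sD \<sigma> k" "sA \<sigma> k * sD \<sigma> k - sB \<sigma> k * sC \<sigma> k = 1"
  using visible_pos[OF zpar_visible[OF assms, of "int k"]] by (simp_all add: sA_def sB_def sC_def sD_def)

lemma s_period:
  assumes "admissible \<sigma>"
  shows "sA \<sigma> (k + length \<sigma>) = sA \<sigma> k" "sB \<sigma> (k + length \<sigma>) = sB \<sigma> k"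
    "sC \<sigma> (k + length \<sigma>) = sC \<sigma> k" "sD \<sigma> (k + length \<sigma>) = sD \<sigma> k"
proof -
  have *: "int (k + length \<sigma>) = int k + int (length \<sigma>)" "int k + int (length \<sigma>) + 1 = int k + 1 + int (length \<sigma>)" by simp_all
  show "sA \<sigma> (k + length \<sigma>) = sA \<sigma> k" "sB \<sigma> (k + length \<sigma>) = sB \<sigma> k"
    "sC \<sigma> (k + length \<sigma>) = sC \<sigma> k" "sD \<sigma> (k + length \<sigma>) = sD \<sigma> k"
    unfolding sA_def sB_def sC_def sD_def by (simp_all only: * per_period zpar_period[OF assms])
qed

text \<open>After one period the cosines at both ends agree, so the differential is a sign times
  \<open>evo\<close> conjugated by the diagonal matrix with entries 1 and \<open>c\<close>.\<close>

lemma return_differential_eq: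
  assumes adm: "admissible \<sigma>"
  shows "\<exists>c>0. return_differential T (\<sigma> ! 0) (length \<sigma>) (labelled_orbit T \<sigma> 0) =
    (\<lambda>h. ((- 1) ^ length \<sigma> * fst (evo (sA \<sigma>) (sB \<sigma>) (sC \<sigma>) (sD \<sigma>) (length \<sigma>) (fst h, c * snd h)),
      (- 1) ^ length \<sigma> * snd (evo (sA \<sigma>) (sB \<sigma>) (sC \<sigma>) (sD \<sigma>) (length \<sigma>) (fst h, c * snd h)) / c))"
proof -
  define N where "N = length \<sigma>"
  have N: "2 \<le> N" using adm by (simp add: admissible_def N_def)
  note r = orb_refl[OF adm, folded per_def]
  define i where "i = per \<sigma> 0"
  have "0 < length \<sigma>" using N N_def by linarith
  then have i: "\<sigma> ! 0 = i" using periodic_repetition_nat[of 0 \<sigma>] by (simp add: i_def per_def)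
  define st where "st k = (spar \<sigma> (int k), arcsin (sin1 (per \<sigma> (int k)) (per \<sigma> (int k + 1)) (zpar \<sigma> (int k))))" for k :: nat
  define C where "C k = cos1 (per \<sigma> (int k)) (per \<sigma> (int k + 1)) (zpar \<sigma> (int k))" for k :: nat
  define E where "E = evo (sA \<sigma>) (sB \<sigma>) (sC \<sigma>) (sD \<sigma>)"
  have ex: "\<exists>f. f (st 0) = st N \<and>
    (f has_derivative (\<lambda>h. ((- 1) ^ N * fst (E N (fst h, C 0 * snd h)), (- 1) ^ N * snd (E N (fst h, C 0 * snd h)) / C N))) (at (st 0)) \<and>
    eventually (\<lambda>w. (billiard_map T ^^ N) (chart T (per \<sigma> 0) w) = chart T (per \<sigma> (int N)) (f w)) (nhds (st 0))"
    using iterate_coords[OF r, of "spar \<sigma>" N] bd_spar[OF adm]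
    unfolding st_def C_def E_def sA_def[abs_def] sB_def[abs_def] sC_def[abs_def] sD_def[abs_def] zpar_def by simp
  have per0: "per \<sigma> (int N) = i" "per \<sigma> (int N + 1) = per \<sigma> 1" "zpar \<sigma> (int N) = zpar \<sigma> 0" "spar \<sigma> (int N) = spar \<sigma> 0"
    using per_period[of \<sigma> 0] per_period[of \<sigma> 1] zpar_period[OF adm, of 0] spar_period[OF adm, of 0]
    by (simp_all add: N_def i_def add.commute)
  have stN: "st N = st 0" "C N = C 0" using per0 by (simp_all add: st_def C_def i_def)
  obtain f where f: "f (st 0) = st 0"
    "(f has_derivative (\<lambda>h. ((- 1) ^ N * fst (E N (fst h, C 0 * snd h)), (- 1) ^ N * snd (E N (fst h, C 0 * snd h)) / C 0))) (at (st 0))"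
    "eventually (\<lambda>w. (billiard_map T ^^ N) (chart T i w) = chart T i (f w)) (nhds (st 0))"
    using ex unfolding stN per0(1) i_def[symmetric] by blast
  note v = zpar_visible[OF adm, of 0]
  have C0: "0 < C 0" using v by (simp add: C_def visible_def)
  define y where "y = sin1 (per \<sigma> 0) (per \<sigma> 1) (zpar \<sigma> 0)"
  have y1: "\<bar>y\<bar> < 1" using visible_sin(1)[OF v] by (simp add: y_def)
  have st0: "st 0 = (spar \<sigma> 0, arcsin y)" by (simp add: st_def y_def)
  have as: "- (pi / 2) < arcsin y" "arcsin y < pi / 2" using y1 arcsin_lt_bounded[of y] by auto
  have y': "y = dir (orb \<sigma>) 0 \<bullet> vel i (spar \<sigma> 0)"
    using chord_refl(4)[OF r, of 0 "spar \<sigma> 0" "spar \<sigma> 1"] bd_spar[OF adm] by (simp add: y_def i_def zpar_def)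
  have "nml i (spar \<sigma> 0) * cis (arcsin y) = dir (orb \<sigma>) 0"
    unfolding y'
  proof (rule chart_dir)
    show "norm (dir (orb \<sigma>) 0) = 1" by (rule refl_norm_dir[OF r])
    show "0 \<le> dir (orb \<sigma>) 0 \<bullet> nml i (spar \<sigma> 0)"
      using refl_out[OF r, of 0] normal_at_bd[of i "spar \<sigma> 0"] bd_spar[OF adm, of 0] by (simp add: i_def)
  qed
  then have "chart T i (st 0) = labelled_orbit T \<sigma> 0"
    using bd_spar[OF adm, of 0] labelled_orbit_orb[OF adm, of 0] by (simp add: chart_def st0 i_def)
  moreover have "coords T i 0 (chart T i (st 0)) = st 0"
    unfolding st0 by (rule coords_chart) (use spar(1)[OF adm, of 0] as in \<open>auto simp: i_def\<close>)
  ultimately have z0: "coords T i 0 (labelled_orbit T \<sigma> 0) = st 0" by simp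
  define c where "c = spar \<sigma> 0"
  define l where "l = perim T i"
  have l: "0 < l" using perim_pos by (simp add: l_def)
  \<comment> \<open>On this open box \<open>coords\<close> inverts \<open>chart\<close>. The
    arc-length window is centred at the fixed point itself, which therefore does not lie on the
    seam.\<close>
  define S where "S = {c - l / 2<..<c + l / 2} \<times> {- (pi / 2)<..<pi / 2}"
  have S: "open S" "st 0 \<in> S" using as l by (auto simp: S_def st0 c_def intro!: open_Times)
  have "filterlim f (nhds (f (st 0))) (nhds (st 0))"
    using isCont_nhds[OF has_derivative_continuous[OF f(2)]] .
  then have "eventually (\<lambda>w. f w \<in> S) (nhds (st 0))"
    using eventually_nhds_in_open[OF S] unfolding f(1) filterlim_iff by blast
  with f(3) have "eventually (\<lambda>w. coords T i c ((billiard_map T ^^ N) (chart T i w)) = f w) (nhds (st 0))"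
  proof eventually_elim
    case (elim w)
    have "coords T i c (chart T i (fst (f w), snd (f w))) = (fst (f w), snd (f w))"
      by (rule coords_chart) (use elim(2) in \<open>auto simp: S_def l_def mem_Times_iff\<close>)
    then show ?case using elim(1) by simp
  qed
  then have ev: "eventually (\<lambda>w. f w = coords T i c ((billiard_map T ^^ N) (chart T i w))) (nhds (st 0))"
    by eventually_elim simp
  have "((\<lambda>w. coords T i c ((billiard_map T ^^ N) (chart T i w))) has_derivative
     (\<lambda>h. ((- 1) ^ N * fst (E N (fst h, C 0 * snd h)), (- 1) ^ N * snd (E N (fst h, C 0 * snd h)) / C 0))) (at (st 0))"
    by (rule has_derivative_transform_eventually[OF f(2)])
      (use ev eventually_nhds_x_imp_x[OF ev] in \<open>auto simp: eventually_at_filter elim: eventually_mono\<close>)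
  from frechet_derivative_at[OF this]
  have "return_differential T i N (labelled_orbit T \<sigma> 0) =
     (\<lambda>h. ((- 1) ^ N * fst (E N (fst h, C 0 * snd h)), (- 1) ^ N * snd (E N (fst h, C 0 * snd h)) / C 0))"
    unfolding return_differential_def Let_def z0 by (simp add: st0 c_def)
  then show ?thesis using C0 unfolding i N_def E_def by blast
qed

text \<open>Neither the conjugation nor the sign, a power of -1, affects the absolute values of the
  eigenvalues.\<close>

lemma marked_multiplier_eq:
  assumes adm: "admissible \<sigma>" and \<mu>: "1 < \<mu>"
    and spec: "\<And>e. (\<exists>v. v \<noteq> 0 \<and> evo (sA \<sigma>) (sB \<sigma>) (sC \<sigma>) (sD \<sigma>) (length \<sigma>) v = e *\<^sub>R v) \<longleftrightarrow> e = \<mu> \<or> e = 1 / \<mu>"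
  shows "marked_multiplier T \<sigma> = \<mu>"
proof -
  define N where "N = length \<sigma>"
  define E where "E = evo (sA \<sigma>) (sB \<sigma>) (sC \<sigma>) (sD \<sigma>) N"
  obtain c where c: "c > 0" "return_differential T (\<sigma> ! 0) N (labelled_orbit T \<sigma> 0) =
    (\<lambda>h. ((- 1) ^ N * fst (E (fst h, c * snd h)), (- 1) ^ N * snd (E (fst h, c * snd h)) / c))"
    using return_differential_eq[OF adm] unfolding N_def E_def by blast
  define \<epsilon> :: real where "\<epsilon> = (- 1) ^ N"
  have \<epsilon>: "\<epsilon> * \<epsilon> = 1" "\<epsilon> \<noteq> 0" "\<bar>\<epsilon>\<bar> = 1" by (simp_all add: \<epsilon>_def power_abs flip: power_mult_distrib)
  have "e \<in> eigenvalues (return_differential T (\<sigma> ! 0) N (labelled_orbit T \<sigma> 0)) \<longleftrightarrow> \<epsilon> * e = \<mu> \<or> \<epsilon> * e = 1 / \<mu>" for e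
  proof -
    have sgn_move: "\<epsilon> * x = y \<longleftrightarrow> x = \<epsilon> * y" for x y using \<epsilon> by (metis mult.left_commute mult.right_neutral)
    have "e \<in> eigenvalues (return_differential T (\<sigma> ! 0) N (labelled_orbit T \<sigma> 0)) \<longleftrightarrow>
        (\<exists>v. v \<noteq> 0 \<and> \<epsilon> * fst (E (fst v, c * snd v)) = e * fst v \<and> \<epsilon> * snd (E (fst v, c * snd v)) / c = e * snd v)"
      unfolding eigenvalues_def c(2) \<epsilon>_def by (auto simp: prod_eq_iff)
    also have "\<dots> \<longleftrightarrow> (\<exists>v. v \<noteq> 0 \<and> E v = (\<epsilon> * e) *\<^sub>R v)"
    proof
      assume "\<exists>v. v \<noteq> 0 \<and> \<epsilon> * fst (E (fst v, c * snd v)) = e * fst v \<and> \<epsilon> * snd (E (fst v, c * snd v)) / c = e * snd v"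
      then obtain v where v: "v \<noteq> 0" "\<epsilon> * fst (E (fst v, c * snd v)) = e * fst v" "\<epsilon> * snd (E (fst v, c * snd v)) = e * (c * snd v)"
        using c(1) by (auto simp: field_simps)
      define w where "w = (fst v, c * snd v)"
      have "w \<noteq> 0" using v(1) c(1) by (auto simp: w_def prod_eq_iff)
      moreover have "fst (E w) = \<epsilon> * (e * fst v)" "snd (E w) = \<epsilon> * (e * (c * snd v))"
        using v(2,3) sgn_move unfolding w_def by blast+
      then have "E w = (\<epsilon> * e) *\<^sub>R w" by (simp add: prod_eq_iff w_def)
      ultimately show "\<exists>v. v \<noteq> 0 \<and> E v = (\<epsilon> * e) *\<^sub>R v" by blast
    next
      assume "\<exists>v. v \<noteq> 0 \<and> E v = (\<epsilon> * e) *\<^sub>R v"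
      then obtain w where w: "w \<noteq> 0" "E w = (\<epsilon> * e) *\<^sub>R w" by blast
      define v where "v = (fst w, snd w / c)"
      have cv: "(fst v, c * snd v) = w" using c(1) by (simp add: v_def)
      have "v \<noteq> 0" using w(1) c(1) by (auto simp: v_def prod_eq_iff)
      moreover have "\<epsilon> * fst (E w) = e * fst v" "\<epsilon> * snd (E w) / c = e * snd v"
        using \<epsilon>(1) w(2) by (simp_all add: v_def mult.assoc[symmetric])
      ultimately show "\<exists>v. v \<noteq> 0 \<and> \<epsilon> * fst (E (fst v, c * snd v)) = e * fst v \<and> \<epsilon> * snd (E (fst v, c * snd v)) / c = e * snd v"
        using cv by metis
    qed
    also have "\<dots> \<longleftrightarrow> \<epsilon> * e = \<mu> \<or> \<epsilon> * e = 1 / \<mu>" unfolding E_def N_def by (rule spec)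
    finally show ?thesis .
  qed
  moreover have "\<epsilon> * e = x \<longleftrightarrow> e = \<epsilon> * x" for e x using \<epsilon> by (metis mult.left_commute mult.right_neutral)
  ultimately have "eigenvalues (return_differential T (\<sigma> ! 0) N (labelled_orbit T \<sigma> 0)) = {\<epsilon> * \<mu>, \<epsilon> * (1 / \<mu>)}" by blast
  then have "abs ` eigenvalues (return_differential T (\<sigma> ! 0) N (labelled_orbit T \<sigma> 0)) = {\<mu>, 1 / \<mu>}"
    using \<mu> \<epsilon>(3) by (simp add: abs_mult)
  moreover have "Max {\<mu>, 1 / \<mu>} = \<mu>"
  proof -
    have "1 / \<mu> \<le> 1" using \<mu> by simp
    then have "1 / \<mu> \<le> \<mu>" using \<mu> by linarith
    then show ?thesis by simp
  qed
  ultimately show ?thesis unfolding marked_multiplier_def N_def by simp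
qed

end

section \<open>Orbits with different pasts separate\<close>

context table
begin

lemma cl_separation:
  obtains d where "0 < d" "\<And>i j x y. i \<noteq> j \<Longrightarrow> x \<in> cl i \<Longrightarrow> y \<in> cl j \<Longrightarrow> d \<le> norm (x - y)"
proof -
  have "\<exists>d>0. \<forall>ij\<in>{ij. fst ij \<noteq> snd ij}. \<forall>x\<in>cl (fst ij). \<forall>y\<in>cl (snd ij). d \<le> norm (x - y)"
  proof (rule finite_uniform_pos)
    fix ij :: "3 \<times> 3" assume "ij \<in> {ij. fst ij \<noteq> snd ij}"
    then show "\<exists>d>0. \<forall>x\<in>cl (fst ij). \<forall>y\<in>cl (snd ij). d \<le> norm (x - y)"
      using separate_compact_closed[OF cl_compact closed_closure cl_disjoint, of "fst ij" "snd ij"]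
      by (simp add: dist_norm)
  qed (simp, meson order_trans)
  then show ?thesis using that by auto
qed

lemma unit_reflect:
  assumes "norm e = 1" "norm f = 1" "(e - f) \<bullet> vel i s = 0" "e \<noteq> f"
  shows "f = - (e \<bullet> nml i s) *\<^sub>R nml i s + (e \<bullet> vel i s) *\<^sub>R vel i s"
proof -
  have v: "f \<bullet> vel i s = e \<bullet> vel i s" using assms(3) by (simp add: inner_diff_left)
  have "(f \<bullet> nml i s)\<^sup>2 = (e \<bullet> nml i s)\<^sup>2"
    using norm_frame[of e i s] norm_frame[of f i s] assms(1,2) v by simp
  moreover have "f \<bullet> nml i s \<noteq> e \<bullet> nml i s"
    using frame_expand[of e i s] frame_expand[of f i s] v assms(4) by metis
  ultimately have "f \<bullet> nml i s = - (e \<bullet> nml i s)" by (simp add: power2_eq_iff)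
  then show ?thesis using frame_expand[of f i s] v by simp
qed

text \<open>The past is determined: the leg from \<open>y\<close> to \<open>z\<close> fixes the
  incoming direction, so both predecessors lie on one backward ray. On different obstacles the
  nearer one would block the other; on the same obstacle both are exit points of the ray, and a
  convex set has only one.\<close>

lemma predecessor_rigid:
  assumes lab: "a \<noteq> b" "a' \<noteq> b" "b \<noteq> d"
    and z: "z \<in> cl d" and y: "y = bd b s" and x: "x = bd a r" and x': "x' = bd a' r'"
    and refl: "(sgn (z - y) - sgn (y - x)) \<bullet> vel b s = 0" "(sgn (z - y) - sgn (y - x')) \<bullet> vel b s = 0"
    and vis: "0 < sgn (y - x) \<bullet> nml a r" "0 < sgn (y - x') \<bullet> nml a' r'"
  shows "x = x'"
proof -
  have mem: "x \<in> cl a" "x' \<in> cl a'" "y \<in> cl b" using x x' y bd_cl by auto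
  have ne: "y \<noteq> x" "y \<noteq> x'" "z \<noteq> y" using mem lab z cl_label_unique by blast+
  have f: "sgn (y - x) = sgn (y - x')"
    using unit_reflect[of "sgn (z - y)" "sgn (y - x)" b s] unit_reflect[of "sgn (z - y)" "sgn (y - x')" b s]
      directions_distinct[OF lab(1,3) mem(1,3) z] directions_distinct[OF lab(2,3) mem(2,3) z] ne refl
    by (simp add: norm_sgn)
  define f where "f = sgn (y - x)"
  define \<tau> where "\<tau> = norm (y - x)"
  define \<tau>' where "\<tau>' = norm (y - x')"
  have pos: "0 < \<tau>" "0 < \<tau>'" using ne by (simp_all add: \<tau>_def \<tau>'_def)
  have xe: "y - x = \<tau> *\<^sub>R f" using sgn_dist[of "y - x"] by (simp add: f_def \<tau>_def)
  have xe': "y - x' = \<tau>' *\<^sub>R f" using sgn_dist[of "y - x'"] f by (simp add: f_def \<tau>'_def)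
  have xx: "x = y - \<tau> *\<^sub>R f" "x' = y - \<tau>' *\<^sub>R f" using xe xe' by (simp_all add: algebra_simps)
  have seg: "y - t *\<^sub>R f \<in> closed_segment y (y - u *\<^sub>R f)" if "0 < t" "t \<le> u" for t u
  proof -
    have "y - t *\<^sub>R f = (1 - t / u) *\<^sub>R y + (t / u) *\<^sub>R (y - u *\<^sub>R f)" using that by (simp add: algebra_simps)
    then show ?thesis unfolding closed_segment_def using that by fastforce
  qed
  show ?thesis
  proof (cases "a = a'")
    case True
    have "nml a r \<bullet> (x' - x) \<le> 0" "nml a' r' \<bullet> (x - x') \<le> 0"
      using supporting_normal[of x' a r] supporting_normal[of x a' r'] mem x x' True by auto
    moreover have "x' - x = (\<tau> - \<tau>') *\<^sub>R f" "x - x' = (\<tau>' - \<tau>) *\<^sub>R f" by (simp_all add: xx algebra_simps)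
    ultimately have "(\<tau> - \<tau>') * (f \<bullet> nml a r) \<le> 0" "(\<tau>' - \<tau>) * (f \<bullet> nml a' r') \<le> 0"
      by (simp_all add: inner_commute)
    then have "\<tau> = \<tau>'" using vis f by (simp add: f_def[symmetric] mult_le_0_iff)
    then show ?thesis by (simp add: xx)
  next
    case False
    show ?thesis
    proof (cases "\<tau> \<le> \<tau>'")
      case True
      then have "x \<in> closed_segment y x'" using seg[OF pos(1)] by (simp add: xx)
      then show ?thesis using not_between[of b a a' y x x'] False lab mem by simp
    next
      case False2: False
      then have "x' \<in> closed_segment y x" using seg[OF pos(2), of \<tau>] by (simp add: xx)
      then show ?thesis using not_between[of b a' a y x' x] False lab mem by simp
    qed
  qed
qed

lemma compact_sublevel:
  fixes f :: "'a :: t2_space \<Rightarrow> real"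
  assumes "compact B" "continuous_on B f" shows "compact {w \<in> B. f w \<le> 0}"
proof -
  have "closedin (top_of_set B) (B \<inter> f -` {..0})"
    using assms(2) continuous_closedin_preimage closed_atMost by blast
  then have "compact (B \<inter> f -` {..0})" by (rule closedin_compact[OF assms(1)])
  moreover have "B \<inter> f -` {..0} = {w \<in> B. f w \<le> 0}" by auto
  ultimately show ?thesis by simp
qed

text \<open>Compactness version of \<open>predecessor_rigid\<close>. The lower bound
  \<open>c\<close> on the cosines replaces the open condition of positivity by a closed one.\<close>

lemma predecessor_close_labels:
  assumes lab: "a \<noteq> b" "a' \<noteq> b" "b \<noteq> d" and \<epsilon>: "0 < \<epsilon>" and c: "0 < c"
  shows "\<exists>\<delta>>0. \<forall>x y z x' y' z'.
    x \<in> frontier (ob a) \<longrightarrow> x' \<in> frontier (ob a') \<longrightarrow> y \<in> frontier (ob b) \<longrightarrow> y' \<in> frontier (ob b) \<longrightarrow>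
    z \<in> frontier (ob d) \<longrightarrow> z' \<in> frontier (ob d) \<longrightarrow>
    (sgn (z - y) - sgn (y - x)) \<bullet> (\<i> * nu y) = 0 \<longrightarrow> (sgn (z' - y') - sgn (y' - x')) \<bullet> (\<i> * nu y') = 0 \<longrightarrow>
    c \<le> sgn (y - x) \<bullet> nu x \<longrightarrow> c \<le> sgn (y' - x') \<bullet> nu x' \<longrightarrow> \<epsilon> \<le> norm (x - x') \<longrightarrow>
    \<delta> \<le> norm (y - y') + norm (z - z')"
proof -
  define B where "B = {0..perim T a} \<times> {0..perim T a'} \<times> {0..perim T b} \<times> {0..perim T b} \<times> {0..perim T d} \<times> {0..perim T d}"
  have B: "compact B" unfolding B_def by (intro compact_Times compact_Icc)
  define x where "x w = bd a (fst w)" for w :: "real \<times> real \<times> real \<times> real \<times> real \<times> real"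
  define x' where "x' w = bd a' (fst (snd w))" for w :: "real \<times> real \<times> real \<times> real \<times> real \<times> real"
  define y where "y w = bd b (fst (snd (snd w)))" for w :: "real \<times> real \<times> real \<times> real \<times> real \<times> real"
  define y' where "y' w = bd b (fst (snd (snd (snd w))))" for w :: "real \<times> real \<times> real \<times> real \<times> real \<times> real"
  define z where "z w = bd d (fst (snd (snd (snd (snd w)))))" for w :: "real \<times> real \<times> real \<times> real \<times> real \<times> real"
  define z' where "z' w = bd d (snd (snd (snd (snd (snd w)))))" for w :: "real \<times> real \<times> real \<times> real \<times> real \<times> real"
  define vy where "vy w = vel b (fst (snd (snd w)))" for w :: "real \<times> real \<times> real \<times> real \<times> real \<times> real"
  define vy' where "vy' w = vel b (fst (snd (snd (snd w))))" for w :: "real \<times> real \<times> real \<times> real \<times> real \<times> real"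
  define nx where "nx w = nml a (fst w)" for w :: "real \<times> real \<times> real \<times> real \<times> real \<times> real"
  define nx' where "nx' w = nml a' (fst (snd w))" for w :: "real \<times> real \<times> real \<times> real \<times> real \<times> real"
  have ct: "continuous_on S x" "continuous_on S x'" "continuous_on S y" "continuous_on S y'" "continuous_on S z"
    "continuous_on S z'" "continuous_on S vy" "continuous_on S vy'" "continuous_on S nx" "continuous_on S nx'" for S
    unfolding x_def[abs_def] x'_def[abs_def] y_def[abs_def] y'_def[abs_def] z_def[abs_def] z'_def[abs_def]
      vy_def[abs_def] vy'_def[abs_def] nx_def[abs_def] nx'_def[abs_def]
    by (intro continuous_intros continuous_on_compose2[OF bd_cont[of UNIV]] continuous_on_compose2[OF vel_cont[of UNIV]]
        continuous_on_compose2[OF nml_cont[of UNIV]]; simp)+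
  have mem: "x w \<in> cl a" "x' w \<in> cl a'" "y w \<in> cl b" "y' w \<in> cl b" "z w \<in> cl d" "z' w \<in> cl d" for w
    by (simp_all add: x_def x'_def y_def y'_def z_def z'_def bd_cl)
  have ne: "z w - y w \<noteq> 0" "y w - x w \<noteq> 0" "z' w - y' w \<noteq> 0" "y' w - x' w \<noteq> 0" for w
    using mem[of w] lab cl_label_unique by (metis eq_iff_diff_eq_0)+
  \<comment> \<open>All closed conditions are packed into one continuous nonnegative function that
    vanishes exactly where they hold.\<close>
  define h where "h w = \<bar>(sgn (z w - y w) - sgn (y w - x w)) \<bullet> vy w\<bar> + \<bar>(sgn (z' w - y' w) - sgn (y' w - x' w)) \<bullet> vy' w\<bar> +
    max 0 (c - sgn (y w - x w) \<bullet> nx w) + max 0 (c - sgn (y' w - x' w) \<bullet> nx' w) + max 0 (\<epsilon> - norm (x w - x' w))" for w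
  define S where "S = {w \<in> B. h w \<le> 0}"
  have "continuous_on B h" unfolding h_def by (intro continuous_intros ct) (use ne in auto)
  then have S: "compact S" unfolding S_def by (rule compact_sublevel[OF B])
  have hS: "w \<in> S \<longleftrightarrow> w \<in> B \<and> (sgn (z w - y w) - sgn (y w - x w)) \<bullet> vy w = 0 \<and>
    (sgn (z' w - y' w) - sgn (y' w - x' w)) \<bullet> vy' w = 0 \<and> c \<le> sgn (y w - x w) \<bullet> nx w \<and>
    c \<le> sgn (y' w - x' w) \<bullet> nx' w \<and> \<epsilon> \<le> norm (x w - x' w)" for w
    unfolding S_def h_def mem_Collect_eq by linarith
  define \<phi> where "\<phi> w = norm (y w - y' w) + norm (z w - z' w)" for w
  have \<phi>c: "continuous_on S \<phi>" unfolding \<phi>_def by (intro continuous_intros ct)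
  have \<phi>0: "0 < \<phi> w" if w: "w \<in> S" for w
  proof (rule ccontr)
    assume "\<not> 0 < \<phi> w"
    then have eq: "y' w = y w" "z' w = z w" by (auto simp: \<phi>_def add_nonneg_eq_0_iff not_less antisym_conv)
    have v: "vy' w = vy w" using nml_unique[of b "fst (snd (snd (snd w)))" "fst (snd (snd w))"] eq(1)
      by (simp add: vy_def vy'_def y_def y'_def vel_eq)
    note * = w[unfolded hS]
    have "x w = x' w"
    proof (rule predecessor_rigid[OF lab mem(5), where y = "y w" and s = "fst (snd (snd w))" and r = "fst w" and r' = "fst (snd w)"])
      show "y w = bd b (fst (snd (snd w)))" "x w = bd a (fst w)" "x' w = bd a' (fst (snd w))"
        by (simp_all add: x_def x'_def y_def)
    qed (use * c eq v in \<open>auto simp: vy_def nx_def nx'_def\<close>)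
    then show False using * \<epsilon> by simp
  qed
  obtain \<delta> where \<delta>: "\<delta> > 0" "\<And>w. w \<in> S \<Longrightarrow> \<delta> \<le> \<phi> w"
  proof (cases "S = {}")
    case True
    then show ?thesis using that[of 1] by simp
  next
    case False
    then obtain w0 where "w0 \<in> S" "\<And>w. w \<in> S \<Longrightarrow> \<phi> w0 \<le> \<phi> w"
      using continuous_attains_inf[OF S _ \<phi>c] by blast
    then show ?thesis using that[of "\<phi> w0"] \<phi>0 by simp
  qed
  show ?thesis
  proof (rule exI[of _ \<delta>], intro conjI \<delta>(1) allI impI)
    fix px py pz px' py' pz'
    assume fr: "px \<in> frontier (ob a)" "px' \<in> frontier (ob a')" "py \<in> frontier (ob b)" "py' \<in> frontier (ob b)"
      "pz \<in> frontier (ob d)" "pz' \<in> frontier (ob d)"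
      and A: "(sgn (pz - py) - sgn (py - px)) \<bullet> (\<i> * nu py) = 0" "(sgn (pz' - py') - sgn (py' - px')) \<bullet> (\<i> * nu py') = 0"
      "c \<le> sgn (py - px) \<bullet> nu px" "c \<le> sgn (py' - px') \<bullet> nu px'" "\<epsilon> \<le> norm (px - px')"
    obtain r where r: "r \<in> {0..<0 + perim T a}" "px = bd a r" using frontier_window[OF fr(1)] .
    obtain r' where r': "r' \<in> {0..<0 + perim T a'}" "px' = bd a' r'" using frontier_window[OF fr(2)] .
    obtain s where s: "s \<in> {0..<0 + perim T b}" "py = bd b s" using frontier_window[OF fr(3)] .
    obtain s' where s': "s' \<in> {0..<0 + perim T b}" "py' = bd b s'" using frontier_window[OF fr(4)] .
    obtain t where t: "t \<in> {0..<0 + perim T d}" "pz = bd d t" using frontier_window[OF fr(5)] .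
    obtain t' where t': "t' \<in> {0..<0 + perim T d}" "pz' = bd d t'" using frontier_window[OF fr(6)] .
    define w where "w = (r, r', s, s', t, t')"
    have eqs: "x w = px" "x' w = px'" "y w = py" "y' w = py'" "z w = pz" "z' w = pz'" "vy w = \<i> * nu py" "vy' w = \<i> * nu py'"
      "nx w = nu px" "nx' w = nu px'"
      using r r' s s' t t'
      by (simp_all add: w_def x_def x'_def y_def y'_def z_def z'_def vy_def vy'_def nx_def nx'_def vel_eq normal_at_bd)
    have "w \<in> B" using r r' s s' t t' by (simp add: w_def B_def)
    then have "w \<in> S" unfolding hS eqs using A by blast
    from \<delta>(2)[OF this] show "\<delta> \<le> norm (py - py') + norm (pz - pz')" by (simp add: \<phi>_def eqs)
  qed
qed

text \<open>Uniform continuity of the inverse billiard map, expressed by pairs of consecutive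
  points.\<close>

lemma predecessor_close:
  assumes \<epsilon>: "0 < \<epsilon>"
  shows "\<exists>\<delta>>0. \<forall>\<rho> q \<rho>' q' k. refl_seq T \<rho> q \<longrightarrow> refl_seq T \<rho>' q' \<longrightarrow>
    norm (q k - q' k) < \<delta> \<longrightarrow> norm (q (k + 1) - q' (k + 1)) < \<delta> \<longrightarrow> norm (q (k - 1) - q' (k - 1)) < \<epsilon>"
proof -
  obtain c where c: "0 < c" "\<And>\<rho> q j. refl_seq T \<rho> q \<Longrightarrow> c \<le> dir q j \<bullet> nu (q j)"
    using refl_out_lower by blast
  obtain d0 where d0: "0 < d0" "\<And>i j x y. i \<noteq> j \<Longrightarrow> x \<in> cl i \<Longrightarrow> y \<in> cl j \<Longrightarrow> d0 \<le> norm (x - y)"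
    using cl_separation by blast
  define P where "P l \<delta> \<longleftrightarrow> (case l of (a, a', b, d) \<Rightarrow> \<forall>x y z x' y' z'.
    x \<in> frontier (ob a) \<longrightarrow> x' \<in> frontier (ob a') \<longrightarrow> y \<in> frontier (ob b) \<longrightarrow> y' \<in> frontier (ob b) \<longrightarrow>
    z \<in> frontier (ob d) \<longrightarrow> z' \<in> frontier (ob d) \<longrightarrow>
    (sgn (z - y) - sgn (y - x)) \<bullet> (\<i> * nu y) = 0 \<longrightarrow> (sgn (z' - y') - sgn (y' - x')) \<bullet> (\<i> * nu y') = 0 \<longrightarrow>
    c \<le> sgn (y - x) \<bullet> nu x \<longrightarrow> c \<le> sgn (y' - x') \<bullet> nu x' \<longrightarrow> \<epsilon> \<le> norm (x - x') \<longrightarrow>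
    \<delta> \<le> norm (y - y') + norm (z - z'))" for l :: "3 \<times> 3 \<times> 3 \<times> 3" and \<delta>
  have "\<exists>\<delta>>0. \<forall>l\<in>{(a, a', b, d). a \<noteq> b \<and> a' \<noteq> b \<and> b \<noteq> d}. P l \<delta>"
  proof (rule finite_uniform_pos)
    show "finite {(a::3, a'::3, b::3, d::3). a \<noteq> b \<and> a' \<noteq> b \<and> b \<noteq> d}" by (rule finite)
    show "\<exists>\<delta>>0. P l \<delta>" if l: "l \<in> {(a, a', b, d). a \<noteq> b \<and> a' \<noteq> b \<and> b \<noteq> d}" for l
    proof -
      obtain a a' b d where "l = (a, a', b, d)" "a \<noteq> b" "a' \<noteq> b" "b \<noteq> d" using l by auto
      then show ?thesis using predecessor_close_labels[of a b a' d \<epsilon> c] \<epsilon> c(1) unfolding P_def by simp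
    qed
    show "P l \<delta>'" if "P l \<delta>" "0 < \<delta>'" "\<delta>' \<le> \<delta>" for l \<delta> \<delta>'
      using that unfolding P_def by (cases l) (simp, meson order_trans)
  qed
  then obtain \<delta> where \<delta>: "0 < \<delta>" "\<And>a a' b d. a \<noteq> b \<Longrightarrow> a' \<noteq> b \<Longrightarrow> b \<noteq> d \<Longrightarrow> P (a, a', b, d) \<delta>" by auto
  \<comment> \<open>Staying below \<open>d0\<close> forces equal labels at \<open>k\<close> and
    \<open>k + 1\<close>, since different obstacles are at least \<open>d0\<close> apart.\<close>
  define \<delta>' where "\<delta>' = min (\<delta> / 2) d0"
  have "norm (q (k - 1) - q' (k - 1)) < \<epsilon>"
    if r: "refl_seq T \<rho> q" and r': "refl_seq T \<rho>' q'"
      and n: "norm (q k - q' k) < \<delta>'" "norm (q (k + 1) - q' (k + 1)) < \<delta>'" for \<rho> q \<rho>' q' k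
  proof (rule ccontr)
    assume "\<not> ?thesis"
    then have far: "\<epsilon> \<le> norm (q (k - 1) - q' (k - 1))" by simp
    have l: "\<rho> k = \<rho>' k" "\<rho> (k + 1) = \<rho>' (k + 1)"
      using d0(2)[of "\<rho> k" "\<rho>' k" "q k" "q' k"] d0(2)[of "\<rho> (k + 1)" "\<rho>' (k + 1)" "q (k + 1)" "q' (k + 1)"]
        refl_cl[OF r] refl_cl[OF r'] n by (force simp: \<delta>'_def)+
    have tang: "(sgn (p (k + 1) - p k) - sgn (p k - p (k - 1))) \<bullet> (\<i> * nu (p k)) = 0 \<and> c \<le> sgn (p k - p (k - 1)) \<bullet> nu (p (k - 1))"
      if rp: "refl_seq T \<tau> p" for \<tau> p
    proof -
      obtain b where "dir p k - dir p (k - 1) = b *\<^sub>R nu (p k)" using refl_law[OF rp] by blast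
      then have "(dir p k - dir p (k - 1)) \<bullet> (\<i> * nu (p k)) = 0" by (simp add: inner_complex_def)
      then show ?thesis using c(2)[OF rp, of "k - 1"] by (simp add: dir_def)
    qed
    have P: "P (\<rho> (k - 1), \<rho>' (k - 1), \<rho> k, \<rho> (k + 1)) \<delta>"
      by (rule \<delta>(2)) (use refl_label[OF r] refl_label'[OF r] refl_label'[OF r'] l in \<open>metis+\<close>)
    have "\<delta> \<le> norm (q k - q' k) + norm (q (k + 1) - q' (k + 1))"
    proof (rule P[unfolded P_def prod.case, rule_format])
      show "q k \<in> frontier (ob (\<rho> k))" "q (k + 1) \<in> frontier (ob (\<rho> (k + 1)))" "q (k - 1) \<in> frontier (ob (\<rho> (k - 1)))"
        "q' k \<in> frontier (ob (\<rho> k))" "q' (k + 1) \<in> frontier (ob (\<rho> (k + 1)))" "q' (k - 1) \<in> frontier (ob (\<rho>' (k - 1)))"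
        using refl_frontier[OF r] refl_frontier[OF r'] l by metis+
    qed (use tang[OF r] tang[OF r'] far in auto)
    then show False using n by (simp add: \<delta>'_def)
  qed
  moreover have "0 < \<delta>'" using \<delta>(1) d0(1) by (simp add: \<delta>'_def)
  ultimately show ?thesis by blast
qed

text \<open>Closeness at two consecutive late indices would propagate back to \<open>a\<close>,
  where the labels differ. The lemma supplies lower bounds for the difference of orbits near the
  ends of a block.\<close>

lemma past_separation:
  "\<exists>c>0. \<forall>\<rho> q \<rho>' q' a. refl_seq T \<rho> q \<longrightarrow> refl_seq T \<rho>' q' \<longrightarrow> \<rho> a \<noteq> \<rho>' a \<longrightarrow>
    c \<le> norm (q (a + int K) - q' (a + int K)) \<or> c \<le> norm (q (a + int K + 1) - q' (a + int K + 1))"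
proof (induction K)
  case 0
  obtain d0 where d0: "0 < d0" "\<And>i j x y. i \<noteq> j \<Longrightarrow> x \<in> cl i \<Longrightarrow> y \<in> cl j \<Longrightarrow> d0 \<le> norm (x - y)"
    using cl_separation by blast
  then show ?case using refl_cl by (intro exI[of _ d0]) auto
next
  case (Suc K)
  then obtain c where c: "c > 0" "\<And>\<rho> q \<rho>' q' a. refl_seq T \<rho> q \<Longrightarrow> refl_seq T \<rho>' q' \<Longrightarrow> \<rho> a \<noteq> \<rho>' a \<Longrightarrow>
    c \<le> norm (q (a + int K) - q' (a + int K)) \<or> c \<le> norm (q (a + int K + 1) - q' (a + int K + 1))" by blast
  obtain \<delta> where \<delta>: "\<delta> > 0" "\<And>\<rho> q \<rho>' q' k. refl_seq T \<rho> q \<Longrightarrow> refl_seq T \<rho>' q' \<Longrightarrow>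
    norm (q k - q' k) < \<delta> \<Longrightarrow> norm (q (k + 1) - q' (k + 1)) < \<delta> \<Longrightarrow> norm (q (k - 1) - q' (k - 1)) < c"
    using predecessor_close[OF c(1)] by blast
  have "min c \<delta> \<le> norm (q (a + int (Suc K)) - q' (a + int (Suc K))) \<or>
    min c \<delta> \<le> norm (q (a + int (Suc K) + 1) - q' (a + int (Suc K) + 1))"
    if r: "refl_seq T \<rho> q" and r': "refl_seq T \<rho>' q'" and a: "\<rho> a \<noteq> \<rho>' a" for \<rho> q \<rho>' q' a
  proof (rule ccontr)
    define k where "k = a + int K + 1"
    have k: "a + int (Suc K) = k" "a + int K = k - 1" by (simp_all add: k_def)
    assume "\<not> ?thesis"
    then have n: "norm (q k - q' k) < c" "norm (q k - q' k) < \<delta>" "norm (q (k + 1) - q' (k + 1)) < \<delta>"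
      unfolding k by auto
    from \<delta>(2)[OF r r' n(2,3)] c(2)[OF r r' a] n(1) show False unfolding k by simp
  qed
  then show ?case using c(1) \<delta>(1) by (intro exI[of _ "min c \<delta>"]) auto
qed

text \<open>\<open>past_separation\<close> under time reversal.\<close>

lemma future_separation:
  "\<exists>c>0. \<forall>\<rho> q \<rho>' q' a. refl_seq T \<rho> q \<longrightarrow> refl_seq T \<rho>' q' \<longrightarrow> \<rho> a \<noteq> \<rho>' a \<longrightarrow>
    c \<le> norm (q (a - int K) - q' (a - int K)) \<or> c \<le> norm (q (a - int K - 1) - q' (a - int K - 1))"
proof -
  obtain c where c: "c > 0" "\<And>\<rho> q \<rho>' q' a. refl_seq T \<rho> q \<Longrightarrow> refl_seq T \<rho>' q' \<Longrightarrow> \<rho> a \<noteq> \<rho>' a \<Longrightarrow>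
    c \<le> norm (q (a + int K) - q' (a + int K)) \<or> c \<le> norm (q (a + int K + 1) - q' (a + int K + 1))"
    using past_separation[of K] by blast
  have "c \<le> norm (q (a - int K) - q' (a - int K)) \<or> c \<le> norm (q (a - int K - 1) - q' (a - int K - 1))"
    if r: "refl_seq T \<rho> q" and r': "refl_seq T \<rho>' q'" and a: "\<rho> a \<noteq> \<rho>' a" for \<rho> q \<rho>' q' a
  proof -
    have "- (- a + int K) = a - int K" "- (- a + int K + 1) = a - int K - 1" by simp_all
    then show ?thesis using c(2)[OF refl_seq_reverse[OF r] refl_seq_reverse[OF r'], of "- a"] a by simp
  qed
  then show ?thesis using c(1) by blast
qed

text \<open>Uniform continuity of the inverse parametrization: parameters that are at least
  \<open>e\<close> apart modulo the perimeter have points at a definite distance, by compactness and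
  injectivity.\<close>

lemma param_close:
  assumes \<delta>: "0 < \<delta>"
  shows "\<exists>\<eta>>0. \<forall>i s0 s. norm (bd i s - bd i s0) < \<eta> \<longrightarrow> (\<exists>s'. \<bar>s' - s0\<bar> < \<delta> \<and> bd i s' = bd i s)"
proof -
  have "\<exists>\<eta>>0. \<forall>i\<in>UNIV. \<forall>s0 s. norm (bd i s - bd i s0) < \<eta> \<longrightarrow> (\<exists>s'. \<bar>s' - s0\<bar> < \<delta> \<and> bd i s' = bd i s)"
  proof (rule finite_uniform_pos)
    fix i :: 3
    define l where "l = perim T i"
    have l: "0 < l" using perim_pos by (simp add: l_def)
    define e where "e = min (\<delta> / 2) (l / 2)"
    have e: "0 < e" "e < \<delta>" "e \<le> l - e" using \<delta> l by (auto simp: e_def min_def)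
    define B where "B = {0..l} \<times> {e..l - e}"
    have B: "compact B" "B \<noteq> {}" using e l by (auto simp: B_def compact_Times)
    define F where "F w = norm (bd i (fst w + snd w) - bd i (fst w))" for w :: "real \<times> real"
    have "continuous_on B F" unfolding F_def
      by (intro continuous_intros continuous_on_compose2[OF bd_cont[of UNIV]]) auto
    then obtain w0 where w0: "w0 \<in> B" "\<And>w. w \<in> B \<Longrightarrow> F w0 \<le> F w"
      using continuous_attains_inf[OF B] by blast
    have F0: "0 < F w0"
    proof (rule ccontr)
      assume "\<not> 0 < F w0"
      then have "bd i (fst w0 + snd w0) = bd i (fst w0)" by (simp add: F_def)
      moreover have "fst w0 + snd w0 \<in> {fst w0..<fst w0 + perim T i}" "fst w0 \<in> {fst w0..<fst w0 + perim T i}"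
        using w0(1) e l by (auto simp: B_def l_def)
      ultimately have "fst w0 + snd w0 = fst w0" using bd_inj_window by blast
      then show False using w0(1) e by (auto simp: B_def)
    qed
    show "\<exists>\<eta>>0. \<forall>s0 s. norm (bd i s - bd i s0) < \<eta> \<longrightarrow> (\<exists>s'. \<bar>s' - s0\<bar> < \<delta> \<and> bd i s' = bd i s)"
    proof (rule exI[of _ "F w0"], intro conjI F0 allI impI)
      fix s0 s assume n: "norm (bd i s - bd i s0) < F w0"
      obtain a k where a: "a \<in> {0..<0 + l}" "bd i a = bd i s0" "a = s0 + of_int k * l"
        unfolding l_def by (rule bd_window)
      obtain s' k' where s': "s' \<in> {s0 - e..<s0 - e + l}" "bd i s' = bd i s" "s' = s + of_int k' * l"
        unfolding l_def by (rule bd_window)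
      define h where "h = s' - s0"
      have "a + h = s' + of_int k * perim T i" using a(3) by (simp add: h_def l_def)
      then have "bd i (a + h) = bd i s" using bd_period_int s'(2) by metis
      then have "F (a, h) < F w0" using n a(2) by (simp add: F_def)
      then have "(a, h) \<notin> B" using w0(2) by force
      then have "\<bar>s' - s0\<bar> < \<delta>" using a(1) s'(1) e by (auto simp: B_def h_def)
      then show "\<exists>s'. \<bar>s' - s0\<bar> < \<delta> \<and> bd i s' = bd i s" using s'(2) by blast
    qed
  qed (simp, meson less_le_trans)
  then show ?thesis by blast
qed

lemma bd_lipschitz: "norm (bd i s - bd i t) \<le> \<bar>s - t\<bar>"
proof -
  have "norm (bd i s - bd i t) \<le> 1 * norm (s - t)"
  proof (rule differentiable_bound[of UNIV "bd i" "\<lambda>x h. h *\<^sub>R vel i x"])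
    show "(bd i has_derivative (\<lambda>h. h *\<^sub>R vel i x)) (at x within UNIV)" for x
      using bd_deriv[of i x] by (simp add: has_vector_derivative_def)
    show "onorm (\<lambda>h. h *\<^sub>R vel i x) \<le> 1" for x
      by (rule onorm_le) (simp add: norm_vel)
  qed auto
  then show ?thesis by simp
qed

end

section \<open>Orbits shadowing a periodic orbit\<close>

context table
begin

lemma mod_period:
  assumes adm: "admissible \<sigma>"
  shows "per \<sigma> (j mod int (length \<sigma>)) = per \<sigma> j" "per \<sigma> (j mod int (length \<sigma>) + 1) = per \<sigma> (j + 1)"
    "zpar \<sigma> (j mod int (length \<sigma>)) = zpar \<sigma> j"
proof -
  have P: "f (j + i * int (length \<sigma>)) = f j" if "\<And>j. f (j + int (length \<sigma>)) = f j" for f :: "int \<Rightarrow> 'b" and i j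
  proof (induction i rule: int_induct[where k=0])
    case (step1 i)
    have "j + (i + 1) * int (length \<sigma>) = j + i * int (length \<sigma>) + int (length \<sigma>)" by (simp add: algebra_simps)
    then show ?case using step1 that by metis
  next
    case (step2 i)
    have "j + i * int (length \<sigma>) = j + (i - 1) * int (length \<sigma>) + int (length \<sigma>)" by (simp add: algebra_simps)
    then show ?case using step2 that by metis
  qed simp
  have m: "j mod int (length \<sigma>) = j + (- (j div int (length \<sigma>))) * int (length \<sigma>)"
    by (simp add: minus_div_mult_eq_mod[symmetric])
  have m1: "j mod int (length \<sigma>) + 1 = j + 1 + (- (j div int (length \<sigma>))) * int (length \<sigma>)"
    using m by simp
  show "per \<sigma> (j mod int (length \<sigma>)) = per \<sigma> j" unfolding m by (rule P[of "per \<sigma>", OF per_period])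
  show "per \<sigma> (j mod int (length \<sigma>) + 1) = per \<sigma> (j + 1)" unfolding m1 by (rule P[of "per \<sigma>", OF per_period])
  show "zpar \<sigma> (j mod int (length \<sigma>)) = zpar \<sigma> j" unfolding m by (rule P[of "zpar \<sigma>", OF zpar_period[OF adm]])
qed

text \<open>The orbit of \<open>\<sigma>\<close> has finitely many positions, so local constants can
  be chosen uniformly along it.\<close>

lemma star_uniform:
  assumes adm: "admissible \<sigma>"
    and ex: "\<And>j. \<exists>d>0. P (per \<sigma> j) (per \<sigma> (j + 1)) (zpar \<sigma> j) d"
    and mono: "\<And>i j z d d'. P i j z d \<Longrightarrow> 0 < d' \<Longrightarrow> d' \<le> d \<Longrightarrow> P i j z d'"
  shows "\<exists>d>0. \<forall>j. P (per \<sigma> j) (per \<sigma> (j + 1)) (zpar \<sigma> j) (d :: real)"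
proof -
  define N where "N = int (length \<sigma>)"
  have N: "0 < N" using adm by (auto simp: admissible_def N_def)
  have "\<exists>d>0. \<forall>j\<in>{0..<N}. P (per \<sigma> j) (per \<sigma> (j + 1)) (zpar \<sigma> j) d"
    by (rule finite_uniform_pos) (use ex mono in auto)
  then obtain d where d: "d > 0" "\<And>j. j \<in> {0..<N} \<Longrightarrow> P (per \<sigma> j) (per \<sigma> (j + 1)) (zpar \<sigma> j) d" by blast
  have "P (per \<sigma> j) (per \<sigma> (j + 1)) (zpar \<sigma> j) d" for j
    using d(2)[of "j mod N"] N unfolding N_def mod_period[OF adm] by simp
  then show ?thesis using d(1) by blast
qed

text \<open>A single constant serves as radius, as lower bound and as inverse of the upper bounds,
  which keeps later estimates in powers of \<open>d\<close>.\<close>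

lemma star_bounds:
  assumes adm: "admissible \<sigma>"
  shows "\<exists>d>0. \<forall>j. \<forall>\<theta>\<in>box_at d (zpar \<sigma> j). d \<le> H12 (per \<sigma> j) (per \<sigma> (j + 1)) \<theta> \<and>
    H12 (per \<sigma> j) (per \<sigma> (j + 1)) \<theta> \<le> 1 / d \<and> H11 (per \<sigma> j) (per \<sigma> (j + 1)) \<theta> \<le> 1 / d \<and> H22 (per \<sigma> j) (per \<sigma> (j + 1)) \<theta> \<le> 1 / d"
proof (rule star_uniform[OF adm, where P = "\<lambda>i j z d. \<forall>\<theta>\<in>box_at d z. d \<le> H12 i j \<theta> \<and> H12 i j \<theta> \<le> 1 / d \<and> H11 i j \<theta> \<le> 1 / d \<and> H22 i j \<theta> \<le> 1 / d"])
  fix k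
  define i j z where "i = per \<sigma> k" "j = per \<sigma> (k + 1)" "z = zpar \<sigma> k"
  note defs = i_j_z_def
  have v: "visible i j z" unfolding defs by (rule zpar_visible[OF adm])
  obtain \<delta> where \<delta>: "\<delta> > 0" "\<And>\<theta>. \<theta> \<in> box_at \<delta> z \<Longrightarrow> near 2 (H11 i j \<theta>) (H11 i j z) \<and> near 2 (H12 i j \<theta>) (H12 i j z) \<and>
    near 2 (H22 i j \<theta>) (H22 i j z)" using local_bounds[OF v] by blast
  note p = visible_pos[OF v]
  define G where "G = 1 + 2 * H11 i j z + 2 * H12 i j z + 2 * H22 i j z"
  have G: "0 < G" "2 * H11 i j z \<le> G" "2 * H12 i j z \<le> G" "2 * H22 i j z \<le> G" using p by (auto simp: G_def)
  define d where "d = min \<delta> (min (H12 i j z / 2) (1 / G))"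
  have d: "d > 0" "d \<le> \<delta>" "d \<le> H12 i j z / 2" "d \<le> 1 / G" using \<delta>(1) p G by (auto simp: d_def)
  have "G \<le> 1 / d" using d(1,4) G(1) by (simp add: field_simps)
  then have "\<forall>\<theta>\<in>box_at d z. d \<le> H12 i j \<theta> \<and> H12 i j \<theta> \<le> 1 / d \<and> H11 i j \<theta> \<le> 1 / d \<and> H22 i j \<theta> \<le> 1 / d"
  proof (intro ballI)
    fix \<theta> assume "\<theta> \<in> box_at d z"
    then have "\<theta> \<in> box_at \<delta> z" using d(2) by (auto simp: mem_box_at)
    from \<delta>(2)[OF this] show "d \<le> H12 i j \<theta> \<and> H12 i j \<theta> \<le> 1 / d \<and> H11 i j \<theta> \<le> 1 / d \<and> H22 i j \<theta> \<le> 1 / d"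
      using d(3) G \<open>G \<le> 1 / d\<close> unfolding near_def by auto
  qed
  then show "\<exists>d>0. \<forall>\<theta>\<in>box_at d (zpar \<sigma> k). d \<le> H12 (per \<sigma> k) (per \<sigma> (k + 1)) \<theta> \<and>
      H12 (per \<sigma> k) (per \<sigma> (k + 1)) \<theta> \<le> 1 / d \<and> H11 (per \<sigma> k) (per \<sigma> (k + 1)) \<theta> \<le> 1 / d \<and> H22 (per \<sigma> k) (per \<sigma> (k + 1)) \<theta> \<le> 1 / d"
    using d(1) unfolding defs by blast
next
  fix i j z and d d' :: real
  assume A: "\<forall>\<theta>\<in>box_at d z. d \<le> H12 i j \<theta> \<and> H12 i j \<theta> \<le> 1 / d \<and> H11 i j \<theta> \<le> 1 / d \<and> H22 i j \<theta> \<le> 1 / d" and d: "0 < d'" "d' \<le> d"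
  have "1 / d \<le> 1 / d'" using d by (simp add: frac_le)
  moreover have "box_at d' z \<subseteq> box_at d z" using d by (auto simp: mem_box_at)
  ultimately show "\<forall>\<theta>\<in>box_at d' z. d' \<le> H12 i j \<theta> \<and> H12 i j \<theta> \<le> 1 / d' \<and> H11 i j \<theta> \<le> 1 / d' \<and> H22 i j \<theta> \<le> 1 / d'"
    using A d by (meson order_trans subsetD)
qed

text \<open>The mixed second difference of the chord length over a rectangle of endpoints. It is
  what swapping the far ends of two nearby chords changes in total length.\<close>

lemma rectangle_exchange:
  assumes ij: "i \<noteq> j" and box: "(r, t) \<in> box_at d z" "(r', t') \<in> box_at d z"
  obtains \<theta> where "\<theta> \<in> box_at d z"
    "chord i j (r', t') + chord i j (r, t) - chord i j (r', t) - chord i j (r, t') = H12 i j \<theta> * ((r' - r) * (t' - t))"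
proof -
  \<comment> \<open>A dummy second coordinate makes the one-variable difference fit
    \<open>segment_mvt\<close>.\<close>
  define F where "F z = chord i j (fst z, t') - chord i j (fst z, t)" for z :: "real \<times> real"
  have c: "((\<lambda>z. chord i j (fst z, u)) has_derivative (\<lambda>h. - sin1 i j (fst z, u) * fst h)) (at z)" for z :: "real \<times> real" and u
  proof -
    have "((\<lambda>z. (fst z, u)) has_derivative (\<lambda>h. (fst h, 0))) (at z)"
      by (auto intro!: derivative_eq_intros)
    from has_derivative_compose[OF this has_derivative_chord[OF ij]] show ?thesis by simp
  qed
  have "(F has_derivative (\<lambda>h. (- sin1 i j (fst z, t') + sin1 i j (fst z, t)) * fst h + 0 * snd h)) (at z)" for z
    unfolding F_def[abs_def] using has_derivative_diff[OF c c]
    by (rule has_derivative_eq_rhs) (auto simp: algebra_simps)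
  note dF = this
  obtain \<theta> :: "real \<times> real" where \<theta>: "\<theta> \<in> closed_segment (r, 0) (r', 0)"
    "F (r', 0) - F (r, 0) = (- sin1 i j (fst \<theta>, t') + sin1 i j (fst \<theta>, t)) * (fst (r', 0::real) - fst (r, 0::real)) +
      0 * (snd (r', 0) - snd (r, 0))" by (rule segment_mvt[OF dF, where z = "(r, 0)" and z' = "(r', 0)"])
  obtain \<omega> where \<omega>: "\<omega> \<in> closed_segment (fst \<theta>, t) (fst \<theta>, t')"
    "sin1 i j (fst \<theta>, t') - sin1 i j (fst \<theta>, t) = - H11 i j \<omega> * (fst \<theta> - fst \<theta>) + - H12 i j \<omega> * (t' - t)"
    using segment_mvt[OF has_derivative_sin1[OF ij], of "(fst \<theta>, t)" "(fst \<theta>, t')"] by (metis fst_conv snd_conv)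
  have "fst \<theta> \<in> closed_segment r r'"
    using \<theta>(1) by (auto simp: closed_segment_def)
  moreover have "closed_segment r r' \<subseteq> {fst z - d<..<fst z + d}"
    using box by (intro closed_segment_subset) (auto simp: mem_box_at abs_less_iff)
  ultimately have "fst \<theta> \<in> {fst z - d<..<fst z + d}" by blast
  then have "\<bar>fst \<theta> - fst z\<bar> < d" by (auto simp: abs_less_iff)
  then have "(fst \<theta>, t) \<in> box_at d z" "(fst \<theta>, t') \<in> box_at d z" using box by (auto simp: mem_box_at)
  then have "\<omega> \<in> box_at d z" using box_at_segment \<omega>(1) by blast
  moreover have "chord i j (r', t') + chord i j (r, t) - chord i j (r', t) - chord i j (r, t') = H12 i j \<omega> * ((r' - r) * (t' - t))"
  proof -
    have "F (r', 0) - F (r, 0) = - (sin1 i j (fst \<theta>, t') - sin1 i j (fst \<theta>, t)) * (r' - r)" using \<theta>(2) by simp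
    also have "\<dots> = H12 i j \<omega> * ((r' - r) * (t' - t))" unfolding \<omega>(2) by simp
    finally show ?thesis by (simp add: F_def)
  qed
  ultimately show ?thesis by (rule that)
qed

text \<open>The step \<open>d\<^sup>2 / 4 * x\<close> gains at least \<open>d ^ 3 / 4 * x\<^sup>2\<close> to first order, and the bound \<open>1 / d\<close> on the
  second derivatives limits the second order loss to a quarter of that.\<close>

lemma vertex_gain:
  assumes ij: "i \<noteq> j" and jk: "j \<noteq> k" and d: "0 < d" "d \<le> 1"
    and B1: "\<And>\<theta>. \<theta> \<in> box_at d z1 \<Longrightarrow> H22 i j \<theta> \<le> 1 / d"
    and B2: "\<And>\<theta>. \<theta> \<in> box_at d z2 \<Longrightarrow> H11 j k \<theta> \<le> 1 / d"
    and z: "snd z1 = fst z2"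
    and u: "\<bar>u - fst z1\<bar> < d" and s: "\<bar>s - fst z2\<bar> < d / 3" and t: "\<bar>t - snd z2\<bar> < d" and x: "\<bar>x\<bar> < 2 * d / 3"
    and slope: "sin2 i j (u, s) - sin1 j k (s, t) = \<beta> * x" "d \<le> \<beta>"
  shows "chord i j (u, s - d\<^sup>2 / 4 * x) + chord j k (s - d\<^sup>2 / 4 * x, t) \<le>
    chord i j (u, s) + chord j k (s, t) - d ^ 3 / 8 * x\<^sup>2"
proof -
  define T where "T = d\<^sup>2 / 4"
  have "d\<^sup>2 \<le> 1" using d by (simp add: power_le_one)
  then have T: "0 < T" "T \<le> 1" using d by (simp_all add: T_def)
  have Td: "T * (2 / d) = d / 2" using d by (simp add: T_def power2_eq_square)
  define f where "f \<tau> = chord i j (u, s - \<tau> * x) + chord j k (s - \<tau> * x, t)" for \<tau>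
  \<comment> \<open>The derivative of \<open>f\<close>: minus \<open>x\<close> times the defect of
    the reflection law at the moved vertex.\<close>
  define D where "D \<tau> = - x * (sin2 i j (u, s - \<tau> * x) - sin1 j k (s - \<tau> * x, t))" for \<tau>
  have df: "(f has_real_derivative D \<tau>) (at \<tau>)" for \<tau>
  proof -
    have p1: "((\<lambda>\<tau>. (u, s - \<tau> * x)) has_derivative (\<lambda>h. (0, - h * x))) (at \<tau>)"
      and p2: "((\<lambda>\<tau>. (s - \<tau> * x, t)) has_derivative (\<lambda>h. (- h * x, 0))) (at \<tau>)"
      by (auto intro!: derivative_eq_intros)
    show ?thesis
      unfolding f_def[abs_def] has_field_derivative_def
      using has_derivative_add[OF has_derivative_compose[OF p1 has_derivative_chord[OF ij]] has_derivative_compose[OF p2 has_derivative_chord[OF jk]]]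
      by (rule has_derivative_eq_rhs) (auto simp: fun_eq_iff D_def algebra_simps)
  qed
  have D: "D \<tau> \<le> - (d / 2) * x\<^sup>2" if \<tau>: "0 \<le> \<tau>" "\<tau> \<le> T" for \<tau>
  proof -
    define s' where "s' = s - \<tau> * x"
    have "\<bar>\<tau> * x\<bar> \<le> \<bar>x\<bar>" using \<tau> T by (simp add: abs_mult mult_left_le_one_le)
    then have s': "\<bar>s' - fst z2\<bar> < d" using s x unfolding s'_def by linarith
    have b: "(u, s) \<in> box_at d z1" "(u, s') \<in> box_at d z1" "(s, t) \<in> box_at d z2" "(s', t) \<in> box_at d z2"
      using u s t s' z d by (auto simp: mem_box_at)
    obtain \<theta> where \<theta>: "\<theta> \<in> closed_segment (u, s) (u, s')"
      "sin2 i j (u, s') - sin2 i j (u, s) = H12 i j \<theta> * (u - u) + H22 i j \<theta> * (s' - s)"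
      using segment_mvt[OF has_derivative_sin2[OF ij], of "(u, s)" "(u, s')"] by (metis fst_conv snd_conv)
    obtain \<omega> where \<omega>: "\<omega> \<in> closed_segment (s, t) (s', t)"
      "sin1 j k (s', t) - sin1 j k (s, t) = - H11 j k \<omega> * (s' - s) + - H12 j k \<omega> * (t - t)"
      using segment_mvt[OF has_derivative_sin1[OF jk], of "(s, t)" "(s', t)"] by (metis fst_conv snd_conv)
    have h: "H22 i j \<theta> \<le> 1 / d" "H11 j k \<omega> \<le> 1 / d"
      using B1 B2 box_at_segment b \<theta>(1) \<omega>(1) by blast+
    have "sin2 i j (u, s') - sin1 j k (s', t) = \<beta> * x + (H22 i j \<theta> + H11 j k \<omega>) * (s' - s)"
      using \<theta>(2) \<omega>(2) slope(1) by (simp add: algebra_simps)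
    then have "D \<tau> = - x * (\<beta> * x + (H22 i j \<theta> + H11 j k \<omega>) * (s' - s))"
      unfolding D_def s'_def[symmetric] by simp
    also have "s' - s = - (\<tau> * x)" by (simp add: s'_def)
    also have "- x * (\<beta> * x + (H22 i j \<theta> + H11 j k \<omega>) * - (\<tau> * x)) = - x\<^sup>2 * (\<beta> - \<tau> * (H22 i j \<theta> + H11 j k \<omega>))"
      by (simp add: power2_eq_square algebra_simps)
    finally have "D \<tau> = - x\<^sup>2 * (\<beta> - \<tau> * (H22 i j \<theta> + H11 j k \<omega>))" .
    moreover have "\<tau> * (H22 i j \<theta> + H11 j k \<omega>) \<le> d / 2"
    proof -
      have "\<tau> * (H22 i j \<theta> + H11 j k \<omega>) \<le> \<tau> * (2 / d)" using h \<tau> by (intro mult_left_mono) auto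
      also have "\<dots> \<le> T * (2 / d)" using \<tau> d by (intro mult_right_mono) auto
      finally show ?thesis using Td by simp
    qed
    then have "x\<^sup>2 * (d / 2) \<le> x\<^sup>2 * (\<beta> - \<tau> * (H22 i j \<theta> + H11 j k \<omega>))"
      using slope(2) by (intro mult_left_mono) auto
    ultimately show ?thesis by (simp add: mult.commute)
  qed
  obtain \<tau> where \<tau>: "0 < \<tau>" "\<tau> < T" "f T - f 0 = (T - 0) * D \<tau>"
    using MVT2[of 0 T f D] df T by blast
  have "f T - f 0 \<le> T * (- (d / 2) * x\<^sup>2)"
    using \<tau> mult_left_mono[OF D[of \<tau>], of T] T by simp
  also have "\<dots> = - (d ^ 3 / 8 * x\<^sup>2)" by (simp add: T_def power3_eq_cube power2_eq_square)
  finally show ?thesis by (simp add: f_def T_def)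
qed

text \<open>\<open>r\<close> lifts the points to real parameters near those of the periodic orbit,
  so that differences of two shadowing orbits are numbers with a sign. Labels outside
  \<open>m..n\<close> are left free.\<close>

definition shad :: "3 list \<Rightarrow> real \<Rightarrow> nat \<Rightarrow> nat \<Rightarrow> (int \<Rightarrow> complex) \<Rightarrow> (nat \<Rightarrow> real) \<Rightarrow> bool" where
  "shad \<sigma> \<delta> m n x r \<longleftrightarrow> (\<exists>\<rho>. refl_seq T \<rho> x \<and> (\<forall>k\<in>{m..n}. \<rho> (int k) = per \<sigma> (int k))) \<and>
     (\<forall>k\<in>{m..n}. bd (per \<sigma> (int k)) (r k) = x (int k) \<and> \<bar>r k - spar \<sigma> (int k)\<bar> < \<delta>)"

text \<open>The momentum conjugate to arc length, that is, the sine of the outgoing angle.\<close>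

definition mom :: "3 list \<Rightarrow> (int \<Rightarrow> complex) \<Rightarrow> (nat \<Rightarrow> real) \<Rightarrow> nat \<Rightarrow> real" where
  "mom \<sigma> x r k = dir x (int k) \<bullet> vel (per \<sigma> (int k)) (r k)"

lemma shad_mono: "shad \<sigma> \<delta> m n x r \<Longrightarrow> m \<le> m' \<Longrightarrow> n' \<le> n \<Longrightarrow> \<delta> \<le> \<delta>' \<Longrightarrow> shad \<sigma> \<delta>' m' n' x r"
  unfolding shad_def by (meson atLeastAtMost_iff le_trans less_le_trans)

lemma shadD:
  assumes "shad \<sigma> \<delta> m n x r" "m \<le> k" "Suc k \<le> n"
  shows "(r k, r (Suc k)) \<in> box_at \<delta> (zpar \<sigma> (int k))"
    and "sin1 (per \<sigma> (int k)) (per \<sigma> (int k + 1)) (r k, r (Suc k)) = mom \<sigma> x r k"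
    and "sin2 (per \<sigma> (int k)) (per \<sigma> (int k + 1)) (r k, r (Suc k)) = mom \<sigma> x r (Suc k)"
    and "chord (per \<sigma> (int k)) (per \<sigma> (int k + 1)) (r k, r (Suc k)) = norm (x (int k + 1) - x (int k))"
    and "per \<sigma> (int k) \<noteq> per \<sigma> (int k + 1)"
proof -
  obtain \<rho> where \<rho>: "refl_seq T \<rho> x" "\<forall>k\<in>{m..n}. \<rho> (int k) = per \<sigma> (int k)"
    and b: "\<And>k. k \<in> {m..n} \<Longrightarrow> bd (per \<sigma> (int k)) (r k) = x (int k) \<and> \<bar>r k - spar \<sigma> (int k)\<bar> < \<delta>"
    using assms(1) unfolding shad_def by blast
  have l: "\<rho> (int k) = per \<sigma> (int k)" "\<rho> (int k + 1) = per \<sigma> (int k + 1)"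
    using \<rho>(2)[rule_format, of k] \<rho>(2)[rule_format, of "Suc k"] assms(2,3) by (simp_all add: add.commute)
  have b0: "bd (\<rho> (int k)) (r k) = x (int k)" "\<bar>r k - spar \<sigma> (int k)\<bar> < \<delta>"
    and b1: "bd (\<rho> (int k + 1)) (r (Suc k)) = x (int k + 1)" "\<bar>r (Suc k) - spar \<sigma> (int k + 1)\<bar> < \<delta>"
    using b[of k] b[of "Suc k"] assms(2,3) l by (simp_all add: add.commute)
  show "(r k, r (Suc k)) \<in> box_at \<delta> (zpar \<sigma> (int k))" using b0 b1 by (simp add: mem_box_at zpar_def)
  note c = chord_refl[OF \<rho>(1) b0(1) b1(1), unfolded l]
  show "sin1 (per \<sigma> (int k)) (per \<sigma> (int k + 1)) (r k, r (Suc k)) = mom \<sigma> x r k"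
    and "sin2 (per \<sigma> (int k)) (per \<sigma> (int k + 1)) (r k, r (Suc k)) = mom \<sigma> x r (Suc k)"
    and "chord (per \<sigma> (int k)) (per \<sigma> (int k + 1)) (r k, r (Suc k)) = norm (x (int k + 1) - x (int k))"
    using c(3,4,5) by (simp_all add: mom_def add.commute)
  show "per \<sigma> (int k) \<noteq> per \<sigma> (int k + 1)" using refl_label[OF \<rho>(1), of "int k"] l by simp
qed

lemma mom_bound: "shad \<sigma> \<delta> m n x r \<Longrightarrow> \<bar>mom \<sigma> x r k\<bar> \<le> 1"
proof -
  assume "shad \<sigma> \<delta> m n x r"
  then obtain \<rho> where "refl_seq T \<rho> x" unfolding shad_def by blast
  then show ?thesis
    using Cauchy_Schwarz_ineq2[of "dir x (int k)" "vel (per \<sigma> (int k)) (r k)"] refl_norm_dir norm_vel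
    by (simp add: mom_def)
qed

lemma shad_bd: "shad \<sigma> \<delta> m n x r \<Longrightarrow> m \<le> k \<Longrightarrow> k \<le> n \<Longrightarrow> bd (per \<sigma> (int k)) (r k) = x (int k)"
  and shad_near: "shad \<sigma> \<delta> m n x r \<Longrightarrow> m \<le> k \<Longrightarrow> k \<le> n \<Longrightarrow> \<bar>r k - spar \<sigma> (int k)\<bar> < \<delta>"
  unfolding shad_def by auto

text \<open>Swapping the continuations of two nearby orbits costs \<open>- H12\<close> times the
  product of the differences. If the product is nonnegative the swap does not lengthen, and the
  swapped polygons violate the reflection law by \<open>H12\<close> times the difference at the
  neighbouring index; correcting the two vertices gains a quadratic amount.\<close>

lemma exchange:
  assumes adm: "admissible \<sigma>"
  shows "\<exists>\<delta>>0. \<exists>c>0. \<exists>C>0. \<forall>k x r x' r'. shad \<sigma> \<delta> k (k + 3) x r \<longrightarrow> shad \<sigma> \<delta> k (k + 3) x' r' \<longrightarrow>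
    (let \<xi> = \<lambda>k. r' k - r k; j = int k in
    norm (x' (j + 2) - x (j + 1)) + norm (x (j + 2) - x' (j + 1)) \<le>
      norm (x (j + 2) - x (j + 1)) + norm (x' (j + 2) - x' (j + 1)) + C * (\<bar>\<xi> (k + 1)\<bar> * \<bar>\<xi> (k + 2)\<bar>) \<and>
    (0 \<le> \<xi> (k + 1) * \<xi> (k + 2) \<longrightarrow> (\<exists>a\<in>cl (per \<sigma> (j + 1)). \<exists>b\<in>cl (per \<sigma> (j + 2)).
      norm (a - x j) + norm (x' (j + 2) - a) + norm (b - x' (j + 1)) + norm (x (j + 3) - b) \<le>
      norm (x (j + 1) - x j) + norm (x (j + 2) - x (j + 1)) + norm (x' (j + 2) - x' (j + 1)) + norm (x (j + 3) - x (j + 2))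
       - c * ((\<xi> (k + 1))\<^sup>2 + (\<xi> (k + 2))\<^sup>2))))"
proof -
  obtain d0 where d0: "d0 > 0" "\<And>j \<theta>. \<theta> \<in> box_at d0 (zpar \<sigma> j) \<Longrightarrow> d0 \<le> H12 (per \<sigma> j) (per \<sigma> (j + 1)) \<theta> \<and>
    H12 (per \<sigma> j) (per \<sigma> (j + 1)) \<theta> \<le> 1 / d0 \<and> H11 (per \<sigma> j) (per \<sigma> (j + 1)) \<theta> \<le> 1 / d0 \<and> H22 (per \<sigma> j) (per \<sigma> (j + 1)) \<theta> \<le> 1 / d0"
    using star_bounds[OF adm] by blast
  define d where "d = min d0 1"
  have d: "0 < d" "d \<le> 1" "d \<le> d0" using d0(1) by (auto simp: d_def)
  have B: "d \<le> H12 (per \<sigma> j) (per \<sigma> (j + 1)) \<theta> \<and>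
    H12 (per \<sigma> j) (per \<sigma> (j + 1)) \<theta> \<le> 1 / d \<and> H11 (per \<sigma> j) (per \<sigma> (j + 1)) \<theta> \<le> 1 / d \<and> H22 (per \<sigma> j) (per \<sigma> (j + 1)) \<theta> \<le> 1 / d"
    if "\<theta> \<in> box_at d (zpar \<sigma> j)" for \<theta> j
  proof -
    have "\<theta> \<in> box_at d0 (zpar \<sigma> j)" using that d by (auto simp: mem_box_at)
    moreover have "1 / d0 \<le> 1 / d" using d by (simp add: frac_le)
    ultimately show ?thesis using d0(2)[of \<theta> j] d(3) by auto
  qed
  show ?thesis
  \<comment> \<open>Within \<open>d / 3\<close> of the periodic orbit, differences stay below
    \<open>2 * d / 3\<close> and moved vertices stay in the box of radius \<open>d\<close>. The
    constant \<open>d ^ 3 / 8\<close> is that of \<open>vertex_gain\<close>, and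
    \<open>1 / d\<close> bounds \<open>H12\<close>.\<close>
  proof (rule exI[of _ "d / 3"], intro conjI, use d in simp, rule exI[of _ "d ^ 3 / 8"], intro conjI, use d in simp,
      rule exI[of _ "1 / d"], intro conjI, use d in simp, intro allI impI)
    fix k x r x' r'
    assume X: "shad \<sigma> (d / 3) k (k + 3) x r" and X': "shad \<sigma> (d / 3) k (k + 3) x' r'"
    define j where "j = int k"
    define i0 i1 i2 i3 where ii: "i0 = per \<sigma> j" "i1 = per \<sigma> (j + 1)" "i2 = per \<sigma> (j + 2)" "i3 = per \<sigma> (j + 3)"
    define z0 z1 z2 where zz: "z0 = zpar \<sigma> j" "z1 = zpar \<sigma> (j + 1)" "z2 = zpar \<sigma> (j + 2)"
    have J: "int (k + 1) = j + 1" "int (k + 2) = j + 2" "j + 1 + 1 = j + 2" "j + 2 + 1 = j + 3" "int k = j" "int (k + 3) = j + 3"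
      by (simp_all add: j_def)
    have S: "Suc (k + 1) = k + 2" "Suc (k + 2) = k + 3" "Suc k = k + 1" by simp_all
    note D0 = shadD[OF X, of k, unfolded J ii[symmetric] zz[symmetric] S]
    note D1 = shadD[OF X, of "k + 1", unfolded J ii[symmetric] zz[symmetric] S]
    note D2 = shadD[OF X, of "k + 2", unfolded J ii[symmetric] zz[symmetric] S]
    note D1' = shadD[OF X', of "k + 1", unfolded J ii[symmetric] zz[symmetric] S]
    have B0: "\<And>\<theta>. \<theta> \<in> box_at d z0 \<Longrightarrow> d \<le> H12 i0 i1 \<theta> \<and> H12 i0 i1 \<theta> \<le> 1 / d \<and> H11 i0 i1 \<theta> \<le> 1 / d \<and> H22 i0 i1 \<theta> \<le> 1 / d"
      and B1: "\<And>\<theta>. \<theta> \<in> box_at d z1 \<Longrightarrow> d \<le> H12 i1 i2 \<theta> \<and> H12 i1 i2 \<theta> \<le> 1 / d \<and> H11 i1 i2 \<theta> \<le> 1 / d \<and> H22 i1 i2 \<theta> \<le> 1 / d"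
      and B2: "\<And>\<theta>. \<theta> \<in> box_at d z2 \<Longrightarrow> d \<le> H12 i2 i3 \<theta> \<and> H12 i2 i3 \<theta> \<le> 1 / d \<and> H11 i2 i3 \<theta> \<le> 1 / d \<and> H22 i2 i3 \<theta> \<le> 1 / d"
      using B[of _ j] B[of _ "j + 1"] B[of _ "j + 2"] unfolding J ii[symmetric] zz[symmetric] by blast+
    have zf: "fst z0 = spar \<sigma> j" "snd z0 = spar \<sigma> (j + 1)" "fst z1 = spar \<sigma> (j + 1)" "snd z1 = spar \<sigma> (j + 2)"
      "fst z2 = spar \<sigma> (j + 2)" "snd z2 = spar \<sigma> (j + 3)" by (simp_all add: zz zpar_def J)
    have n: "\<bar>r k - spar \<sigma> j\<bar> < d / 3" "\<bar>r (k + 1) - spar \<sigma> (j + 1)\<bar> < d / 3" "\<bar>r (k + 2) - spar \<sigma> (j + 2)\<bar> < d / 3" "\<bar>r (k + 3) - spar \<sigma> (j + 3)\<bar> < d / 3"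
      "\<bar>r' (k + 1) - spar \<sigma> (j + 1)\<bar> < d / 3" "\<bar>r' (k + 2) - spar \<sigma> (j + 2)\<bar> < d / 3"
      using shad_near[OF X, of k] shad_near[OF X, of "k + 1"] shad_near[OF X, of "k + 2"] shad_near[OF X, of "k + 3"]
        shad_near[OF X', of "k + 1"] shad_near[OF X', of "k + 2"] unfolding J by auto
    have pts: "bd i0 (r k) = x j" "bd i1 (r (k + 1)) = x (j + 1)" "bd i2 (r (k + 2)) = x (j + 2)" "bd i3 (r (k + 3)) = x (j + 3)"
      "bd i1 (r' (k + 1)) = x' (j + 1)" "bd i2 (r' (k + 2)) = x' (j + 2)"
      using shad_bd[OF X, of k] shad_bd[OF X, of "k + 1"] shad_bd[OF X, of "k + 2"] shad_bd[OF X, of "k + 3"]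
        shad_bd[OF X', of "k + 1"] shad_bd[OF X', of "k + 2"] unfolding J ii by auto
    have ch: "chord a b (u, v) = norm (bd b v - bd a u)" for a b u v by (simp add: chord_def disp_def)
    define \<xi>1 \<xi>2 where xi: "\<xi>1 = r' (k + 1) - r (k + 1)" "\<xi>2 = r' (k + 2) - r (k + 2)"
    have r': "r' (k + 1) = r (k + 1) + \<xi>1" "r' (k + 2) = r (k + 2) + \<xi>2" by (simp_all add: xi)
    have ne: "i0 \<noteq> i1" "i1 \<noteq> i2" "i2 \<noteq> i3" using D0(5) D1(5) D2(5) by simp_all
    have bx: "(r (k + 1), r (k + 2)) \<in> box_at d z1" "(r' (k + 1), r' (k + 2)) \<in> box_at d z1"
      using n d(1) by (auto simp: mem_box_at zf)
    obtain \<theta> where \<theta>: "\<theta> \<in> box_at d z1"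
      "chord i1 i2 (r' (k + 1), r' (k + 2)) + chord i1 i2 (r (k + 1), r (k + 2)) - chord i1 i2 (r' (k + 1), r (k + 2)) -
        chord i1 i2 (r (k + 1), r' (k + 2)) = H12 i1 i2 \<theta> * (\<xi>1 * \<xi>2)"
      using rectangle_exchange[OF ne(2) bx] unfolding xi by blast
    then have rect: "norm (x' (j + 2) - x (j + 1)) + norm (x (j + 2) - x' (j + 1)) =
      norm (x (j + 2) - x (j + 1)) + norm (x' (j + 2) - x' (j + 1)) - H12 i1 i2 \<theta> * (\<xi>1 * \<xi>2)"
      unfolding ch pts by linarith
    note H = B1[OF \<theta>(1)]
    have "\<bar>H12 i1 i2 \<theta> * (\<xi>1 * \<xi>2)\<bar> \<le> 1 / d * (\<bar>\<xi>1\<bar> * \<bar>\<xi>2\<bar>)"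
      unfolding abs_mult using H d(1) by (intro mult_right_mono) auto
    then have up: "norm (x' (j + 2) - x (j + 1)) + norm (x (j + 2) - x' (j + 1)) \<le>
      norm (x (j + 2) - x (j + 1)) + norm (x' (j + 2) - x' (j + 1)) + 1 / d * (\<bar>\<xi>1\<bar> * \<bar>\<xi>2\<bar>)"
      using rect by linarith
    have low: "\<exists>a\<in>cl i1. \<exists>b\<in>cl i2.
      norm (a - x j) + norm (x' (j + 2) - a) + norm (b - x' (j + 1)) + norm (x (j + 3) - b) \<le>
      norm (x (j + 1) - x j) + norm (x (j + 2) - x (j + 1)) + norm (x' (j + 2) - x' (j + 1)) + norm (x (j + 3) - x (j + 2))
       - d ^ 3 / 8 * (\<xi>1\<^sup>2 + \<xi>2\<^sup>2)" if pos: "0 \<le> \<xi>1 * \<xi>2"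
    proof (rule bexI, rule bexI)
      \<comment> \<open>At index \<open>k + 1\<close> the new neighbour is off by
        \<open>\<xi>2\<close>, at \<open>k + 2\<close> by \<open>\<xi>1\<close>, so each vertex
        moves in proportion to the difference at the other index.\<close>
      define s1 where "s1 = r (k + 1) - d\<^sup>2 / 4 * \<xi>2"
      define s2 where "s2 = r (k + 2) - d\<^sup>2 / 4 * \<xi>1"
      have b1: "(r (k + 1), r (k + 2) + \<xi>2) \<in> box_at d z1" "(r (k + 1) + \<xi>1, r (k + 2)) \<in> box_at d z1"
        using n d(1) unfolding r'[symmetric] by (auto simp: mem_box_at zf)
      have a1: "\<bar>r (k + 2) + \<xi>2 - spar \<sigma> (j + 2)\<bar> < d" "\<bar>r (k + 1) + \<xi>1 - spar \<sigma> (j + 1)\<bar> < d"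
        using b1 by (simp_all add: mem_box_at zf)
      have x: "\<bar>\<xi>1\<bar> < 2 * d / 3" "\<bar>\<xi>2\<bar> < 2 * d / 3" using n unfolding xi by linarith+
      obtain \<omega> where \<omega>: "\<omega> \<in> closed_segment (r (k + 1), r (k + 2)) (r (k + 1), r (k + 2) + \<xi>2)"
        "sin1 i1 i2 (r (k + 1), r (k + 2) + \<xi>2) - sin1 i1 i2 (r (k + 1), r (k + 2)) =
          - H11 i1 i2 \<omega> * (r (k + 1) - r (k + 1)) + - H12 i1 i2 \<omega> * (r (k + 2) + \<xi>2 - r (k + 2))"
        using segment_mvt[OF has_derivative_sin1[OF ne(2)], of "(r (k + 1), r (k + 2))" "(r (k + 1), r (k + 2) + \<xi>2)"]
        by (metis fst_conv snd_conv)
      obtain \<omega>' where \<omega>': "\<omega>' \<in> closed_segment (r (k + 1), r (k + 2)) (r (k + 1) + \<xi>1, r (k + 2))"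
        "sin2 i1 i2 (r (k + 1) + \<xi>1, r (k + 2)) - sin2 i1 i2 (r (k + 1), r (k + 2)) =
          H12 i1 i2 \<omega>' * (r (k + 1) + \<xi>1 - r (k + 1)) + H22 i1 i2 \<omega>' * (r (k + 2) - r (k + 2))"
        using segment_mvt[OF has_derivative_sin2[OF ne(2)], of "(r (k + 1), r (k + 2))" "(r (k + 1) + \<xi>1, r (k + 2))"]
        by (metis fst_conv snd_conv)
      have "\<omega> \<in> box_at d z1" "\<omega>' \<in> box_at d z1"
        using \<omega>(1) \<omega>'(1) box_at_segment[OF bx(1) b1(1)] box_at_segment[OF bx(1) b1(2)] by blast+
      then have \<beta>: "d \<le> H12 i1 i2 \<omega>" "d \<le> H12 i1 i2 \<omega>'" using B1 by blast+
      have g1: "chord i0 i1 (r k, s1) + chord i1 i2 (s1, r (k + 2) + \<xi>2) \<le>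
        chord i0 i1 (r k, r (k + 1)) + chord i1 i2 (r (k + 1), r (k + 2) + \<xi>2) - d ^ 3 / 8 * \<xi>2\<^sup>2"
        unfolding s1_def
      proof (rule vertex_gain[OF ne(1,2) d(1,2), of z0 z1])
        show "sin2 i0 i1 (r k, r (k + 1)) - sin1 i1 i2 (r (k + 1), r (k + 2) + \<xi>2) = H12 i1 i2 \<omega> * \<xi>2"
          using \<omega>(2) D0(3) D1(2) by simp
        show "\<And>\<theta>. \<theta> \<in> box_at d z0 \<Longrightarrow> H22 i0 i1 \<theta> \<le> 1 / d" "\<And>\<theta>. \<theta> \<in> box_at d z1 \<Longrightarrow> H11 i1 i2 \<theta> \<le> 1 / d"
          using B0 B1 by blast+
        show "snd z0 = fst z1" "\<bar>r k - fst z0\<bar> < d" "\<bar>r (k + 1) - fst z1\<bar> < d / 3" "\<bar>r (k + 2) + \<xi>2 - snd z1\<bar> < d"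
          unfolding zf using n(1,2) a1(1) d(1) by linarith+
      qed (rule x \<beta>)+
      have g2: "chord i1 i2 (r (k + 1) + \<xi>1, s2) + chord i2 i3 (s2, r (k + 3)) \<le>
        chord i1 i2 (r (k + 1) + \<xi>1, r (k + 2)) + chord i2 i3 (r (k + 2), r (k + 3)) - d ^ 3 / 8 * \<xi>1\<^sup>2"
        unfolding s2_def
      proof (rule vertex_gain[OF ne(2,3) d(1,2), of z1 z2])
        show "sin2 i1 i2 (r (k + 1) + \<xi>1, r (k + 2)) - sin1 i2 i3 (r (k + 2), r (k + 3)) = H12 i1 i2 \<omega>' * \<xi>1"
          using \<omega>'(2) D1(3) D2(2) by simp
        show "\<And>\<theta>. \<theta> \<in> box_at d z1 \<Longrightarrow> H22 i1 i2 \<theta> \<le> 1 / d" "\<And>\<theta>. \<theta> \<in> box_at d z2 \<Longrightarrow> H11 i2 i3 \<theta> \<le> 1 / d"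
          using B1 B2 by blast+
        show "snd z1 = fst z2" "\<bar>r (k + 1) + \<xi>1 - fst z1\<bar> < d" "\<bar>r (k + 2) - fst z2\<bar> < d / 3" "\<bar>r (k + 3) - snd z2\<bar> < d"
          unfolding zf using n(3,4) a1(2) d(1) by linarith+
      qed (rule x \<beta>)+
      have "0 \<le> H12 i1 i2 \<theta> * (\<xi>1 * \<xi>2)" using H d(1) by (intro mult_nonneg_nonneg[OF _ pos]) auto
      with rect have "norm (x' (j + 2) - x (j + 1)) + norm (x (j + 2) - x' (j + 1)) \<le>
        norm (x (j + 2) - x (j + 1)) + norm (x' (j + 2) - x' (j + 1))" by linarith
      then show "norm (bd i1 s1 - x j) + norm (x' (j + 2) - bd i1 s1) + norm (bd i2 s2 - x' (j + 1)) + norm (x (j + 3) - bd i2 s2) \<le>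
      norm (x (j + 1) - x j) + norm (x (j + 2) - x (j + 1)) + norm (x' (j + 2) - x' (j + 1)) + norm (x (j + 3) - x (j + 2))
       - d ^ 3 / 8 * (\<xi>1\<^sup>2 + \<xi>2\<^sup>2)"
        using g1 g2 unfolding r'[symmetric] ch pts distrib_left by linarith
    qed (rule bd_cl)+
    show "let \<xi> = \<lambda>k. r' k - r k; j = int k in
    norm (x' (j + 2) - x (j + 1)) + norm (x (j + 2) - x' (j + 1)) \<le>
      norm (x (j + 2) - x (j + 1)) + norm (x' (j + 2) - x' (j + 1)) + 1 / d * (\<bar>\<xi> (k + 1)\<bar> * \<bar>\<xi> (k + 2)\<bar>) \<and>
    (0 \<le> \<xi> (k + 1) * \<xi> (k + 2) \<longrightarrow> (\<exists>a\<in>cl (per \<sigma> (j + 1)). \<exists>b\<in>cl (per \<sigma> (j + 2)).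
      norm (a - x j) + norm (x' (j + 2) - a) + norm (b - x' (j + 1)) + norm (x (j + 3) - b) \<le>
      norm (x (j + 1) - x j) + norm (x (j + 2) - x (j + 1)) + norm (x' (j + 2) - x' (j + 1)) + norm (x (j + 3) - x (j + 2))
       - d ^ 3 / 8 * ((\<xi> (k + 1))\<^sup>2 + (\<xi> (k + 2))\<^sup>2)))"
      unfolding Let_def j_def[symmetric] xi[symmetric] ii[symmetric] using up low by blast
  qed
qed

end

section \<open>Growth of the distance between shadowing orbits\<close>

lemma near_upper:
  assumes "near g A a" "near g B b" "0 \<le> a" "0 \<le> b" "1 < g" "X' = - (A * X + B * Y)"
  shows "\<bar>X'\<bar> \<le> g * (a * \<bar>X\<bar> + b * \<bar>Y\<bar>)"
proof -
  have "0 \<le> a / g" "0 \<le> b / g" using assms by simp_all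
  then have A: "0 \<le> A" "A \<le> g * a" "0 \<le> B" "B \<le> g * b"
    using assms(1,2) unfolding near_def by linarith+
  have "\<bar>X'\<bar> \<le> A * \<bar>X\<bar> + B * \<bar>Y\<bar>"
    using abs_triangle_ineq[of "A * X" "B * Y"] A by (simp add: assms(6) abs_mult)
  also have "\<dots> \<le> g * a * \<bar>X\<bar> + g * b * \<bar>Y\<bar>" using A by (intro add_mono mult_right_mono) auto
  finally show ?thesis by (simp add: algebra_simps)
qed

lemma near_lower:
  assumes "near g A a" "near g B b" "1 < g" "0 \<le> x" "0 \<le> y"
  shows "(a * x + b * y) / g \<le> A * x + B * y"
proof -
  have "a / g * x \<le> A * x" "b / g * y \<le> B * y"
    using mult_right_mono[of "a / g" A x] mult_right_mono[of "b / g" B y] assms unfolding near_def by simp_all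
  then show ?thesis by (simp add: add_divide_distrib)
qed

context table
begin

lemma entry_bounds:
  assumes adm: "admissible \<sigma>"
  shows "\<exists>d>0. \<forall>k. d \<le> sA \<sigma> k \<and> d \<le> sB \<sigma> k \<and> d \<le> sC \<sigma> k \<and> d \<le> sD \<sigma> k \<and> sA \<sigma> k \<le> 1 / d"
proof -
  have "\<exists>d>0. \<forall>j. d \<le> mA (per \<sigma> j) (per \<sigma> (j + 1)) (zpar \<sigma> j) \<and> d \<le> mB (per \<sigma> j) (per \<sigma> (j + 1)) (zpar \<sigma> j) \<and>
    d \<le> mC (per \<sigma> j) (per \<sigma> (j + 1)) (zpar \<sigma> j) \<and> d \<le> mD (per \<sigma> j) (per \<sigma> (j + 1)) (zpar \<sigma> j) \<and>
    mA (per \<sigma> j) (per \<sigma> (j + 1)) (zpar \<sigma> j) \<le> 1 / d"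
  proof (rule star_uniform[OF adm, where P = "\<lambda>i j z d. d \<le> mA i j z \<and> d \<le> mB i j z \<and> d \<le> mC i j z \<and> d \<le> mD i j z \<and> mA i j z \<le> 1 / d"])
    fix l
    define i j z where "i = per \<sigma> l" "j = per \<sigma> (l + 1)" "z = zpar \<sigma> l"
    have v: "visible i j z" unfolding i_j_z_def by (rule zpar_visible[OF adm])
    note p = visible_pos[OF v]
    define d where "d = min (min (mA i j z) (mB i j z)) (min (min (mC i j z) (mD i j z)) (1 / mA i j z))"
    have d: "0 < d" using p by (simp add: d_def)
    have "d \<le> 1 / mA i j z" by (simp add: d_def)
    then have "mA i j z \<le> 1 / d" using d p by (simp add: field_simps)
    then show "\<exists>d>0. d \<le> mA (per \<sigma> l) (per \<sigma> (l + 1)) (zpar \<sigma> l) \<and> d \<le> mB (per \<sigma> l) (per \<sigma> (l + 1)) (zpar \<sigma> l) \<and>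
        d \<le> mC (per \<sigma> l) (per \<sigma> (l + 1)) (zpar \<sigma> l) \<and> d \<le> mD (per \<sigma> l) (per \<sigma> (l + 1)) (zpar \<sigma> l) \<and>
        mA (per \<sigma> l) (per \<sigma> (l + 1)) (zpar \<sigma> l) \<le> 1 / d"
    proof -
      have "d \<le> mA i j z" "d \<le> mB i j z" "d \<le> mC i j z" "d \<le> mD i j z" by (simp_all add: d_def)
      then show ?thesis using d \<open>mA i j z \<le> 1 / d\<close> unfolding i_j_z_def[symmetric] by blast
    qed
  next
    fix i j z and d d' :: real
    assume *: "d \<le> mA i j z \<and> d \<le> mB i j z \<and> d \<le> mC i j z \<and> d \<le> mD i j z \<and> mA i j z \<le> 1 / d" "0 < d'" "d' \<le> d"
    have "1 / d \<le> 1 / d'" using * by (simp add: frac_le)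
    then show "d' \<le> mA i j z \<and> d' \<le> mB i j z \<and> d' \<le> mC i j z \<and> d' \<le> mD i j z \<and> mA i j z \<le> 1 / d'" using * by auto
  qed
  then show ?thesis unfolding sA_def sB_def sC_def sD_def by blast
qed

text \<open>\<open>local_step\<close> with one radius for all positions of the periodic
  orbit.\<close>

lemma shad_step:
  assumes adm: "admissible \<sigma>" and g: "1 < g"
  shows "\<exists>\<delta>>0. \<forall>m n x r x' r' k. shad \<sigma> \<delta> m n x r \<longrightarrow> shad \<sigma> \<delta> m n x' r' \<longrightarrow> m \<le> k \<longrightarrow> k < n \<longrightarrow>
    (let \<xi> = \<lambda>k. r' k - r k; \<eta> = \<lambda>k. mom \<sigma> x' r' k - mom \<sigma> x r k in
    (\<exists>A B C D. near g A (sA \<sigma> k) \<and> near g B (sB \<sigma> k) \<and> near g C (sC \<sigma> k) \<and> near g D (sD \<sigma> k) \<and>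
      \<xi> (Suc k) = - (A * \<xi> k + B * \<eta> k) \<and> \<eta> (Suc k) = - (C * \<xi> k + D * \<eta> k)) \<and>
    (\<exists>A B C D. near g A (sA \<sigma> k) \<and> near g B (sB \<sigma> k) \<and> near g C (sC \<sigma> k) \<and> near g D (sD \<sigma> k) \<and>
      \<xi> k = - (D * \<xi> (Suc k) + B * - \<eta> (Suc k)) \<and> - \<eta> k = - (C * \<xi> (Suc k) + A * - \<eta> (Suc k))))"
proof -
  define Q where "Q i j z0 \<delta> \<longleftrightarrow> (\<forall>z\<in>box_at \<delta> z0. \<forall>z'\<in>box_at \<delta> z0. 
    (\<exists>A B C D. near g A (mA i j z0) \<and> near g B (mB i j z0) \<and> near g C (mC i j z0) \<and> near g D (mD i j z0) \<and>
      snd z' - snd z = - (A * (fst z' - fst z) + B * (sin1 i j z' - sin1 i j z)) \<and>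
      sin2 i j z' - sin2 i j z = - (C * (fst z' - fst z) + D * (sin1 i j z' - sin1 i j z))) \<and>
    (\<exists>A B C D. near g A (mA i j z0) \<and> near g B (mB i j z0) \<and> near g C (mC i j z0) \<and> near g D (mD i j z0) \<and>
      fst z' - fst z = - (D * (snd z' - snd z) + B * - (sin2 i j z' - sin2 i j z)) \<and>
      - (sin1 i j z' - sin1 i j z) = - (C * (snd z' - snd z) + A * - (sin2 i j z' - sin2 i j z))))" for i j z0 \<delta>
  have "\<exists>\<delta>>0. \<forall>j. Q (per \<sigma> j) (per \<sigma> (j + 1)) (zpar \<sigma> j) \<delta>"
  proof (rule star_uniform[OF adm])
    show "\<exists>d>0. Q (per \<sigma> j) (per \<sigma> (j + 1)) (zpar \<sigma> j) d" for j
      unfolding Q_def by (rule local_step[OF zpar_visible[OF adm] g])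
    show "Q i j z d'" if "Q i j z d" "0 < d'" "d' \<le> d" for i j z d d'
    proof -
      have "box_at d' z \<subseteq> box_at d z" using that by (auto simp: mem_box_at)
      then show ?thesis unfolding Q_def
        by - (rule ballI, rule ballI, rule that(1)[unfolded Q_def, THEN bspec, THEN bspec], blast+)
    qed
  qed
  then obtain \<delta> where \<delta>: "0 < \<delta>" "\<And>j. Q (per \<sigma> j) (per \<sigma> (j + 1)) (zpar \<sigma> j) \<delta>" by blast
  show ?thesis
  proof (rule exI[of _ \<delta>], intro conjI \<delta>(1) allI impI)
    fix m n x r x' r' k
    assume X: "shad \<sigma> \<delta> m n x r" "shad \<sigma> \<delta> m n x' r'" and k: "m \<le> k" "k < n"
    have k': "Suc k \<le> n" using k by simp
    note D = shadD[OF X(1) k(1) k'] and D' = shadD[OF X(2) k(1) k']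
    from \<delta>(2)[of "int k", unfolded Q_def, rule_format, OF D(1) D'(1)]
    show "let \<xi> = \<lambda>k. r' k - r k; \<eta> = \<lambda>k. mom \<sigma> x' r' k - mom \<sigma> x r k in
    (\<exists>A B C D. near g A (sA \<sigma> k) \<and> near g B (sB \<sigma> k) \<and> near g C (sC \<sigma> k) \<and> near g D (sD \<sigma> k) \<and>
      \<xi> (Suc k) = - (A * \<xi> k + B * \<eta> k) \<and> \<eta> (Suc k) = - (C * \<xi> k + D * \<eta> k)) \<and>
    (\<exists>A B C D. near g A (sA \<sigma> k) \<and> near g B (sB \<sigma> k) \<and> near g C (sC \<sigma> k) \<and> near g D (sD \<sigma> k) \<and>
      \<xi> k = - (D * \<xi> (Suc k) + B * - \<eta> (Suc k)) \<and> - \<eta> k = - (C * \<xi> (Suc k) + A * - \<eta> (Suc k)))"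
      unfolding Let_def D(2,3) D'(2,3) fst_conv snd_conv sA_def sB_def sC_def sD_def .
  qed
qed

text \<open>The first estimate bounds the middle from below: away from \<open>k\<close>, in either
  direction, differences grow by at most \<open>g * \<nu>\<close> per bounce. The second bounds it
  from above: a vector lies either in the forward cone and expands up to \<open>n\<close>, or in the
  backward cone and expands down to \<open>m\<close>, while differences at the ends stay
  bounded.\<close>

theorem pair_growth:
  assumes adm: "admissible \<sigma>"
  obtains \<nu> where "1 < \<nu>" "marked_lyapunov T \<sigma> = ln \<nu>"
    "\<And>g. 1 < g \<Longrightarrow> \<exists>\<delta>>0. \<exists>K>0. \<forall>m n x r x' r' k. shad \<sigma> \<delta> m n x r \<longrightarrow> shad \<sigma> \<delta> m n x' r' \<longrightarrow> m \<le> k \<longrightarrow> k < n \<longrightarrow>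
      \<bar>r' m - r m\<bar> * \<bar>r' n - r n\<bar> \<le> K * (g * \<nu>) ^ (n - m) * (\<bar>r' k - r k\<bar> + \<bar>r' (Suc k) - r (Suc k)\<bar>)\<^sup>2 \<and>
      \<bar>r' k - r k\<bar> \<le> K * ((g / \<nu>) ^ (n - k) + (g / \<nu>) ^ (k - m))"
proof -
  define N where "N = length \<sigma>"
  have N: "0 < N" using adm by (auto simp: admissible_def N_def)
  obtain \<mu> \<nu> wx wy ux uy c1 c2 where F: "1 < \<mu>" "1 < \<nu>" "\<nu> ^ N = \<mu>"
    "\<And>e. (\<exists>v. v \<noteq> 0 \<and> evo (sA \<sigma>) (sB \<sigma>) (sC \<sigma>) (sD \<sigma>) N v = e *\<^sub>R v) \<longleftrightarrow> e = \<mu> \<or> e = 1 / \<mu>"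
    "\<And>k. wx (Suc k) = sA \<sigma> k * wx k + sB \<sigma> k * wy k" "\<And>k. wy (Suc k) = sC \<sigma> k * wx k + sD \<sigma> k * wy k"
    "\<And>k. ux k = sD \<sigma> k * ux (Suc k) + sB \<sigma> k * uy (Suc k)" "\<And>k. uy k = sC \<sigma> k * ux (Suc k) + sA \<sigma> k * uy (Suc k)"
    "0 < c1" "0 < c2"
    "\<And>k::nat. c1 * \<nu> ^ k \<le> wx k \<and> wx k \<le> c2 * \<nu> ^ k" "\<And>k::nat. c1 * \<nu> ^ k \<le> wy k \<and> wy k \<le> c2 * \<nu> ^ k"
    "\<And>k::nat. c1 * (1 / \<nu>) ^ k \<le> ux k \<and> ux k \<le> c2 * (1 / \<nu>) ^ k" "\<And>k::nat. c1 * (1 / \<nu>) ^ k \<le> uy k \<and> uy k \<le> c2 * (1 / \<nu>) ^ k"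
    using floquet[of N "sA \<sigma>" "sB \<sigma>" "sC \<sigma>" "sD \<sigma>", OF N s_pos[OF adm] s_period[OF adm, folded N_def]] by blast
  have "marked_multiplier T \<sigma> = \<mu>" by (rule marked_multiplier_eq[OF adm F(1) F(4)[unfolded N_def]])
  then have lyap: "marked_lyapunov T \<sigma> = ln \<nu>"
    unfolding marked_lyapunov_def N_def[symmetric] F(3)[symmetric] using N F(2) by (simp add: ln_realpow)
  obtain e0 where e0: "0 < e0" "\<And>k. e0 \<le> sA \<sigma> k" "\<And>k. e0 \<le> sB \<sigma> k" "\<And>k. e0 \<le> sC \<sigma> k" "\<And>k. e0 \<le> sD \<sigma> k" "\<And>k. sA \<sigma> k \<le> 1 / e0"
    using entry_bounds[OF adm] by blast
  note sp = s_pos(1-4)[OF adm, THEN less_imp_le]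
  have \<nu>0: "0 < \<nu>" using F(2) by simp
  have main: "\<exists>\<delta>>0. \<exists>K>0. \<forall>m n x r x' r' k. shad \<sigma> \<delta> m n x r \<longrightarrow> shad \<sigma> \<delta> m n x' r' \<longrightarrow> m \<le> k \<longrightarrow> k < n \<longrightarrow>
      \<bar>r' m - r m\<bar> * \<bar>r' n - r n\<bar> \<le> K * (g * \<nu>) ^ (n - m) * (\<bar>r' k - r k\<bar> + \<bar>r' (Suc k) - r (Suc k)\<bar>)\<^sup>2 \<and>
      \<bar>r' k - r k\<bar> \<le> K * ((g / \<nu>) ^ (n - k) + (g / \<nu>) ^ (k - m))" if g: "1 < g" for g
  proof -
    have g0: "0 < g" "1 \<le> g" using g by auto
    obtain \<delta>0 where \<delta>0: "0 < \<delta>0" "\<And>m n x r x' r' k. shad \<sigma> \<delta>0 m n x r \<Longrightarrow> shad \<sigma> \<delta>0 m n x' r' \<Longrightarrow> m \<le> k \<Longrightarrow> k < n \<Longrightarrow>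
    (let \<xi> = \<lambda>k. r' k - r k; \<eta> = \<lambda>k. mom \<sigma> x' r' k - mom \<sigma> x r k in
    (\<exists>A B C D. near g A (sA \<sigma> k) \<and> near g B (sB \<sigma> k) \<and> near g C (sC \<sigma> k) \<and> near g D (sD \<sigma> k) \<and>
      \<xi> (Suc k) = - (A * \<xi> k + B * \<eta> k) \<and> \<eta> (Suc k) = - (C * \<xi> k + D * \<eta> k)) \<and>
    (\<exists>A B C D. near g A (sA \<sigma> k) \<and> near g B (sB \<sigma> k) \<and> near g C (sC \<sigma> k) \<and> near g D (sD \<sigma> k) \<and>
      \<xi> k = - (D * \<xi> (Suc k) + B * - \<eta> (Suc k)) \<and> - \<eta> k = - (C * \<xi> (Suc k) + A * - \<eta> (Suc k))))"
      using shad_step[OF adm g] by blast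
    define \<delta> where "\<delta> = min \<delta>0 1"
    have \<delta>: "0 < \<delta>" "\<delta> \<le> \<delta>0" "\<delta> \<le> 1" using \<delta>0(1) by (auto simp: \<delta>_def)
    define K1 where "K1 = 2 * (c2 / c1)"
    define \<kappa> where "\<kappa> = min 1 (e0 * c1 / (c2 * \<nu>))"
    \<comment> \<open>The price for replacing the sine difference at \<open>k\<close> by the
      arc-length difference at \<open>Suc k\<close>; see \<open>S_le\<close>.\<close>
    define K2 where "K2 = 1 + g / e0 * (1 + g / e0)"
    define K where "K = K1\<^sup>2 * K2\<^sup>2 + 4 / \<kappa>"
    have K1: "0 < K1" using F(9,10) by (simp add: K1_def)
    have \<kappa>: "0 < \<kappa>" using F(9,10) e0(1) \<nu>0 by (simp add: \<kappa>_def)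
    have K2: "0 < K2" using g0 e0(1) by (auto simp: K2_def intro!: add_pos_nonneg)
    have K: "0 < K" "K1\<^sup>2 * K2\<^sup>2 \<le> K" "4 / \<kappa> \<le> K" using K1 K2 \<kappa> by (auto simp: K_def intro!: add_nonneg_pos)
    show ?thesis
    proof (rule exI[of _ \<delta>], intro conjI \<delta>(1), rule exI[of _ K], intro conjI K(1), intro allI impI conjI)
      fix m n x r x' r' k
      assume X: "shad \<sigma> \<delta> m n x r" "shad \<sigma> \<delta> m n x' r'" and k: "m \<le> k" "k < n"
      define \<xi> where "\<xi> k = r' k - r k" for k
      define \<eta> where "\<eta> k = mom \<sigma> x' r' k - mom \<sigma> x r k" for k
      define S where "S k = \<bar>\<xi> k\<bar> + \<bar>\<eta> k\<bar>" for k
      note X0 = shad_mono[OF X(1) order_refl order_refl \<delta>(2)] shad_mono[OF X(2) order_refl order_refl \<delta>(2)]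
      note st = \<delta>0(2)[OF X0, unfolded Let_def, folded \<xi>_def \<eta>_def]
      have up1: "\<bar>\<xi> (Suc i)\<bar> \<le> g * (sA \<sigma> i * \<bar>\<xi> i\<bar> + sB \<sigma> i * \<bar>\<eta> i\<bar>)" "\<bar>\<eta> (Suc i)\<bar> \<le> g * (sC \<sigma> i * \<bar>\<xi> i\<bar> + sD \<sigma> i * \<bar>\<eta> i\<bar>)"
        and up2: "\<bar>\<xi> i\<bar> \<le> g * (sD \<sigma> i * \<bar>\<xi> (Suc i)\<bar> + sB \<sigma> i * \<bar>\<eta> (Suc i)\<bar>)" "\<bar>\<eta> i\<bar> \<le> g * (sC \<sigma> i * \<bar>\<xi> (Suc i)\<bar> + sA \<sigma> i * \<bar>\<eta> (Suc i)\<bar>)"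
        if i: "m \<le> i" "i < n" for i
      proof -
        obtain A B C D where 1: "near g A (sA \<sigma> i)" "near g B (sB \<sigma> i)" "near g C (sC \<sigma> i)" "near g D (sD \<sigma> i)"
          "\<xi> (Suc i) = - (A * \<xi> i + B * \<eta> i)" "\<eta> (Suc i) = - (C * \<xi> i + D * \<eta> i)" using st[OF i] by blast
        show "\<bar>\<xi> (Suc i)\<bar> \<le> g * (sA \<sigma> i * \<bar>\<xi> i\<bar> + sB \<sigma> i * \<bar>\<eta> i\<bar>)" "\<bar>\<eta> (Suc i)\<bar> \<le> g * (sC \<sigma> i * \<bar>\<xi> i\<bar> + sD \<sigma> i * \<bar>\<eta> i\<bar>)"
          using near_upper[OF 1(1,2) sp(1,2) g 1(5)] near_upper[OF 1(3,4) sp(3,4) g 1(6)] .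
        obtain A B C D where 2: "near g A (sA \<sigma> i)" "near g B (sB \<sigma> i)" "near g C (sC \<sigma> i)" "near g D (sD \<sigma> i)"
          "\<xi> i = - (D * \<xi> (Suc i) + B * - \<eta> (Suc i))" "- \<eta> i = - (C * \<xi> (Suc i) + A * - \<eta> (Suc i))" using st[OF i] by blast
        show "\<bar>\<xi> i\<bar> \<le> g * (sD \<sigma> i * \<bar>\<xi> (Suc i)\<bar> + sB \<sigma> i * \<bar>\<eta> (Suc i)\<bar>)" "\<bar>\<eta> i\<bar> \<le> g * (sC \<sigma> i * \<bar>\<xi> (Suc i)\<bar> + sA \<sigma> i * \<bar>\<eta> (Suc i)\<bar>)"
          using near_upper[OF 2(4,2) sp(4,2) g 2(5)] near_upper[OF 2(3,1) sp(3,1) g 2(6)] by simp_all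
      qed
      have fwd_up: "S n \<le> K1 * (g * \<nu>) ^ (n - k) * S k"
      proof -
        have "\<bar>\<xi> (k + (n - k))\<bar> + \<bar>\<eta> (k + (n - k))\<bar> \<le> 2 * (c2 / c1) * (g * \<nu>) ^ (n - k) * (\<bar>\<xi> (k + 0)\<bar> + \<bar>\<eta> (k + 0)\<bar>)"
          by (rule grow_upper[where a = "\<lambda>i. sA \<sigma> (k + i)" and b = "\<lambda>i. sB \<sigma> (k + i)" and c = "\<lambda>i. sC \<sigma> (k + i)" and d = "\<lambda>i. sD \<sigma> (k + i)"
              and wx = "\<lambda>i. wx (k + i)" and wy = "\<lambda>i. wy (k + i)" and e = "\<nu> ^ k"])
            (use up1 k F(5,6,9) F(11,12)[of k] F(11,12)[of n] sp g0 \<nu>0 in \<open>auto simp: power_add[symmetric] mult.assoc\<close>)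
        then show ?thesis using k by (simp add: S_def K1_def)
      qed
      \<comment> \<open>Run backwards from \<open>k\<close>, the contracting solution grows like
        \<open>\<nu> ^ i\<close>, with scale \<open>(1 / \<nu>) ^ k\<close>.\<close>
      have pw: "(1 / \<nu>) ^ (k - i) = (1 / \<nu>) ^ k * \<nu> ^ i" if "i \<le> k" for i k
        using that \<nu>0 by (simp add: power_diff power_one_over field_simps)
      have bwd_up: "S m \<le> K1 * (g * \<nu>) ^ (k - m) * S k"
      proof -
        have ix: "Suc (k - Suc i) = k - i" "m \<le> k - Suc i" "k - Suc i < n" if "i < k - m" for i using that k by auto
        have "\<bar>\<xi> (k - (k - m))\<bar> + \<bar>\<eta> (k - (k - m))\<bar> \<le> 2 * (c2 / c1) * (g * \<nu>) ^ (k - m) * (\<bar>\<xi> (k - 0)\<bar> + \<bar>\<eta> (k - 0)\<bar>)"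
        proof (rule grow_upper[where a = "\<lambda>i. sD \<sigma> (k - Suc i)" and b = "\<lambda>i. sB \<sigma> (k - Suc i)" and c = "\<lambda>i. sC \<sigma> (k - Suc i)" and d = "\<lambda>i. sA \<sigma> (k - Suc i)"
              and wx = "\<lambda>i. ux (k - i)" and wy = "\<lambda>i. uy (k - i)" and e = "(1 / \<nu>) ^ k"])
          fix i assume i: "i < k - m"
          show "\<bar>\<xi> (k - Suc i)\<bar> \<le> g * (sD \<sigma> (k - Suc i) * \<bar>\<xi> (k - i)\<bar> + sB \<sigma> (k - Suc i) * \<bar>\<eta> (k - i)\<bar>)"
            "\<bar>\<eta> (k - Suc i)\<bar> \<le> g * (sC \<sigma> (k - Suc i) * \<bar>\<xi> (k - i)\<bar> + sA \<sigma> (k - Suc i) * \<bar>\<eta> (k - i)\<bar>)"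
            using up2[OF ix(2,3)[OF i]] unfolding ix(1)[OF i] .
          show "ux (k - Suc i) = sD \<sigma> (k - Suc i) * ux (k - i) + sB \<sigma> (k - Suc i) * uy (k - i)"
            "uy (k - Suc i) = sC \<sigma> (k - Suc i) * ux (k - i) + sA \<sigma> (k - Suc i) * uy (k - i)"
            using F(7,8)[of "k - Suc i"] unfolding ix(1)[OF i] .
          show "0 \<le> sD \<sigma> (k - Suc i) \<and> 0 \<le> sB \<sigma> (k - Suc i) \<and> 0 \<le> sC \<sigma> (k - Suc i) \<and> 0 \<le> sA \<sigma> (k - Suc i)" using sp by blast
        next
          show "ux (k - (k - m)) \<le> c2 * (1 / \<nu>) ^ k * \<nu> ^ (k - m)" "uy (k - (k - m)) \<le> c2 * (1 / \<nu>) ^ k * \<nu> ^ (k - m)"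
            using F(13)[of "k - (k - m)"] F(14)[of "k - (k - m)"] pw[of "k - m" k] by (simp_all add: mult.assoc)
        qed (use F(9,13,14) g0 \<nu>0 in auto)
        then show ?thesis using k by (simp add: S_def K1_def)
      qed
      \<comment> \<open>At most 2 from the parameters, as \<open>\<delta> \<le> 1\<close>, and at
        most 2 from the sines.\<close>
      have Sbound: "S i \<le> 4" if "m \<le> i" "i \<le> n" for i
      proof -
        have "\<bar>\<xi> i\<bar> \<le> 2" using shad_near[OF X(1) that] shad_near[OF X(2) that] \<delta>(3) unfolding \<xi>_def by linarith
        moreover have "\<bar>\<eta> i\<bar> \<le> 2" using mom_bound[OF X(1), of i] mom_bound[OF X(2), of i] unfolding \<eta>_def by linarith
        ultimately show ?thesis by (simp add: S_def)
      qed
      have S_le: "S k \<le> K2 * (\<bar>\<xi> k\<bar> + \<bar>\<xi> (Suc k)\<bar>)"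
      proof -
        \<comment> \<open>The first row of the step determines the sine difference, since its
          coefficient \<open>B\<close> is bounded below.\<close>
        obtain A B where 1: "near g A (sA \<sigma> k)" "near g B (sB \<sigma> k)" "\<xi> (Suc k) = - (A * \<xi> k + B * \<eta> k)" using st[OF k] by blast
        have B: "e0 / g \<le> B"
          using 1(2) divide_right_mono[OF e0(3)[of k], of g] g0(1) unfolding near_def by linarith
        have A: "0 \<le> A" "A \<le> g / e0"
        proof -
          have "0 \<le> sA \<sigma> k / g" "g * sA \<sigma> k \<le> g / e0"
            using sp(1)[of k] g0(1) mult_left_mono[OF e0(6)[of k], of g] by simp_all
          then show "0 \<le> A" "A \<le> g / e0" using 1(1) unfolding near_def by linarith+
        qed
        have eg: "0 < e0 / g" using e0(1) g0 by simp
        have "B * \<eta> k = - (\<xi> (Suc k) + A * \<xi> k)" using 1(3) by simp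
        then have "B * \<bar>\<eta> k\<bar> \<le> \<bar>\<xi> (Suc k)\<bar> + A * \<bar>\<xi> k\<bar>"
        proof -
          have "B * \<bar>\<eta> k\<bar> = \<bar>B * \<eta> k\<bar>" using B eg by (simp add: abs_mult)
          also have "\<dots> = \<bar>\<xi> (Suc k) + A * \<xi> k\<bar>" unfolding \<open>B * \<eta> k = - (\<xi> (Suc k) + A * \<xi> k)\<close> by simp
          also have "\<dots> \<le> \<bar>\<xi> (Suc k)\<bar> + A * \<bar>\<xi> k\<bar>"
            using abs_triangle_ineq[of "\<xi> (Suc k)" "A * \<xi> k"] A(1) by (simp add: abs_mult)
          finally show ?thesis .
        qed
        moreover have "e0 / g * \<bar>\<eta> k\<bar> \<le> B * \<bar>\<eta> k\<bar>" using B by (intro mult_right_mono) auto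
        moreover have "A * \<bar>\<xi> k\<bar> \<le> g / e0 * \<bar>\<xi> k\<bar>" using A by (intro mult_right_mono) auto
        ultimately have "e0 / g * \<bar>\<eta> k\<bar> \<le> \<bar>\<xi> (Suc k)\<bar> + g / e0 * \<bar>\<xi> k\<bar>" by linarith
        also have "\<dots> \<le> (1 + g / e0) * (\<bar>\<xi> k\<bar> + \<bar>\<xi> (Suc k)\<bar>)" using e0(1) g0 by (simp add: algebra_simps)
        finally have "g / e0 * (e0 / g * \<bar>\<eta> k\<bar>) \<le> g / e0 * ((1 + g / e0) * (\<bar>\<xi> k\<bar> + \<bar>\<xi> (Suc k)\<bar>))"
          using e0(1) g0 by (intro mult_left_mono) auto
        then have "\<bar>\<eta> k\<bar> \<le> g / e0 * (1 + g / e0) * (\<bar>\<xi> k\<bar> + \<bar>\<xi> (Suc k)\<bar>)" using e0(1) g0 by (simp add: mult.assoc)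
        then show ?thesis unfolding S_def K2_def distrib_right[of 1] by simp
      qed
      have S0: "0 \<le> S i" for i by (simp add: S_def)
      have first: "\<bar>\<xi> m\<bar> * \<bar>\<xi> n\<bar> \<le> K * (g * \<nu>) ^ (n - m) * (\<bar>\<xi> k\<bar> + \<bar>\<xi> (Suc k)\<bar>)\<^sup>2"
      proof -
        have "\<bar>\<xi> m\<bar> * \<bar>\<xi> n\<bar> \<le> S m * S n" by (intro mult_mono) (auto simp: S_def)
        also have "\<dots> \<le> (K1 * (g * \<nu>) ^ (k - m) * S k) * (K1 * (g * \<nu>) ^ (n - k) * S k)"
          by (intro mult_mono fwd_up bwd_up) (use S0 K1 g0 \<nu>0 in auto)
        also have "\<dots> = K1\<^sup>2 * (g * \<nu>) ^ (n - m) * (S k)\<^sup>2"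
        proof -
          have "(g * \<nu>) ^ (n - m) = (g * \<nu>) ^ (k - m) * (g * \<nu>) ^ (n - k)" using k by (simp flip: power_add)
          then show ?thesis by (simp add: power2_eq_square)
        qed
        also have "\<dots> \<le> K1\<^sup>2 * (g * \<nu>) ^ (n - m) * (K2 * (\<bar>\<xi> k\<bar> + \<bar>\<xi> (Suc k)\<bar>))\<^sup>2"
          using S_le S0[of k] g0 \<nu>0 by (intro mult_left_mono power_mono) auto
        also have "\<dots> = (K1\<^sup>2 * K2\<^sup>2) * ((g * \<nu>) ^ (n - m) * (\<bar>\<xi> k\<bar> + \<bar>\<xi> (Suc k)\<bar>)\<^sup>2)"
          by (simp add: power_mult_distrib)
        also have "\<dots> \<le> K * ((g * \<nu>) ^ (n - m) * (\<bar>\<xi> k\<bar> + \<bar>\<xi> (Suc k)\<bar>)\<^sup>2)"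
          using K(2) g0 \<nu>0 by (intro mult_right_mono) auto
        finally show ?thesis by (simp add: mult.assoc)
      qed
      have inv: "S k \<le> K * (g / \<nu>) ^ l" if "\<kappa> * (\<nu> / g) ^ l * S k \<le> 4" for l
      proof -
        have p: "(\<nu> / g) ^ l * (g / \<nu>) ^ l = 1" using g0 \<nu>0 by (simp flip: power_mult_distrib)
        have q: "0 < (g / \<nu>) ^ l" using g0 \<nu>0 by simp
        have "\<kappa> * S k = (\<kappa> * (\<nu> / g) ^ l * S k) * (g / \<nu>) ^ l"
          using p by (metis mult.assoc mult.commute mult.left_neutral)
        also have "\<dots> \<le> 4 * (g / \<nu>) ^ l" using that q by (intro mult_right_mono) auto
        finally have "S k * \<kappa> \<le> 4 * (g / \<nu>) ^ l" by (simp only: mult.commute)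
        then have "S k \<le> 4 / \<kappa> * (g / \<nu>) ^ l" unfolding pos_le_divide_eq[OF \<kappa>, symmetric] by simp
        also have "\<dots> \<le> K * (g / \<nu>) ^ l" using K(3) q by (intro mult_right_mono) auto
        finally show ?thesis .
      qed
      have second: "S k \<le> K * ((g / \<nu>) ^ (n - k) + (g / \<nu>) ^ (k - m))"
      \<comment> \<open>Equal signs mean the forward cone; otherwise negating \<open>\<eta>\<close>
        gives the backward cone.\<close>
      proof (cases "0 \<le> \<xi> k * \<eta> k")
        case True
        define s :: real where "s = (if 0 \<le> \<xi> k \<and> 0 \<le> \<eta> k then 1 else - 1)"
        have s: "0 \<le> s * \<xi> k" "0 \<le> s * \<eta> k" "\<bar>s\<bar> = 1" using True by (auto simp: s_def zero_le_mult_iff)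
        \<comment> \<open>Each bounce reverses both signs, so multiplication by \<open>sg i\<close>
          keeps the vector in the positive quadrant.\<close>
        define sg where "sg i = s * (- 1) ^ i" for i :: nat
        have sg: "\<bar>sg i\<bar> = 1" "sg (Suc i) = - sg i" "sg 0 = s" for i using s(3) by (simp_all add: sg_def abs_mult power_abs)
        have "\<kappa> * (\<nu> / g) ^ (n - k) * (sg 0 * \<xi> (k + 0) + sg 0 * \<eta> (k + 0)) \<le> sg (n - k) * \<xi> (k + (n - k)) + sg (n - k) * \<eta> (k + (n - k))"
          unfolding \<kappa>_def
        proof (rule grow_lower[where a = "\<lambda>i. sA \<sigma> (k + i)" and b = "\<lambda>i. sB \<sigma> (k + i)" and c = "\<lambda>i. sC \<sigma> (k + i)" and d = "\<lambda>i. sD \<sigma> (k + i)"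
              and wx = "\<lambda>i. wx (k + i)" and wy = "\<lambda>i. wy (k + i)" and e = "\<nu> ^ k"])
          fix i assume i: "i < n - k" and p: "0 \<le> sg i * \<xi> (k + i)" "0 \<le> sg i * \<eta> (k + i)"
          have ki: "m \<le> k + i" "k + i < n" using i k by auto
          obtain A B C D where 1: "near g A (sA \<sigma> (k + i))" "near g B (sB \<sigma> (k + i))" "near g C (sC \<sigma> (k + i))" "near g D (sD \<sigma> (k + i))"
            "\<xi> (Suc (k + i)) = - (A * \<xi> (k + i) + B * \<eta> (k + i))" "\<eta> (Suc (k + i)) = - (C * \<xi> (k + i) + D * \<eta> (k + i))"
            using st[OF ki] by blast
          have e: "sg (Suc i) * \<xi> (k + Suc i) = A * (sg i * \<xi> (k + i)) + B * (sg i * \<eta> (k + i))"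
            "sg (Suc i) * \<eta> (k + Suc i) = C * (sg i * \<xi> (k + i)) + D * (sg i * \<eta> (k + i))"
            unfolding add_Suc_right sg(2) 1(5,6) by (simp_all add: algebra_simps)
          show "(sA \<sigma> (k + i) * (sg i * \<xi> (k + i)) + sB \<sigma> (k + i) * (sg i * \<eta> (k + i))) / g \<le> sg (Suc i) * \<xi> (k + Suc i)"
            "(sC \<sigma> (k + i) * (sg i * \<xi> (k + i)) + sD \<sigma> (k + i) * (sg i * \<eta> (k + i))) / g \<le> sg (Suc i) * \<eta> (k + Suc i)"
            unfolding e by (rule near_lower[OF 1(1,2) g p], rule near_lower[OF 1(3,4) g p])
        next
          fix i assume "i < n - k"
          show "wx (k + Suc i) = sA \<sigma> (k + i) * wx (k + i) + sB \<sigma> (k + i) * wy (k + i)"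
            "wy (k + Suc i) = sC \<sigma> (k + i) * wx (k + i) + sD \<sigma> (k + i) * wy (k + i)"
            using F(5,6)[of "k + i"] by simp_all
          show "e0 \<le> sA \<sigma> (k + i) \<and> e0 \<le> sB \<sigma> (k + i) \<and> e0 \<le> sC \<sigma> (k + i) \<and> e0 \<le> sD \<sigma> (k + i)" using e0 by blast
        next
          fix i assume "i \<le> n - k"
          show "c1 * \<nu> ^ k * \<nu> ^ i \<le> wx (k + i) \<and> wx (k + i) \<le> c2 * \<nu> ^ k * \<nu> ^ i"
            "c1 * \<nu> ^ k * \<nu> ^ i \<le> wy (k + i) \<and> wy (k + i) \<le> c2 * \<nu> ^ k * \<nu> ^ i"
            using F(11,12)[of "k + i"] unfolding power_add mult.assoc .
        qed (use F(9,10) e0(1) s g0 \<nu>0 sg(3) in auto)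
        moreover have "sg 0 * \<xi> (k + 0) + sg 0 * \<eta> (k + 0) = S k"
          using s by (simp add: sg(3) S_def) (metis abs_mult abs_of_nonneg mult.left_neutral)
        moreover have "sg (n - k) * \<xi> (k + (n - k)) + sg (n - k) * \<eta> (k + (n - k)) \<le> S n"
        proof -
          have "sg (n - k) * v \<le> \<bar>v\<bar>" for v using abs_ge_self[of "sg (n - k) * v"] by (simp add: abs_mult sg(1))
          then show ?thesis using k by (simp add: S_def add_mono)
        qed
        ultimately have "\<kappa> * (\<nu> / g) ^ (n - k) * S k \<le> 4" using Sbound[of n] k by simp
        from inv[OF this] show ?thesis using K(1) g0 \<nu>0 by (simp add: distrib_left add_increasing2)
      next
        case False
        define s :: real where "s = (if 0 \<le> \<xi> k then 1 else - 1)"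
        have s: "0 \<le> s * \<xi> k" "0 \<le> s * - \<eta> k" "\<bar>s\<bar> = 1" using False by (auto simp: s_def zero_le_mult_iff not_le mult_less_0_iff)
        define sg where "sg i = s * (- 1) ^ i" for i :: nat
        have sg: "\<bar>sg i\<bar> = 1" "sg (Suc i) = - sg i" "sg 0 = s" for i using s(3) by (simp_all add: sg_def abs_mult power_abs)
        have ix: "Suc (k - Suc i) = k - i" "m \<le> k - Suc i" "k - Suc i < n" if "i < k - m" for i using that k by auto
        have "\<kappa> * (\<nu> / g) ^ (k - m) * (sg 0 * \<xi> (k - 0) + sg 0 * - \<eta> (k - 0)) \<le> sg (k - m) * \<xi> (k - (k - m)) + sg (k - m) * - \<eta> (k - (k - m))"
          unfolding \<kappa>_def
        proof (rule grow_lower[where a = "\<lambda>i. sD \<sigma> (k - Suc i)" and b = "\<lambda>i. sB \<sigma> (k - Suc i)" and c = "\<lambda>i. sC \<sigma> (k - Suc i)" and d = "\<lambda>i. sA \<sigma> (k - Suc i)"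
              and wx = "\<lambda>i. ux (k - i)" and wy = "\<lambda>i. uy (k - i)" and e = "(1 / \<nu>) ^ k"])
          fix i assume i: "i < k - m"
          show "ux (k - Suc i) = sD \<sigma> (k - Suc i) * ux (k - i) + sB \<sigma> (k - Suc i) * uy (k - i)"
            "uy (k - Suc i) = sC \<sigma> (k - Suc i) * ux (k - i) + sA \<sigma> (k - Suc i) * uy (k - i)"
            using F(7,8)[of "k - Suc i"] unfolding ix(1)[OF i] .
          show "e0 \<le> sD \<sigma> (k - Suc i) \<and> e0 \<le> sB \<sigma> (k - Suc i) \<and> e0 \<le> sC \<sigma> (k - Suc i) \<and> e0 \<le> sA \<sigma> (k - Suc i)" using e0 by blast
          assume p: "0 \<le> sg i * \<xi> (k - i)" "0 \<le> sg i * - \<eta> (k - i)"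
          define l where "l = k - Suc i"
          obtain A B C D where 1: "near g A (sA \<sigma> l)" "near g B (sB \<sigma> l)" "near g C (sC \<sigma> l)" "near g D (sD \<sigma> l)"
            "\<xi> l = - (D * \<xi> (Suc l) + B * - \<eta> (Suc l))" "- \<eta> l = - (C * \<xi> (Suc l) + A * - \<eta> (Suc l))"
            using st[OF ix(2,3)[OF i]] unfolding l_def by blast
          have l: "Suc l = k - i" using ix(1)[OF i] by (simp add: l_def)
          have e: "sg (Suc i) * \<xi> l = D * (sg i * \<xi> (k - i)) + B * (sg i * - \<eta> (k - i))"
            "sg (Suc i) * - \<eta> l = C * (sg i * \<xi> (k - i)) + A * (sg i * - \<eta> (k - i))"
            unfolding sg(2) 1(5,6) l by (simp_all add: algebra_simps)
          show "(sD \<sigma> (k - Suc i) * (sg i * \<xi> (k - i)) + sB \<sigma> (k - Suc i) * (sg i * - \<eta> (k - i))) / g \<le> sg (Suc i) * \<xi> (k - Suc i)"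
            "(sC \<sigma> (k - Suc i) * (sg i * \<xi> (k - i)) + sA \<sigma> (k - Suc i) * (sg i * - \<eta> (k - i))) / g \<le> sg (Suc i) * - \<eta> (k - Suc i)"
            unfolding l_def[symmetric] e by (rule near_lower[OF 1(4,2) g p], rule near_lower[OF 1(3,1) g p])
        next
          fix i assume "i \<le> k - m"
          then have i: "i \<le> k" by simp
          show "c1 * (1 / \<nu>) ^ k * \<nu> ^ i \<le> ux (k - i) \<and> ux (k - i) \<le> c2 * (1 / \<nu>) ^ k * \<nu> ^ i"
            "c1 * (1 / \<nu>) ^ k * \<nu> ^ i \<le> uy (k - i) \<and> uy (k - i) \<le> c2 * (1 / \<nu>) ^ k * \<nu> ^ i"
            using F(13,14)[of "k - i"] unfolding pw[OF i] mult.assoc .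
        qed (use F(9,10) e0 s g0 \<nu>0 sg(3) in auto)
        moreover have "sg 0 * \<xi> (k - 0) + sg 0 * - \<eta> (k - 0) = S k"
        proof -
          have "sg 0 * \<xi> k = \<bar>\<xi> k\<bar>" "sg 0 * - \<eta> k = \<bar>\<eta> k\<bar>"
            using s sg(3) by (metis abs_mult abs_of_nonneg mult.left_neutral, metis abs_minus_cancel abs_mult abs_of_nonneg mult.left_neutral)
          then show ?thesis by (simp add: S_def)
        qed
        moreover have "sg (k - m) * \<xi> (k - (k - m)) + sg (k - m) * - \<eta> (k - (k - m)) \<le> S m"
        proof -
          have "sg (k - m) * v \<le> \<bar>v\<bar>" for v using abs_ge_self[of "sg (k - m) * v"] by (simp add: abs_mult sg(1))
          from add_mono[OF this[of "\<xi> m"] this[of "- \<eta> m"]] show ?thesis using k by (simp add: S_def)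
        qed
        ultimately have "\<kappa> * (\<nu> / g) ^ (k - m) * S k \<le> 4" using Sbound[of m] k by simp
        from inv[OF this] show ?thesis using K(1) g0 \<nu>0 by (simp add: distrib_left add_increasing)
      qed
      have "\<bar>\<xi> k\<bar> \<le> S k" by (simp add: S_def)
      then show "\<bar>r' m - r m\<bar> * \<bar>r' n - r n\<bar> \<le> K * (g * \<nu>) ^ (n - m) * (\<bar>r' k - r k\<bar> + \<bar>r' (Suc k) - r (Suc k)\<bar>)\<^sup>2"
        "\<bar>r' k - r k\<bar> \<le> K * ((g / \<nu>) ^ (n - k) + (g / \<nu>) ^ (k - m))"
        using first second unfolding \<xi>_def by linarith+
    qed
  qed
  show ?thesis by (rule that[OF F(2) lyap main])
qed

end

section \<open>Words with one excursion\<close>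

text \<open>An even number of copies, so that inserting or removing \<open>2 * n\<close> turns
  shifts indices by an even amount; the parity argument in \<open>excess_asymptotics\<close> rests
  on this.\<close>

definition excursion :: "3 list \<Rightarrow> 3 \<Rightarrow> nat \<Rightarrow> 3 list" where
  "excursion \<sigma> t M = concat (replicate (2 * M) \<sigma>) @ [t]"

definition excess :: "billiard \<Rightarrow> 3 list \<Rightarrow> 3 \<Rightarrow> nat \<Rightarrow> nat \<Rightarrow> real" where
  "excess T \<sigma> t n M = marked_length T (excursion \<sigma> t M) + 2 * real n * marked_length T \<sigma> - marked_length T (excursion \<sigma> t (M + n))"

lemma length_concat_replicate: "length (concat (replicate n \<sigma>)) = n * length \<sigma>"
  by (induction n) auto

lemma nth_concat_replicate: "i < n * length \<sigma> \<Longrightarrow> concat (replicate n \<sigma>) ! i = \<sigma> ! (i mod length \<sigma>)"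
proof (induction n arbitrary: i)
  case (Suc n)
  then show ?case by (cases "i < length \<sigma>") (auto simp: nth_append le_mod_geq)
qed simp

lemma length_excursion: "length (excursion \<sigma> t M) = 2 * M * length \<sigma> + 1"
  by (simp add: excursion_def length_concat_replicate)

lemma nth_excursion: "i < 2 * M * length \<sigma> \<Longrightarrow> excursion \<sigma> t M ! i = \<sigma> ! (i mod length \<sigma>)"
  by (simp add: excursion_def nth_append length_concat_replicate nth_concat_replicate)

lemma nth_excursion_last: "excursion \<sigma> t M ! (2 * M * length \<sigma>) = t"
  by (simp add: excursion_def nth_append length_concat_replicate)

lemma admissible_excursion:
  assumes adm: "admissible \<sigma>" and t: "t \<noteq> \<sigma> ! 0" "t \<noteq> \<sigma> ! (length \<sigma> - 1)" and M: "1 \<le> M"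
  shows "admissible (excursion \<sigma> t M)"
proof -
  define p where "p = length \<sigma>"
  have p: "2 \<le> p" using adm by (simp add: admissible_def p_def)
  define L where "L = 2 * M * p"
  have "2 * 1 * p \<le> 2 * M * p" using M by (intro mult_le_mono) auto
  then have L: "p \<le> L" "0 < L" using p by (simp_all add: L_def)
  have len: "length (excursion \<sigma> t M) = L + 1" by (simp add: length_excursion L_def p_def)
  have nth: "excursion \<sigma> t M ! i = \<sigma> ! (i mod p)" if "i < L" for i
    using nth_excursion that by (simp add: L_def p_def)
  have last: "excursion \<sigma> t M ! L = t" using nth_excursion_last by (simp add: L_def p_def)
  have "excursion \<sigma> t M ! (Suc j mod (L + 1)) \<noteq> excursion \<sigma> t M ! j" if j: "j < L + 1" for j
  proof (cases "j = L")
    case True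
    then show ?thesis using nth[of 0] last L t(1) by auto
  next
    case jL: False
    show ?thesis
    proof (cases "Suc j = L")
      case True
      have "j = (2 * M - 1) * p + (p - 1)"
      proof -
        have "(2 * M - 1) * p + p = L" using M by (cases M) (auto simp: L_def)
        then show ?thesis using True p by linarith
      qed
      then have "j mod p = p - 1" by (simp only: mod_mult_self3) (use p in simp)
      then show ?thesis using nth[of j] last True t(2) by (simp add: p_def)
    next
      case False
      then have j': "j < L" "Suc j < L" using j jL by auto
      have "Suc (j mod p) mod p = Suc j mod p" by (rule mod_Suc_eq)
      moreover have "\<sigma> ! (Suc (j mod p) mod p) \<noteq> \<sigma> ! (j mod p)"
        using adm p unfolding admissible_def p_def[symmetric] by simp
      ultimately show ?thesis using nth[OF j'(1)] nth[OF j'(2)] j' by simp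
    qed
  qed
  then show ?thesis unfolding admissible_def len using L by auto
qed

lemma periodic_sum:
  fixes f :: "nat \<Rightarrow> real"
  assumes "\<And>i. f (i + p) = f i"
  shows "(\<Sum>i\<in>{a..<a + m * p}. f i) = real m * (\<Sum>i<p. f i)"
proof -
  have one: "(\<Sum>i\<in>{a..<a + p}. f i) = (\<Sum>i<p. f i)" for a
  proof (induction a)
    case 0
    show ?case by (simp add: atLeast0LessThan)
  next
    case (Suc a)
    show ?case
    proof (cases "p = 0")
      case False
      have "(\<Sum>i\<in>{a..<Suc a + p}. f i) = f a + (\<Sum>i\<in>{Suc a..<Suc a + p}. f i)"
        by (rule sum.atLeast_Suc_lessThan) simp
      moreover have "(\<Sum>i\<in>{a..<Suc a + p}. f i) = (\<Sum>i\<in>{a..<a + p}. f i) + f (a + p)" by simp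
      ultimately show ?thesis using Suc assms[of a] by simp
    qed simp
  qed
  show ?thesis
  proof (induction m)
    case (Suc m)
    have "(\<Sum>i\<in>{a..<a + Suc m * p}. f i) = (\<Sum>i\<in>{a..<a + m * p}. f i) + (\<Sum>i\<in>{a + m * p..<a + m * p + p}. f i)"
      by (subst sum.atLeastLessThan_concat) (auto simp: algebra_simps)
    then show ?case using Suc one[of "a + m * p"] by (simp add: algebra_simps)
  qed simp
qed

definition path_sum :: "(nat \<Rightarrow> complex) \<Rightarrow> nat \<Rightarrow> nat \<Rightarrow> real" where
  "path_sum Q a b = (\<Sum>i\<in>{a..<b}. norm (Q (Suc i) - Q i))"

lemma path_sum_split: "a \<le> b \<Longrightarrow> b \<le> c \<Longrightarrow> path_sum Q a c = path_sum Q a b + path_sum Q b c"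
  unfolding path_sum_def by (simp add: sum.atLeastLessThan_concat)

lemma path_sum_Suc: "path_sum Q a (Suc a) = norm (Q (Suc a) - Q a)"
  by (simp add: path_sum_def)

lemma path_sum_cong: "(\<And>i. a \<le> i \<Longrightarrow> i \<le> b \<Longrightarrow> Q i = Q' i) \<Longrightarrow> path_sum Q a b = path_sum Q' a b"
  unfolding path_sum_def by (intro sum.cong) auto

lemma path_sum_shift: "path_sum (\<lambda>i. Q (i + s)) a b = path_sum Q (a + s) (b + s)"
  unfolding path_sum_def by (simp add: sum.shift_bounds_nat_ivl)

context table
begin

definition orbn :: "3 list \<Rightarrow> nat \<Rightarrow> complex" where "orbn \<sigma> i = orb \<sigma> (int i)"

lemma marked_length_path: "admissible \<sigma> \<Longrightarrow> marked_length T \<sigma> = path_sum (orbn \<sigma>) 0 (length \<sigma>)"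
  by (simp add: marked_length_eq path_sum_def orbn_def atLeast0LessThan add.commute)

lemma orbn_period: "admissible \<sigma> \<Longrightarrow> orbn \<sigma> (i + length \<sigma>) = orbn \<sigma> i"
  using orb_period[of \<sigma> "int i"] by (simp add: orbn_def)

lemma orb_period_mult: "admissible \<sigma> \<Longrightarrow> orb \<sigma> (j + int (m * length \<sigma>)) = orb \<sigma> j"
proof (induction m)
  case (Suc m)
  have "j + int (Suc m * length \<sigma>) = j + int (m * length \<sigma>) + int (length \<sigma>)" by simp
  then show ?case using Suc orb_period[OF Suc.prems] by metis
qed simp

lemma per_period_mult: "per \<sigma> (j + int (m * length \<sigma>)) = per \<sigma> j"
proof (induction m)
  case (Suc m)
  have "j + int (Suc m * length \<sigma>) = j + int (m * length \<sigma>) + int (length \<sigma>)" by simp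
  then show ?case using Suc per_period by metis
qed simp

lemma spar_period_mult: "admissible \<sigma> \<Longrightarrow> spar \<sigma> (j + int (m * length \<sigma>)) = spar \<sigma> j"
  by (simp only: spar_def per_period_mult orb_period_mult)

lemma path_sum_period:
  assumes "admissible \<sigma>" shows "path_sum (orbn \<sigma>) a (a + m * length \<sigma>) = real m * marked_length T \<sigma>"
proof -
  have "norm (orbn \<sigma> (Suc (i + length \<sigma>)) - orbn \<sigma> (i + length \<sigma>)) = norm (orbn \<sigma> (Suc i) - orbn \<sigma> i)" for i
    using orbn_period[OF assms, of i] orbn_period[OF assms, of "Suc i"] by simp
  from periodic_sum[of "\<lambda>i. norm (orbn \<sigma> (Suc i) - orbn \<sigma> i)", OF this] show ?thesis
    unfolding marked_length_path[OF assms] path_sum_def by (simp add: atLeast0LessThan)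
qed

text \<open>Used with excursion words for \<open>m = 1\<close> and with \<open>2 * n\<close> turns
  of \<open>\<sigma>\<close>. The starting index \<open>a\<close> is free because polygons are cut
  out at arbitrary places.\<close>

lemma closed_path_minimal:
  assumes adm: "admissible \<sigma>" and m: "Q (m * length \<sigma>) = Q 0"
    and Q: "\<And>i. i < m * length \<sigma> \<Longrightarrow> Q i \<in> cl (per \<sigma> (int (a + i)))"
  shows "real m * marked_length T \<sigma> \<le> path_sum Q 0 (m * length \<sigma>)"
proof -
  have "(\<Sum>i<m * length \<sigma>. norm (orb \<sigma> (int a + int i + 1) - orb \<sigma> (int a + int i))) \<le> (\<Sum>i<m * length \<sigma>. norm (Q (Suc i) - Q i))"
    using orbit_minimal[OF orb_refl[OF adm], of "m * length \<sigma>" Q "int a"] orb_period_mult[OF adm] Q m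
    by (simp add: per_def)
  moreover have "(\<Sum>i<m * length \<sigma>. norm (orb \<sigma> (int a + int i + 1) - orb \<sigma> (int a + int i))) = path_sum (orbn \<sigma>) a (a + m * length \<sigma>)"
  proof -
    have "path_sum (orbn \<sigma>) (0 + a) (m * length \<sigma> + a) = path_sum (\<lambda>i. orbn \<sigma> (i + a)) 0 (m * length \<sigma>)"
      by (rule path_sum_shift[symmetric])
    then show ?thesis by (simp add: path_sum_def orbn_def atLeast0LessThan add.commute add.left_commute)
  qed
  ultimately show ?thesis using path_sum_period[OF adm] by (simp add: path_sum_def atLeast0LessThan)
qed

lemma orbn_cl: "admissible \<sigma> \<Longrightarrow> orbn \<sigma> i \<in> cl (per \<sigma> (int i))"
  using refl_cl[OF orb_refl] by (simp add: orbn_def per_def)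

lemma per_excursion:
  assumes "i < 2 * M * length \<sigma>" shows "per (excursion \<sigma> t M) (int i) = per \<sigma> (int i)"
proof -
  have "per (excursion \<sigma> t M) (int i) = excursion \<sigma> t M ! i"
    unfolding per_def by (rule periodic_repetition_nat) (use assms in \<open>simp add: length_excursion\<close>)
  also have "\<dots> = per \<sigma> (int i)"
    using nth_excursion[OF assms] by (simp add: per_def periodic_repetition_def nat_mod_distrib)
  finally show ?thesis .
qed

lemma per_excursion_last: "per (excursion \<sigma> t M) (int (2 * M * length \<sigma>)) = t" "per (excursion \<sigma> t M) (- 1) = t"
proof -
  show 1: "per (excursion \<sigma> t M) (int (2 * M * length \<sigma>)) = t"
    unfolding per_def using periodic_repetition_nat[of "2 * M * length \<sigma>" "excursion \<sigma> t M"] nth_excursion_last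
    by (simp add: length_excursion)
  have "int (2 * M * length \<sigma>) = - 1 + int (length (excursion \<sigma> t M))" by (simp add: length_excursion)
  then show "per (excursion \<sigma> t M) (- 1) = t" using 1 per_period by metis
qed

context
  fixes \<sigma> :: "3 list" and t :: 3
  assumes adm: "admissible \<sigma>" and t: "t \<noteq> \<sigma> ! 0" "t \<noteq> \<sigma> ! (length \<sigma> - 1)"
begin

lemma adm_exc: "1 \<le> M \<Longrightarrow> admissible (excursion \<sigma> t M)"
  by (rule admissible_excursion[OF adm t])

lemma length2: "2 \<le> length \<sigma>" using adm by (simp add: admissible_def)

text \<open>The polygon follows the short excursion orbit to \<open>k\<close>, makes
  \<open>2 * n\<close> turns along the orbit of \<open>\<sigma>\<close> and resumes. Its labels are
  those of the long word, whose orbit is no longer than it. The free vertices \<open>a\<close>,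
  \<open>b\<close> stand for the original points or for corrected ones.\<close>

lemma splice_insert:
  assumes M: "1 \<le> M" and n: "1 \<le> n" and k: "k + 3 < 2 * M * length \<sigma>"
    and a: "a \<in> cl (per \<sigma> (int k + 1))" and b: "b \<in> cl (per \<sigma> (int k + 2))"
  defines "x \<equiv> orb (excursion \<sigma> t M)" and "y \<equiv> orb \<sigma>" and "j \<equiv> int k"
  shows "norm (x (j + 1) - x j) + norm (x (j + 2) - x (j + 1)) + norm (y (j + 2) - y (j + 1)) + norm (x (j + 3) - x (j + 2)) \<le>
    excess T \<sigma> t n M + (norm (a - x j) + norm (y (j + 2) - a) + norm (b - y (j + 1)) + norm (x (j + 3) - b))"
proof -
  define p where "p = length \<sigma>"
  define s where "s = 2 * n * p"
  define L where "L = 2 * M * p"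
  have p: "2 \<le> p" using length2 by (simp add: p_def)
  have s: "2 \<le> s" using n p mult_le_mono[of 1 "2 * n" 2 p] by (simp add: s_def)
  have kL: "k + 3 < L" using k by (simp add: L_def p_def)
  define X where "X = orbn (excursion \<sigma> t M)"
  define Y where "Y = orbn \<sigma>"
  note aM = adm_exc[OF M]
  have aMn: "admissible (excursion \<sigma> t (M + n))" by (rule adm_exc) (use M in simp)
  have lenM: "length (excursion \<sigma> t M) = L + 1" "length (excursion \<sigma> t (M + n)) = L + s + 1"
    by (simp_all add: length_excursion L_def s_def p_def algebra_simps)
  have Yp: "Y (i + s) = Y i" for i
    using orb_period_mult[OF adm, of "int i" "2 * n"] by (simp add: Y_def orbn_def s_def p_def)
  have XL: "X (L + 1) = X 0" using orbn_period[OF aM, of 0] by (simp add: X_def lenM)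
  \<comment> \<open>\<open>s\<close> is a multiple of the period, so the labels fit. The full turns
    lose the side from \<open>Y (k + 1)\<close> to \<open>Y (k + 2)\<close>, which the connecting
    sides replace.\<close>
  define Q where "Q i = (if i \<le> k then X i else if i = k + 1 then a else if i \<le> k + 1 + s then Y i else if i = k + 2 + s then b else X (i - s))" for i
  have lab: "per (excursion \<sigma> t (M + n)) (int i) = per \<sigma> (int i)" if "i < L + s" for i
    using per_excursion[of i "M + n" \<sigma> t] that by (simp add: L_def s_def p_def algebra_simps)
  have labM: "per (excursion \<sigma> t M) (int i) = per \<sigma> (int i)" if "i < L" for i
    using per_excursion[of i M \<sigma> t] that by (simp add: L_def p_def)
  have pers: "per \<sigma> (int (i + s)) = per \<sigma> (int i)" for i
    using per_period_mult[of \<sigma> "int i" "2 * n"] by (simp add: s_def p_def)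
  have Qcl: "Q i \<in> cl (per (excursion \<sigma> t (M + n)) (int i))" if i: "i < L + s + 1" for i
  proof -
    consider "i \<le> k" | "i = k + 1" | "k + 2 \<le> i" "i \<le> k + 1 + s" | "i = k + 2 + s" | "k + 3 + s \<le> i" "i < L + s" | "i = L + s"
      using i by linarith
    then show ?thesis
    proof cases
      case 1
      then show ?thesis using lab[of i] labM[of i] kL orbn_cl[OF aM, of i] by (simp add: Q_def X_def)
    next
      case 2
      then show ?thesis using lab[of i] kL a by (simp add: Q_def add.commute)
    next
      case 3
      then show ?thesis using lab[of i] kL orbn_cl[OF adm, of i] by (simp add: Q_def Y_def)
    next
      case 4
      have "per \<sigma> (int i) = per \<sigma> (int k + 2)" using pers[of "k + 2"] 4 by (simp add: add.commute)
      then show ?thesis using lab[of i] kL b 4 by (simp add: Q_def)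
    next
      case 5
      then have "per \<sigma> (int i) = per \<sigma> (int (i - s))" using pers[of "i - s"] by simp
      then show ?thesis using lab[of i] labM[of "i - s"] 5 orbn_cl[OF aM, of "i - s"] by (simp add: Q_def X_def)
    next
      case 6
      have "per (excursion \<sigma> t (M + n)) (int (L + s)) = t" "per (excursion \<sigma> t M) (int L) = t"
        using per_excursion_last(1)[of \<sigma> t "M + n"] per_excursion_last(1)[of \<sigma> t M] by (simp_all add: L_def s_def p_def algebra_simps)
      then show ?thesis using 6 kL orbn_cl[OF aM, of L] by (simp add: Q_def X_def)
    qed
  qed
  have "real 1 * marked_length T (excursion \<sigma> t (M + n)) \<le> path_sum Q 0 (1 * length (excursion \<sigma> t (M + n)))"
    by (rule closed_path_minimal[OF aMn, where a = 0]) (use Qcl XL kL in \<open>auto simp: lenM Q_def\<close>)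
  then have min: "marked_length T (excursion \<sigma> t (M + n)) \<le> path_sum Q 0 (L + s + 1)" by (simp add: lenM)
  have e: "path_sum Q 0 (L + s + 1) = path_sum Q 0 k + path_sum Q k (Suc k) + path_sum Q (Suc k) (Suc (Suc k)) +
     path_sum Q (k + 2) (k + 1 + s) + path_sum Q (k + 1 + s) (Suc (k + 1 + s)) + path_sum Q (k + 2 + s) (Suc (k + 2 + s)) + path_sum Q (k + 3 + s) (L + s + 1)"
    using path_sum_split[of 0 k "L + s + 1" Q] path_sum_split[of k "Suc k" "L + s + 1" Q] path_sum_split[of "Suc k" "Suc (Suc k)" "L + s + 1" Q]
      path_sum_split[of "k + 2" "k + 1 + s" "L + s + 1" Q] path_sum_split[of "k + 1 + s" "Suc (k + 1 + s)" "L + s + 1" Q]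
      path_sum_split[of "k + 2 + s" "Suc (k + 2 + s)" "L + s + 1" Q] kL s by (simp add: numeral_eq_Suc)
  have e1: "path_sum Q 0 k = path_sum X 0 k" by (rule path_sum_cong) (simp add: Q_def)
  have e2: "path_sum Q k (Suc k) = norm (a - X k)" "path_sum Q (Suc k) (Suc (Suc k)) = norm (Y (k + 2) - a)"
    "path_sum Q (k + 1 + s) (Suc (k + 1 + s)) = norm (b - Y (k + 1))" "path_sum Q (k + 2 + s) (Suc (k + 2 + s)) = norm (X (k + 3) - b)"
    using s Yp[of "k + 1"] unfolding path_sum_Suc by (simp_all add: Q_def numeral_eq_Suc)
  have e3: "path_sum Q (k + 2) (k + 1 + s) = path_sum Y (k + 2) (k + 1 + s)" by (rule path_sum_cong) (simp add: Q_def)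
  have e4: "path_sum Q (k + 3 + s) (L + s + 1) = path_sum X (k + 3) (L + 1)"
  proof -
    have "path_sum Q (k + 3 + s) (L + 1 + s) = path_sum (\<lambda>i. Q (i + s)) (k + 3) (L + 1)" by (rule path_sum_shift[symmetric])
    also have "\<dots> = path_sum X (k + 3) (L + 1)" by (rule path_sum_cong) (simp add: Q_def)
    finally show ?thesis by (simp add: algebra_simps)
  qed
  have "path_sum Y (k + 1) (k + 1 + s) = real (2 * n) * marked_length T \<sigma>"
    using path_sum_period[OF adm, of "k + 1" "2 * n"] by (simp add: Y_def s_def p_def)
  moreover have "path_sum Y (k + 1) (k + 1 + s) = norm (Y (k + 2) - Y (k + 1)) + path_sum Y (k + 2) (k + 1 + s)"
    using path_sum_split[of "k + 1" "Suc (k + 1)" "k + 1 + s" Y] s path_sum_Suc[of Y "k + 1"] by (simp add: numeral_eq_Suc)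
  moreover have "marked_length T (excursion \<sigma> t M) = path_sum X 0 (L + 1)"
    using marked_length_path[OF aM] by (simp add: X_def lenM)
  moreover have "path_sum X 0 (L + 1) = path_sum X 0 k + norm (X (k + 1) - X k) + norm (X (k + 2) - X (k + 1)) + norm (X (k + 3) - X (k + 2)) + path_sum X (k + 3) (L + 1)"
    using path_sum_split[of 0 k "L + 1" X] path_sum_split[of k "Suc k" "L + 1" X] path_sum_split[of "Suc k" "Suc (Suc k)" "L + 1" X]
      path_sum_split[of "Suc (Suc k)" "Suc (Suc (Suc k))" "L + 1" X] kL by (simp add: path_sum_Suc numeral_eq_Suc)
  ultimately have fin: "norm (X (k + 1) - X k) + norm (X (k + 2) - X (k + 1)) + norm (Y (k + 2) - Y (k + 1)) + norm (X (k + 3) - X (k + 2)) \<le>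
    excess T \<sigma> t n M + (norm (a - X k) + norm (Y (k + 2) - a) + norm (b - Y (k + 1)) + norm (X (k + 3) - b))"
    using min unfolding e e1 e2 e3 e4 excess_def by simp
  have "X k = x j" "X (k + 1) = x (j + 1)" "X (k + 2) = x (j + 2)" "X (k + 3) = x (j + 3)" "Y (k + 1) = y (j + 1)" "Y (k + 2) = y (j + 2)"
    by (simp_all add: X_def Y_def x_def y_def j_def orbn_def add.commute)
  then show ?thesis using fin by simp
qed

text \<open>Cutting the long excursion orbit at \<open>k\<close> and again \<open>s\<close> steps
  later yields a closed polygon for the short word and one with \<open>2 * n\<close> turns of
  \<open>\<sigma>\<close>, both bounded below by the corresponding orbits. The two orbits that are
  reconnected are the long orbit and its own shift.\<close>

lemma splice_remove:
  assumes M: "1 \<le> M" and n: "1 \<le> n" and k: "k + 3 < 2 * M * length \<sigma>"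
    and a: "a \<in> cl (per \<sigma> (int k + 1))" and b: "b \<in> cl (per \<sigma> (int k + 2))"
  defines "x \<equiv> orb (excursion \<sigma> t (M + n))" and "y \<equiv> (\<lambda>j. orb (excursion \<sigma> t (M + n)) (j + int (2 * n * length \<sigma>)))" and "j \<equiv> int k"
  shows "norm (x (j + 1) - x j) + norm (x (j + 2) - x (j + 1)) + norm (y (j + 2) - y (j + 1)) + norm (x (j + 3) - x (j + 2)) + excess T \<sigma> t n M \<le>
    norm (a - x j) + norm (y (j + 2) - a) + norm (b - y (j + 1)) + norm (x (j + 3) - b)"
proof -
  define p where "p = length \<sigma>"
  define s where "s = 2 * n * p"
  define L where "L = 2 * M * p"
  have p: "2 \<le> p" using length2 by (simp add: p_def)
  have s: "2 \<le> s" using n p mult_le_mono[of 1 "2 * n" 2 p] by (simp add: s_def)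
  have kL: "k + 3 < L" using k by (simp add: L_def p_def)
  define X where "X = orbn (excursion \<sigma> t (M + n))"
  note aM = adm_exc[OF M]
  have aMn: "admissible (excursion \<sigma> t (M + n))" by (rule adm_exc) (use M in simp)
  have lenM: "length (excursion \<sigma> t M) = L + 1" "length (excursion \<sigma> t (M + n)) = L + s + 1"
    by (simp_all add: length_excursion L_def s_def p_def algebra_simps)
  have XL: "X (L + s + 1) = X 0" using orbn_period[OF aMn, of 0] by (simp add: X_def lenM)
  have lab: "per (excursion \<sigma> t (M + n)) (int i) = per \<sigma> (int i)" if "i < L + s" for i
    using per_excursion[of i "M + n" \<sigma> t] that by (simp add: L_def s_def p_def algebra_simps)
  have labM: "per (excursion \<sigma> t M) (int i) = per \<sigma> (int i)" if "i < L" for i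
    using per_excursion[of i M \<sigma> t] that by (simp add: L_def p_def)
  have pers: "per \<sigma> (int (i + s)) = per \<sigma> (int i)" for i
    using per_period_mult[of \<sigma> "int i" "2 * n"] by (simp add: s_def p_def)
  \<comment> \<open>The outer polygon, with \<open>a\<close> in place of \<open>X (k + 1)\<close>
    and \<open>s\<close> points skipped.\<close>
  define Q where "Q i = (if i \<le> k then X i else if i = k + 1 then a else X (i + s))" for i
  have Qcl: "Q i \<in> cl (per (excursion \<sigma> t M) (int i))" if i: "i < L + 1" for i
  proof -
    consider "i \<le> k" | "i = k + 1" | "k + 2 \<le> i" "i < L" | "i = L" using i by linarith
    then show ?thesis
    proof cases
      case 1
      then show ?thesis using lab[of i] labM[of i] kL orbn_cl[OF aMn, of i] by (simp add: Q_def X_def)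
    next
      case 2
      then show ?thesis using labM[of i] kL a by (simp add: Q_def add.commute)
    next
      case 3
      then show ?thesis using lab[of "i + s"] labM[of i] pers[of i] orbn_cl[OF aMn, of "i + s"] by (simp add: Q_def X_def)
    next
      case 4
      have "per (excursion \<sigma> t (M + n)) (int (L + s)) = t" "per (excursion \<sigma> t M) (int L) = t"
        using per_excursion_last(1)[of \<sigma> t "M + n"] per_excursion_last(1)[of \<sigma> t M] by (simp_all add: L_def s_def p_def algebra_simps)
      then show ?thesis using 4 kL orbn_cl[OF aMn, of "L + s"] by (simp add: Q_def X_def)
    qed
  qed
  have "real 1 * marked_length T (excursion \<sigma> t M) \<le> path_sum Q 0 (1 * length (excursion \<sigma> t M))"
    by (rule closed_path_minimal[OF aM, where a = 0]) (use Qcl XL kL in \<open>auto simp: lenM Q_def add.commute add.left_commute\<close>)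
  then have min: "marked_length T (excursion \<sigma> t M) \<le> path_sum Q 0 (L + 1)" by (simp add: lenM)
  \<comment> \<open>The piece cut out, closed up at \<open>b\<close>, which replaces
    \<open>X (k + 2)\<close>.\<close>
  define R where "R i = (if i = 0 \<or> i = s then b else X (k + 2 + i))" for i
  have ss: "s = 2 * n * length \<sigma>" by (simp add: s_def p_def)
  have Rcl: "R i \<in> cl (per \<sigma> (int (k + 2 + i)))" if i: "i < s" for i
  proof (cases "i = 0")
    case True
    then show ?thesis using b by (simp add: R_def add.commute)
  next
    case False
    then show ?thesis using lab[of "k + 2 + i"] kL i orbn_cl[OF aMn, of "k + 2 + i"] by (simp add: R_def X_def)
  qed
  have min2: "real (2 * n) * marked_length T \<sigma> \<le> path_sum R 0 s"
    unfolding ss by (rule closed_path_minimal[OF adm, where a = "k + 2"]) (use Rcl in \<open>auto simp: ss[symmetric] R_def\<close>)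
  have e: "path_sum Q 0 (L + 1) = path_sum Q 0 k + path_sum Q k (Suc k) + path_sum Q (Suc k) (Suc (Suc k)) + path_sum Q (k + 2) (L + 1)"
    using path_sum_split[of 0 k "L + 1" Q] path_sum_split[of k "Suc k" "L + 1" Q] path_sum_split[of "Suc k" "Suc (Suc k)" "L + 1" Q] kL
    by (simp add: numeral_eq_Suc)
  have e1: "path_sum Q 0 k = path_sum X 0 k" by (rule path_sum_cong) (simp add: Q_def)
  have e2: "path_sum Q k (Suc k) = norm (a - X k)" "path_sum Q (Suc k) (Suc (Suc k)) = norm (X (k + 2 + s) - a)"
    unfolding path_sum_Suc by (simp_all add: Q_def numeral_eq_Suc)
  have e3: "path_sum Q (k + 2) (L + 1) = path_sum X (k + 2 + s) (L + 1 + s)"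
  proof -
    have "path_sum Q (k + 2) (L + 1) = path_sum (\<lambda>i. X (i + s)) (k + 2) (L + 1)" by (rule path_sum_cong) (simp add: Q_def)
    also have "\<dots> = path_sum X (k + 2 + s) (L + 1 + s)" by (rule path_sum_shift)
    finally show ?thesis .
  qed
  have f: "path_sum R 0 s = path_sum R 0 (Suc 0) + path_sum R 1 (s - 1) + path_sum R (s - 1) (Suc (s - 1))"
    using path_sum_split[of 0 "Suc 0" s R] path_sum_split[of 1 "s - 1" s R] s by simp
  have f1: "path_sum R 0 (Suc 0) = norm (X (k + 3) - b)" "path_sum R (s - 1) (Suc (s - 1)) = norm (b - X (k + 1 + s))"
    using s unfolding path_sum_Suc by (auto simp: R_def numeral_eq_Suc)
  have f2: "path_sum R 1 (s - 1) = path_sum X (k + 3) (k + 1 + s)"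
  proof -
    have "path_sum R 1 (s - 1) = path_sum (\<lambda>i. X (i + (k + 2))) 1 (s - 1)"
      by (rule path_sum_cong) (use s in \<open>auto simp: R_def add.commute\<close>)
    also have "\<dots> = path_sum X (1 + (k + 2)) (s - 1 + (k + 2))" by (rule path_sum_shift)
    also have "1 + (k + 2) = k + 3" by simp
    also have "s - 1 + (k + 2) = k + 1 + s" using s by simp
    finally show ?thesis .
  qed
  have "marked_length T (excursion \<sigma> t (M + n)) = path_sum X 0 (L + s + 1)"
    using marked_length_path[OF aMn] by (simp add: X_def lenM)
  moreover have "path_sum X 0 (L + s + 1) = path_sum X 0 k + norm (X (k + 1) - X k) + norm (X (k + 2) - X (k + 1)) + norm (X (k + 3) - X (k + 2)) +
      path_sum X (k + 3) (k + 1 + s) + norm (X (k + 2 + s) - X (k + 1 + s)) + path_sum X (k + 2 + s) (L + 1 + s)"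
    using path_sum_split[of 0 k "L + s + 1" X] path_sum_split[of k "Suc k" "L + s + 1" X] path_sum_split[of "Suc k" "Suc (Suc k)" "L + s + 1" X]
      path_sum_split[of "Suc (Suc k)" "Suc (Suc (Suc k))" "L + s + 1" X] path_sum_split[of "k + 3" "k + 1 + s" "L + s + 1" X]
      path_sum_split[of "k + 1 + s" "Suc (k + 1 + s)" "L + s + 1" X] kL s by (simp add: path_sum_Suc numeral_eq_Suc)
  ultimately have fin: "norm (X (k + 1) - X k) + norm (X (k + 2) - X (k + 1)) + norm (X (k + 2 + s) - X (k + 1 + s)) + norm (X (k + 3) - X (k + 2)) + excess T \<sigma> t n M \<le>
    norm (a - X k) + norm (X (k + 2 + s) - a) + norm (b - X (k + 1 + s)) + norm (X (k + 3) - b)"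
    using min min2 unfolding e e1 e2 e3 f f1 f2 excess_def by simp
  have "X k = x j" "X (k + 1) = x (j + 1)" "X (k + 2) = x (j + 2)" "X (k + 3) = x (j + 3)" "X (k + 1 + s) = y (j + 1)" "X (k + 2 + s) = y (j + 2)"
    by (simp_all add: X_def x_def y_def j_def orbn_def ss algebra_simps)
  then show ?thesis using fin by simp
qed

end

end

section \<open>Asymptotics of the excess\<close>

lemma alternating_sign:
  fixes f :: "nat \<Rightarrow> real"
  assumes alt: "\<And>k. m \<le> k \<Longrightarrow> k < n \<Longrightarrow> f k * f (Suc k) < 0" and m: "f m \<noteq> 0" and mn: "m \<le> n"
  shows "0 < (- 1) ^ (n - m) * (f m * f n)"
  using mn alt
proof (induction n rule: dec_induct)
  case base
  then show ?case using m by (auto simp: zero_less_mult_iff neq_iff)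
next
  case (step n)
  then have IH: "0 < (- 1) ^ (n - m) * (f m * f n)" and a: "f n * f (Suc n) < 0" by auto
  from mult_pos_neg[OF this] have "(- 1) ^ (n - m) * (f m * f (Suc n)) * (f n)\<^sup>2 < 0"
    by (simp add: power2_eq_square algebra_simps)
  then have "(- 1) ^ (n - m) * (f m * f (Suc n)) < 0" by (simp add: mult_less_0_iff)
  then show ?case using step(1) by (simp add: Suc_diff_le)
qed

context table
begin

lemma star_shad: "admissible \<sigma> \<Longrightarrow> 0 < \<delta> \<Longrightarrow> shad \<sigma> \<delta> m n (orb \<sigma>) (\<lambda>k. spar \<sigma> (int k))"
  using orb_refl[of \<sigma>] bd_spar unfolding shad_def per_def by auto

lemma shad_shift:
  assumes adm: "admissible \<sigma>" and X: "shad \<sigma> \<delta> m' n' x r" and m: "m' \<le> m + c * length \<sigma>" "n + c * length \<sigma> \<le> n'"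
  shows "shad \<sigma> \<delta> m n (\<lambda>j. x (j + int (c * length \<sigma>))) (\<lambda>k. r (k + c * length \<sigma>))"
proof -
  define s where "s = c * length \<sigma>"
  obtain \<rho> where \<rho>: "refl_seq T \<rho> x" "\<And>k. k \<in> {m'..n'} \<Longrightarrow> \<rho> (int k) = per \<sigma> (int k)"
    and b: "\<And>k. k \<in> {m'..n'} \<Longrightarrow> bd (per \<sigma> (int k)) (r k) = x (int k) \<and> \<bar>r k - spar \<sigma> (int k)\<bar> < \<delta>"
    using X unfolding shad_def by blast
  have per: "per \<sigma> (int k + int s) = per \<sigma> (int k)" "spar \<sigma> (int k + int s) = spar \<sigma> (int k)" for k
    using per_period_mult[of \<sigma> "int k" c] spar_period_mult[OF adm, of "int k" c] by (simp_all add: s_def)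
  have r: "refl_seq T (\<lambda>j. \<rho> (j + int s)) (\<lambda>j. x (j + int s))" by (rule refl_seq_shift[OF \<rho>(1)])
  have in_range: "k + s \<in> {m'..n'}" if "k \<in> {m..n}" for k using that m unfolding s_def by auto
  have "\<rho> (int k + int s) = per \<sigma> (int k)" "bd (per \<sigma> (int k)) (r (k + s)) = x (int k + int s)" "\<bar>r (k + s) - spar \<sigma> (int k)\<bar> < \<delta>"
    if "k \<in> {m..n}" for k
    using \<rho>(2)[OF in_range[OF that]] b[OF in_range[OF that]] per by simp_all
  then show ?thesis unfolding shad_def s_def[symmetric] using r by blast
qed

text \<open>The choice depends on the orbit and the index only, so the parameters agree on
  overlapping windows; a candidate within half a perimeter of \<open>spar\<close> is the chosen one
  by \<open>lift_eq\<close>.\<close>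

definition lift :: "3 list \<Rightarrow> (int \<Rightarrow> complex) \<Rightarrow> nat \<Rightarrow> real" where
  "lift \<sigma> x k = (SOME s. s \<in> {spar \<sigma> (int k) - perim T (per \<sigma> (int k)) / 2..<spar \<sigma> (int k) - perim T (per \<sigma> (int k)) / 2 + perim T (per \<sigma> (int k))} \<and>
     bd (per \<sigma> (int k)) s = x (int k))"

lemma lift_eq:
  assumes "\<bar>s - spar \<sigma> (int k)\<bar> < perim T (per \<sigma> (int k)) / 2" "bd (per \<sigma> (int k)) s = x (int k)"
  shows "lift \<sigma> x k = s"
  unfolding lift_def
proof (rule some_equality)
  define c where "c = spar \<sigma> (int k) - perim T (per \<sigma> (int k)) / 2"
  have s: "s \<in> {c..<c + perim T (per \<sigma> (int k))}" 
    using assms(1) unfolding c_def atLeastLessThan_iff by linarith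
  then show "s \<in> {spar \<sigma> (int k) - perim T (per \<sigma> (int k)) / 2..<spar \<sigma> (int k) - perim T (per \<sigma> (int k)) / 2 + perim T (per \<sigma> (int k))} \<and> bd (per \<sigma> (int k)) s = x (int k)"
    using assms(2) by (simp add: c_def)
  fix s' assume s': "s' \<in> {spar \<sigma> (int k) - perim T (per \<sigma> (int k)) / 2..<spar \<sigma> (int k) - perim T (per \<sigma> (int k)) / 2 + perim T (per \<sigma> (int k))} \<and> bd (per \<sigma> (int k)) s' = x (int k)"
  show "s' = s"
    by (rule bd_inj_window[OF _ s]) (use s' assms(2) in \<open>auto simp: c_def\<close>)
qed

context
  fixes \<sigma> :: "3 list" and t :: 3
  assumes adm: "admissible \<sigma>" and t: "t \<noteq> \<sigma> ! 0" "t \<noteq> \<sigma> ! (length \<sigma> - 1)"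
begin

abbreviation exo where "exo M \<equiv> orb (excursion \<sigma> t M)"

lemma exo_refl: "1 \<le> M \<Longrightarrow> refl_seq T (per (excursion \<sigma> t M)) (exo M)"
  using orb_refl[OF adm_exc[OF adm t]] by (simp add: per_def)

lemma orb_refl_per: "refl_seq T (per \<sigma>) (orb \<sigma>)"
  using orb_refl[OF adm] by (simp add: per_def)

text \<open>At a fixed number of letters away from both ends of the block the excursion orbit shares
  a long window of labels with the orbit of \<open>\<sigma>\<close>, hence is close to it. The
  number \<open>K\<close> is independent of \<open>M\<close>.\<close>

lemma lift_shad:
  assumes \<delta>: "0 < \<delta>"
  shows "\<exists>K. \<forall>M m n. 1 \<le> M \<longrightarrow> K \<le> m \<longrightarrow> n + K < 2 * M * length \<sigma> \<longrightarrow> shad \<sigma> \<delta> m n (exo M) (lift \<sigma> (exo M))"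
proof -
  have "\<exists>d>0. \<forall>i\<in>UNIV. d \<le> perim T i / 2"
    by (rule finite_uniform_pos) (use perim_pos in \<open>auto intro: exI[of _ "perim T _ / 2"]\<close>)
  then obtain d where d: "d > 0" "\<And>i. d \<le> perim T i / 2" by blast
  \<comment> \<open>Below half of every perimeter the nearby parameter is the one selected by
    \<open>lift\<close>.\<close>
  define \<delta>' where "\<delta>' = min \<delta> d"
  have \<delta>': "0 < \<delta>'" "\<delta>' \<le> \<delta>" "\<delta>' \<le> d" using \<delta> d(1) by (simp_all add: \<delta>'_def)
  obtain \<eta> where \<eta>: "\<eta> > 0" "\<And>i s0 s. norm (bd i s - bd i s0) < \<eta> \<Longrightarrow> \<exists>s'. \<bar>s' - s0\<bar> < \<delta>' \<and> bd i s' = bd i s"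
    using param_close[OF \<delta>'(1)] by blast
  obtain K where K: "\<And>\<rho> q \<rho>' q' a. refl_seq T \<rho> q \<Longrightarrow> refl_seq T \<rho>' q' \<Longrightarrow>
    (\<And>j. \<bar>j - a\<bar> \<le> int K \<Longrightarrow> \<rho> j = \<rho>' j) \<Longrightarrow> norm (q' a - q a) < \<eta>"
    using label_closeness[OF \<eta>(1)] by blast
  have "shad \<sigma> \<delta> m n (exo M) (lift \<sigma> (exo M))" if M: "1 \<le> M" and m: "K \<le> m" and n: "n + K < 2 * M * length \<sigma>" for M m n
  proof -
    have lab: "per (excursion \<sigma> t M) j = per \<sigma> j" if "0 \<le> j" "j < int (2 * M * length \<sigma>)" for j
    proof -
      have "nat j < 2 * M * length \<sigma>" using that nat_less_iff by blast
      from per_excursion[OF this, of t] show ?thesis using that(1) by simp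
    qed
    have pt: "bd (per \<sigma> (int k)) (lift \<sigma> (exo M) k) = exo M (int k) \<and> \<bar>lift \<sigma> (exo M) k - spar \<sigma> (int k)\<bar> < \<delta>"
      if k: "k \<in> {m..n}" for k
    proof -
      have "norm (exo M (int k) - orb \<sigma> (int k)) < \<eta>"
      proof (rule K[OF orb_refl_per exo_refl[OF M]])
        fix j assume j: "\<bar>j - int k\<bar> \<le> int K"
        have "int n + int K < int (2 * M * length \<sigma>)" using n by (simp only: of_nat_add[symmetric] of_nat_less_iff)
        moreover have "int k \<le> int n" "int K \<le> int k" using k m by auto
        ultimately show "per \<sigma> j = per (excursion \<sigma> t M) j" using j by (intro lab[symmetric]) linarith+
      qed
      moreover have "orb \<sigma> (int k) = bd (per \<sigma> (int k)) (spar \<sigma> (int k))" using bd_spar[OF adm] by simp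
      moreover obtain s where s: "exo M (int k) = bd (per \<sigma> (int k)) s"
      proof -
        have "k < 2 * M * length \<sigma>" using k n by simp
        then have "exo M (int k) \<in> frontier (ob (per \<sigma> (int k)))"
          using refl_frontier[OF exo_refl[OF M], of "int k"] per_excursion[of k M \<sigma> t] by simp
        then show ?thesis using that by (rule frontier_bdE)
      qed
      ultimately obtain s' where s': "\<bar>s' - spar \<sigma> (int k)\<bar> < \<delta>'" "bd (per \<sigma> (int k)) s' = exo M (int k)"
        using \<eta>(2) by metis
      have "lift \<sigma> (exo M) k = s'"
        by (rule lift_eq) (use s' \<delta>'(3) d(2)[of "per \<sigma> (int k)"] in auto)
      then show ?thesis using s' \<delta>'(2) by simp
    qed
    show ?thesis unfolding shad_def
    proof (intro conjI exI[of _ "per (excursion \<sigma> t M)"] ballI)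
      show "refl_seq T (per (excursion \<sigma> t M)) (exo M)" by (rule exo_refl[OF M])
      show "per (excursion \<sigma> t M) (int k) = per \<sigma> (int k)" if "k \<in> {m..n}" for k 
        using per_excursion[of k M \<sigma> t] that n by simp
    qed (use pt in blast)+
  qed
  then show ?thesis by blast
qed

lemma exo_cl:
  assumes "1 \<le> M" "k < 2 * M * length \<sigma>" shows "exo M (int k) \<in> cl (per \<sigma> (int k))"
  using refl_cl[OF exo_refl[OF assms(1)], of "int k"] per_excursion[OF assms(2), of t] by simp

text \<open>\<open>exchange\<close> combined with the two splices: insertion bounds the excess from
  below, removal from above, and either bound improves where two consecutive differences do not have
  opposite signs.\<close>

lemma excess_bounds:
  obtains \<delta> c C where "0 < \<delta>" "0 < c" "0 < C"
    "\<And>n M k r. 1 \<le> M \<Longrightarrow> 1 \<le> n \<Longrightarrow> k + 3 < 2 * M * length \<sigma> \<Longrightarrow> shad \<sigma> \<delta> k (k + 3) (exo M) r \<Longrightarrow>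
      - (C * (\<bar>r (k + 1) - spar \<sigma> (int (k + 1))\<bar> * \<bar>r (k + 2) - spar \<sigma> (int (k + 2))\<bar>)) \<le> excess T \<sigma> t n M"
    "\<And>n M k r. 1 \<le> M \<Longrightarrow> 1 \<le> n \<Longrightarrow> k + 3 < 2 * M * length \<sigma> \<Longrightarrow> shad \<sigma> \<delta> k (k + 3) (exo M) r \<Longrightarrow>
      0 \<le> (r (k + 1) - spar \<sigma> (int (k + 1))) * (r (k + 2) - spar \<sigma> (int (k + 2))) \<Longrightarrow>
      c * ((r (k + 1) - spar \<sigma> (int (k + 1)))\<^sup>2 + (r (k + 2) - spar \<sigma> (int (k + 2)))\<^sup>2) \<le> excess T \<sigma> t n M"
    "\<And>n M k r r'. 1 \<le> M \<Longrightarrow> 1 \<le> n \<Longrightarrow> k + 3 < 2 * M * length \<sigma> \<Longrightarrow> shad \<sigma> \<delta> k (k + 3) (exo (M + n)) r \<Longrightarrow>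
      shad \<sigma> \<delta> k (k + 3) (\<lambda>j. exo (M + n) (j + int (2 * n * length \<sigma>))) r' \<Longrightarrow>
      excess T \<sigma> t n M \<le> C * (\<bar>r' (k + 1) - r (k + 1)\<bar> * \<bar>r' (k + 2) - r (k + 2)\<bar>)"
    "\<And>n M k r r'. 1 \<le> M \<Longrightarrow> 1 \<le> n \<Longrightarrow> k + 3 < 2 * M * length \<sigma> \<Longrightarrow> shad \<sigma> \<delta> k (k + 3) (exo (M + n)) r \<Longrightarrow>
      shad \<sigma> \<delta> k (k + 3) (\<lambda>j. exo (M + n) (j + int (2 * n * length \<sigma>))) r' \<Longrightarrow>
      0 \<le> (r' (k + 1) - r (k + 1)) * (r' (k + 2) - r (k + 2)) \<Longrightarrow>
      excess T \<sigma> t n M \<le> - (c * ((r' (k + 1) - r (k + 1))\<^sup>2 + (r' (k + 2) - r (k + 2))\<^sup>2))"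
proof -
  obtain \<delta> c C where E: "0 < \<delta>" "0 < c" "0 < C" "\<And>k x r x' r'. shad \<sigma> \<delta> k (k + 3) x r \<Longrightarrow> shad \<sigma> \<delta> k (k + 3) x' r' \<Longrightarrow>
    (let \<xi> = \<lambda>k. r' k - r k; j = int k in
    norm (x' (j + 2) - x (j + 1)) + norm (x (j + 2) - x' (j + 1)) \<le>
      norm (x (j + 2) - x (j + 1)) + norm (x' (j + 2) - x' (j + 1)) + C * (\<bar>\<xi> (k + 1)\<bar> * \<bar>\<xi> (k + 2)\<bar>) \<and>
    (0 \<le> \<xi> (k + 1) * \<xi> (k + 2) \<longrightarrow> (\<exists>a\<in>cl (per \<sigma> (j + 1)). \<exists>b\<in>cl (per \<sigma> (j + 2)).
      norm (a - x j) + norm (x' (j + 2) - a) + norm (b - x' (j + 1)) + norm (x (j + 3) - b) \<le>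
      norm (x (j + 1) - x j) + norm (x (j + 2) - x (j + 1)) + norm (x' (j + 2) - x' (j + 1)) + norm (x (j + 3) - x (j + 2))
       - c * ((\<xi> (k + 1))\<^sup>2 + (\<xi> (k + 2))\<^sup>2))))"
    using exchange[OF adm] by blast
  have mem: "exo M (int k + 1) \<in> cl (per \<sigma> (int k + 1))" "exo M (int k + 2) \<in> cl (per \<sigma> (int k + 2))"
    if "1 \<le> M" "k + 3 < 2 * M * length \<sigma>" for M k
    using exo_cl[OF that(1), of "k + 1"] exo_cl[OF that(1), of "k + 2"] that(2) by (simp_all add: add.commute)
  show ?thesis
  proof (rule that[OF E(1-3)])
    fix n M k :: nat and r assume A: "1 \<le> M" "1 \<le> n" "k + 3 < 2 * M * length \<sigma>" "shad \<sigma> \<delta> k (k + 3) (exo M) r"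
    note X = E(4)[OF A(4) star_shad[OF adm E(1)], unfolded Let_def]
    note I = splice_insert[OF adm t A(1-3)]
    show "- (C * (\<bar>r (k + 1) - spar \<sigma> (int (k + 1))\<bar> * \<bar>r (k + 2) - spar \<sigma> (int (k + 2))\<bar>)) \<le> excess T \<sigma> t n M"
      using conjunct1[OF X] I[OF mem[OF A(1,3)]] by (simp add: abs_minus_commute)
    assume pos: "0 \<le> (r (k + 1) - spar \<sigma> (int (k + 1))) * (r (k + 2) - spar \<sigma> (int (k + 2)))"
    have "0 \<le> (spar \<sigma> (int (k + 1)) - r (k + 1)) * (spar \<sigma> (int (k + 2)) - r (k + 2))"
      using pos by (simp add: algebra_simps)
    from conjunct2[OF X, rule_format, OF this] obtain a b where ab: "a \<in> cl (per \<sigma> (int k + 1))" "b \<in> cl (per \<sigma> (int k + 2))"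
      "norm (a - exo M (int k)) + norm (orb \<sigma> (int k + 2) - a) + norm (b - orb \<sigma> (int k + 1)) + norm (exo M (int k + 3) - b) \<le>
      norm (exo M (int k + 1) - exo M (int k)) + norm (exo M (int k + 2) - exo M (int k + 1)) + norm (orb \<sigma> (int k + 2) - orb \<sigma> (int k + 1)) + norm (exo M (int k + 3) - exo M (int k + 2))
       - c * ((spar \<sigma> (int (k + 1)) - r (k + 1))\<^sup>2 + (spar \<sigma> (int (k + 2)) - r (k + 2))\<^sup>2)" by blast
    show "c * ((r (k + 1) - spar \<sigma> (int (k + 1)))\<^sup>2 + (r (k + 2) - spar \<sigma> (int (k + 2)))\<^sup>2) \<le> excess T \<sigma> t n M"
      using ab(3) I[OF ab(1,2)] unfolding power2_commute[of "r _"] by linarith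
  next
    fix n M k :: nat and r r' assume A: "1 \<le> M" "1 \<le> n" "k + 3 < 2 * M * length \<sigma>" "shad \<sigma> \<delta> k (k + 3) (exo (M + n)) r"
      "shad \<sigma> \<delta> k (k + 3) (\<lambda>j. exo (M + n) (j + int (2 * n * length \<sigma>))) r'"
    note X = E(4)[OF A(4,5), unfolded Let_def]
    note R = splice_remove[OF adm t A(1-3)]
    have Mn: "1 \<le> M + n" "k + 3 < 2 * (M + n) * length \<sigma>" using A(1,3) by (auto simp: algebra_simps)
    show "excess T \<sigma> t n M \<le> C * (\<bar>r' (k + 1) - r (k + 1)\<bar> * \<bar>r' (k + 2) - r (k + 2)\<bar>)"
      using conjunct1[OF X] R[OF mem[OF Mn]] by linarith
    assume pos: "0 \<le> (r' (k + 1) - r (k + 1)) * (r' (k + 2) - r (k + 2))"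
    from conjunct2[OF X, rule_format, OF this] obtain a b where ab: "a \<in> cl (per \<sigma> (int k + 1))" "b \<in> cl (per \<sigma> (int k + 2))"
      "norm (a - exo (M + n) (int k)) + norm (exo (M + n) (int k + 2 + int (2 * n * length \<sigma>)) - a) + norm (b - exo (M + n) (int k + 1 + int (2 * n * length \<sigma>))) + norm (exo (M + n) (int k + 3) - b) \<le>
      norm (exo (M + n) (int k + 1) - exo (M + n) (int k)) + norm (exo (M + n) (int k + 2) - exo (M + n) (int k + 1)) +
      norm (exo (M + n) (int k + 2 + int (2 * n * length \<sigma>)) - exo (M + n) (int k + 1 + int (2 * n * length \<sigma>))) + norm (exo (M + n) (int k + 3) - exo (M + n) (int k + 2))
       - c * ((r' (k + 1) - r (k + 1))\<^sup>2 + (r' (k + 2) - r (k + 2))\<^sup>2)" by blast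
    show "excess T \<sigma> t n M \<le> - (c * ((r' (k + 1) - r (k + 1))\<^sup>2 + (r' (k + 2) - r (k + 2))\<^sup>2))"
      using ab(3) R[OF ab(1,2)] by linarith
  qed
qed

text \<open>Upper bound: cut in the middle of the block, far from both ends. Lower bound: some pair
  of consecutive differences fails to alternate, either against the periodic orbit or against the
  shifted excursion orbit; in the second case the given word is the long one, so the estimate
  concerns \<open>M - n\<close>.\<close>

lemma excess_asymptotics:
  obtains \<nu> where "1 < \<nu>" "marked_lyapunov T \<sigma> = ln \<nu>"
    "\<And>g n. 1 < g \<Longrightarrow> g < \<nu> \<Longrightarrow> 1 \<le> n \<Longrightarrow>
      \<exists>C M0. \<forall>M\<ge>M0. \<bar>excess T \<sigma> t n M\<bar> \<le> C * (g / \<nu>) ^ (2 * M * length \<sigma>)"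
    "\<And>g. 1 < g \<Longrightarrow> \<exists>n0. \<forall>n\<ge>n0. \<exists>c>0. \<exists>M0. \<forall>M\<ge>M0. c \<le> (g * \<nu>) ^ (2 * M * length \<sigma>) * \<bar>excess T \<sigma> t n M\<bar> \<or>
      n \<le> M \<and> c \<le> (g * \<nu>) ^ (2 * M * length \<sigma>) * \<bar>excess T \<sigma> t n (M - n)\<bar>"
proof -
  define p where "p = length \<sigma>"
  have p: "2 \<le> p" using adm by (simp add: p_def admissible_def)
  obtain \<delta>e c C where E: "0 < \<delta>e" "0 < c" "0 < C"
    "\<And>n M k r. 1 \<le> M \<Longrightarrow> 1 \<le> n \<Longrightarrow> k + 3 < 2 * M * length \<sigma> \<Longrightarrow> shad \<sigma> \<delta>e k (k + 3) (exo M) r \<Longrightarrow>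
      - (C * (\<bar>r (k + 1) - spar \<sigma> (int (k + 1))\<bar> * \<bar>r (k + 2) - spar \<sigma> (int (k + 2))\<bar>)) \<le> excess T \<sigma> t n M"
    "\<And>n M k r. 1 \<le> M \<Longrightarrow> 1 \<le> n \<Longrightarrow> k + 3 < 2 * M * length \<sigma> \<Longrightarrow> shad \<sigma> \<delta>e k (k + 3) (exo M) r \<Longrightarrow>
      0 \<le> (r (k + 1) - spar \<sigma> (int (k + 1))) * (r (k + 2) - spar \<sigma> (int (k + 2))) \<Longrightarrow>
      c * ((r (k + 1) - spar \<sigma> (int (k + 1)))\<^sup>2 + (r (k + 2) - spar \<sigma> (int (k + 2)))\<^sup>2) \<le> excess T \<sigma> t n M"
    "\<And>n M k r r'. 1 \<le> M \<Longrightarrow> 1 \<le> n \<Longrightarrow> k + 3 < 2 * M * length \<sigma> \<Longrightarrow> shad \<sigma> \<delta>e k (k + 3) (exo (M + n)) r \<Longrightarrow>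
      shad \<sigma> \<delta>e k (k + 3) (\<lambda>j. exo (M + n) (j + int (2 * n * length \<sigma>))) r' \<Longrightarrow>
      excess T \<sigma> t n M \<le> C * (\<bar>r' (k + 1) - r (k + 1)\<bar> * \<bar>r' (k + 2) - r (k + 2)\<bar>)"
    "\<And>n M k r r'. 1 \<le> M \<Longrightarrow> 1 \<le> n \<Longrightarrow> k + 3 < 2 * M * length \<sigma> \<Longrightarrow> shad \<sigma> \<delta>e k (k + 3) (exo (M + n)) r \<Longrightarrow>
      shad \<sigma> \<delta>e k (k + 3) (\<lambda>j. exo (M + n) (j + int (2 * n * length \<sigma>))) r' \<Longrightarrow>
      0 \<le> (r' (k + 1) - r (k + 1)) * (r' (k + 2) - r (k + 2)) \<Longrightarrow>
      excess T \<sigma> t n M \<le> - (c * ((r' (k + 1) - r (k + 1))\<^sup>2 + (r' (k + 2) - r (k + 2))\<^sup>2))"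
    using excess_bounds by blast
  obtain \<nu> where \<nu>: "1 < \<nu>" "marked_lyapunov T \<sigma> = ln \<nu>" and growth:
    "\<And>g. 1 < g \<Longrightarrow> \<exists>\<delta>>0. \<exists>K>0. \<forall>m n x r x' r' k. shad \<sigma> \<delta> m n x r \<longrightarrow> shad \<sigma> \<delta> m n x' r' \<longrightarrow> m \<le> k \<longrightarrow> k < n \<longrightarrow>
      \<bar>r' m - r m\<bar> * \<bar>r' n - r n\<bar> \<le> K * (g * \<nu>) ^ (n - m) * (\<bar>r' k - r k\<bar> + \<bar>r' (Suc k) - r (Suc k)\<bar>)\<^sup>2 \<and>
      \<bar>r' k - r k\<bar> \<le> K * ((g / \<nu>) ^ (n - k) + (g / \<nu>) ^ (k - m))"
    using pair_growth[OF adm] by blast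
  have prep: "\<exists>\<delta> D K. 0 < \<delta> \<and> \<delta> \<le> \<delta>e \<and> 0 < D \<and>
    (\<forall>m n x r x' r' k. shad \<sigma> \<delta> m n x r \<longrightarrow> shad \<sigma> \<delta> m n x' r' \<longrightarrow> m \<le> k \<longrightarrow> k < n \<longrightarrow>
      \<bar>r' m - r m\<bar> * \<bar>r' n - r n\<bar> \<le> D * (g * \<nu>) ^ (n - m) * (\<bar>r' k - r k\<bar> + \<bar>r' (Suc k) - r (Suc k)\<bar>)\<^sup>2 \<and>
      \<bar>r' k - r k\<bar> \<le> D * ((g / \<nu>) ^ (n - k) + (g / \<nu>) ^ (k - m))) \<and>
    (\<forall>M m n. 1 \<le> M \<longrightarrow> K \<le> m \<longrightarrow> n + K < 2 * M * p \<longrightarrow> shad \<sigma> \<delta> m n (exo M) (lift \<sigma> (exo M)))" if g: "1 < g" for g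
  proof -
    obtain \<delta>g D where G: "0 < \<delta>g" "0 < D" "\<And>m n x r x' r' k. shad \<sigma> \<delta>g m n x r \<Longrightarrow> shad \<sigma> \<delta>g m n x' r' \<Longrightarrow> m \<le> k \<Longrightarrow> k < n \<Longrightarrow>
      \<bar>r' m - r m\<bar> * \<bar>r' n - r n\<bar> \<le> D * (g * \<nu>) ^ (n - m) * (\<bar>r' k - r k\<bar> + \<bar>r' (Suc k) - r (Suc k)\<bar>)\<^sup>2 \<and>
      \<bar>r' k - r k\<bar> \<le> D * ((g / \<nu>) ^ (n - k) + (g / \<nu>) ^ (k - m))" using growth[OF g] by blast
    define \<delta> where "\<delta> = min \<delta>e \<delta>g"
    have \<delta>: "0 < \<delta>" "\<delta> \<le> \<delta>e" "\<delta> \<le> \<delta>g" using E(1) G(1) by (auto simp: \<delta>_def)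
    obtain K where K: "\<forall>M m n. 1 \<le> M \<longrightarrow> K \<le> m \<longrightarrow> n + K < 2 * M * length \<sigma> \<longrightarrow> shad \<sigma> \<delta> m n (exo M) (lift \<sigma> (exo M))"
      using lift_shad[OF \<delta>(1)] by blast
    show ?thesis
    proof (intro exI conjI)
      show "\<forall>m n x r x' r' k. shad \<sigma> \<delta> m n x r \<longrightarrow> shad \<sigma> \<delta> m n x' r' \<longrightarrow> m \<le> k \<longrightarrow> k < n \<longrightarrow>
      \<bar>r' m - r m\<bar> * \<bar>r' n - r n\<bar> \<le> D * (g * \<nu>) ^ (n - m) * (\<bar>r' k - r k\<bar> + \<bar>r' (Suc k) - r (Suc k)\<bar>)\<^sup>2 \<and>
      \<bar>r' k - r k\<bar> \<le> D * ((g / \<nu>) ^ (n - k) + (g / \<nu>) ^ (k - m))"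
        using G(3)[OF shad_mono[OF _ order_refl order_refl \<delta>(3)] shad_mono[OF _ order_refl order_refl \<delta>(3)]] by blast
    qed (use \<delta> G(2) K in \<open>auto simp: p_def\<close>)
  qed
  have upper: "\<exists>C M0. \<forall>M\<ge>M0. \<bar>excess T \<sigma> t n M\<bar> \<le> C * (g / \<nu>) ^ (2 * M * length \<sigma>)"
    if g: "1 < g" "g < \<nu>" and n: "1 \<le> n" for g n
  proof -
    obtain \<delta> D K where S: "0 < \<delta>" "\<delta> \<le> \<delta>e" "0 < D"
      and gr: "\<And>m n x r x' r' k. shad \<sigma> \<delta> m n x r \<Longrightarrow> shad \<sigma> \<delta> m n x' r' \<Longrightarrow> m \<le> k \<Longrightarrow> k < n \<Longrightarrow>
        \<bar>r' k - r k\<bar> \<le> D * ((g / \<nu>) ^ (n - k) + (g / \<nu>) ^ (k - m))"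
      and sh: "\<And>M m n. 1 \<le> M \<Longrightarrow> K \<le> m \<Longrightarrow> n + K < 2 * M * p \<Longrightarrow> shad \<sigma> \<delta> m n (exo M) (lift \<sigma> (exo M))"
      using prep[OF g(1)] by metis
    define q where "q = g / \<nu>"
    have q: "0 < q" "q < 1" using g by (simp_all add: q_def)
    \<comment> \<open>Cutting at \<open>k = M * p\<close> loses a fixed number of indices: the
      exponents add up to \<open>2 * (k - K - 3) = 2 * M * p - (2 * K + 6)\<close>.\<close>
    define B where "B = C * (2 * D)\<^sup>2 / q ^ (2 * K + 6)"
    have "\<bar>excess T \<sigma> t n M\<bar> \<le> B * q ^ (2 * M * p)" if M: "K + 4 \<le> M" for M
    proof -
      define k where "k = M * p"
      have "2 * M \<le> M * p" using p by (simp add: mult.commute)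
      then have k: "K + 4 \<le> k" using M unfolding k_def by linarith
      define L where "L = 2 * M * p"
      have L: "L = 2 * k" by (simp add: L_def k_def)
      have M1: "1 \<le> M" using M by simp
      have mid: "\<bar>r' (k + 1) - r (k + 1)\<bar> * \<bar>r' (k + 2) - r (k + 2)\<bar> \<le> (2 * D)\<^sup>2 / q ^ (2 * K + 6) * q ^ L"
        if pair: "shad \<sigma> \<delta> K (L - 1 - K) x r" "shad \<sigma> \<delta> K (L - 1 - K) x' r'" for x r x' r'
      proof -
        \<comment> \<open>\<open>k + 1\<close> and \<open>k + 2\<close> are at least
          \<open>k - K - 3\<close> steps away from both ends of the window from \<open>K\<close> to
          \<open>L - 1 - K\<close>.\<close>
        have small: "\<bar>r' i - r i\<bar> \<le> 2 * D * q ^ (k - K - 3)" if i: "i = k + 1 \<or> i = k + 2" for i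
        proof -
          have r: "K \<le> i" "i < L - 1 - K" using i k L by auto
          have "q ^ (L - 1 - K - i) \<le> q ^ (k - K - 3)" "q ^ (i - K) \<le> q ^ (k - K - 3)"
            using q i k L by (auto intro!: power_decreasing)
          then have "D * (q ^ (L - 1 - K - i) + q ^ (i - K)) \<le> D * (2 * q ^ (k - K - 3))"
            using S(3) by (intro mult_left_mono) auto
          then show ?thesis using gr[OF pair r] unfolding q_def[symmetric] by simp
        qed
        have "\<bar>r' (k + 1) - r (k + 1)\<bar> * \<bar>r' (k + 2) - r (k + 2)\<bar> \<le> (2 * D * q ^ (k - K - 3)) * (2 * D * q ^ (k - K - 3))"
          using S(3) q by (intro mult_mono small) auto
        also have "\<dots> = (2 * D)\<^sup>2 * q ^ (2 * (k - K - 3))"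
          by (simp only: power2_eq_square mult_2 power_add mult.assoc mult.left_commute)
        also have "q ^ (2 * (k - K - 3)) = q ^ L / q ^ (2 * K + 6)"
        proof -
          have "2 * (k - K - 3) + (2 * K + 6) = L" using k L by simp
          then have "q ^ L = q ^ (2 * (k - K - 3)) * q ^ (2 * K + 6)" by (metis power_add)
          then show ?thesis using q by simp
        qed
        finally show ?thesis by simp
      qed
      have kM: "k + 3 < 2 * M * length \<sigma>" using k L by (simp add: L_def p_def)
      have "- (C * (\<bar>lift \<sigma> (exo M) (k + 1) - spar \<sigma> (int (k + 1))\<bar> * \<bar>lift \<sigma> (exo M) (k + 2) - spar \<sigma> (int (k + 2))\<bar>)) \<le> excess T \<sigma> t n M"
        by (rule E(4)[OF M1 n kM shad_mono[OF sh[OF M1, of k "k + 3"] order_refl order_refl S(2)]]) (use k L in \<open>auto simp: L_def\<close>)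
      moreover have "C * (\<bar>lift \<sigma> (exo M) (k + 1) - spar \<sigma> (int (k + 1))\<bar> * \<bar>lift \<sigma> (exo M) (k + 2) - spar \<sigma> (int (k + 2))\<bar>) \<le> B * q ^ L"
      proof -
        have "shad \<sigma> \<delta> K (L - 1 - K) (exo M) (lift \<sigma> (exo M))" by (rule sh[OF M1]) (use k L in \<open>auto simp: L_def\<close>)
        from mult_left_mono[OF mid[OF star_shad[OF adm S(1)] this] less_imp_le[OF E(3)]] show ?thesis by (simp add: B_def)
      qed
      moreover
      define r where "r = lift \<sigma> (exo (M + n))"
      define s where "s = 2 * n * length \<sigma>"
      have Mn: "1 \<le> M + n" "2 * (M + n) * p = L + s" using M1 by (simp_all add: L_def s_def p_def algebra_simps)
      have big: "shad \<sigma> \<delta> K (L + s - 1 - K) (exo (M + n)) r"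
        unfolding r_def by (rule sh[OF Mn(1) order_refl]) (use k L Mn(2) in auto)
      have sx: "shad \<sigma> \<delta> K (L - 1 - K) (exo (M + n)) r" by (rule shad_mono[OF big]) auto
      have sx': "shad \<sigma> \<delta> K (L - 1 - K) (\<lambda>j. exo (M + n) (j + int s)) (\<lambda>k. r (k + s))"
        unfolding s_def by (rule shad_shift[OF adm big]) (use k L in \<open>auto simp: s_def\<close>)
      have "excess T \<sigma> t n M \<le> C * (\<bar>r (k + 1 + s) - r (k + 1)\<bar> * \<bar>r (k + 2 + s) - r (k + 2)\<bar>)"
        by (rule E(6)[OF M1 n kM shad_mono[OF sx _ _ S(2)] shad_mono[OF sx'[unfolded s_def] _ _ S(2)], folded s_def]) (use k L in auto)
      moreover have "C * (\<bar>r (k + 1 + s) - r (k + 1)\<bar> * \<bar>r (k + 2 + s) - r (k + 2)\<bar>) \<le> B * q ^ L"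
        using mult_left_mono[OF mid[OF sx sx'] less_imp_le[OF E(3)]] by (simp add: B_def)
      ultimately show ?thesis unfolding L_def[symmetric] by linarith
    qed
    then show ?thesis unfolding q_def p_def by blast
  qed
  have lower: "\<exists>n0. \<forall>n\<ge>n0. \<exists>c>0. \<exists>M0. \<forall>M\<ge>M0. c \<le> (g * \<nu>) ^ (2 * M * length \<sigma>) * \<bar>excess T \<sigma> t n M\<bar> \<or>
      n \<le> M \<and> c \<le> (g * \<nu>) ^ (2 * M * length \<sigma>) * \<bar>excess T \<sigma> t n (M - n)\<bar>" if g: "1 < g" for g
  proof -
    obtain \<delta> D K where S: "0 < \<delta>" "\<delta> \<le> \<delta>e" "0 < D"
      and gr: "\<And>m n x r x' r' k. shad \<sigma> \<delta> m n x r \<Longrightarrow> shad \<sigma> \<delta> m n x' r' \<Longrightarrow> m \<le> k \<Longrightarrow> k < n \<Longrightarrow>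
        \<bar>r' m - r m\<bar> * \<bar>r' n - r n\<bar> \<le> D * (g * \<nu>) ^ (n - m) * (\<bar>r' k - r k\<bar> + \<bar>r' (Suc k) - r (Suc k)\<bar>)\<^sup>2"
      and sh: "\<And>M m n. 1 \<le> M \<Longrightarrow> K \<le> m \<Longrightarrow> n + K < 2 * M * p \<Longrightarrow> shad \<sigma> \<delta> m n (exo M) (lift \<sigma> (exo M))"
      using prep[OF g] by metis
    \<comment> \<open>The labels differ at index -1 and at index \<open>L\<close>. A depth of
      \<open>K + 2\<close> leaves room for the index before the cut, which \<open>exchange\<close>
      also needs in the shadowing window.\<close>
    obtain e1 where e1: "e1 > 0" "\<And>\<rho> q \<rho>' q' a. refl_seq T \<rho> q \<Longrightarrow> refl_seq T \<rho>' q' \<Longrightarrow> \<rho> a \<noteq> \<rho>' a \<Longrightarrow>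
      e1 \<le> norm (q (a + int (K + 2)) - q' (a + int (K + 2))) \<or> e1 \<le> norm (q (a + int (K + 2) + 1) - q' (a + int (K + 2) + 1))"
      using past_separation[of "K + 2"] by blast
    obtain e2 where e2: "e2 > 0" "\<And>\<rho> q \<rho>' q' a. refl_seq T \<rho> q \<Longrightarrow> refl_seq T \<rho>' q' \<Longrightarrow> \<rho> a \<noteq> \<rho>' a \<Longrightarrow>
      e2 \<le> norm (q (a - int (K + 2)) - q' (a - int (K + 2))) \<or> e2 \<le> norm (q (a - int (K + 2) - 1) - q' (a - int (K + 2) - 1))"
      using future_separation[of "K + 2"] by blast
    define e where "e = min e1 e2"
    have e: "0 < e" "e \<le> e1" "e \<le> e2" using e1(1) e2(1) by (auto simp: e_def)
    have e2pos: "0 < e / 2" using e(1) by simp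
    \<comment> \<open>At depth at least \<open>K2\<close> the differences are below half of the size
      \<open>e\<close> that they have near the ends.\<close>
    obtain K2 where K2: "\<And>M m n. 1 \<le> M \<Longrightarrow> K2 \<le> m \<Longrightarrow> n + K2 < 2 * M * p \<Longrightarrow> shad \<sigma> (e / 2) m n (exo M) (lift \<sigma> (exo M))"
      using lift_shad[OF e2pos] unfolding p_def by blast
    define Q where "Q = g * \<nu>"
    have Q: "1 < Q" using g \<nu>(1) by (simp add: Q_def less_1_mult)
    define c0 where "c0 = c * (e / 2)\<^sup>2 / (2 * D)"
    have c0: "0 < c0" using E(2) e(1) S(3) by (simp add: c0_def)
    \<comment> \<open>Large end values force a lower bound on the squares of the middle differences,
      and these bound the excess. The 2 in \<open>c0\<close> comes from \<open>(\<bar>w1\<bar> +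
      \<bar>w2\<bar>)\<^sup>2 \<le> 2 * (w1\<^sup>2 + w2\<^sup>2)\<close>.\<close>
    have conclude: "c0 \<le> Q ^ L * v"
      if uw: "e / 2 \<le> \<bar>u1\<bar>" "e / 2 \<le> \<bar>u2\<bar>" and "\<bar>u1\<bar> * \<bar>u2\<bar> \<le> D * Q ^ l * (\<bar>w1\<bar> + \<bar>w2\<bar>)\<^sup>2" "l \<le> L" "c * (w1\<^sup>2 + w2\<^sup>2) \<le> v"
      for u1 u2 w1 w2 v :: real and l L
    proof -
      have "(e / 2)\<^sup>2 \<le> \<bar>u1\<bar> * \<bar>u2\<bar>" unfolding power2_eq_square using uw e(1) by (intro mult_mono) auto
      also have "\<dots> \<le> D * Q ^ l * (\<bar>w1\<bar> + \<bar>w2\<bar>)\<^sup>2" by fact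
      also have "\<dots> \<le> D * Q ^ L * (2 * (w1\<^sup>2 + w2\<^sup>2))"
      proof (intro mult_mono mult_left_mono)
        show "Q ^ l \<le> Q ^ L" using Q that(4) by (intro power_increasing) auto
        show "(\<bar>w1\<bar> + \<bar>w2\<bar>)\<^sup>2 \<le> 2 * (w1\<^sup>2 + w2\<^sup>2)"
          using sum_squares_ge_zero[of "\<bar>w1\<bar> - \<bar>w2\<bar>" 0] by (simp add: power2_eq_square algebra_simps flip: abs_mult)
      qed (use S(3) Q in auto)
      finally have "c * (e / 2)\<^sup>2 \<le> c * (D * Q ^ L * (2 * (w1\<^sup>2 + w2\<^sup>2)))" using E(2) by (intro mult_left_mono) auto
      also have "\<dots> = D * Q ^ L * 2 * (c * (w1\<^sup>2 + w2\<^sup>2))" by simp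
      also have "\<dots> \<le> D * Q ^ L * 2 * v" using S(3) Q that(5) by (intro mult_left_mono) auto
      finally have "c * (e / 2)\<^sup>2 \<le> Q ^ L * v * (2 * D)" by (simp add: algebra_simps)
      then show ?thesis using S(3) unfolding c0_def by (simp add: pos_divide_le_eq)
    qed
    \<comment> \<open>\<open>n\<close> is so large that a shift by \<open>s\<close> carries the ends
      of the block into the region of small differences.\<close>
    have "\<exists>c>0. \<exists>M0. \<forall>M\<ge>M0. c \<le> (g * \<nu>) ^ (2 * M * length \<sigma>) * \<bar>excess T \<sigma> t n M\<bar> \<or>
      n \<le> M \<and> c \<le> (g * \<nu>) ^ (2 * M * length \<sigma>) * \<bar>excess T \<sigma> t n (M - n)\<bar>" if n: "K2 + 1 \<le> n" for n
    proof (rule exI[of _ c0], intro conjI c0, rule exI[of _ "2 * K + K2 + 2 * n * p + 10"], intro allI impI)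
      fix M assume M0: "2 * K + K2 + 2 * n * p + 10 \<le> M"
      define s where "s = 2 * n * p"
      define L where "L = 2 * M * p"
      have "M * 2 \<le> M * p" using p by (intro mult_le_mono) auto
      then have L: "2 * M \<le> L" unfolding L_def mult.assoc by linarith
      have ns: "n \<le> s" "K2 \<le> s" using p n by (auto simp: s_def intro: order_trans[of _ n])
      have M: "1 \<le> M" "n + 1 \<le> M" "2 * K + K2 + s + 10 \<le> L" using M0 ns(1) L unfolding s_def[symmetric] by linarith+
      define r where "r = lift \<sigma> (exo M)"
      define \<xi> where "\<xi> k = r k - spar \<sigma> (int k)" for k
      have shX: "shad \<sigma> \<delta> K (L - 1 - K) (exo M) r"
        unfolding r_def by (rule sh[OF M(1) order_refl]) (use M(3) in \<open>auto simp: L_def\<close>)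
      have shP: "shad \<sigma> \<delta> m n (orb \<sigma>) (\<lambda>k. spar \<sigma> (int k))" for m n by (rule star_shad[OF adm S(1)])
      have small: "\<bar>\<xi> k\<bar> < e / 2" if "K2 \<le> k" "k + K2 < L" for k
        using shad_near[OF K2[OF M(1), of k k], of k] that unfolding \<xi>_def r_def L_def by simp
      have far: "norm (exo M (int k) - orb \<sigma> (int k)) \<le> \<bar>\<xi> k\<bar>" if "K \<le> k" "k \<le> L - 1 - K" for k
        using bd_lipschitz[of "per \<sigma> (int k)" "r k" "spar \<sigma> (int k)"] shad_bd[OF shX that] bd_spar[OF adm, of "int k"]
        by (simp add: \<xi>_def)
      have lab: "per (excursion \<sigma> t M) (- 1) \<noteq> per \<sigma> (- 1)" "per (excursion \<sigma> t M) (int L) \<noteq> per \<sigma> (int L)"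
      proof -
        have "per \<sigma> (- 1) = per \<sigma> (- 1 + int (length \<sigma>))" by (rule per_period[symmetric])
        also have "\<dots> = per \<sigma> (int (length \<sigma> - 1))" using p by (simp add: p_def)
        also have "\<dots> = \<sigma> ! (length \<sigma> - 1)" unfolding per_def by (rule periodic_repetition_nat) (use p p_def in simp)
        finally show "per (excursion \<sigma> t M) (- 1) \<noteq> per \<sigma> (- 1)" using per_excursion_last(2) t(2) by metis
        have "per \<sigma> (int L) = per \<sigma> (0 + int (2 * M * length \<sigma>))" by (simp add: L_def p_def)
        also have "\<dots> = per \<sigma> 0" by (rule per_period_mult)
        also have "\<dots> = \<sigma> ! 0" 
        proof -
          have "0 < length \<sigma>" using p p_def by linarith
          then show ?thesis unfolding per_def using periodic_repetition_nat[of 0 \<sigma>] by simp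
        qed
        finally show "per (excursion \<sigma> t M) (int L) \<noteq> per \<sigma> (int L)"
          using per_excursion_last(1)[of \<sigma> t M] t(1) by (simp add: L_def p_def)
      qed
      obtain m where m: "m = K + 1 \<or> m = K + 2" "e \<le> \<bar>\<xi> m\<bar>"
      proof -
        have ix: "- 1 + int (K + 2) = int (K + 1)" "int (K + 1) + 1 = int (K + 2)" by simp_all
        have f: "norm (exo M (int (K + 1)) - orb \<sigma> (int (K + 1))) \<le> \<bar>\<xi> (K + 1)\<bar>"
          "norm (exo M (int (K + 2)) - orb \<sigma> (int (K + 2))) \<le> \<bar>\<xi> (K + 2)\<bar>"
          by (rule far; use M(3) in auto)+
        have "e1 \<le> norm (exo M (int (K + 1)) - orb \<sigma> (int (K + 1))) \<or> e1 \<le> norm (exo M (int (K + 2)) - orb \<sigma> (int (K + 2)))"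
          using e1(2)[OF exo_refl[OF M(1)] orb_refl_per lab(1)] by (simp only: ix)
        then have "e \<le> \<bar>\<xi> (K + 1)\<bar> \<or> e \<le> \<bar>\<xi> (K + 2)\<bar>"
          using f e(2) by linarith
        then show ?thesis using that by blast
      qed
      obtain N where N: "N = L - K - 2 \<or> N = L - K - 3" "e \<le> \<bar>\<xi> N\<bar>"
      proof -
        have ix: "int L - int (K + 2) = int (L - K - 2)" "int (L - K - 2) - 1 = int (L - K - 3)" using M(3) by auto
        have f: "norm (exo M (int (L - K - 2)) - orb \<sigma> (int (L - K - 2))) \<le> \<bar>\<xi> (L - K - 2)\<bar>"
          "norm (exo M (int (L - K - 3)) - orb \<sigma> (int (L - K - 3))) \<le> \<bar>\<xi> (L - K - 3)\<bar>"
          by (rule far; use M(3) in auto)+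
        have "e2 \<le> norm (exo M (int (L - K - 2)) - orb \<sigma> (int (L - K - 2))) \<or> e2 \<le> norm (exo M (int (L - K - 3)) - orb \<sigma> (int (L - K - 3)))"
          using e2(2)[OF exo_refl[OF M(1)] orb_refl_per lab(2)] by (simp only: ix)
        then have "e \<le> \<bar>\<xi> (L - K - 2)\<bar> \<or> e \<le> \<bar>\<xi> (L - K - 3)\<bar>"
          using f e(3) by linarith
        then show ?thesis using that by blast
      qed
      have idx: "K + 1 \<le> m" "m + s + 1 \<le> N" "N + 1 \<le> L - 1 - K" "N - m \<le> L" "N - s - m \<le> L" using m(1) N(1) M(3) by auto
      show "c0 \<le> (g * \<nu>) ^ (2 * M * length \<sigma>) * \<bar>excess T \<sigma> t n M\<bar> \<or>
        n \<le> M \<and> c0 \<le> (g * \<nu>) ^ (2 * M * length \<sigma>) * \<bar>excess T \<sigma> t n (M - n)\<bar>"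
      proof (cases "\<exists>k\<ge>m. k < N \<and> 0 \<le> \<xi> k * \<xi> (Suc k)")
        case True
        then obtain k where k: "m \<le> k" "k < N" "0 \<le> \<xi> k * \<xi> (Suc k)" by blast
        \<comment> \<open>\<open>exchange\<close> names its window by the index before the first
          vertex concerned.\<close>
        define b where "b = k - 1"
        have b: "b + 1 = k" "b + 2 = Suc k" "K \<le> b" "b + 3 \<le> L - 1 - K" "b + 3 < L" using k idx by (auto simp: b_def)
        have "c * ((r (b + 1) - spar \<sigma> (int (b + 1)))\<^sup>2 + (r (b + 2) - spar \<sigma> (int (b + 2)))\<^sup>2) \<le> excess T \<sigma> t n M"
        proof (rule E(5)[OF M(1)])
          show "1 \<le> n" using n by simp
          show "b + 3 < 2 * M * length \<sigma>" using b(5) by (simp add: L_def p_def)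
          show "shad \<sigma> \<delta>e b (b + 3) (exo M) r" by (rule shad_mono[OF shX b(3,4) S(2)])
          show "0 \<le> (r (b + 1) - spar \<sigma> (int (b + 1))) * (r (b + 2) - spar \<sigma> (int (b + 2)))"
            using k(3) unfolding b(1,2) \<xi>_def .
        qed
        then have gain: "c * ((\<xi> k)\<^sup>2 + (\<xi> (Suc k))\<^sup>2) \<le> \<bar>excess T \<sigma> t n M\<bar>"
          unfolding b(1,2) \<xi>_def by linarith
        have "shad \<sigma> \<delta> m N (exo M) r" by (rule shad_mono[OF shX]) (use idx in auto)
        from gr[OF shP this k(1,2)] have "\<bar>\<xi> m\<bar> * \<bar>\<xi> N\<bar> \<le> D * Q ^ (N - m) * (\<bar>\<xi> k\<bar> + \<bar>\<xi> (Suc k)\<bar>)\<^sup>2"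
          unfolding \<xi>_def Q_def .
        from conclude[OF _ _ this idx(4) gain] m(2) N(2) e(1) show ?thesis by (simp add: Q_def L_def p_def)
      next
        case False
        then have alt: "\<xi> k * \<xi> (Suc k) < 0" if "m \<le> k" "k < N" for k using that by (meson not_le)
        \<comment> \<open>The difference between the orbit and its own shift. At \<open>m\<close> it
          is dominated by \<open>- \<xi> m\<close>, at \<open>N - s\<close> by
          \<open>\<xi> N\<close>.\<close>
        define \<eta> where "\<eta> k = r (k + s) - r k" for k
        have \<eta>: "\<eta> k = \<xi> (k + s) - \<xi> k" for k
          using spar_period_mult[OF adm, of "int k" "2 * n"] by (simp add: \<eta>_def \<xi>_def s_def p_def)
        have \<xi>m0: "\<xi> m \<noteq> 0" using m(2) e(1) by auto
        have sm: "\<bar>\<xi> (m + s)\<bar> < e / 2" by (rule small) (use m(1) ns M(3) in auto)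
        have sN: "\<bar>\<xi> (N - s)\<bar> < e / 2" by (rule small) (use N(1) ns M(3) in auto)
        have sgn1: "0 < (- 1) ^ (N - m) * (\<xi> m * \<xi> N)"
          by (rule alternating_sign[OF alt \<xi>m0]) (use idx in auto)
        have \<eta>m: "e / 2 \<le> \<bar>\<eta> m\<bar>" "\<eta> m * \<xi> m < 0"
          using sm m(2) e(1) unfolding \<eta> by (auto simp: abs_if mult_less_0_iff split: if_splits)
        have NsN: "N - s + s = N" using idx by simp
        have \<eta>N: "e / 2 \<le> \<bar>\<eta> (N - s)\<bar>" "0 < \<eta> (N - s) * \<xi> N"
          using sN N(2) e(1) unfolding \<eta> NsN by (auto simp: abs_if zero_less_mult_iff split: if_splits)
        \<comment> \<open>If \<open>\<eta>\<close> alternated too, the relative sign of its end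
          values would follow the parity of \<open>N - s - m\<close>, while that of
          \<open>\<xi>\<close> follows the parity of \<open>N - m\<close>. These parities agree
          because \<open>s\<close> is even, but the end values of \<open>\<eta>\<close> have the
          opposite relative sign.\<close>
        have "\<exists>k\<ge>m. k < N - s \<and> 0 \<le> \<eta> k * \<eta> (Suc k)"
        proof (rule ccontr)
          assume "\<not> ?thesis"
          then have "\<eta> k * \<eta> (Suc k) < 0" if "m \<le> k" "k < N - s" for k using that by (meson not_le)
          moreover have "\<eta> m \<noteq> 0" using \<eta>m(1) e(1) by auto
          ultimately have "0 < (- 1) ^ (N - s - m) * (\<eta> m * \<eta> (N - s))"
            by (rule alternating_sign) (use idx in auto)
          moreover have "(- 1 :: real) ^ (N - m) = (- 1) ^ (N - s - m)"
          proof -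
            have "N - m = (N - s - m) + 2 * (n * p)" using idx by (simp add: s_def)
            then show ?thesis by (simp add: power_add)
          qed
          ultimately have 1: "0 < ((- 1) ^ (N - m) * (\<xi> m * \<xi> N)) * ((- 1) ^ (N - m) * (\<eta> m * \<eta> (N - s)))"
            using sgn1 by simp
          have 2: "((- 1) ^ (N - m) * (\<xi> m * \<xi> N)) * ((- 1) ^ (N - m) * (\<eta> m * \<eta> (N - s))) = (\<eta> m * \<xi> m) * (\<eta> (N - s) * \<xi> N)"
          proof -
            have "((- 1 :: real) ^ (N - m)) * (- 1) ^ (N - m) = 1" by (simp flip: power_mult_distrib)
            then show ?thesis by (simp add: algebra_simps)
          qed
          have "(\<eta> m * \<xi> m) * (\<eta> (N - s) * \<xi> N) < 0" using \<eta>m(2) \<eta>N(2) by (rule mult_neg_pos)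
          with 1 2 show False by simp
        qed
        then obtain k where k: "m \<le> k" "k < N - s" "0 \<le> \<eta> k * \<eta> (Suc k)" by blast
        define b where "b = k - 1"
        \<comment> \<open>The word with \<open>2 * M\<close> copies now plays the long one, so the
          excess is that of \<open>M - n\<close>.\<close>
        define M' where "M' = M - n"
        have M': "1 \<le> M'" "M' + n = M" "2 * M' * p + s = L"
          using M(2) by (auto simp: M'_def L_def s_def algebra_simps diff_mult_distrib2)
        have b: "b + 1 = k" "b + 2 = Suc k" "K \<le> b" "b + 3 + s \<le> L - 1 - K" "b + 3 < 2 * M' * p"
          using k idx M'(3) by (auto simp: b_def)
        have "excess T \<sigma> t n M' \<le> - (c * ((r (b + 1 + s) - r (b + 1))\<^sup>2 + (r (b + 2 + s) - r (b + 2))\<^sup>2))"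
        proof (rule E(7)[OF M'(1), where r' = "\<lambda>k. r (k + s)"])
          show "1 \<le> n" using n by simp
          show "b + 3 < 2 * M' * length \<sigma>" using b(5) by (simp add: p_def)
          show "shad \<sigma> \<delta>e b (b + 3) (exo (M' + n)) r" unfolding M'(2)
            by (rule shad_mono[OF shX b(3) _ S(2)]) (use b(4) in auto)
          show "shad \<sigma> \<delta>e b (b + 3) (\<lambda>j. exo (M' + n) (j + int (2 * n * length \<sigma>))) (\<lambda>k. r (k + s))"
            unfolding M'(2) s_def p_def
            by (rule shad_shift[OF adm shad_mono[OF shX order_refl order_refl S(2)]]) (use b(3,4) in \<open>auto simp: s_def p_def\<close>)
          show "0 \<le> (r (b + 1 + s) - r (b + 1)) * (r (b + 2 + s) - r (b + 2))"
            using k(3) unfolding b(1,2) \<eta>_def .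
        qed
        then have gain: "c * ((\<eta> k)\<^sup>2 + (\<eta> (Suc k))\<^sup>2) \<le> \<bar>excess T \<sigma> t n (M - n)\<bar>"
          unfolding b(1,2) \<eta>_def M'_def by linarith
        have sh1: "shad \<sigma> \<delta> m (N - s) (exo M) r" by (rule shad_mono[OF shX]) (use idx in auto)
        have sh2: "shad \<sigma> \<delta> m (N - s) (\<lambda>j. exo M (j + int (2 * n * length \<sigma>))) (\<lambda>k. r (k + 2 * n * length \<sigma>))"
          by (rule shad_shift[OF adm shX]) (use idx in \<open>auto simp: s_def p_def\<close>)
        from gr[OF sh1 sh2 k(1,2)] have "\<bar>\<eta> m\<bar> * \<bar>\<eta> (N - s)\<bar> \<le> D * Q ^ (N - s - m) * (\<bar>\<eta> k\<bar> + \<bar>\<eta> (Suc k)\<bar>)\<^sup>2"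
          unfolding \<eta>_def Q_def s_def p_def .
        from conclude[OF \<eta>m(1) \<eta>N(1) this idx(5) gain] show ?thesis using M(2) by (simp add: Q_def L_def p_def)
      qed
    qed
    then show ?thesis by blast
  qed
  show ?thesis by (rule that[OF \<nu> upper lower])
qed

end

end

text \<open>If \<open>\<nu> < \<nu>'\<close>, the lower bound at rate \<open>\<nu>\<close> and the
  upper bound at rate \<open>\<nu>'\<close> for the same numbers contradict each other once
  \<open>g\<close> is close enough to 1.\<close>

lemma growth_comparison:
  fixes E :: "nat \<Rightarrow> nat \<Rightarrow> real"
  assumes p: "2 \<le> p" and \<nu>: "1 < \<nu>" "1 < \<nu>'"
    and up: "\<And>g n. 1 < g \<Longrightarrow> g < \<nu>' \<Longrightarrow> 1 \<le> n \<Longrightarrow> \<exists>C M0. \<forall>M\<ge>M0. \<bar>E n M\<bar> \<le> C * (g / \<nu>') ^ (2 * M * p)"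
    and low: "\<And>g. 1 < g \<Longrightarrow> \<exists>n0. \<forall>n\<ge>n0. \<exists>c>0. \<exists>M0. \<forall>M\<ge>M0. c \<le> (g * \<nu>) ^ (2 * M * p) * \<bar>E n M\<bar> \<or>
      n \<le> M \<and> c \<le> (g * \<nu>) ^ (2 * M * p) * \<bar>E n (M - n)\<bar>"
  shows "\<nu>' \<le> \<nu>"
proof (rule ccontr)
  assume "\<not> \<nu>' \<le> \<nu>"
  then have lt: "\<nu> < \<nu>'" by simp
  \<comment> \<open>\<open>g\<close> is lost once in each of the two bounds, so
    \<open>g * g * \<nu> < \<nu>'\<close> is needed; \<open>h\<close> is the midpoint of 1 and
    \<open>\<nu>' / \<nu>\<close>.\<close>
  define h where "h = (1 + \<nu>' / \<nu>) / 2"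
  have h: "1 < h" "h < \<nu>' / \<nu>" using lt \<nu> by (simp_all add: h_def field_simps)
  define g where "g = sqrt h"
  have g: "1 < g" "g * g = h" using h by (simp_all add: g_def)
  have "g < g * g" using g(1) by simp
  moreover have "h * \<nu> < \<nu>'" using h(2) \<nu> by (simp add: pos_less_divide_eq)
  moreover have "h \<le> h * \<nu>" using h(1) \<nu>(1) by simp
  ultimately have g\<nu>: "g < \<nu>'" using g(2) by linarith
  define q where "q = g / \<nu>'"
  have q: "0 < q" "q < 1" using g(1) g\<nu> by (simp_all add: q_def)
  define R where "R = (g * \<nu>) * q"
  have R0: "0 < R" using g(1) q \<nu> by (simp add: R_def)
  have "R = h * \<nu> / \<nu>'" using g(2) by (simp add: R_def q_def algebra_simps)
  then have R1: "R < 1" using \<open>h * \<nu> < \<nu>'\<close> \<nu> by simp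
  obtain n0 where n0: "\<And>n. n0 \<le> n \<Longrightarrow> \<exists>c>0. \<exists>M0. \<forall>M\<ge>M0. c \<le> (g * \<nu>) ^ (2 * M * p) * \<bar>E n M\<bar> \<or>
      n \<le> M \<and> c \<le> (g * \<nu>) ^ (2 * M * p) * \<bar>E n (M - n)\<bar>" using low[OF g(1)] by blast
  define n where "n = n0 + 1"
  obtain c M0 where c: "0 < c" "\<And>M. M0 \<le> M \<Longrightarrow> c \<le> (g * \<nu>) ^ (2 * M * p) * \<bar>E n M\<bar> \<or>
      n \<le> M \<and> c \<le> (g * \<nu>) ^ (2 * M * p) * \<bar>E n (M - n)\<bar>" using n0[of n] by (auto simp: n_def)
  obtain C M1 where C: "\<And>M. M1 \<le> M \<Longrightarrow> \<bar>E n M\<bar> \<le> C * q ^ (2 * M * p)"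
    using up[OF g(1) g\<nu>, of n] by (auto simp: n_def q_def)
  \<comment> \<open>Absorbs the factor by which the upper bound at \<open>M - n\<close> exceeds that
    at \<open>M\<close>, so that both alternatives are treated alike.\<close>
  define B where "B = \<bar>C\<bar> / q ^ (2 * n * p)"
  have CB: "\<bar>C\<bar> \<le> B" using q by (simp add: B_def pos_le_divide_eq mult_left_le power_le_one)
  have main: "c \<le> B * R ^ (2 * M * p)" if M: "M0 + M1 + n \<le> M" for M
  proof -
    have e1: "\<bar>E n M\<bar> \<le> B * q ^ (2 * M * p)"
    proof -
      have "\<bar>E n M\<bar> \<le> C * q ^ (2 * M * p)" using C M by simp
      also have "\<dots> \<le> B * q ^ (2 * M * p)" using CB q by (intro mult_right_mono) auto
      finally show ?thesis .
    qed
    have e2: "\<bar>E n (M - n)\<bar> \<le> B * q ^ (2 * M * p)"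
    proof -
      have "\<bar>E n (M - n)\<bar> \<le> C * q ^ (2 * (M - n) * p)" using C M by simp
      also have "\<dots> \<le> \<bar>C\<bar> * q ^ (2 * (M - n) * p)" using q by (intro mult_right_mono) auto
      also have "\<dots> = B * q ^ (2 * M * p)"
      proof -
        have "2 * M = 2 * (M - n) + 2 * n" using M by simp
        then have "2 * M * p = 2 * (M - n) * p + 2 * n * p" by (metis add_mult_distrib)
        then have "q ^ (2 * M * p) = q ^ (2 * (M - n) * p) * q ^ (2 * n * p)" by (metis power_add)
        then show ?thesis using q by (simp add: B_def)
      qed
      finally show ?thesis .
    qed
    have "0 \<le> (g * \<nu>) ^ (2 * M * p)" using g \<nu> by simp
    from mult_left_mono[OF e1 this] mult_left_mono[OF e2 this] c(2)[of M] M
    have "c \<le> (g * \<nu>) ^ (2 * M * p) * (B * q ^ (2 * M * p))" by auto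
    then show ?thesis by (simp add: R_def power_mult_distrib algebra_simps)
  qed
  have B0: "0 \<le> B" using q by (simp add: B_def)
  then have "0 < c / (B + 1)" using c(1) by simp
  then obtain j where j: "R ^ j < c / (B + 1)" using real_arch_pow_inv[OF _ R1] by blast
  define M where "M = M0 + M1 + n + j"
  have "j \<le> M" by (simp add: M_def)
  also have "M \<le> 2 * M * p" using p mult_le_mono[of M "2 * M" 1 p] by simp
  finally have "R ^ (2 * M * p) \<le> R ^ j" using R0 R1 by (intro power_decreasing) auto
  then have "B * R ^ (2 * M * p) \<le> B * R ^ j" using B0 by (intro mult_left_mono)
  also have "\<dots> \<le> (B + 1) * R ^ j" using R0 by (intro mult_right_mono) auto
  also have "\<dots> < c" using j B0 by (simp add: pos_less_divide_eq mult.commute)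
  finally show False using main[of M] by (simp add: M_def)
qed

theorem corollaryE:
  fixes T T' :: billiard
  assumes "billiard_table T" and "billiard_table T'"
    and "\<forall>\<sigma>. admissible \<sigma> \<longrightarrow> marked_length T \<sigma> = marked_length T' \<sigma>"
  shows "\<forall>\<sigma>. admissible \<sigma> \<longrightarrow> marked_lyapunov T \<sigma> = marked_lyapunov T' \<sigma>"
  proof (intro allI impI)
  fix \<sigma> :: "3 list"
  assume adm: "admissible \<sigma>"
  have p: "2 \<le> length \<sigma>" using adm by (simp add: admissible_def)
  obtain t where t: "t \<noteq> \<sigma> ! 0" "t \<noteq> \<sigma> ! (length \<sigma> - 1)" using ex_third by blast
  interpret A: table T by unfold_locales (rule assms(1))
  interpret B: table T' by unfold_locales (rule assms(2))
  \<comment> \<open>For \<open>M = 0\<close> the excursion is the single letter \<open>t\<close>,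
    which is not admissible.\<close>
  have eq: "excess T \<sigma> t n M = excess T' \<sigma> t n M" if "1 \<le> M" for n M
    using assms(3) adm admissible_excursion[OF adm t, of M] admissible_excursion[OF adm t, of "M + n"] that
    by (simp add: excess_def)
  obtain \<nu> where \<nu>: "1 < \<nu>" "marked_lyapunov T \<sigma> = ln \<nu>"
    and up: "\<And>g n. 1 < g \<Longrightarrow> g < \<nu> \<Longrightarrow> 1 \<le> n \<Longrightarrow>
      \<exists>C M0. \<forall>M\<ge>M0. \<bar>excess T \<sigma> t n M\<bar> \<le> C * (g / \<nu>) ^ (2 * M * length \<sigma>)"
    and low: "\<And>g. 1 < g \<Longrightarrow> \<exists>n0. \<forall>n\<ge>n0. \<exists>c>0. \<exists>M0. \<forall>M\<ge>M0. c \<le> (g * \<nu>) ^ (2 * M * length \<sigma>) * \<bar>excess T \<sigma> t n M\<bar> \<or>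
      n \<le> M \<and> c \<le> (g * \<nu>) ^ (2 * M * length \<sigma>) * \<bar>excess T \<sigma> t n (M - n)\<bar>"
    using A.excess_asymptotics[OF adm t] by blast
  obtain \<nu>' where \<nu>': "1 < \<nu>'" "marked_lyapunov T' \<sigma> = ln \<nu>'"
    and up': "\<And>g n. 1 < g \<Longrightarrow> g < \<nu>' \<Longrightarrow> 1 \<le> n \<Longrightarrow>
      \<exists>C M0. \<forall>M\<ge>M0. \<bar>excess T' \<sigma> t n M\<bar> \<le> C * (g / \<nu>') ^ (2 * M * length \<sigma>)"
    and low': "\<And>g. 1 < g \<Longrightarrow> \<exists>n0. \<forall>n\<ge>n0. \<exists>c>0. \<exists>M0. \<forall>M\<ge>M0. c \<le> (g * \<nu>') ^ (2 * M * length \<sigma>) * \<bar>excess T' \<sigma> t n M\<bar> \<or>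
      n \<le> M \<and> c \<le> (g * \<nu>') ^ (2 * M * length \<sigma>) * \<bar>excess T' \<sigma> t n (M - n)\<bar>"
    using B.excess_asymptotics[OF adm t] by blast
  \<comment> \<open>The upper bound of the other table carries over because the excesses coincide;
    it is played against the lower bound of this table.\<close>
  have "\<exists>C M0. \<forall>M\<ge>M0. \<bar>excess T \<sigma> t n M\<bar> \<le> C * (g / \<nu>') ^ (2 * M * length \<sigma>)"
    if h: "1 < g" "g < \<nu>'" "1 \<le> n" for g n
  proof -
    obtain C M0 where "\<And>M. M0 \<le> M \<Longrightarrow> \<bar>excess T' \<sigma> t n M\<bar> \<le> C * (g / \<nu>') ^ (2 * M * length \<sigma>)" using up'[OF h] by blast
    then show ?thesis using eq by (intro exI[of _ C] exI[of _ "M0 + 1"]) auto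
  qed
  from growth_comparison[OF p \<nu>(1) \<nu>'(1) this low] have "\<nu>' \<le> \<nu>" .
  moreover have "\<exists>C M0. \<forall>M\<ge>M0. \<bar>excess T' \<sigma> t n M\<bar> \<le> C * (g / \<nu>) ^ (2 * M * length \<sigma>)"
    if h: "1 < g" "g < \<nu>" "1 \<le> n" for g n
  proof -
    obtain C M0 where "\<And>M. M0 \<le> M \<Longrightarrow> \<bar>excess T \<sigma> t n M\<bar> \<le> C * (g / \<nu>) ^ (2 * M * length \<sigma>)" using up[OF h] by blast
    then show ?thesis using eq[symmetric] by (intro exI[of _ C] exI[of _ "M0 + 1"]) auto
  qed
  from growth_comparison[OF p \<nu>'(1) \<nu>(1) this low'] have "\<nu> \<le> \<nu>'" .
  ultimately show "marked_lyapunov T \<sigma> = marked_lyapunov T' \<sigma>" using \<nu>(2) \<nu>'(2) by simp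
qed

end
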